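(* Let $(M,J,g,\omega)$ be a compact connected almost Kähler $4$-manifold. Then $$\mathcal H^2_{d+d^c}=\mathbb C\langle\omega\rangle\oplus\mathcal H^-_g\oplus\mathcal H^{(2,0)(0,2)}_J.$$
   Context: An almost Kähler manifold $(M,J,g,\omega)$ is a symplectic manifold $(M,\omega)$ with an $\omega$-compatible almost complex structure $J$ and associated Riemannian metric $g(\cdot,\cdot)=\omega(J\cdot,\cdot)$ (sign conventions such that $g$ is positive definite); it is oriented by $J$ (equivalently by the top power of $\omega$), and $*$ is the $\mathbb C$-linear Hodge operator. $A^k$ is the space of smooth complex $k$-forms; $J$ acts on forms by $J\alpha=i^{p-q}\alpha$ for $\alpha\in A^{p,q}$; $d^c:=J^{-1}dJ$. Put $P^*:=-*P*$, so $(dd^c)^*\alpha=0$ means $dd^c*\alpha=0$. Then $$\mathcal H^2_{d+d^c}=\{\alpha\in A^2:d\alpha=0,\ d^c\alpha=0,\ (dd^c)^*\alpha=0\}.$$ $\mathcal H^-_g$ is the space of anti-self-dual $d$-harmonic complex $2$-forms ($*\alpha=-\alpha$, $d\alpha=0$). $\mathcal H^{(2,0)(0,2)}_J$ is the space of $J$-anti-invariant $d$-harmonic complex $2$-forms, i.e. $d$-harmonic forms in $A^{2,0}\oplus A^{0,2}$. Here $d$-harmonic means in the kernel of the Hodge Laplacian $dd^*+d^*d$. *)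

theory Defs
  imports "HOL-Analysis.Analysis" "HOL-Library.Function_Algebras"
begin

section \<open>Smooth functions and smooth 4-manifolds\<close>

text \<open>Only used on open sets, where the derivative at a point is determined by the values on the set.\<close>

primrec Ck_on :: "nat \<Rightarrow> 'a set \<Rightarrow> ('a::real_normed_vector \<Rightarrow> 'b::real_normed_vector) \<Rightarrow> bool" where
  "Ck_on 0 S f \<longleftrightarrow> continuous_on S f"
| "Ck_on (Suc k) S f \<longleftrightarrow> (\<forall>x\<in>S. f differentiable (at x)) \<and>
     (\<forall>v. Ck_on k S (\<lambda>x. frechet_derivative f (at x) v))"

definition smooth_on :: "'a set \<Rightarrow> ('a::real_normed_vector \<Rightarrow> 'b::real_normed_vector) \<Rightarrow> bool" where
  "smooth_on S f \<longleftrightarrow> (\<forall>k. Ck_on k S f)"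

text \<open>A chart is a pair of its domain and its coordinate map.\<close>

type_synonym 'a chart = "'a set \<times> ('a \<Rightarrow> real^4)"

definition chart_image :: "'a chart \<Rightarrow> (real^4) set" where
  "chart_image c = snd c ` fst c"

definition is_chart :: "'a topology \<Rightarrow> 'a chart \<Rightarrow> bool" where
  "is_chart M c \<longleftrightarrow> openin M (fst c) \<and> open (chart_image c) \<and>
     homeomorphic_map (subtopology M (fst c)) (top_of_set (chart_image c)) (snd c)"

definition transition :: "'a chart \<Rightarrow> 'a chart \<Rightarrow> real^4 \<Rightarrow> real^4" where
  "transition c c' = snd c' \<circ> inv_into (fst c) (snd c)"

definition transition_deriv :: "'a chart \<Rightarrow> 'a chart \<Rightarrow> 'a \<Rightarrow> real^4 \<Rightarrow> real^4" where
  "transition_deriv c c' p = frechet_derivative (transition c c') (at (snd c p))"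

text \<open>The atlas \<open>A\<close> is an arbitrary smooth atlas; it need not be maximal.\<close>

definition smooth_manifold4 :: "'a topology \<Rightarrow> 'a chart set \<Rightarrow> bool" where
  "smooth_manifold4 M A \<longleftrightarrow>
     Hausdorff_space M \<and> second_countable M \<and>
     (\<forall>c\<in>A. is_chart M c) \<and> (\<Union>c\<in>A. fst c) = topspace M \<and>
     (\<forall>c\<in>A. \<forall>c'\<in>A. smooth_on (snd c ` (fst c \<inter> fst c')) (transition c c'))"


section \<open>Linear algebra of complex alternating forms on \<open>\<real>\<^sup>4\<close>\<close>

text \<open>A \<open>k\<close>-covector is a complex-valued, real-multilinear, alternating function of \<open>k\<close> vectors;
  the arguments are given as a list, and the value on lists of another length is \<open>0\<close>.\<close>

type_synonym covector = "(real^4) list \<Rightarrow> complex"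

definition alternating :: "nat \<Rightarrow> covector \<Rightarrow> bool" where
  "alternating k \<alpha> \<longleftrightarrow>
     (\<forall>vs. length vs \<noteq> k \<longrightarrow> \<alpha> vs = 0) \<and>
     (\<forall>vs i. length vs = k \<longrightarrow> i < k \<longrightarrow> linear (\<lambda>v. \<alpha> (vs[i := v]))) \<and>
     (\<forall>vs i j. length vs = k \<longrightarrow> i < j \<longrightarrow> j < k \<longrightarrow> vs ! i = vs ! j \<longrightarrow> \<alpha> vs = 0)"

definition wedge1 :: "(real^4 \<Rightarrow> complex) list \<Rightarrow> covector" where
  "wedge1 \<theta>s vs = (if length vs = length \<theta>s
     then \<Sum>\<pi> | \<pi> permutes {..<length vs}.
            of_int (sign \<pi>) * (\<Prod>i<length vs. (\<theta>s ! i) (vs ! \<pi> i))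
     else 0)"

definition covector10 :: "(real^4 \<Rightarrow> real^4) \<Rightarrow> (real^4 \<Rightarrow> complex) set" where
  "covector10 J = {\<theta>. linear \<theta> \<and> (\<forall>v. \<theta> (J v) = \<i> * \<theta> v)}"

definition covector01 :: "(real^4 \<Rightarrow> real^4) \<Rightarrow> (real^4 \<Rightarrow> complex) set" where
  "covector01 J = {\<theta>. linear \<theta> \<and> (\<forall>v. \<theta> (J v) = - \<i> * \<theta> v)}"

definition covectors_pq :: "(real^4 \<Rightarrow> real^4) \<Rightarrow> nat \<Rightarrow> nat \<Rightarrow> covector set" where
  "covectors_pq J p q = module.span (\<lambda>(a::complex) \<alpha> vs. a * \<alpha> vs)
     {wedge1 (\<theta>s @ \<eta>s) | \<theta>s \<eta>s. length \<theta>s = p \<and> set \<theta>s \<subseteq> covector10 J \<and>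
                                length \<eta>s = q \<and> set \<eta>s \<subseteq> covector01 J}"

text \<open>The action of \<open>J\<close> on \<open>k\<close>-covectors: \<open>\<i>\<^bsup>p-q\<^esup>\<close> on the component of bidegree \<open>(p,q)\<close>, extended
  linearly along the bidegree decomposition. The value does not depend on the decomposition,
  see \<open>J_decomposition_unique\<close> below.\<close>

definition J_cov :: "(real^4 \<Rightarrow> real^4) \<Rightarrow> nat \<Rightarrow> covector \<Rightarrow> covector" where
  "J_cov J k \<alpha> = (THE \<beta>. \<exists>part. (\<forall>p\<le>k. part p \<in> covectors_pq J p (k - p)) \<and>
     \<alpha> = (\<lambda>vs. \<Sum>p\<le>k. part p vs) \<and>
     \<beta> = (\<lambda>vs. \<Sum>p\<le>k. \<i> powi (int p - int (k - p)) * part p vs))"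

definition J_inv_cov :: "(real^4 \<Rightarrow> real^4) \<Rightarrow> nat \<Rightarrow> covector \<Rightarrow> covector" where
  "J_inv_cov J k = inv_into {\<alpha>. alternating k \<alpha>} (J_cov J k)"

text \<open>The orientation induced by \<open>J\<close> is the one in which \<open>(u, Ju, v, Jv)\<close> is positive
  whenever it is a basis.\<close>

definition oriented_onb ::
    "(real^4 \<Rightarrow> real^4) \<Rightarrow> (real^4 \<Rightarrow> real^4 \<Rightarrow> real) \<Rightarrow> (real^4) list \<Rightarrow> bool" where
  "oriented_onb J G es \<longleftrightarrow> length es = 4 \<and>
     (\<forall>i<4. \<forall>j<4. G (es ! i) (es ! j) = (if i = j then 1 else 0)) \<and>
     (\<exists>u v. 0 < det (vector es :: real^4^4) * det (vector [u, J u, v, J v] :: real^4^4))"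

text \<open>\<open>*\<alpha>\<close> is characterised by \<open>*(e\<^sup>1 \<and> \<dots> \<and> e\<^sup>k) = e\<^bsup>k+1\<^esup> \<and> \<dots> \<and> e\<^sup>4\<close> for
  the dual bases of oriented orthonormal bases, and complex linearity; that is, the
  coefficient of \<open>e\<^bsup>k+1\<^esup> \<and> \<dots> \<and> e\<^sup>4\<close> in \<open>*\<alpha>\<close> is that of \<open>e\<^sup>1 \<and> \<dots> \<and> e\<^sup>k\<close> in \<open>\<alpha>\<close>.\<close>

definition hodge_cov ::
    "(real^4 \<Rightarrow> real^4) \<Rightarrow> (real^4 \<Rightarrow> real^4 \<Rightarrow> real) \<Rightarrow> nat \<Rightarrow> covector \<Rightarrow> covector" where
  "hodge_cov J G k \<alpha> = (THE \<beta>. alternating (4 - k) \<beta> \<and>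
     (\<forall>es. oriented_onb J G es \<longrightarrow> \<beta> (drop k es) = \<alpha> (take k es)))"


section \<open>Differential forms\<close>

text \<open>Tensor fields are given by their coordinate representations: \<open>\<alpha> c x\<close> is the value, in the
  chart \<open>c\<close>, at the point with coordinates \<open>x\<close>. The representations in different charts have to
  agree under the transition maps. Forms are extended by \<open>0\<close> outside the chart images, so
  that equality of forms is equality of functions.\<close>

type_synonym 'a cform = "'a chart \<Rightarrow> real^4 \<Rightarrow> covector"
type_synonym 'a endo_field = "'a chart \<Rightarrow> real^4 \<Rightarrow> real^4 \<Rightarrow> real^4"
type_synonym 'a metric_field = "'a chart \<Rightarrow> real^4 \<Rightarrow> real^4 \<Rightarrow> real^4 \<Rightarrow> real"

definition on_charts :: "'a chart set \<Rightarrow> 'a cform \<Rightarrow> 'a cform" where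
  "on_charts A \<alpha> = (\<lambda>c x. if c \<in> A \<and> x \<in> chart_image c then \<alpha> c x else 0)"

definition forms :: "'a chart set \<Rightarrow> nat \<Rightarrow> 'a cform set" where
  "forms A k = {\<alpha>.
     on_charts A \<alpha> = \<alpha> \<and>
     (\<forall>c\<in>A. \<forall>x\<in>chart_image c. alternating k (\<alpha> c x)) \<and>
     (\<forall>c\<in>A. \<forall>vs. smooth_on (chart_image c) (\<lambda>x. \<alpha> c x vs)) \<and>
     (\<forall>c\<in>A. \<forall>c'\<in>A. \<forall>p\<in>fst c \<inter> fst c'. \<forall>vs.
        \<alpha> c (snd c p) vs = \<alpha> c' (snd c' p) (map (transition_deriv c c' p) vs))}"

definition scale_form :: "complex \<Rightarrow> 'a cform \<Rightarrow> 'a cform" where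
  "scale_form a \<alpha> = (\<lambda>c x vs. a * \<alpha> c x vs)"

text \<open>The exterior derivative in coordinates,
  \<open>d\<alpha>(v\<^sub>0, \<dots>, v\<^sub>k) = \<Sum>\<^sub>i (-1)\<^sup>i (D\<^bsub>v\<^sub>i\<^esub> \<alpha>)(v\<^sub>0, \<dots>, v\<^bsub>i-1\<^esub>, v\<^bsub>i+1\<^esub>, \<dots>, v\<^sub>k)\<close>
  for constant vectors \<open>v\<^sub>i\<close>.\<close>

definition ext_d :: "'a chart set \<Rightarrow> 'a cform \<Rightarrow> 'a cform" where
  "ext_d A \<alpha> = on_charts A (\<lambda>c x vs. \<Sum>i<length vs. (-1) ^ i *
     frechet_derivative (\<lambda>y. \<alpha> c y (take i vs @ drop (Suc i) vs)) (at x) (vs ! i))"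

text \<open>In the following operators, \<open>k\<close> is the degree of the argument.\<close>

definition J_form :: "'a chart set \<Rightarrow> 'a endo_field \<Rightarrow> nat \<Rightarrow> 'a cform \<Rightarrow> 'a cform" where
  "J_form A J k \<alpha> = on_charts A (\<lambda>c x. J_cov (J c x) k (\<alpha> c x))"

definition J_inv_form :: "'a chart set \<Rightarrow> 'a endo_field \<Rightarrow> nat \<Rightarrow> 'a cform \<Rightarrow> 'a cform" where
  "J_inv_form A J k \<alpha> = on_charts A (\<lambda>c x. J_inv_cov (J c x) k (\<alpha> c x))"

definition d_c :: "'a chart set \<Rightarrow> 'a endo_field \<Rightarrow> nat \<Rightarrow> 'a cform \<Rightarrow> 'a cform" where
  "d_c A J k \<alpha> = J_inv_form A J (Suc k) (ext_d A (J_form A J k \<alpha>))"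

definition forms_pq :: "'a chart set \<Rightarrow> 'a endo_field \<Rightarrow> nat \<Rightarrow> nat \<Rightarrow> 'a cform set" where
  "forms_pq A J p q = {\<alpha> \<in> forms A (p + q).
     \<forall>c\<in>A. \<forall>x\<in>chart_image c. \<alpha> c x \<in> covectors_pq (J c x) p q}"

definition hodge ::
    "'a chart set \<Rightarrow> 'a endo_field \<Rightarrow> 'a metric_field \<Rightarrow> nat \<Rightarrow> 'a cform \<Rightarrow> 'a cform" where
  "hodge A J g k \<alpha> = on_charts A (\<lambda>c x. hodge_cov (J c x) (g c x) k (\<alpha> c x))"

text \<open>Formal adjoints, \<open>P\<^sup>* = - * P *\<close>.\<close>

definition d_adj ::
    "'a chart set \<Rightarrow> 'a endo_field \<Rightarrow> 'a metric_field \<Rightarrow> nat \<Rightarrow> 'a cform \<Rightarrow> 'a cform" where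
  "d_adj A J g k \<alpha> = - hodge A J g (4 - k + 1) (ext_d A (hodge A J g k \<alpha>))"

definition ddc_adj ::
    "'a chart set \<Rightarrow> 'a endo_field \<Rightarrow> 'a metric_field \<Rightarrow> nat \<Rightarrow> 'a cform \<Rightarrow> 'a cform" where
  "ddc_adj A J g k \<alpha> =
     - hodge A J g (4 - k + 2) (ext_d A (d_c A J (4 - k) (hodge A J g k \<alpha>)))"

definition hodge_laplacian ::
    "'a chart set \<Rightarrow> 'a endo_field \<Rightarrow> 'a metric_field \<Rightarrow> nat \<Rightarrow> 'a cform \<Rightarrow> 'a cform" where
  "hodge_laplacian A J g k \<alpha> =
     ext_d A (d_adj A J g k \<alpha>) + d_adj A J g (Suc k) (ext_d A \<alpha>)"

definition d_harmonic ::
    "'a chart set \<Rightarrow> 'a endo_field \<Rightarrow> 'a metric_field \<Rightarrow> nat \<Rightarrow> 'a cform set" where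
  "d_harmonic A J g k = {\<alpha> \<in> forms A k. hodge_laplacian A J g k \<alpha> = 0}"


section \<open>Almost Kaehler 4-manifolds and their spaces of harmonic 2-forms\<close>

definition almost_complex_structure :: "'a chart set \<Rightarrow> 'a endo_field \<Rightarrow> bool" where
  "almost_complex_structure A J \<longleftrightarrow>
     (\<forall>c\<in>A. \<forall>x\<in>chart_image c. linear (J c x) \<and> (\<forall>v. J c x (J c x v) = - v)) \<and>
     (\<forall>c\<in>A. \<forall>v. smooth_on (chart_image c) (\<lambda>x. J c x v)) \<and>
     (\<forall>c\<in>A. \<forall>c'\<in>A. \<forall>p\<in>fst c \<inter> fst c'. \<forall>v.
        transition_deriv c c' p (J c (snd c p) v) = J c' (snd c' p) (transition_deriv c c' p v))"

definition riemannian_metric :: "'a chart set \<Rightarrow> 'a metric_field \<Rightarrow> bool" where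
  "riemannian_metric A g \<longleftrightarrow>
     (\<forall>c\<in>A. \<forall>x\<in>chart_image c. bilinear (g c x) \<and> (\<forall>u v. g c x u v = g c x v u) \<and>
        (\<forall>v. v \<noteq> 0 \<longrightarrow> 0 < g c x v v)) \<and>
     (\<forall>c\<in>A. \<forall>u v. smooth_on (chart_image c) (\<lambda>x. g c x u v)) \<and>
     (\<forall>c\<in>A. \<forall>c'\<in>A. \<forall>p\<in>fst c \<inter> fst c'. \<forall>u v.
        g c (snd c p) u v =
        g c' (snd c' p) (transition_deriv c c' p u) (transition_deriv c c' p v))"

definition symplectic_form :: "'a chart set \<Rightarrow> 'a cform \<Rightarrow> bool" where
  "symplectic_form A \<omega> \<longleftrightarrow> \<omega> \<in> forms A 2 \<and> (\<forall>c x vs. \<omega> c x vs \<in> \<real>) \<and> ext_d A \<omega> = 0 \<and>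
     (\<forall>c\<in>A. \<forall>x\<in>chart_image c. \<forall>u. (\<forall>v. \<omega> c x [u, v] = 0) \<longrightarrow> u = 0)"

text \<open>Compatibility of \<open>J\<close> with \<open>\<omega>\<close> consists of the \<open>J\<close>-invariance of \<open>\<omega>\<close> and the positivity of
  \<open>g = \<omega>(J\<cdot>, \<cdot>)\<close>, which is part of \<open>g\<close> being a Riemannian metric.\<close>

definition almost_kahler4 ::
    "'a topology \<Rightarrow> 'a chart set \<Rightarrow> 'a endo_field \<Rightarrow> 'a metric_field \<Rightarrow> 'a cform \<Rightarrow> bool" where
  "almost_kahler4 M A J g \<omega> \<longleftrightarrow>
     smooth_manifold4 M A \<and> almost_complex_structure A J \<and> symplectic_form A \<omega> \<and>
     riemannian_metric A g \<and>
     (\<forall>c\<in>A. \<forall>x\<in>chart_image c. \<forall>u v.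
        \<omega> c x [J c x u, J c x v] = \<omega> c x [u, v] \<and>
        complex_of_real (g c x u v) = \<omega> c x [J c x u, v])"

definition H2_d_dc ::
    "'a chart set \<Rightarrow> 'a endo_field \<Rightarrow> 'a metric_field \<Rightarrow> 'a cform set" where
  "H2_d_dc A J g = {\<alpha> \<in> forms A 2. ext_d A \<alpha> = 0 \<and> d_c A J 2 \<alpha> = 0 \<and> ddc_adj A J g 2 \<alpha> = 0}"

definition H_minus ::
    "'a chart set \<Rightarrow> 'a endo_field \<Rightarrow> 'a metric_field \<Rightarrow> 'a cform set" where
  "H_minus A J g = {\<alpha> \<in> d_harmonic A J g 2. hodge A J g 2 \<alpha> = - \<alpha>}"

definition H_J_anti_invariant ::
    "'a chart set \<Rightarrow> 'a endo_field \<Rightarrow> 'a metric_field \<Rightarrow> 'a cform set" where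
  "H_J_anti_invariant A J g =
     {\<alpha> \<in> d_harmonic A J g 2. \<exists>\<beta>\<in>forms_pq A J 2 0. \<exists>\<gamma>\<in>forms_pq A J 0 2. \<alpha> = \<beta> + \<gamma>}"

text \<open>\<open>S\<close> is the internal direct sum of the complex subspaces \<open>U\<close>, \<open>V\<close>, \<open>W\<close>.\<close>

definition direct_sum3 ::
    "'a cform set \<Rightarrow> 'a cform set \<Rightarrow> 'a cform set \<Rightarrow> 'a cform set \<Rightarrow> bool" where
  "direct_sum3 S U V W \<longleftrightarrow>
     module.subspace scale_form U \<and> module.subspace scale_form V \<and>
     module.subspace scale_form W \<and>
     S = {u + v + w | u v w. u \<in> U \<and> v \<in> V \<and> w \<in> W} \<and>
     (\<forall>u\<in>U. \<forall>v\<in>V. \<forall>w\<in>W. u + v + w = 0 \<longrightarrow> u = 0 \<and> v = 0 \<and> w = 0)"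


section \<open>The bidegree decomposition determines the action of \<open>J\<close>\<close>

lemma module_covector: "module (\<lambda>(a::complex) (\<alpha>::covector) vs. a * \<alpha> vs)"
  by unfold_locales (auto simp: algebra_simps fun_eq_iff)

lemma i_powi_diff: "\<i> powi (int p - int q) = \<i> ^ p * (- \<i>) ^ q"
proof -
  have "\<i> powi (int p - int q) = \<i> ^ p / \<i> ^ q"
    by (simp add: power_int_diff)
  also have "\<dots> = \<i> ^ p * (inverse \<i>) ^ q"
    by (simp add: divide_inverse flip: power_inverse)
  finally show ?thesis by simp
qed

lemma wedge1_J:
  assumes "set \<theta>s \<subseteq> covector10 J" "set \<eta>s \<subseteq> covector01 J"
  shows "wedge1 (\<theta>s @ \<eta>s) (map J vs) =
    \<i> powi (int (length \<theta>s) - int (length \<eta>s)) * wedge1 (\<theta>s @ \<eta>s) vs"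
proof (cases "length vs = length \<theta>s + length \<eta>s")
  case True
  note True' = True
  let ?p = "length \<theta>s" and ?q = "length \<eta>s" and ?n = "length vs"
  define c where "c = (\<lambda>i. if i < ?p then \<i> else - \<i>)"
  have step: "((\<theta>s @ \<eta>s) ! i) (J v) = c i * ((\<theta>s @ \<eta>s) ! i) v" if "i < ?n" for i v
  proof (cases "i < ?p")
    case True
    then have "\<theta>s ! i \<in> covector10 J" using assms(1) nth_mem by blast
    then show ?thesis using True by (simp add: c_def nth_append covector10_def)
  next
    case False
    then have "\<eta>s ! (i - ?p) \<in> covector01 J"
      using assms(2) that True' nth_mem[of "i - length \<theta>s" \<eta>s] by auto
    then show ?thesis using False by (simp add: c_def nth_append covector01_def)
  qed
  have "(\<Prod>i<?n. c i) = (\<Prod>i<?p. c i) * (\<Prod>i\<in>{?p..<?p + ?q}. c i)"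
    using True by (simp add: lessThan_atLeast0 prod.atLeastLessThan_concat)
  also have "(\<Prod>i<?p. c i) = \<i> ^ ?p"
    by (simp add: c_def)
  also have "(\<Prod>i\<in>{?p..<?p + ?q}. c i) = (- \<i>) ^ ?q"
    by (simp add: c_def)
  finally have pc: "(\<Prod>i<?n. c i) = \<i> powi (int ?p - int ?q)"
    by (simp add: i_powi_diff)
  have "(\<Prod>i<?n. ((\<theta>s @ \<eta>s) ! i) (map J vs ! \<pi> i)) =
      (\<Prod>i<?n. c i) * (\<Prod>i<?n. ((\<theta>s @ \<eta>s) ! i) (vs ! \<pi> i))"
    if "\<pi> permutes {..<?n}" for \<pi>
  proof -
    have "\<pi> i < ?n" if "i < ?n" for i
      using permutes_in_image[OF \<open>\<pi> permutes {..<?n}\<close>] that by simp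
    then show ?thesis
      by (simp add: step flip: prod.distrib)
  qed
  then show ?thesis
    using True pc by (simp add: wedge1_def sum_distrib_left mult_ac)
qed (simp add: wedge1_def)

lemma covectors_pq_J:
  assumes "\<alpha> \<in> covectors_pq J p q"
  shows "\<alpha> (map J vs) = \<i> powi (int p - int q) * \<alpha> vs"
proof -
  interpret module "\<lambda>(a::complex) (\<alpha>::covector) vs. a * \<alpha> vs"
    by (rule module_covector)
  from assms have "\<alpha> \<in> span {wedge1 (\<theta>s @ \<eta>s) | \<theta>s \<eta>s. length \<theta>s = p \<and> set \<theta>s \<subseteq> covector10 J \<and>
                                length \<eta>s = q \<and> set \<eta>s \<subseteq> covector01 J}"
    by (simp add: covectors_pq_def)
  then show ?thesis
  proof (induction rule: span_induct_alt)
    case base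
    show ?case by simp
  next
    case (step c x y)
    then obtain \<theta>s \<eta>s where "x = wedge1 (\<theta>s @ \<eta>s)" "length \<theta>s = p" "set \<theta>s \<subseteq> covector10 J"
      "length \<eta>s = q" "set \<eta>s \<subseteq> covector01 J" by auto
    with wedge1_J[of \<theta>s J \<eta>s vs] step(2) show ?case by (simp add: algebra_simps)
  qed
qed

lemma J_decomposition_unique:
  fixes part :: "nat \<Rightarrow> covector"
  assumes "\<forall>p\<le>k. part p \<in> covectors_pq J p (k - p)"
  shows "(\<Sum>p\<le>k. \<i> powi (int p - int (k - p)) * part p vs) = (\<Sum>p\<le>k. part p (map J vs))"
  using assms by (intro sum.cong) (auto simp: covectors_pq_J)

lemma J_cov_pq:
  assumes "\<alpha> \<in> covectors_pq J p q"
  shows "J_cov J (p + q) \<alpha> = (\<lambda>vs. \<i> powi (int p - int q) * \<alpha> vs)"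
proof -
  interpret module "\<lambda>(a::complex) (\<alpha>::covector) vs. a * \<alpha> vs"
    by (rule module_covector)
  define part where "part = (\<lambda>r. if r = p then \<alpha> else (0::covector))"
  have z: "(0::covector) \<in> covectors_pq J r s" for r s
    unfolding covectors_pq_def by (rule span_zero)
  show ?thesis
    unfolding J_cov_def
  proof (rule the_equality)
    show "\<exists>part. (\<forall>r\<le>p + q. part r \<in> covectors_pq J r (p + q - r)) \<and>
      \<alpha> = (\<lambda>vs. \<Sum>r\<le>p + q. part r vs) \<and>
      (\<lambda>vs. \<i> powi (int p - int q) * \<alpha> vs) =
      (\<lambda>vs. \<Sum>r\<le>p + q. \<i> powi (int r - int (p + q - r)) * part r vs)"
    proof (intro exI[of _ part] conjI)
      show "\<forall>r\<le>p + q. part r \<in> covectors_pq J r (p + q - r)"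
        using assms z by (auto simp: part_def)
      have "part r vs = (if r = p then \<alpha> vs else 0)" for r vs
        by (simp add: part_def)
      then show "\<alpha> = (\<lambda>vs. \<Sum>r\<le>p + q. part r vs)"
        "(\<lambda>vs. \<i> powi (int p - int q) * \<alpha> vs) =
         (\<lambda>vs. \<Sum>r\<le>p + q. \<i> powi (int r - int (p + q - r)) * part r vs)"
        by (auto simp: if_distrib[of "\<lambda>x. _ * x"] cong: if_cong)
    qed
  next
    fix \<beta>
    assume "\<exists>part. (\<forall>r\<le>p + q. part r \<in> covectors_pq J r (p + q - r)) \<and>
      \<alpha> = (\<lambda>vs. \<Sum>r\<le>p + q. part r vs) \<and>
      \<beta> = (\<lambda>vs. \<Sum>r\<le>p + q. \<i> powi (int r - int (p + q - r)) * part r vs)"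
    then obtain part where c: "\<forall>r\<le>p + q. part r \<in> covectors_pq J r (p + q - r)"
      "\<alpha> = (\<lambda>vs. \<Sum>r\<le>p + q. part r vs)"
      "\<beta> = (\<lambda>vs. \<Sum>r\<le>p + q. \<i> powi (int r - int (p + q - r)) * part r vs)" by blast
    have "\<beta> vs = \<alpha> (map J vs)" for vs
      using J_decomposition_unique[OF c(1), of vs] c(2,3) by simp
    then show "\<beta> = (\<lambda>vs. \<i> powi (int p - int q) * \<alpha> vs)"
      using covectors_pq_J[OF assms] by auto
  qed
qed

end

theory Submission
  imports Defs
begin

text \<open>
  Write \<open>\<alpha> = f \<omega> + \<gamma> + \<delta>\<close> with \<open>\<gamma>\<close> anti-self-dual and \<open>\<delta>\<close> anti-invariant. Since \<open>J\<close> acts on 2-forms as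
  \<open>1\<close> on the invariant and \<open>-1\<close> on the anti-invariant part, \<open>d\<alpha> = d\<^sup>c\<alpha> = 0\<close> says that both parts are
  closed, and \<open>dd\<^sup>c*\<alpha> = 0\<close> becomes \<open>d(J\<^sup>-\<^sup>1df \<and> \<omega>) = 0\<close>. Integrating \<open>d(f J\<^sup>-\<^sup>1df \<and> \<omega>)\<close>, which is \<open>|df|\<^sup>2\<close>
  times the volume form up to sign, shows that \<open>f\<close> is constant. Conversely, if \<open>\<alpha>\<close> is harmonic and
  \<open>*\<alpha> = \<plusminus>\<alpha>\<close>, then \<open>\<beta> = *d\<alpha>\<close> satisfies \<open>d\<beta> = \<minusplus>*d\<beta>\<close>; integrating \<open>d(\<beta> \<and> d\<beta>)\<close> and then \<open>d(\<alpha> \<and> \<beta>)\<close>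
  gives \<open>d\<beta> = 0\<close> and \<open>d\<alpha> = 0\<close>. The only integration theory needed is that a nonnegative divergence
  on a compact manifold vanishes.
\<close>

section \<open>Differentiability along fixed directions: closure rules, Schwarz's theorem, integrals
  of derivatives\<close>

section \<open>Calculus of finitely often differentiable functions\<close>

text \<open>The star and the action of J are defined by descriptions ranging over oriented frames
  and bidegree decompositions, from which neither smoothness nor independence of the chart can be
  read off. Both are therefore replaced by closed formulas: J acts by precomposition, and the star
  of a 2-form a is -(tr a)/2 \<omega> - a(J,J), where tr a is the trace of a(., J .). Since g =
  \<omega>(J., .), the value of \<omega> on a pair e, Je with e a unit vector is -1, so tr \<omega>
  = -4 and the function f of the overview is -(tr \<alpha>)/4. Forms are complex and the star is
  complex linear, so every positivity argument pairs a form with its conjugate; the integrand is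
  then a real multiple of constant sign of \<open>Vol\<close>, the coefficient of
  \<omega>\<and>\<omega>/2. The atlas is arbitrary, its charts need not respect the orientation, and
  \<open>Vol\<close> may be negative in some of them. Integrals are therefore taken against its
  absolute value.\<close>

lemma Ck_on_subset: "Ck_on k S f \<Longrightarrow> T \<subseteq> S \<Longrightarrow> Ck_on k T f"
proof (induction k arbitrary: f)
  case 0
  then show ?case by (auto intro: continuous_on_subset)
next
  case (Suc k)
  then show ?case by (auto simp: subset_iff)
qed

text \<open>\<open>frechet_derivative\<close> chooses among the derivatives at the point. Near
  \<open>x\<close> both functions have the same ones, so the choices agree even where there is
  none.\<close>

lemma frechet_derivative_cong_open:
  assumes "open S" "x \<in> S" "\<And>y. y \<in> S \<Longrightarrow> f y = g y"
  shows "frechet_derivative f (at x) = frechet_derivative g (at x)"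
proof -
  have "(f has_derivative D) (at x) \<longleftrightarrow> (g has_derivative D) (at x)" for D
    using assms has_derivative_transform_within_open[of f D x UNIV S g]
      has_derivative_transform_within_open[of g D x UNIV S f] by auto
  then show ?thesis by (simp add: frechet_derivative_def)
qed

lemma differentiable_cong_open:
  assumes "open S" "x \<in> S" "\<And>y. y \<in> S \<Longrightarrow> f y = g y"
  shows "f differentiable (at x) \<longleftrightarrow> g differentiable (at x)"
proof -
  have "(f has_derivative D) (at x) \<longleftrightarrow> (g has_derivative D) (at x)" for D
    using assms has_derivative_transform_within_open[of f D x UNIV S g]
      has_derivative_transform_within_open[of g D x UNIV S f] by auto
  then show ?thesis by (simp add: differentiable_def)
qed

lemma Ck_on_cong:
  assumes "open S" "\<And>x. x \<in> S \<Longrightarrow> f x = g x"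
  shows "Ck_on k S f \<longleftrightarrow> Ck_on k S g"
  using assms(2)
proof (induction k arbitrary: f g)
  case 0
  then show ?case by (auto cong: continuous_on_cong)
next
  case (Suc k)
  have "frechet_derivative f (at x) = frechet_derivative g (at x)" if "x \<in> S" for x
    using frechet_derivative_cong_open[OF assms(1) that Suc.prems] by simp
  then have "Ck_on k S (\<lambda>x. frechet_derivative f (at x) v) \<longleftrightarrow> Ck_on k S (\<lambda>x. frechet_derivative g (at x) v)" for v
    by (intro Suc.IH) simp
  moreover have "f differentiable (at x) \<longleftrightarrow> g differentiable (at x)" if "x \<in> S" for x
    using differentiable_cong_open[OF assms(1) that Suc.prems] by simp
  ultimately show ?case by simp
qed

text \<open>The closure proofs by induction on \<open>k\<close> go through this rule: it allows an
  explicit derivative in place of the chosen one. Openness of \<open>S\<close> makes the two agree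
  around each point, hence to all orders.\<close>

lemma Ck_on_Suc_I:
  assumes "open S" "\<And>x. x \<in> S \<Longrightarrow> (f has_derivative f' x) (at x)"
    and "\<And>v. Ck_on k S (\<lambda>x. f' x v)"
  shows "Ck_on (Suc k) S f"
proof -
  have "frechet_derivative f (at x) = f' x" if "x \<in> S" for x
    using frechet_derivative_at[OF assms(2)[OF that]] by simp
  then have "Ck_on k S (\<lambda>x. frechet_derivative f (at x) v)" for v
    using assms(3) Ck_on_cong[OF assms(1), of "\<lambda>x. frechet_derivative f (at x) v" "\<lambda>x. f' x v" k] by simp
  moreover have "f differentiable (at x)" if "x \<in> S" for x
    using assms(2)[OF that] by (auto simp: differentiable_def)
  ultimately show ?thesis by simp
qed

lemma Ck_on_has_derivative:
  "Ck_on (Suc k) S f \<Longrightarrow> x \<in> S \<Longrightarrow> (f has_derivative frechet_derivative f (at x)) (at x)"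
  by (simp add: frechet_derivative_works)

lemma Ck_on_continuous_on: "Ck_on k S f \<Longrightarrow> continuous_on S f"
  by (cases k) (auto intro!: continuous_at_imp_continuous_on differentiable_imp_continuous_within)

lemma Ck_on_Suc_D: "Ck_on (Suc k) S f \<Longrightarrow> Ck_on k S f"
proof (induction k arbitrary: f)
  case 0
  then show ?case using Ck_on_continuous_on[of "Suc 0" S f] by simp
next
  case (Suc k)
  from Suc.prems have "\<forall>x\<in>S. f differentiable (at x)"
    and "\<And>v. Ck_on (Suc k) S (\<lambda>x. frechet_derivative f (at x) v)"
    unfolding Ck_on.simps(2)[of "Suc k"] by blast+
  note d = this
  show ?case
    unfolding Ck_on.simps(2)[of k] using d(1) Suc.IH[OF d(2)] by blast
qed

text \<open>The sets \<open>T\<close> may leave \<open>S\<close>, since derivatives see only a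
  neighbourhood of the point. This glues functions that are extended by 0.\<close>

lemma Ck_on_local:
  assumes "\<And>x. x \<in> S \<Longrightarrow> \<exists>T. open T \<and> x \<in> T \<and> Ck_on k T f"
  shows "Ck_on k S f"
  using assms
proof (induction k arbitrary: f)
  case 0
  have "isCont f x" if "x \<in> S" for x
    using 0[OF that] continuous_on_eq_continuous_at by auto
  then show ?case by (simp add: continuous_at_imp_continuous_on)
next
  case (Suc k)
  have "f differentiable (at x)" if "x \<in> S" for x
    using Suc.prems[OF that] by auto
  moreover have "Ck_on k S (\<lambda>x. frechet_derivative f (at x) v)" for v
    using Suc.prems by (intro Suc.IH) fastforce
  ultimately show ?case by simp
qed

lemma Ck_on_const [intro, simp]: "Ck_on k S (\<lambda>x. c)"
proof (induction k arbitrary: c)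
  case (Suc k)
  then show ?case by (simp add: frechet_derivative_const)
qed simp

context
  fixes S :: "'a::real_normed_vector set"
  assumes S: "open S"
begin

lemma Ck_on_bounded_linear:
  assumes h: "bounded_linear h" and "Ck_on k S f"
  shows "Ck_on k S (\<lambda>x. h (f x))"
  using assms(2)
proof (induction k arbitrary: f)
  case 0
  then show ?case using bounded_linear.continuous_on[OF h] by auto
next
  case (Suc k)
  show ?case
  proof (rule Ck_on_Suc_I[OF S])
    show "((\<lambda>x. h (f x)) has_derivative (\<lambda>v. h (frechet_derivative f (at x) v))) (at x)" if "x \<in> S" for x
      by (rule bounded_linear.has_derivative[OF h Ck_on_has_derivative[OF Suc.prems that]])
    show "Ck_on k S (\<lambda>x. h (frechet_derivative f (at x) v))" for v
      using Suc by simp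
  qed
qed

lemma Ck_on_add:
  assumes "Ck_on k S f" "Ck_on k S g"
  shows "Ck_on k S (\<lambda>x. f x + g x)"
  using assms
proof (induction k arbitrary: f g)
  case 0
  then show ?case by (auto intro: continuous_on_add)
next
  case (Suc k)
  show ?case
  proof (rule Ck_on_Suc_I[OF S])
    show "((\<lambda>x. f x + g x) has_derivative (\<lambda>v. frechet_derivative f (at x) v + frechet_derivative g (at x) v)) (at x)" if "x \<in> S" for x
      by (intro has_derivative_add Ck_on_has_derivative[OF Suc.prems(1) that] Ck_on_has_derivative[OF Suc.prems(2) that])
    show "Ck_on k S (\<lambda>x. frechet_derivative f (at x) v + frechet_derivative g (at x) v)" for v
      using Suc by simp
  qed
qed

lemma Ck_on_bilinear:
  assumes h: "bounded_bilinear h" and "Ck_on k S f" "Ck_on k S g"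
  shows "Ck_on k S (\<lambda>x. h (f x) (g x))"
  using assms(2,3)
proof (induction k arbitrary: f g)
  case 0
  then show ?case using bounded_bilinear.continuous_on[OF h] by auto
next
  case (Suc k)
  show ?case
  proof (rule Ck_on_Suc_I[OF S])
    show "((\<lambda>x. h (f x) (g x)) has_derivative (\<lambda>v. h (f x) (frechet_derivative g (at x) v) +
        h (frechet_derivative f (at x) v) (g x))) (at x)" if "x \<in> S" for x
      by (intro bounded_bilinear.FDERIV[OF h] Ck_on_has_derivative[OF Suc.prems(1) that] Ck_on_has_derivative[OF Suc.prems(2) that])
    show "Ck_on k S (\<lambda>x. h (f x) (frechet_derivative g (at x) v) + h (frechet_derivative f (at x) v) (g x))" for v
      using Suc.prems Ck_on_Suc_D[OF Suc.prems(1)] Ck_on_Suc_D[OF Suc.prems(2)]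
      by (intro Ck_on_add Suc.IH) auto
  qed
qed

lemma Ck_on_diff:
  assumes "Ck_on k S f" "Ck_on k S g"
  shows "Ck_on k S (\<lambda>x. f x - g x)"
  using Ck_on_add[OF assms(1) Ck_on_bounded_linear[OF bounded_linear_minus[OF bounded_linear_ident] assms(2)]]
  by simp

lemma Ck_on_sum:
  assumes "\<And>i. i \<in> I \<Longrightarrow> Ck_on k S (f i)"
  shows "Ck_on k S (\<lambda>x. \<Sum>i\<in>I. f i x)"
  using assms by (induction I rule: infinite_finite_induct) (auto intro: Ck_on_add)

text \<open>The derivative of the inverse contains the inverse itself, but only to order
  \<open>k\<close>; the induction therefore keeps \<open>f\<close> fixed.\<close>

lemma Ck_on_inverse:
  fixes f :: "'a \<Rightarrow> 'b::real_normed_field"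
  assumes "Ck_on k S f" "\<And>x. x \<in> S \<Longrightarrow> f x \<noteq> 0"
  shows "Ck_on k S (\<lambda>x. inverse (f x))"
  using assms(1)
proof (induction k)
  case 0
  then show ?case using assms(2) by (auto intro!: continuous_on_inverse)
next
  case (Suc k)
  have IH: "Ck_on k S (\<lambda>x. inverse (f x))"
    using Suc Ck_on_Suc_D by blast
  show ?case
  proof (rule Ck_on_Suc_I[OF S])
    show "((\<lambda>x. inverse (f x)) has_derivative (\<lambda>v. - (inverse (f x) * frechet_derivative f (at x) v * inverse (f x)))) (at x)" if "x \<in> S" for x
      by (rule Deriv.has_derivative_inverse[OF assms(2)[OF that] Ck_on_has_derivative[OF Suc.prems that]])
    have "Ck_on k S (\<lambda>x. inverse (f x) * frechet_derivative f (at x) v * inverse (f x))" for v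
      using Suc.prems by (intro Ck_on_bilinear[OF bounded_bilinear_mult] IH) auto
    from Ck_on_bounded_linear[OF bounded_linear_minus[OF bounded_linear_ident] this]
    show "Ck_on k S (\<lambda>x. - (inverse (f x) * frechet_derivative f (at x) v * inverse (f x)))" for v .
  qed
qed

end

lemma Ck_on_linear:
  fixes h :: "'a::euclidean_space \<Rightarrow> 'b::real_normed_vector"
  assumes "linear h"
  shows "Ck_on k S h"
proof (cases k)
  case 0
  then show ?thesis using assms by (simp add: linear_continuous_on linear_conv_bounded_linear)
next
  case (Suc m)
  have d: "(h has_derivative h) (at x)" for x
    using assms by (simp add: linear_imp_has_derivative)
  then have "frechet_derivative h (at x) = h" for x
    using frechet_derivative_at[of h h x] by simp
  then show ?thesis using d Suc by (auto simp: differentiable_def)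
qed

lemma Ck_on_compose:
  fixes g :: "'b::euclidean_space \<Rightarrow> 'c::real_normed_vector" and \<phi> :: "'a::real_normed_vector \<Rightarrow> 'b"
  assumes "open S" "open T" "Ck_on k T g" "Ck_on k S \<phi>" "\<phi> ` S \<subseteq> T"
  shows "Ck_on k S (\<lambda>x. g (\<phi> x))"
  using assms(3,4)
proof (induction k arbitrary: g)
  case 0
  then show ?case using assms(5) by (auto intro: continuous_on_compose2)
next
  case (Suc k)
  have phi: "\<phi> x \<in> T" if "x \<in> S" for x using assms(5) that by auto
  show ?case
  proof (rule Ck_on_Suc_I[OF assms(1)])
    fix x assume x: "x \<in> S"
    have g: "(g has_derivative frechet_derivative g (at (\<phi> x))) (at (\<phi> x))"
      using Ck_on_has_derivative[OF Suc.prems(1) phi[OF x]] .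
    have "((\<lambda>x. g (\<phi> x)) has_derivative (\<lambda>v. frechet_derivative g (at (\<phi> x)) (frechet_derivative \<phi> (at x) v))) (at x)"
      by (rule has_derivative_compose[OF Ck_on_has_derivative[OF Suc.prems(2) x] g])
    \<comment> \<open>The induction hypothesis covers derivatives of \<open>g\<close> along fixed
      directions, while the chain rule evaluates at a moving vector. Expanding in
      \<open>Basis\<close> separates the two.\<close>
    moreover have "frechet_derivative g (at (\<phi> x)) u = (\<Sum>b\<in>Basis. (u \<bullet> b) *\<^sub>R frechet_derivative g (at (\<phi> x)) b)" for u
    proof -
      have l: "linear (frechet_derivative g (at (\<phi> x)))"
        using g has_derivative_linear by blast
      have "frechet_derivative g (at (\<phi> x)) u = frechet_derivative g (at (\<phi> x)) (\<Sum>b\<in>Basis. (u \<bullet> b) *\<^sub>R b)"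
        by (simp add: euclidean_representation)
      also have "\<dots> = (\<Sum>b\<in>Basis. (u \<bullet> b) *\<^sub>R frechet_derivative g (at (\<phi> x)) b)"
        using l by (simp add: linear_sum linear_cmul)
      finally show ?thesis .
    qed
    then have "(\<lambda>v. frechet_derivative g (at (\<phi> x)) (frechet_derivative \<phi> (at x) v)) =
        (\<lambda>v. \<Sum>b\<in>Basis. (frechet_derivative \<phi> (at x) v \<bullet> b) *\<^sub>R frechet_derivative g (at (\<phi> x)) b)"
      by (intro ext)
    ultimately show "((\<lambda>x. g (\<phi> x)) has_derivative (\<lambda>v. \<Sum>b\<in>Basis. (frechet_derivative \<phi> (at x) v \<bullet> b) *\<^sub>R frechet_derivative g (at (\<phi> x)) b)) (at x)"
      by (simp only:)
  next
    fix v
    show "Ck_on k S (\<lambda>x. \<Sum>b\<in>Basis. (frechet_derivative \<phi> (at x) v \<bullet> b) *\<^sub>R frechet_derivative g (at (\<phi> x)) b)"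
      using Suc.prems Ck_on_Suc_D[OF Suc.prems(2)]
      by (intro Ck_on_sum[OF assms(1)] Ck_on_bilinear[OF assms(1) bounded_bilinear_scaleR]
          Ck_on_bounded_linear[OF assms(1) bounded_linear_inner_left] Suc.IH) auto
  qed
qed

text \<open>A field of linear maps is known to be differentiable on fixed vectors only; in finite
  dimension that suffices, by expanding the moving vector. This is how \<open>J\<close> gets
  inserted into the arguments of a form.\<close>

lemma Ck_on_evaluate:
  fixes a :: "'a::real_normed_vector \<Rightarrow> 'b::euclidean_space \<Rightarrow> 'c::real_normed_vector"
  assumes "open S" "\<And>x. x \<in> S \<Longrightarrow> linear (a x)" "\<And>v. Ck_on k S (\<lambda>x. a x v)" "Ck_on k S X"
  shows "Ck_on k S (\<lambda>x. a x (X x))"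
proof -
  have "a x (X x) = (\<Sum>b\<in>Basis. (X x \<bullet> b) *\<^sub>R a x b)" if "x \<in> S" for x
  proof -
    have "a x (X x) = a x (\<Sum>b\<in>Basis. (X x \<bullet> b) *\<^sub>R b)"
      by (simp add: euclidean_representation)
    also have "\<dots> = (\<Sum>b\<in>Basis. (X x \<bullet> b) *\<^sub>R a x b)"
      using assms(2)[OF that] by (simp add: linear_sum linear_cmul)
    finally show ?thesis .
  qed
  then have "Ck_on k S (\<lambda>x. a x (X x)) \<longleftrightarrow> Ck_on k S (\<lambda>x. \<Sum>b\<in>Basis. (X x \<bullet> b) *\<^sub>R a x b)"
    by (rule Ck_on_cong[OF assms(1)])
  then show ?thesis
    using assms by (auto intro!: Ck_on_sum Ck_on_bilinear[OF _ bounded_bilinear_scaleR]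
          Ck_on_bounded_linear[OF assms(1) bounded_linear_inner_left])
qed

lemma has_derivative_evaluate:
  fixes a :: "'a::real_normed_vector \<Rightarrow> 'b::euclidean_space \<Rightarrow> 'c::real_normed_vector"
  assumes "open S" "x \<in> S" "\<And>y. y \<in> S \<Longrightarrow> linear (a y)"
    and "\<And>v. ((\<lambda>y. a y v) has_derivative a' v) (at x)" "(X has_derivative X') (at x)"
  shows "((\<lambda>y. a y (X y)) has_derivative (\<lambda>w. a' (X x) w + a x (X' w))) (at x)"
proof -
  have eq: "a y u = (\<Sum>b\<in>Basis. (u \<bullet> b) *\<^sub>R a y b)" if "y \<in> S" for y u
  proof -
    have "a y u = a y (\<Sum>b\<in>Basis. (u \<bullet> b) *\<^sub>R b)"
      by (simp add: euclidean_representation)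
    also have "\<dots> = (\<Sum>b\<in>Basis. (u \<bullet> b) *\<^sub>R a y b)"
      using assms(3)[OF that] by (simp add: linear_sum linear_cmul)
    finally show ?thesis .
  qed
  \<comment> \<open>The expansion of \<open>a y u\<close> is differentiated term by term; uniqueness
    of derivatives then shows that \<open>a'\<close> expands in the same way in its vector
    argument.\<close>
  have "((\<lambda>y. \<Sum>b\<in>Basis. (u \<bullet> b) *\<^sub>R a y b) has_derivative (\<lambda>w. \<Sum>b\<in>Basis. (u \<bullet> b) *\<^sub>R a' b w)) (at x)" for u
    by (intro has_derivative_sum has_derivative_scaleR_right assms(4))
  then have "((\<lambda>y. a y u) has_derivative (\<lambda>w. \<Sum>b\<in>Basis. (u \<bullet> b) *\<^sub>R a' b w)) (at x)" for u
    by (rule has_derivative_transform_within_open[OF _ assms(1,2)]) (simp add: eq[symmetric])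
  from has_derivative_unique[OF assms(4) this]
  have a': "a' u w = (\<Sum>b\<in>Basis. (u \<bullet> b) *\<^sub>R a' b w)" for u w
    by (rule fun_cong)
  have "((\<lambda>y. \<Sum>b\<in>Basis. (X y \<bullet> b) *\<^sub>R a y b) has_derivative
      (\<lambda>w. \<Sum>b\<in>Basis. (X x \<bullet> b) *\<^sub>R a' b w + (X' w \<bullet> b) *\<^sub>R a x b)) (at x)"
    by (intro has_derivative_sum has_derivative_scaleR assms(4) has_derivative_inner_left assms(5))
  moreover have "(\<lambda>w. \<Sum>b\<in>Basis. (X x \<bullet> b) *\<^sub>R a' b w + (X' w \<bullet> b) *\<^sub>R a x b) =
      (\<lambda>w. a' (X x) w + a x (X' w))"
    by (rule ext) (simp only: sum.distrib flip: a' eq[OF assms(2)])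
  ultimately have "((\<lambda>y. \<Sum>b\<in>Basis. (X y \<bullet> b) *\<^sub>R a y b) has_derivative (\<lambda>w. a' (X x) w + a x (X' w))) (at x)"
    by simp
  then show ?thesis
    by (rule has_derivative_transform_within_open[OF _ assms(1,2)]) (simp add: eq[symmetric])
qed

lemma frechet_derivative_add_at:
  assumes "f differentiable (at x)" "g differentiable (at x)"
  shows "frechet_derivative (\<lambda>y. f y + g y) (at x) v = frechet_derivative f (at x) v + frechet_derivative g (at x) v"
  by (subst frechet_derivative_at[OF has_derivative_add[OF assms[unfolded frechet_derivative_works]], symmetric]) simp

lemma frechet_derivative_diff_at:
  assumes "f differentiable (at x)" "g differentiable (at x)"
  shows "frechet_derivative (\<lambda>y. f y - g y) (at x) v = frechet_derivative f (at x) v - frechet_derivative g (at x) v"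
  by (subst frechet_derivative_at[OF has_derivative_diff[OF assms[unfolded frechet_derivative_works]], symmetric]) simp

lemma frechet_derivative_bounded_linear_at:
  assumes "bounded_linear h" "f differentiable (at x)"
  shows "frechet_derivative (\<lambda>y. h (f y)) (at x) v = h (frechet_derivative f (at x) v)"
  by (subst frechet_derivative_at[OF bounded_linear.has_derivative[OF assms(1) assms(2)[unfolded frechet_derivative_works]], symmetric]) simp

lemma frechet_derivative_mult_at:
  fixes f g :: "'a::real_normed_vector \<Rightarrow> 'b::real_normed_algebra"
  assumes "f differentiable (at x)" "g differentiable (at x)"
  shows "frechet_derivative (\<lambda>y. f y * g y) (at x) v = f x * frechet_derivative g (at x) v + frechet_derivative f (at x) v * g x"
  by (subst frechet_derivative_at[OF has_derivative_mult[OF assms[unfolded frechet_derivative_works]], symmetric]) simp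

lemma linear_frechet_derivative_at: "f differentiable (at x) \<Longrightarrow> linear (frechet_derivative f (at x))"
  by (simp add: linear_frechet_derivative)

subsection \<open>Symmetry of second derivatives\<close>

lemma DERIV_along_line:
  fixes f :: "'a::real_normed_vector \<Rightarrow> real"
  assumes "f differentiable (at (z + s *\<^sub>R u))"
  shows "((\<lambda>s. f (z + s *\<^sub>R u)) has_field_derivative frechet_derivative f (at (z + s *\<^sub>R u)) u) (at s)"
proof -
  have l: "((\<lambda>s. z + s *\<^sub>R u) has_derivative (\<lambda>t. t *\<^sub>R u)) (at s)"
    by (auto intro!: derivative_eq_intros)
  have f: "(f has_derivative frechet_derivative f (at (z + s *\<^sub>R u))) (at (z + s *\<^sub>R u))"
    using assms frechet_derivative_works by blast
  have "((\<lambda>s. f (z + s *\<^sub>R u)) has_derivative (\<lambda>t. frechet_derivative f (at (z + s *\<^sub>R u)) (t *\<^sub>R u))) (at s)"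
    by (rule has_derivative_compose[OF l f])
  moreover have "(\<lambda>t. frechet_derivative f (at (z + s *\<^sub>R u)) (t *\<^sub>R u)) = (\<lambda>t. t * frechet_derivative f (at (z + s *\<^sub>R u)) u)"
    using linear_cmul[OF linear_frechet_derivative_at[OF assms]] by auto
  ultimately show ?thesis
    by (simp add: has_field_derivative_def mult_commute_abs)
qed

text \<open>The mean value theorem is used in direction \<open>u\<close> for the increment along
  \<open>v\<close>, and then in direction \<open>v\<close>. The left side is symmetric in
  \<open>u\<close> and \<open>v\<close>, the right side not visibly so.\<close>

lemma second_difference:
  fixes f :: "'a::real_normed_vector \<Rightarrow> real"
  assumes f: "Ck_on 2 (ball x r) f" and h: "0 < h" "h * (norm u + norm v) < r"
  shows "\<exists>p. norm (p - x) \<le> h * (norm u + norm v) \<and>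
    f (x + h *\<^sub>R u + h *\<^sub>R v) - f (x + h *\<^sub>R u) - f (x + h *\<^sub>R v) + f x =
    h * h * frechet_derivative (\<lambda>y. frechet_derivative f (at y) u) (at p) v"
proof -
  define g where "g = (\<lambda>y. frechet_derivative f (at y) u)"
  have nb: "norm (s *\<^sub>R u + t *\<^sub>R v) \<le> h * (norm u + norm v)" if "0 \<le> s" "s \<le> h" "0 \<le> t" "t \<le> h" for s t
  proof -
    have "norm (s *\<^sub>R u + t *\<^sub>R v) \<le> s * norm u + t * norm v"
      using norm_triangle_ineq[of "s *\<^sub>R u" "t *\<^sub>R v"] that by simp
    also have "\<dots> \<le> h * norm u + h * norm v"
      using that by (intro add_mono mult_right_mono) auto
    finally show ?thesis by (simp add: algebra_simps)
  qed
  have inb: "x + s *\<^sub>R u + t *\<^sub>R v \<in> ball x r" if "0 \<le> s" "s \<le> h" "0 \<le> t" "t \<le> h" for s t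
  proof -
    have "dist (x + s *\<^sub>R u + t *\<^sub>R v) x = norm (s *\<^sub>R u + t *\<^sub>R v)"
      by (simp add: dist_norm)
    also have "\<dots> < r" using nb[OF that] h(2) by simp
    finally show ?thesis by (simp add: dist_commute)
  qed
  have df: "f differentiable (at y)" if "y \<in> ball x r" for y
    using f that by (simp add: numeral_2_eq_2)
  have dg: "g differentiable (at y)" if "y \<in> ball x r" for y
    using f that by (simp add: numeral_2_eq_2 g_def)
  define ph where "ph = (\<lambda>s. f ((x + h *\<^sub>R v) + s *\<^sub>R u) - f (x + s *\<^sub>R u))"
  have "DERIV ph s :> g ((x + h *\<^sub>R v) + s *\<^sub>R u) - g (x + s *\<^sub>R u)" if "0 \<le> s" "s \<le> h" for s
    unfolding ph_def g_def using inb[of s h] inb[of s 0] that h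
    by (intro DERIV_diff DERIV_along_line df) (auto simp: add_ac)
  from MVT2[OF h(1) this] obtain s where s: "0 < s" "s < h"
    "ph h - ph 0 = (h - 0) * (g ((x + h *\<^sub>R v) + s *\<^sub>R u) - g (x + s *\<^sub>R u))" by blast
  define ps where "ps = (\<lambda>t. g ((x + s *\<^sub>R u) + t *\<^sub>R v))"
  have "DERIV ps t :> frechet_derivative g (at ((x + s *\<^sub>R u) + t *\<^sub>R v)) v" if "0 \<le> t" "t \<le> h" for t
    unfolding ps_def using inb[of s t] that s by (intro DERIV_along_line dg) auto
  from MVT2[OF h(1) this] obtain t where t: "0 < t" "t < h"
    "ps h - ps 0 = (h - 0) * frechet_derivative g (at ((x + s *\<^sub>R u) + t *\<^sub>R v)) v" by blast
  have "ph h - ph 0 = h * (ps h - ps 0)"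
    using s(3) by (simp add: ps_def add_ac)
  then have "ph h - ph 0 = h * h * frechet_derivative g (at ((x + s *\<^sub>R u) + t *\<^sub>R v)) v"
    using t(3) by simp
  moreover have "norm ((x + s *\<^sub>R u) + t *\<^sub>R v - x) \<le> h * (norm u + norm v)"
    using nb[of s t] s t by (simp add: algebra_simps)
  ultimately show ?thesis
    by (intro exI[of _ "(x + s *\<^sub>R u) + t *\<^sub>R v"]) (simp add: g_def ph_def add_ac)
qed

text \<open>Schwarz's theorem: the symmetric second difference is \<open>h * h\<close> times either
  mixed derivative at some point near \<open>x\<close>, and both mixed derivatives are
  continuous.\<close>

lemma symmetric_second_derivative_real:
  fixes f :: "'a::real_normed_vector \<Rightarrow> real"
  assumes "open U" "x \<in> U" "Ck_on 2 U f"
  shows "frechet_derivative (\<lambda>y. frechet_derivative f (at y) u) (at x) v =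
    frechet_derivative (\<lambda>y. frechet_derivative f (at y) v) (at x) u" (is "?A x = ?B x")
proof (rule ccontr)
  assume ne: "?A x \<noteq> ?B x"
  define e where "e = dist (?A x) (?B x) / 2"
  have e: "e > 0" using ne by (simp add: e_def)
  obtain r where r: "r > 0" "ball x r \<subseteq> U" using assms openE by blast
  have C: "Ck_on 2 (ball x r) f" using Ck_on_subset[OF assms(3) r(2)] .
  then have "continuous_on (ball x r) ?A" "continuous_on (ball x r) ?B"
    by (auto simp: numeral_2_eq_2)
  then have "isCont ?A x" "isCont ?B x"
    using r(1) continuous_on_eq_continuous_at[OF open_ball] by (metis centre_in_ball)+
  then obtain d1 d2 where d: "d1 > 0" "\<And>y. dist y x < d1 \<Longrightarrow> dist (?A y) (?A x) < e"
      "d2 > 0" "\<And>y. dist y x < d2 \<Longrightarrow> dist (?B y) (?B x) < e"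
    unfolding continuous_at_eps_delta using e by metis
  define m where "m = min r (min d1 d2)"
  define n where "n = norm u + norm v"
  have m: "m > 0" using r(1) d by (simp add: m_def)
  have n: "n \<ge> 0" by (simp add: n_def)
  \<comment> \<open>The summand 1 covers \<open>u = v = 0\<close>. What counts is
    \<open>h * n < m\<close>: both intermediate points stay in all three neighbourhoods.\<close>
  define h where "h = m / (n + 1) / 2"
  have h: "h > 0" using m n by (simp add: h_def)
  have "h * n < m"
  proof -
    have "h * n \<le> h * (n + 1)" using h by simp
    also have "\<dots> = m / 2" using n by (simp add: h_def field_simps)
    finally show ?thesis using m by simp
  qed
  then have hn: "h * (norm u + norm v) < r" "h * (norm u + norm v) < d1" "h * (norm u + norm v) < d2"
    by (auto simp: n_def m_def)
  obtain p where p: "norm (p - x) \<le> h * (norm u + norm v)"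
    "f (x + h *\<^sub>R u + h *\<^sub>R v) - f (x + h *\<^sub>R u) - f (x + h *\<^sub>R v) + f x = h * h * ?A p"
    using second_difference[OF C h hn(1)] by blast
  obtain q where q: "norm (q - x) \<le> h * (norm v + norm u)"
    "f (x + h *\<^sub>R v + h *\<^sub>R u) - f (x + h *\<^sub>R v) - f (x + h *\<^sub>R u) + f x = h * h * ?B q"
    using second_difference[OF C h, of v u] hn(1) by (auto simp: add.commute)
  have "h * h * ?A p = h * h * ?B q"
    unfolding p(2)[symmetric] q(2)[symmetric] by (simp add: algebra_simps)
  then have "?A p = ?B q" using h by simp
  moreover have "dist (?A p) (?A x) < e"
    using p(1) hn by (intro d(2)) (simp add: dist_norm)
  moreover have "dist (?B q) (?B x) < e"
    using q(1) hn by (intro d(4)) (simp add: dist_norm add.commute)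
  ultimately show False
    using dist_triangle[of "?A x" "?B x" "?A p"] by (simp add: e_def dist_commute[of "?A x"])
qed

lemma symmetric_second_derivative:
  fixes f :: "'a::real_normed_vector \<Rightarrow> 'b::euclidean_space"
  assumes "open U" "x \<in> U" "Ck_on 2 U f"
  shows "frechet_derivative (\<lambda>y. frechet_derivative f (at y) u) (at x) v =
    frechet_derivative (\<lambda>y. frechet_derivative f (at y) v) (at x) u"
proof (rule euclidean_eqI)
  fix b :: 'b
  have lin: "bounded_linear (\<lambda>z::'b. z \<bullet> b)" by (rule bounded_linear_inner_left)
  have C: "Ck_on 2 U (\<lambda>y. f y \<bullet> b)"
    by (rule Ck_on_bounded_linear[OF assms(1) lin assms(3)])
  have d1: "f differentiable (at y)" if "y \<in> U" for y
    using assms(3) that by (simp add: numeral_2_eq_2)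
  have d2: "(\<lambda>y. frechet_derivative f (at y) w) differentiable (at x)" for w
    using assms(2,3) by (simp add: numeral_2_eq_2)
  have "frechet_derivative (\<lambda>y. frechet_derivative f (at y) w) (at x) z \<bullet> b =
      frechet_derivative (\<lambda>y. frechet_derivative (\<lambda>y. f y \<bullet> b) (at y) w) (at x) z" for w z
  proof -
    have "frechet_derivative (\<lambda>y. frechet_derivative f (at y) w) (at x) z \<bullet> b =
      frechet_derivative (\<lambda>y. frechet_derivative f (at y) w \<bullet> b) (at x) z"
      using frechet_derivative_bounded_linear_at[OF lin d2] by simp
    also have "\<dots> = frechet_derivative (\<lambda>y. frechet_derivative (\<lambda>y. f y \<bullet> b) (at y) w) (at x) z"
      by (intro fun_cong[OF frechet_derivative_cong_open[OF assms(1,2)]])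
        (simp add: frechet_derivative_bounded_linear_at[OF lin d1])
    finally show ?thesis .
  qed
  then show "frechet_derivative (\<lambda>y. frechet_derivative f (at y) u) (at x) v \<bullet> b =
    frechet_derivative (\<lambda>y. frechet_derivative f (at y) v) (at x) u \<bullet> b"
    using symmetric_second_derivative_real[OF assms(1,2) C] by metis
qed


subsection \<open>Integrals of derivatives of functions with compact support\<close>

lemma integral_eq_of_support:
  fixes f :: "'a::euclidean_space \<Rightarrow> 'b::banach"
  assumes "\<And>x. f x \<noteq> 0 \<Longrightarrow> x \<in> S \<and> x \<in> T"
  shows "integral S f = integral T f"
proof -
  have "(\<lambda>x. if x \<in> S then f x else 0) = (\<lambda>x. if x \<in> T then f x else 0)"
    using assms by (intro ext) metis
  then show ?thesis
    using integral_restrict_UNIV[of S f] integral_restrict_UNIV[of T f] by simp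
qed

text \<open>Translating a compactly supported \<open>w\<close> by a multiple \<open>t\<close> of
  \<open>u\<close> does not change its integral; differentiating under the integral sign at
  \<open>t = 0\<close> gives the claim.\<close>

lemma integral_derivative_eq_0:
  fixes w :: "'a::euclidean_space \<Rightarrow> real"
  assumes w: "Ck_on 1 UNIV w" and supp: "\<And>x. x \<notin> cball p r \<Longrightarrow> w x = 0"
  shows "integral (cball p r) (\<lambda>x. frechet_derivative w (at x) u) = 0"
proof -
  let ?D = "\<lambda>x. frechet_derivative w (at x) u"
  have contw: "continuous_on UNIV w" using Ck_on_continuous_on[OF w] .
  have contD: "continuous_on UNIV ?D" using w by simp
  have dw: "w differentiable (at x)" for x using w by simp
  have D0: "?D x = 0" if "x \<notin> cball p r" for x
  proof -
    have "open (- cball p r)" by (simp add: open_Compl)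
    then have "frechet_derivative w (at x) = frechet_derivative (\<lambda>_. 0) (at x)"
      using that supp by (intro frechet_derivative_cong_open[of "- cball p r"]) auto
    then show ?thesis by (simp add: frechet_derivative_const)
  qed
  \<comment> \<open>Enlarging the radius by \<open>norm u\<close> keeps the supports of all
    translates with \<open>\<bar>t\<bar> \<le> 1\<close> inside one box.\<close>
  obtain a where a: "cball p (r + norm u) \<subseteq> cbox (-a) a"
    using bounded_subset_cbox_symmetric[OF bounded_cball] by blast
  define F where "F = (\<lambda>t::real. integral (cbox (-a) a) (\<lambda>x. w (x + t *\<^sub>R u)))"
  have sub: "x \<in> cbox (-a) a" if "x + t *\<^sub>R u \<in> cball p r" "\<bar>t\<bar> \<le> 1" for x t
  proof -
    have "dist p x \<le> dist p (x + t *\<^sub>R u) + norm (t *\<^sub>R u)"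
      using dist_triangle[of p x "x + t *\<^sub>R u"] by (simp add: dist_norm)
    also have "norm (t *\<^sub>R u) \<le> norm u"
      using that(2) mult_right_mono[of "\<bar>t\<bar>" 1 "norm u"] by simp
    finally show ?thesis using a that(1) by auto
  qed
  have "F t = integral (cbox (-a) a) w" if t: "\<bar>t\<bar> \<le> 1" for t
  proof -
    have "F t = integral (cbox (-a - t *\<^sub>R u) (a - t *\<^sub>R u)) (\<lambda>x. w (x + t *\<^sub>R u))"
      unfolding F_def
    proof (rule integral_eq_of_support)
      fix x assume "w (x + t *\<^sub>R u) \<noteq> 0"
      then have "x + t *\<^sub>R u \<in> cball p r" using supp by blast
      moreover from this have "x + t *\<^sub>R u \<in> cbox (-a) a"
        using sub[of "x + t *\<^sub>R u" 0] by simp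
      then have "x \<in> cbox (-a - t *\<^sub>R u) (a - t *\<^sub>R u)"
        by (auto simp: mem_box algebra_simps)
      ultimately show "x \<in> cbox (-a) a \<and> x \<in> cbox (-a - t *\<^sub>R u) (a - t *\<^sub>R u)"
        using sub t by blast
    qed
    also have "\<dots> = integral (cbox (-a) a) w" by (rule integral_shift_cbox)
    finally show ?thesis .
  qed
  then have "(F has_vector_derivative 0) (at 0)"
    by (intro has_vector_derivative_transform_within_open[of "\<lambda>_. integral (cbox (-a) a) w" 0 0 "{-1<..<1}" F])
      auto
  moreover have "(F has_vector_derivative integral (cbox (-a) a) (\<lambda>x. ?D (x + 0 *\<^sub>R u))) (at 0 within {-1<..<1})"
    unfolding F_def
  proof (rule leibniz_rule_vector_derivative)
    show "((\<lambda>t. w (x + t *\<^sub>R u)) has_vector_derivative ?D (x + t *\<^sub>R u)) (at t within {-1<..<1})" for t x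
      using DERIV_along_line[where z = x and s = t and u = u, OF dw]
      by (simp add: has_real_derivative_iff_has_vector_derivative has_vector_derivative_at_within)
    show "(\<lambda>x. w (x + t *\<^sub>R u)) integrable_on cbox (-a) a" for t
      by (intro integrable_continuous continuous_on_compose2[OF contw] continuous_intros) auto
    show "continuous_on ({-1<..<1} \<times> cbox (-a) a) (\<lambda>(t, x). ?D (x + t *\<^sub>R u))"
      unfolding split_beta by (intro continuous_on_compose2[OF contD] continuous_intros) auto
  qed auto
  then have "(F has_vector_derivative integral (cbox (-a) a) ?D) (at 0)"
    by (simp add: at_within_open[of 0 "{-1<..<1::real}"])
  ultimately have "integral (cbox (-a) a) ?D = 0"
    by (rule vector_derivative_unique_at[symmetric])
  moreover have "integral (cbox (-a) a) ?D = integral (cball p r) ?D"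
    using D0 sub[of _ 0] by (intro integral_eq_of_support) auto
  ultimately show ?thesis by simp
qed

section \<open>Curried alternating functions: vanishing on bases, wedge products, the line of
  top-degree forms\<close>

section \<open>Alternating forms on \<open>\<real>\<^sup>4\<close>\<close>

abbreviation E4 :: "4 \<Rightarrow> real^4" where
  "E4 i \<equiv> axis i 1"

definition alt2 :: "(real^4 \<Rightarrow> real^4 \<Rightarrow> complex) \<Rightarrow> bool" where
  "alt2 a \<longleftrightarrow> (\<forall>v. linear (\<lambda>u. a u v)) \<and> (\<forall>u. linear (a u)) \<and> (\<forall>u. a u u = 0)"

text \<open>Freezing the first and freezing the last argument controls adjacent pairs only;
  alternation in the outer pair is derived in \<open>alt3_same\<close>. Degree 4 is built in the
  same way.\<close>

definition alt3 :: "(real^4 \<Rightarrow> real^4 \<Rightarrow> real^4 \<Rightarrow> complex) \<Rightarrow> bool" where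
  "alt3 t \<longleftrightarrow> (\<forall>u. alt2 (t u)) \<and> (\<forall>w. alt2 (\<lambda>u v. t u v w))"

definition alt4 :: "(real^4 \<Rightarrow> real^4 \<Rightarrow> real^4 \<Rightarrow> real^4 \<Rightarrow> complex) \<Rightarrow> bool" where
  "alt4 g \<longleftrightarrow> (\<forall>u. alt3 (g u)) \<and> (\<forall>z. alt3 (\<lambda>u v w. g u v w z))"

lemma linear_complexD:
  fixes f :: "real^4 \<Rightarrow> complex"
  assumes "linear f"
  shows "f (u + v) = f u + f v" "f (u - v) = f u - f v" "f (c *\<^sub>R u) = of_real c * f u" "f (- u) = - f u" "f 0 = 0"
  using assms by (auto simp: linear_add linear_diff linear_cmul linear_neg linear_0 scaleR_conv_of_real[where 'a = complex])

lemma linear_complexI: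
  fixes f :: "real^4 \<Rightarrow> complex"
  assumes "\<And>u v. f (u + v) = f u + f v" "\<And>c u. f (c *\<^sub>R u) = of_real c * f u"
  shows "linear f"
  using assms by (auto intro!: linearI simp: scaleR_conv_of_real[where 'a = complex])

lemma alt2_linear:
  assumes "alt2 a"
  shows "linear (\<lambda>u. a u v)" "linear (a u)"
  using assms by (auto simp: alt2_def)

lemmas alt2_simps = linear_complexD[OF alt2_linear(1)] linear_complexD[OF alt2_linear(2)]

lemma alt2_same: "alt2 a \<Longrightarrow> a u u = 0"
  by (simp add: alt2_def)

lemma alt2_skew:
  assumes "alt2 a" shows "a v u = - a u v"
proof -
  have "a (u + v) (u + v) = a u v + a v u"
    using assms by (simp add: alt2_simps[OF assms] alt2_same)
  then show ?thesis
    using alt2_same[OF assms, of "u + v"] by (simp add: add_eq_0_iff)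
qed

lemma alt3_alt2:
  assumes "alt3 t" shows "alt2 (t u)" "alt2 (\<lambda>u v. t u v w)"
  using assms by (auto simp: alt3_def)

lemma alt3_linear:
  assumes "alt3 t"
  shows "linear (\<lambda>u. t u v w)" "linear (\<lambda>v. t u v w)" "linear (\<lambda>w. t u v w)"
  using alt2_linear(1)[OF alt3_alt2(2)[OF assms]] alt2_linear[OF alt3_alt2(1)[OF assms]] by auto

lemmas alt3_simps = linear_complexD[OF alt3_linear(1)] linear_complexD[OF alt3_linear(2)]
  linear_complexD[OF alt3_linear(3)]

lemma alt3_skew:
  assumes "alt3 t"
  shows "t v u w = - t u v w" "t u w v = - t u v w"
  by (rule alt2_skew[OF alt3_alt2(2)[OF assms]], rule alt2_skew[OF alt3_alt2(1)[OF assms]])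

lemma alt3_same:
  assumes "alt3 t"
  shows "t u u w = 0" "t u w w = 0" "t u v u = 0"
proof -
  show "t u u w = 0" for u w using alt2_same[OF alt3_alt2(2)[OF assms]] .
  then show "t u v u = 0" using alt3_skew(2)[OF assms, of u u v] by simp
  show "t u w w = 0" using alt2_same[OF alt3_alt2(1)[OF assms]] .
qed

lemma alt4_alt3:
  assumes "alt4 g" shows "alt3 (g u)" "alt3 (\<lambda>u v w. g u v w z)"
  using assms by (auto simp: alt4_def)

lemma alt4_linear:
  assumes "alt4 g"
  shows "linear (\<lambda>u. g u v w z)" "linear (\<lambda>v. g u v w z)" "linear (\<lambda>w. g u v w z)" "linear (\<lambda>z. g u v w z)"
  using alt3_linear[OF alt4_alt3(2)[OF assms]] alt3_linear[OF alt4_alt3(1)[OF assms]] by auto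

lemma alt4_skew:
  assumes "alt4 g"
  shows "g v u w z = - g u v w z" "g u w v z = - g u v w z" "g u v z w = - g u v w z"
  by (rule alt3_skew(1)[OF alt4_alt3(2)[OF assms]], rule alt3_skew(2)[OF alt4_alt3(2)[OF assms]],
      rule alt3_skew(2)[OF alt4_alt3(1)[OF assms]])

lemma alt4_same:
  assumes "alt4 g"
  shows "g u u v w = 0" "g u v u w = 0" "g u v w u = 0" "g u v v w = 0" "g u v w v = 0" "g u v w w = 0"
proof -
  show "g u u v w = 0" "g u v u w = 0" "g u v v w = 0" for u v w
    using alt3_same[OF alt4_alt3(2)[OF assms]] by auto
  then show "g u v w u = 0" using alt4_skew(3)[OF assms, of u v u w] by simp
  show "g u v w v = 0" "g u v w w = 0"
    using alt3_same[OF alt4_alt3(1)[OF assms]] by auto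
qed

lemma linear_eq_0_spanning:
  fixes f :: "real^4 \<Rightarrow> complex"
  assumes "linear f" "span {e1,e2,e3,e4} = UNIV" "f e1 = 0" "f e2 = 0" "f e3 = 0" "f e4 = 0"
  shows "f x = 0"
proof -
  have "f x = (\<lambda>_. 0) x"
    using assms by (intro linear_eq_on_span[of f "\<lambda>_. 0" "{e1,e2,e3,e4}" x]) (auto intro: linear_zero)
  then show ?thesis by simp
qed

text \<open>Stated for an arbitrary spanning quadruple, since it serves the standard basis as well
  as orthonormal frames.\<close>

lemma alt2_eq_0:
  assumes a: "alt2 a" and sp: "span {e1,e2,e3,e4} = UNIV"
    and z: "a e1 e2 = 0" "a e1 e3 = 0" "a e1 e4 = 0" "a e2 e3 = 0" "a e2 e4 = 0" "a e3 e4 = 0"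
  shows "a u v = 0"
proof -
  have s: "a e2 e1 = 0" "a e3 e1 = 0" "a e4 e1 = 0" "a e3 e2 = 0" "a e4 e2 = 0" "a e4 e3 = 0"
    by (simp_all add: alt2_skew[OF a, of e2 e1] alt2_skew[OF a, of e3 e1] alt2_skew[OF a, of e4 e1]
      alt2_skew[OF a, of e3 e2] alt2_skew[OF a, of e4 e2] alt2_skew[OF a, of e4 e3] z)
  have 1: "a e v = 0" if "a e e1 = 0" "a e e2 = 0" "a e e3 = 0" "a e e4 = 0" for e v
    using linear_eq_0_spanning[OF alt2_linear(2)[OF a] sp that] .
  show ?thesis
    by (rule linear_eq_0_spanning[OF alt2_linear(1)[OF a] sp]; rule 1; simp add: z s alt2_same[OF a])
qed

lemma alt3_eq_0:
  assumes t: "alt3 t" and sp: "span {e1,e2,e3,e4} = UNIV"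
    and z: "t e1 e2 e3 = 0" "t e1 e2 e4 = 0" "t e1 e3 e4 = 0" "t e2 e3 e4 = 0"
  shows "t u v w = 0"
proof -
  have z2: "t e2 e1 e3 = 0" "t e2 e1 e4 = 0" "t e3 e1 e4 = 0" "t e3 e2 e4 = 0"
    by (simp_all add: alt3_skew(1)[OF t, of e2 e1] alt3_skew(1)[OF t, of e3 e1] alt3_skew(1)[OF t, of e3 e2] z)
  have z3: "t e3 e1 e2 = 0" "t e4 e1 e2 = 0" "t e4 e1 e3 = 0" "t e4 e2 e3 = 0"
    by (simp_all add: alt3_skew(1)[OF t, of e3 e1 e2] alt3_skew(1)[OF t, of e4 e1 e2] alt3_skew(1)[OF t, of e4 e1 e3]
      alt3_skew(1)[OF t, of e4 e2 e3] alt3_skew(2)[OF t, of e1 e3 e2] alt3_skew(2)[OF t, of e1 e4 e2]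
      alt3_skew(2)[OF t, of e1 e4 e3] alt3_skew(2)[OF t, of e2 e4 e3] z)
  have e1: "t e1 v w = 0" for v w
    by (rule alt2_eq_0[OF alt3_alt2(1)[OF t, of e1] sp]) (simp_all add: z z2 z3 alt3_same[OF t])
  have e2: "t e2 v w = 0" for v w
    by (rule alt2_eq_0[OF alt3_alt2(1)[OF t, of e2] sp]) (simp_all add: z z2 z3 alt3_same[OF t])
  have e3: "t e3 v w = 0" for v w
    by (rule alt2_eq_0[OF alt3_alt2(1)[OF t, of e3] sp]) (simp_all add: z z2 z3 alt3_same[OF t])
  have e4: "t e4 v w = 0" for v w
    by (rule alt2_eq_0[OF alt3_alt2(1)[OF t, of e4] sp]) (simp_all add: z z2 z3 alt3_same[OF t])
  show ?thesis
    by (rule linear_eq_0_spanning[OF alt3_linear(1)[OF t] sp]) (simp_all add: e1 e2 e3 e4)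
qed

lemma alt4_eq_0:
  assumes g: "alt4 g" and sp: "span {e1,e2,e3,e4} = UNIV" and z: "g e1 e2 e3 e4 = 0"
  shows "g u v w x = 0"
proof -
  have s2: "g e2 e1 e3 e4 = 0" using alt4_skew(1)[OF g, of e2 e1] z by simp
  have s3: "g e3 e1 e2 e4 = 0"
    using alt4_skew(1)[OF g, of e3 e1] alt4_skew(2)[OF g, of e1 e3 e2] z by simp
  have s4: "g e4 e1 e2 e3 = 0"
    using alt4_skew(1)[OF g, of e4 e1] alt4_skew(2)[OF g, of e1 e4 e2] alt4_skew(3)[OF g, of e1 e2 e4 e3] z by simp
  have e1: "g e1 v w x = 0" for v w x
    by (rule alt3_eq_0[OF alt4_alt3(1)[OF g, of e1] sp]) (simp_all add: z s2 s3 s4 alt4_same[OF g])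
  have e2: "g e2 v w x = 0" for v w x
    by (rule alt3_eq_0[OF alt4_alt3(1)[OF g, of e2] sp]) (simp_all add: z s2 s3 s4 alt4_same[OF g])
  have e3: "g e3 v w x = 0" for v w x
    by (rule alt3_eq_0[OF alt4_alt3(1)[OF g, of e3] sp]) (simp_all add: z s2 s3 s4 alt4_same[OF g])
  have e4: "g e4 v w x = 0" for v w x
    by (rule alt3_eq_0[OF alt4_alt3(1)[OF g, of e4] sp]) (simp_all add: z s2 s3 s4 alt4_same[OF g])
  show ?thesis
    by (rule linear_eq_0_spanning[OF alt4_linear(1)[OF g] sp]) (simp_all add: e1 e2 e3 e4)
qed

lemma span_E4: "span {E4 1, E4 2, E4 3, E4 4} = UNIV"
proof -
  have "(Basis :: (real^4) set) = {E4 1, E4 2, E4 3, E4 4}"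
    by (auto simp: Basis_vec_def UNIV_4)
  then show ?thesis by (metis span_Basis)
qed


subsection \<open>Wedge products\<close>

text \<open>The wedge products are signed sums over shuffles without factorials. This agrees with
  \<open>wedge1\<close> on products of covectors and with the signs in \<open>ext_d\<close>.\<close>

definition wedge11 :: "(real^4 \<Rightarrow> complex) \<Rightarrow> (real^4 \<Rightarrow> complex) \<Rightarrow> real^4 \<Rightarrow> real^4 \<Rightarrow> complex" where
  "wedge11 \<theta> \<eta> u v = \<theta> u * \<eta> v - \<theta> v * \<eta> u"

definition wedge12 :: "(real^4 \<Rightarrow> complex) \<Rightarrow> (real^4 \<Rightarrow> real^4 \<Rightarrow> complex) \<Rightarrow>
    real^4 \<Rightarrow> real^4 \<Rightarrow> real^4 \<Rightarrow> complex" where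
  "wedge12 \<theta> a u v w = \<theta> u * a v w - \<theta> v * a u w + \<theta> w * a u v"

definition wedge13 :: "(real^4 \<Rightarrow> complex) \<Rightarrow> (real^4 \<Rightarrow> real^4 \<Rightarrow> real^4 \<Rightarrow> complex) \<Rightarrow>
    real^4 \<Rightarrow> real^4 \<Rightarrow> real^4 \<Rightarrow> real^4 \<Rightarrow> complex" where
  "wedge13 \<theta> t u v w x = \<theta> u * t v w x - \<theta> v * t u w x + \<theta> w * t u v x - \<theta> x * t u v w"

definition wedge22 :: "(real^4 \<Rightarrow> real^4 \<Rightarrow> complex) \<Rightarrow> (real^4 \<Rightarrow> real^4 \<Rightarrow> complex) \<Rightarrow>
    real^4 \<Rightarrow> real^4 \<Rightarrow> real^4 \<Rightarrow> real^4 \<Rightarrow> complex" where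
  "wedge22 a b u v w x = a u v * b w x - a u w * b v x + a u x * b v w
     + a v w * b u x - a v x * b u w + a w x * b u v"

lemma alt2_wedge11: "linear \<theta> \<Longrightarrow> linear \<eta> \<Longrightarrow> alt2 (wedge11 \<theta> \<eta>)"
  unfolding alt2_def wedge11_def
  by (intro conjI allI linear_complexI) (simp_all add: linear_complexD algebra_simps)

lemma alt3_wedge12:
  assumes "linear \<theta>" "alt2 a" shows "alt3 (wedge12 \<theta> a)"
  unfolding alt3_def alt2_def wedge12_def
proof (intro conjI allI linear_complexI)
qed (simp_all add: linear_complexD[OF assms(1)] alt2_simps[OF assms(2)] alt2_same[OF assms(2)] alt2_skew[OF assms(2), of _ "_ + _"] algebra_simps)

lemma alt4_wedge13:
  assumes "linear \<theta>" "alt3 t" shows "alt4 (wedge13 \<theta> t)"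
  unfolding alt4_def alt3_def alt2_def wedge13_def
proof (intro conjI allI linear_complexI)
qed (simp_all add: linear_complexD[OF assms(1)] alt3_simps[OF assms(2)] alt3_same[OF assms(2)] algebra_simps)

lemma alt4_wedge22:
  assumes "alt2 a" "alt2 b" shows "alt4 (wedge22 a b)"
  unfolding alt4_def alt3_def alt2_def wedge22_def
proof (intro conjI allI linear_complexI)
  fix u v w x
  show "a u v * b v x - a u v * b v x + a u x * b v v + a v v * b u x - a v x * b u v + a v x * b u v = 0"
    by (simp add: alt2_same[OF assms(1)] alt2_same[OF assms(2)])
  show "a v v * b w x - a v w * b v x + a v x * b v w + a v w * b v x - a v x * b v w + a w x * b v v = 0"
    by (simp add: alt2_same[OF assms(1)] alt2_same[OF assms(2)])
qed (simp_all add: alt2_simps[OF assms(1)] alt2_simps[OF assms(2)] alt2_same[OF assms(1)] alt2_same[OF assms(2)] algebra_simps)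


subsection \<open>Determinants\<close>

lemma vector_4 [simp]:
 "(vector [x,y,z,w] ::('a::zero)^4)$1 = x"
 "(vector [x,y,z,w] ::('a::zero)^4)$2 = y"
 "(vector [x,y,z,w] ::('a::zero)^4)$3 = z"
 "(vector [x,y,z,w] ::('a::zero)^4)$4 = w"
  unfolding vector_def by simp_all

lemma det_row_linear:
  fixes F :: "real^4 \<Rightarrow> real^4^4"
  assumes "\<And>u i. i \<noteq> k \<Longrightarrow> F u $ i = c i" "\<And>u. F u $ k = u"
  shows "linear (\<lambda>u. complex_of_real (det (F u)))"
proof -
  have F: "F u = (\<chi> i. if i = k then u else c i)" for u
    using assms by (auto simp: vec_eq_iff)
  have a: "det (\<chi> i. if i = k then u + v else c i) =
      det (\<chi> i. if i = k then u else c i) + det (\<chi> i. if i = k then v else c i)" for u v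
    using det_row_add[of k "\<lambda>_. u" "\<lambda>_. v" c] .
  have m: "det (\<chi> i. if i = k then r *\<^sub>R u else c i) = r * det (\<chi> i. if i = k then u else c i)" for r u
    using det_row_mul[of k r "\<lambda>_. u" c] unfolding scalar_mult_eq_scaleR .
  show ?thesis
    unfolding F by (intro linear_complexI) (simp_all add: a m)
qed

lemma alt4_det: "alt4 (\<lambda>u v w x. complex_of_real (det (vector [u,v,w,x] :: real^4^4)))"
proof -
  have r: "row i (vector [u,v,w,x] :: real^4^4) = vector [u,v,w,x] $ i" for i u v w x
    by (simp add: row_def vec_eq_iff)
  have z: "det (vector [u,v,w,x] :: real^4^4) = 0" if "u = v \<or> v = w \<or> w = x" for u v w x
  proof -
    have "\<exists>i j. i \<noteq> j \<and> row i (vector [u,v,w,x] :: real^4^4) = row j (vector [u,v,w,x])"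
      unfolding r using that
      by (elim disjE) (rule exI[of _ 1] exI[of _ 2] exI[of _ 3]; rule exI[of _ 2] exI[of _ 3] exI[of _ 4]; simp; fail)+
    then show ?thesis using det_identical_rows by blast
  qed
  have l: "linear (\<lambda>u. complex_of_real (det (vector [u,v,w,x] :: real^4^4)))"
    "linear (\<lambda>v. complex_of_real (det (vector [u,v,w,x] :: real^4^4)))"
    "linear (\<lambda>w. complex_of_real (det (vector [u,v,w,x] :: real^4^4)))"
    "linear (\<lambda>x. complex_of_real (det (vector [u,v,w,x] :: real^4^4)))" for u v w x
    by (rule det_row_linear[where k = 1 and c = "\<lambda>i. vector [0,v,w,x] $ i"]
        det_row_linear[where k = 2 and c = "\<lambda>i. vector [u,0,w,x] $ i"]
        det_row_linear[where k = 3 and c = "\<lambda>i. vector [u,v,0,x] $ i"]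
        det_row_linear[where k = 4 and c = "\<lambda>i. vector [u,v,w,0] $ i"];
      use exhaust_4 in force)+
  show ?thesis
    unfolding alt4_def alt3_def alt2_def using l z by auto
qed

lemma det_E4: "det (vector [E4 1, E4 2, E4 3, E4 4] :: real^4^4) = 1"
proof -
  have "(vector [E4 1, E4 2, E4 3, E4 4] :: real^4^4) = mat 1"
    by (simp add: vec_eq_iff forall_4 mat_def axis_def)
  then show ?thesis by simp
qed

lemma alt4_diff_scale:
  assumes "alt4 g" "alt4 h"
  shows "alt4 (\<lambda>u v w x. g u v w x - c * h u v w x)"
  unfolding alt4_def alt3_def alt2_def
  by (intro conjI allI linear_complexI)
    (simp_all add: linear_complexD[OF alt4_linear(1)[OF assms(1)]] linear_complexD[OF alt4_linear(2)[OF assms(1)]]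
      linear_complexD[OF alt4_linear(3)[OF assms(1)]] linear_complexD[OF alt4_linear(4)[OF assms(1)]]
      linear_complexD[OF alt4_linear(1)[OF assms(2)]] linear_complexD[OF alt4_linear(2)[OF assms(2)]]
      linear_complexD[OF alt4_linear(3)[OF assms(2)]] linear_complexD[OF alt4_linear(4)[OF assms(2)]]
      alt4_same[OF assms(1)] alt4_same[OF assms(2)] algebra_simps)

text \<open>Top-degree forms are a line: after subtracting the right multiple of the determinant,
  the form vanishes on the standard basis and hence everywhere.\<close>

lemma alt4_det_unique:
  assumes "alt4 g"
  shows "g u v w x = g (E4 1) (E4 2) (E4 3) (E4 4) * of_real (det (vector [u,v,w,x] :: real^4^4))"
  using alt4_eq_0[OF alt4_diff_scale[OF assms alt4_det, of "g (E4 1) (E4 2) (E4 3) (E4 4)"] span_E4, of u v w x]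
  by (simp add: det_E4)

text \<open>The source of every Jacobian factor below: pullback multiplies the coefficient of a
  top-degree form by the determinant.\<close>

lemma alt4_linear_image:
  assumes "alt4 g" "linear T"
  shows "g (T (E4 1)) (T (E4 2)) (T (E4 3)) (T (E4 4)) = of_real (det (matrix T)) * g (E4 1) (E4 2) (E4 3) (E4 4)"
proof -
  \<comment> \<open>\<open>vector\<close> lists rows, whereas the images of the basis are the
    columns of \<open>matrix T\<close>.\<close>
  have "(vector [T (E4 1), T (E4 2), T (E4 3), T (E4 4)] :: real^4^4) = transpose (matrix T)"
    by (simp add: vec_eq_iff forall_4 transpose_def matrix_def)
  then show ?thesis
    by (subst alt4_det_unique[OF assms(1)]) (simp add: det_transpose)
qed

subsection \<open>Alternating covectors as functions of several arguments\<close>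

text \<open>\<open>cov1\<close>, \<open>cov2\<close>, \<open>cov3\<close> invert evaluation on
  lists; the value 0 on lists of another length is what \<open>alternating\<close> demands.\<close>

definition cov1 :: "(real^4 \<Rightarrow> complex) \<Rightarrow> covector" where
  "cov1 \<theta> = (\<lambda>vs. if length vs = 1 then \<theta> (vs ! 0) else 0)"

definition cov2 :: "(real^4 \<Rightarrow> real^4 \<Rightarrow> complex) \<Rightarrow> covector" where
  "cov2 a = (\<lambda>vs. if length vs = 2 then a (vs ! 0) (vs ! 1) else 0)"

definition cov3 :: "(real^4 \<Rightarrow> real^4 \<Rightarrow> real^4 \<Rightarrow> complex) \<Rightarrow> covector" where
  "cov3 t = (\<lambda>vs. if length vs = 3 then t (vs ! 0) (vs ! 1) (vs ! 2) else 0)"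

lemma cov_simps [simp]:
  "cov1 \<theta> [u] = \<theta> u" "cov2 a [u, v] = a u v" "cov3 t [u, v, w] = t u v w"
  by (simp_all add: cov1_def cov2_def cov3_def)

lemma length_1: "length vs = 1 \<longleftrightarrow> (\<exists>a. vs = [a])"
  and length_2: "length vs = 2 \<longleftrightarrow> (\<exists>a b. vs = [a, b])"
  and length_3: "length vs = 3 \<longleftrightarrow> (\<exists>a b c. vs = [a, b, c])"
  and length_4: "length vs = 4 \<longleftrightarrow> (\<exists>a b c d. vs = [a, b, c, d])"
  by (auto simp: length_Suc_conv numeral_eq_Suc)

lemma alternating_0: "alternating 0 \<alpha> \<longleftrightarrow> (\<forall>vs. length vs \<noteq> 0 \<longrightarrow> \<alpha> vs = 0)"
  by (simp add: alternating_def)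

lemma alternating_1: "alternating 1 \<alpha> \<longleftrightarrow> (\<forall>vs. length vs \<noteq> 1 \<longrightarrow> \<alpha> vs = 0) \<and> linear (\<lambda>v. \<alpha> [v])"
  unfolding alternating_def length_1 by auto

lemma alternating_2:
  "alternating 2 \<alpha> \<longleftrightarrow> (\<forall>vs. length vs \<noteq> 2 \<longrightarrow> \<alpha> vs = 0) \<and> alt2 (\<lambda>u v. \<alpha> [u, v])" (is "?L \<longleftrightarrow> ?R")
proof
  assume L: ?L
  then have lin: "linear (\<lambda>v. \<alpha> (vs[i := v]))" if "length vs = 2" "i < 2" for vs i
    using that by (simp add: alternating_def)
  have s: "\<alpha> [u, u] = 0" for u
    using L[unfolded alternating_def, THEN conjunct2, THEN conjunct2, rule_format, of "[u, u]" 0 1] by simp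
  have "linear (\<lambda>u. \<alpha> [u, v])" "linear (\<lambda>v. \<alpha> [u, v])" for u v
    using lin[of "[v, v]" 0] lin[of "[u, u]" 1] by simp_all
  with s L show ?R by (auto simp: alt2_def alternating_def)
next
  assume R: ?R
  then have a: "alt2 (\<lambda>u v. \<alpha> [u, v])" by blast
  show ?L unfolding alternating_def
  proof (intro conjI allI impI)
    fix vs :: "(real^4) list" assume "length vs \<noteq> 2"
    then show "\<alpha> vs = 0" using R by blast
  next
    fix vs :: "(real^4) list" and i :: nat assume "length vs = 2" "i < 2"
    then obtain a b where "vs = [a, b]" by (auto simp: length_2)
    with \<open>i < 2\<close> show "linear (\<lambda>v. \<alpha> (vs[i := v]))"
      using alt2_linear[OF a] by (auto simp: less_Suc_eq numeral_eq_Suc)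
  next
    fix vs :: "(real^4) list" and i j :: nat assume "length vs = 2" "i < j" "j < 2" "vs ! i = vs ! j"
    moreover from this obtain a b where "vs = [a, b]" by (auto simp: length_2)
    ultimately show "\<alpha> vs = 0"
      using alt2_same[OF a] by (auto simp: less_Suc_eq numeral_eq_Suc)
  qed
qed

lemma alternating_3:
  "alternating 3 \<alpha> \<longleftrightarrow> (\<forall>vs. length vs \<noteq> 3 \<longrightarrow> \<alpha> vs = 0) \<and> alt3 (\<lambda>u v w. \<alpha> [u, v, w])" (is "?L \<longleftrightarrow> ?R")
proof
  assume L: ?L
  then have lin: "linear (\<lambda>v. \<alpha> (vs[i := v]))" if "length vs = 3" "i < 3" for vs i
    using that by (simp add: alternating_def)
  have s: "\<alpha> [u, u, w] = 0" "\<alpha> [u, w, w] = 0" for u w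
    using L[unfolded alternating_def, THEN conjunct2, THEN conjunct2, rule_format, of "[u, u, w]" 0 1]
      L[unfolded alternating_def, THEN conjunct2, THEN conjunct2, rule_format, of "[u, w, w]" 1 2] by simp_all
  have "linear (\<lambda>u. \<alpha> [u, v, w])" "linear (\<lambda>v. \<alpha> [u, v, w])" "linear (\<lambda>w. \<alpha> [u, v, w])" for u v w
    using lin[of "[v, v, w]" 0] lin[of "[u, u, w]" 1] lin[of "[u, v, v]" 2] by simp_all
  with s L show ?R by (auto simp: alt2_def alt3_def alternating_def)
next
  assume R: ?R
  then have a: "alt3 (\<lambda>u v w. \<alpha> [u, v, w])" by blast
  show ?L unfolding alternating_def
  proof (intro conjI allI impI)
    fix vs :: "(real^4) list" assume "length vs \<noteq> 3"
    then show "\<alpha> vs = 0" using R by blast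
  next
    fix vs :: "(real^4) list" and i :: nat assume "length vs = 3" "i < 3"
    then obtain a b c where "vs = [a, b, c]" by (auto simp: length_3)
    with \<open>i < 3\<close> show "linear (\<lambda>v. \<alpha> (vs[i := v]))"
      using alt3_linear[OF a] by (auto simp: less_Suc_eq numeral_eq_Suc)
  next
    fix vs :: "(real^4) list" and i j :: nat assume "length vs = 3" "i < j" "j < 3" "vs ! i = vs ! j"
    moreover from this obtain a b c where "vs = [a, b, c]" by (auto simp: length_3)
    ultimately show "\<alpha> vs = 0"
      using alt3_same[OF a] by (auto simp: less_Suc_eq numeral_eq_Suc)
  qed
qed

lemma alternating_4:
  "alternating 4 \<alpha> \<longleftrightarrow> (\<forall>vs. length vs \<noteq> 4 \<longrightarrow> \<alpha> vs = 0) \<and> alt4 (\<lambda>u v w x. \<alpha> [u, v, w, x])" (is "?L \<longleftrightarrow> ?R")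
proof
  assume L: ?L
  then have lin: "linear (\<lambda>v. \<alpha> (vs[i := v]))" if "length vs = 4" "i < 4" for vs i
    using that by (simp add: alternating_def)
  have s: "\<alpha> [u, u, v, w] = 0" "\<alpha> [u, v, v, w] = 0" "\<alpha> [u, v, w, w] = 0" for u v w
    using L[unfolded alternating_def, THEN conjunct2, THEN conjunct2, rule_format, of "[u, u, v, w]" 0 1]
      L[unfolded alternating_def, THEN conjunct2, THEN conjunct2, rule_format, of "[u, v, v, w]" 1 2]
      L[unfolded alternating_def, THEN conjunct2, THEN conjunct2, rule_format, of "[u, v, w, w]" 2 3] by simp_all
  have "linear (\<lambda>u. \<alpha> [u, v, w, x])" "linear (\<lambda>v. \<alpha> [u, v, w, x])" "linear (\<lambda>w. \<alpha> [u, v, w, x])"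
    "linear (\<lambda>x. \<alpha> [u, v, w, x])" for u v w x
    using lin[of "[v, v, w, x]" 0] lin[of "[u, u, w, x]" 1] lin[of "[u, v, v, x]" 2] lin[of "[u, v, w, w]" 3] by simp_all
  with s L show ?R by (auto simp: alt2_def alt3_def alt4_def alternating_def)
next
  assume R: ?R
  then have a: "alt4 (\<lambda>u v w x. \<alpha> [u, v, w, x])" by blast
  show ?L unfolding alternating_def
  proof (intro conjI allI impI)
    fix vs :: "(real^4) list" assume "length vs \<noteq> 4"
    then show "\<alpha> vs = 0" using R by blast
  next
    fix vs :: "(real^4) list" and i :: nat assume "length vs = 4" "i < 4"
    then obtain a b c d where "vs = [a, b, c, d]" by (auto simp: length_4)
    with \<open>i < 4\<close> show "linear (\<lambda>v. \<alpha> (vs[i := v]))"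
      using alt4_linear[OF a] by (auto simp: less_Suc_eq numeral_eq_Suc)
  next
    fix vs :: "(real^4) list" and i j :: nat assume "length vs = 4" "i < j" "j < 4" "vs ! i = vs ! j"
    moreover from this obtain a b c d where "vs = [a, b, c, d]" by (auto simp: length_4)
    ultimately show "\<alpha> vs = 0"
      using alt4_same[OF a] by (auto simp: less_Suc_eq numeral_eq_Suc)
  qed
qed

lemma alternating_cov1: "linear \<theta> \<Longrightarrow> alternating 1 (cov1 \<theta>)"
  unfolding alternating_1 by (auto simp: cov1_def)

lemma alternating_cov2: "alt2 a \<Longrightarrow> alternating 2 (cov2 a)"
  unfolding alternating_2 by (auto simp: cov2_def)

lemma alternating_cov3: "alt3 t \<Longrightarrow> alternating 3 (cov3 t)"
  unfolding alternating_3 by (auto simp: cov3_def)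

lemma alternating_eqI2:
  assumes "alternating 2 \<alpha>" "alternating 2 \<beta>" "\<And>u v. \<alpha> [u, v] = \<beta> [u, v]"
  shows "\<alpha> = \<beta>"
proof
  fix vs
  show "\<alpha> vs = \<beta> vs"
    using assms by (cases "length vs = 2") (auto simp: alternating_def length_2)
qed

lemma alternating_eqI3:
  assumes "alternating 3 \<alpha>" "alternating 3 \<beta>" "\<And>u v w. \<alpha> [u, v, w] = \<beta> [u, v, w]"
  shows "\<alpha> = \<beta>"
proof
  fix vs
  show "\<alpha> vs = \<beta> vs"
    using assms by (cases "length vs = 3") (auto simp: alternating_def length_3)
qed


section \<open>A single tangent space: oriented frames, the star, positivity\<close>

section \<open>Hermitian linear algebra and the Hodge operator\<close>

text \<open>The pointwise model of a Hermitian tangent space. Its fundamental form is built from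
  \<open>G\<close> and \<open>J\<close> alone and identified with \<omega> later, in
  \<open>omega_eq\<close>.\<close>

locale hermitian4 =
  fixes J :: "real^4 \<Rightarrow> real^4" and G :: "real^4 \<Rightarrow> real^4 \<Rightarrow> real"
  assumes linear_J: "linear J" and JJ [simp]: "J (J v) = - v"
    and bilinear_G: "bilinear G" and G_sym: "G u v = G v u"
    and G_pos: "v \<noteq> 0 \<Longrightarrow> 0 < G v v" and G_J: "G (J u) (J v) = G u v"
begin

lemma linear_G: "linear (\<lambda>u. G u v)" "linear (G u)"
  using bilinear_G by (auto simp: bilinear_def)

lemma G_simps:
  "G (u + u') v = G u v + G u' v" "G (u - u') v = G u v - G u' v" "G (c *\<^sub>R u) v = c * G u v" "G (- u) v = - G u v" "G 0 v = 0"
  "G v (u + u') = G v u + G v u'" "G v (u - u') = G v u - G v u'" "G v (c *\<^sub>R u) = c * G v u" "G v (- u) = - G v u" "G v 0 = 0"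
  using linear_add[OF linear_G(1)] linear_diff[OF linear_G(1)] linear_cmul[OF linear_G(1)] linear_neg[OF linear_G(1)] linear_0[OF linear_G(1)]
    linear_add[OF linear_G(2)] linear_diff[OF linear_G(2)] linear_cmul[OF linear_G(2)] linear_neg[OF linear_G(2)] linear_0[OF linear_G(2)]
  by auto

lemma J_simps:
  "J (u + v) = J u + J v" "J (u - v) = J u - J v" "J (c *\<^sub>R u) = c *\<^sub>R J u" "J (- u) = - J u" "J 0 = 0"
  using linear_J by (auto simp: linear_add linear_diff linear_cmul linear_neg linear_0)

lemma G_J_left: "G (J u) v = - G u (J v)"
  using G_J[of u "J v"] G_simps(9)[of "J u" v] by simp

text \<open>The fundamental form; the sign is that of \<open>g = \<omega>(J\<cdot>, \<cdot>)\<close>.\<close>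

definition om :: "real^4 \<Rightarrow> real^4 \<Rightarrow> real" where
  "om u v = G u (J v)"

abbreviation W :: "real^4 \<Rightarrow> real^4 \<Rightarrow> complex" where
  "W u v \<equiv> complex_of_real (om u v)"

lemma om_skew: "om v u = - om u v"
  using G_J_left[of u v] by (simp add: om_def G_sym)

lemma om_same: "om u u = 0"
  using om_skew[of u u] by simp

lemma om_J: "om (J u) (J v) = om u v" "om (J u) v = G u v" "om u (J v) = - G u v"
  by (simp_all add: om_def G_simps G_J_left)

lemma alt2_W: "alt2 W"
  unfolding alt2_def
proof (intro conjI allI linear_complexI)
  show "W u u = 0" for u by (simp add: om_same)
qed (simp_all add: om_def G_simps J_simps)

text \<open>Half the square of the fundamental form, which is the Riemannian volume form of
  \<open>G\<close> for the orientation given by \<open>J\<close>; no determinant of \<open>G\<close>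
  has to be taken.\<close>

definition vol :: "real^4 \<Rightarrow> real^4 \<Rightarrow> real^4 \<Rightarrow> real^4 \<Rightarrow> real" where
  "vol u v w x = om u v * om w x - om u w * om v x + om u x * om v w"

lemma wedge22_W_W: "wedge22 W W u v w x = 2 * of_real (vol u v w x)"
  by (simp add: wedge22_def vol_def)

lemma vol_det: "vol u v w x = vol (E4 1) (E4 2) (E4 3) (E4 4) * det (vector [u,v,w,x] :: real^4^4)"
proof -
  have "complex_of_real (vol u v w x) = of_real (vol (E4 1) (E4 2) (E4 3) (E4 4) * det (vector [u,v,w,x] :: real^4^4))"
    using alt4_det_unique[OF alt4_wedge22[OF alt2_W alt2_W], of u v w x] unfolding wedge22_W_W by simp
  then show ?thesis using of_real_eq_iff by blast
qed

definition orthonormal :: "real^4 \<Rightarrow> real^4 \<Rightarrow> real^4 \<Rightarrow> real^4 \<Rightarrow> bool" where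
  "orthonormal e1 e2 e3 e4 \<longleftrightarrow> G e1 e1 = 1 \<and> G e2 e2 = 1 \<and> G e3 e3 = 1 \<and> G e4 e4 = 1 \<and>
     G e1 e2 = 0 \<and> G e1 e3 = 0 \<and> G e1 e4 = 0 \<and> G e2 e3 = 0 \<and> G e2 e4 = 0 \<and> G e3 e4 = 0"

text \<open>Positivity is tested by \<open>vol\<close> and not by comparing determinants;
  \<open>oriented_onb_iff\<close> proves that this is the prescribed orientation.\<close>

definition oriented :: "real^4 \<Rightarrow> real^4 \<Rightarrow> real^4 \<Rightarrow> real^4 \<Rightarrow> bool" where
  "oriented e1 e2 e3 e4 \<longleftrightarrow> orthonormal e1 e2 e3 e4 \<and> vol e1 e2 e3 e4 = 1"

lemma orthonormalD:
  assumes "orthonormal e1 e2 e3 e4"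
  shows "G e1 e1 = 1" "G e2 e2 = 1" "G e3 e3 = 1" "G e4 e4 = 1"
     "G e1 e2 = 0" "G e1 e3 = 0" "G e1 e4 = 0" "G e2 e3 = 0" "G e2 e4 = 0" "G e3 e4 = 0"
     "G e2 e1 = 0" "G e3 e1 = 0" "G e4 e1 = 0" "G e3 e2 = 0" "G e4 e2 = 0" "G e4 e3 = 0"
  using assms G_sym unfolding orthonormal_def by auto

text \<open>Inner products with the frame recover the coefficients, so the map \<open>S\<close> that
  builds vectors from coefficients is injective and, in dimension 4, onto.\<close>

lemma orthonormal_expand:
  assumes "orthonormal e1 e2 e3 e4"
  shows "v = G v e1 *\<^sub>R e1 + G v e2 *\<^sub>R e2 + G v e3 *\<^sub>R e3 + G v e4 *\<^sub>R e4"
proof -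
  define S :: "real^4 \<Rightarrow> real^4" where "S = (\<lambda>c. c$1 *\<^sub>R e1 + c$2 *\<^sub>R e2 + c$3 *\<^sub>R e3 + c$4 *\<^sub>R e4)"
  have c: "G (S c) e1 = c$1" "G (S c) e2 = c$2" "G (S c) e3 = c$3" "G (S c) e4 = c$4" for c
    by (simp_all add: S_def G_simps orthonormalD[OF assms])
  have "linear S"
    by (rule linearI) (simp_all add: S_def algebra_simps)
  moreover have "inj S"
  proof (rule injI)
    fix c d assume "S c = S d"
    then have "c$1 = d$1" "c$2 = d$2" "c$3 = d$3" "c$4 = d$4" using c by metis+
    then show "c = d" by (simp add: vec_eq_iff forall_4)
  qed
  ultimately have "surj S" by (simp add: linear_injective_imp_surjective)
  then obtain c where "v = S c" by (metis surjD)
  then show ?thesis using c[of c] by (simp add: S_def)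
qed

lemma orthonormal_span:
  assumes "orthonormal e1 e2 e3 e4"
  shows "span {e1,e2,e3,e4} = UNIV"
proof -
  have "v \<in> span {e1,e2,e3,e4}" for v
    by (subst orthonormal_expand[OF assms]) (intro span_add span_scale span_base; simp)
  then show ?thesis by auto
qed

text \<open>The matrix of \<open>om\<close> in the frame is skew, and orthogonal because
  \<open>J\<close> is an isometry. These are relations between its rows.\<close>

lemma orthonormal_om:
  assumes "orthonormal e1 e2 e3 e4"
  shows "(om e1 e2)\<^sup>2 + (om e1 e3)\<^sup>2 + (om e1 e4)\<^sup>2 = 1" "(om e1 e2)\<^sup>2 + (om e2 e3)\<^sup>2 + (om e2 e4)\<^sup>2 = 1"
    "(om e1 e3)\<^sup>2 + (om e2 e3)\<^sup>2 + (om e3 e4)\<^sup>2 = 1" "(om e1 e4)\<^sup>2 + (om e2 e4)\<^sup>2 + (om e3 e4)\<^sup>2 = 1"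
    "om e1 e3 * om e2 e3 = - (om e1 e4 * om e2 e4)" "om e1 e2 * om e2 e3 = om e1 e4 * om e3 e4"
    "om e1 e2 * om e2 e4 = - (om e1 e3 * om e3 e4)"
proof -
  have e: "G (J u) (J v) = om e1 u * om e1 v + om e2 u * om e2 v + om e3 u * om e3 v + om e4 u * om e4 v" for u v
  proof -
    have "G (J u) (J v) = G (G (J u) e1 *\<^sub>R e1 + G (J u) e2 *\<^sub>R e2 + G (J u) e3 *\<^sub>R e3 + G (J u) e4 *\<^sub>R e4) (J v)"
      using orthonormal_expand[OF assms, of "J u"] by simp
    then show ?thesis by (simp only: G_simps om_def G_sym[of "J u"])
  qed
  note r = e[unfolded G_J] om_same orthonormalD[OF assms] om_skew[of e2 e1] om_skew[of e3 e1] om_skew[of e4 e1]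
    om_skew[of e3 e2] om_skew[of e4 e2] om_skew[of e4 e3]
  show "(om e1 e2)\<^sup>2 + (om e1 e3)\<^sup>2 + (om e1 e4)\<^sup>2 = 1"
    using e[of e1 e1, unfolded G_J] by (simp add: r(2-) power2_eq_square)
  show "(om e1 e2)\<^sup>2 + (om e2 e3)\<^sup>2 + (om e2 e4)\<^sup>2 = 1"
    using e[of e2 e2, unfolded G_J] by (simp add: r(2-) power2_eq_square)
  show "(om e1 e3)\<^sup>2 + (om e2 e3)\<^sup>2 + (om e3 e4)\<^sup>2 = 1"
    using e[of e3 e3, unfolded G_J] by (simp add: r(2-) power2_eq_square)
  show "(om e1 e4)\<^sup>2 + (om e2 e4)\<^sup>2 + (om e3 e4)\<^sup>2 = 1"
    using e[of e4 e4, unfolded G_J] by (simp add: r(2-) power2_eq_square)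
  show "om e1 e3 * om e2 e3 = - (om e1 e4 * om e2 e4)"
    using e[of e1 e2, unfolded G_J] by (simp add: r(2-))
  show "om e1 e2 * om e2 e3 = om e1 e4 * om e3 e4"
    using e[of e1 e3, unfolded G_J] by (simp add: r(2-))
  show "om e1 e2 * om e2 e4 = - (om e1 e3 * om e3 e4)"
    using e[of e1 e4, unfolded G_J] by (simp add: r(2-))
qed

text \<open>\<open>vol\<close> is the Pfaffian of a skew orthogonal matrix, so its square is a
  determinant equal to 1. Elementary version: complementary entries have equal squares because all
  rows have norm 1, and the mixed products come from the orthogonality of rows.\<close>

lemma vol_orthonormal:
  assumes "orthonormal e1 e2 e3 e4"
  shows "(vol e1 e2 e3 e4)\<^sup>2 = 1"
proof -
  define a b c c' b' a' where d: "a = om e1 e2" "b = om e1 e3" "c = om e1 e4" "c' = om e2 e3" "b' = om e2 e4" "a' = om e3 e4"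
  note o = orthonormal_om[OF assms, folded d]
  have sq: "a'\<^sup>2 = a\<^sup>2" "b'\<^sup>2 = b\<^sup>2" "c'\<^sup>2 = c\<^sup>2" using o by linarith+
  have "a * a' * (b * b') = (a * b') * (b * a')" "b * b' * (c * c') = (b * c') * (c * b')" "a * a' * (c * c') = (a * c') * (c * a')"
    by (simp_all add: algebra_simps)
  then have "a * a' * (b * b') = - (b * a')\<^sup>2" "b * b' * (c * c') = - (b * c')\<^sup>2" "a * a' * (c * c') = (c * a')\<^sup>2"
    unfolding o(6,7) power2_eq_square using o(5) by simp_all
  then have m: "a * a' * (b * b') = - (b\<^sup>2 * a\<^sup>2)" "b * b' * (c * c') = - (b\<^sup>2 * c\<^sup>2)" "a * a' * (c * c') = c\<^sup>2 * a\<^sup>2"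
    unfolding power_mult_distrib sq by simp_all
  have "(vol e1 e2 e3 e4)\<^sup>2 = a\<^sup>2 * a'\<^sup>2 + b\<^sup>2 * b'\<^sup>2 + c\<^sup>2 * c'\<^sup>2
      - 2 * (a * a' * (b * b')) + 2 * (a * a' * (c * c')) - 2 * (b * b' * (c * c'))"
    unfolding vol_def d[symmetric] by (simp add: power2_eq_square algebra_simps)
  also have "\<dots> = (a\<^sup>2 + b\<^sup>2 + c\<^sup>2)\<^sup>2"
    unfolding m sq by (simp add: power2_eq_square algebra_simps)
  finally show ?thesis using o(1) by simp
qed

text \<open>The fundamental form is self-dual. The squares of the three defects add up to
  \<open>2 - 2 * vol\<close>, which is 0 in an oriented frame.\<close>

lemma oriented_om:
  assumes "oriented e1 e2 e3 e4"
  shows "om e3 e4 = om e1 e2" "om e2 e4 = - om e1 e3" "om e2 e3 = om e1 e4"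
proof -
  have o: "orthonormal e1 e2 e3 e4" and v: "vol e1 e2 e3 e4 = 1" using assms by (auto simp: oriented_def)
  have "(om e3 e4 - om e1 e2)\<^sup>2 + (om e2 e4 + om e1 e3)\<^sup>2 + (om e2 e3 - om e1 e4)\<^sup>2 = 0"
    using orthonormal_om(1-4)[OF o] v unfolding vol_def power2_eq_square by (simp add: algebra_simps)
  then have "(om e3 e4 - om e1 e2)\<^sup>2 = 0" "(om e2 e4 + om e1 e3)\<^sup>2 = 0" "(om e2 e3 - om e1 e4)\<^sup>2 = 0"
    using zero_le_power2[of "om e3 e4 - om e1 e2"] zero_le_power2[of "om e2 e4 + om e1 e3"]
      zero_le_power2[of "om e2 e3 - om e1 e4"] by linarith+
  then show "om e3 e4 = om e1 e2" "om e2 e4 = - om e1 e3" "om e2 e3 = om e1 e4" by (auto simp: add_eq_0_iff)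
qed

text \<open>By self-duality three numbers, whose squares add up to 1, describe \<open>J\<close> in
  an oriented frame.\<close>

lemma oriented_J:
  assumes "oriented e1 e2 e3 e4"
  shows "J e1 = - om e1 e2 *\<^sub>R e2 - om e1 e3 *\<^sub>R e3 - om e1 e4 *\<^sub>R e4"
    "J e2 = om e1 e2 *\<^sub>R e1 - om e1 e4 *\<^sub>R e3 + om e1 e3 *\<^sub>R e4"
    "J e3 = om e1 e3 *\<^sub>R e1 + om e1 e4 *\<^sub>R e2 - om e1 e2 *\<^sub>R e4"
    "J e4 = om e1 e4 *\<^sub>R e1 - om e1 e3 *\<^sub>R e2 + om e1 e2 *\<^sub>R e3"
proof -
  have o: "orthonormal e1 e2 e3 e4" using assms by (auto simp: oriented_def)
  have e: "J v = om e1 v *\<^sub>R e1 + om e2 v *\<^sub>R e2 + om e3 v *\<^sub>R e3 + om e4 v *\<^sub>R e4" for v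
    using orthonormal_expand[OF o, of "J v"] by (simp add: om_def G_sym[of "J v"])
  note r = om_same om_skew[of e2 e1] om_skew[of e3 e1] om_skew[of e4 e1]
    om_skew[of e3 e2] om_skew[of e4 e2] om_skew[of e4 e3] oriented_om[OF assms]
  show "J e1 = - om e1 e2 *\<^sub>R e2 - om e1 e3 *\<^sub>R e3 - om e1 e4 *\<^sub>R e4"
    "J e2 = om e1 e2 *\<^sub>R e1 - om e1 e4 *\<^sub>R e3 + om e1 e3 *\<^sub>R e4"
    "J e3 = om e1 e3 *\<^sub>R e1 + om e1 e4 *\<^sub>R e2 - om e1 e2 *\<^sub>R e4"
    "J e4 = om e1 e4 *\<^sub>R e1 - om e1 e3 *\<^sub>R e2 + om e1 e2 *\<^sub>R e3"
    by (subst e; simp add: r)+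
qed

text \<open>Gram-Schmidt over complex lines. The frame is positive since \<open>om e (J e)\<close>
  and \<open>om f (J f)\<close> are both -1.\<close>

lemma exists_unitary_frame: "\<exists>e f. oriented e (J e) f (J f)"
proof -
  have unit: "\<exists>c. G (c *\<^sub>R v) (c *\<^sub>R v) = 1" if "v \<noteq> 0" for v
    using G_pos[OF that] by (intro exI[of _ "1 / sqrt (G v v)"]) (simp add: G_simps field_simps)
  have JG: "G u (J u) = 0" for u using om_same by (simp add: om_def)
  obtain c where c: "G (c *\<^sub>R E4 1) (c *\<^sub>R E4 1) = 1" using unit[of "E4 1"] by auto
  define e where "e = c *\<^sub>R E4 1"
  have e: "G e e = 1" "G e (J e) = 0" "G (J e) e = 0" "G (J e) (J e) = 1"
    using c JG G_J G_sym[of "J e" e] by (auto simp: e_def)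
  \<comment> \<open>A complex line has real dimension at most 2, so some \<open>v\<close> lies
    outside it.\<close>
  have "dim (span {e, J e}) \<le> card {e, J e}" by (rule dim_le_card) auto
  also have "\<dots> \<le> 2" by (simp add: card_insert_if)
  finally have "dim (span {e, J e}) < dim (UNIV :: (real^4) set)" unfolding dim_UNIV by simp
  then have "span {e, J e} \<noteq> UNIV" by (metis less_irrefl)
  then obtain v where v: "v \<notin> span {e, J e}" by auto
  define w where "w = v - G v e *\<^sub>R e - G v (J e) *\<^sub>R J e"
  have "w \<noteq> 0"
  proof
    assume "w = 0"
    then have "v = G v e *\<^sub>R e + G v (J e) *\<^sub>R J e" by (simp add: w_def algebra_simps)
    moreover have "G v e *\<^sub>R e + G v (J e) *\<^sub>R J e \<in> span {e, J e}"
      by (intro span_add span_scale span_base) auto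
    ultimately show False using v by simp
  qed
  then obtain b where b: "G (b *\<^sub>R w) (b *\<^sub>R w) = 1" using unit by blast
  define f where "f = b *\<^sub>R w"
  have f: "G e f = 0" "G (J e) f = 0" "G f f = 1"
    using b e by (simp_all add: f_def w_def G_simps G_sym[of e v] G_sym[of "J e" v])
  have f2: "G e (J f) = 0" "G (J e) (J f) = 0" "G f (J f) = 0" "G (J f) (J f) = 1"
    using f G_J_left[of e f] by (simp_all add: G_J JG)
  have "orthonormal e (J e) f (J f)"
    using e f f2 by (simp add: orthonormal_def)
  moreover have "vol e (J e) f (J f) = 1"
    using e f f2 by (simp add: vol_def om_def G_simps)
  ultimately show ?thesis by (auto simp: oriented_def)
qed

lemma vol_E4_nonzero: "vol (E4 1) (E4 2) (E4 3) (E4 4) \<noteq> 0"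
proof
  assume "vol (E4 1) (E4 2) (E4 3) (E4 4) = 0"
  moreover obtain e f where "oriented e (J e) f (J f)" using exists_unitary_frame by blast
  ultimately show False using vol_det[of e "J e" f "J f"] by (simp add: oriented_def)
qed

text \<open>The value is the squared norm of \<open>u\<close> times that of the component of
  \<open>v\<close> orthogonal to the complex line of \<open>u\<close>.\<close>

lemma vol_complex_line_nonneg: "0 \<le> vol u (J u) v (J v)"
proof (cases "u = 0")
  case True
  then show ?thesis by (simp add: vol_def om_def G_simps J_simps)
next
  case False
  then have p: "G u u > 0" by (rule G_pos)
  \<comment> \<open>This is \<open>G u u\<close> times that component. Without the division, its
    squared norm is \<open>G u u\<close> times the wanted number.\<close>
  define z where "z = G u u *\<^sub>R v - G u v *\<^sub>R u - G (J u) v *\<^sub>R J u"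
  have "0 \<le> G z z"
    using G_pos[of z] by (cases "z = 0") (auto simp: G_simps)
  also have "G z z = G u u * (G u u * G v v - (G u v)\<^sup>2 - (G (J u) v)\<^sup>2)"
    using om_same[of u] G_J_left[of u u]
    by (simp add: z_def G_simps G_sym[of v u] G_sym[of v "J u"] G_J om_def power2_eq_square algebra_simps)
  also have "G u u * G v v - (G u v)\<^sup>2 - (G (J u) v)\<^sup>2 = vol u (J u) v (J v)"
    unfolding vol_def by (simp add: om_J) (simp add: om_def G_J_left power2_eq_square)
  finally show ?thesis using p by (simp add: zero_le_mult_iff)
qed

text \<open>The prescribed condition names only some \<open>u\<close> and \<open>v\<close>, but
  \<open>vol\<close> is nonnegative on every quadruple \<open>u, J u, v, J v\<close>. Both
  determinants are turned into values of \<open>vol\<close> by the same coefficient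
  \<open>?k\<close>, whose unknown sign disappears in the square.\<close>

lemma oriented_onb_iff:
  "oriented_onb J G es \<longleftrightarrow> (\<exists>e1 e2 e3 e4. es = [e1,e2,e3,e4] \<and> oriented e1 e2 e3 e4)"
proof
  assume L: "oriented_onb J G es"
  then obtain e1 e2 e3 e4 where es: "es = [e1,e2,e3,e4]" by (auto simp: oriented_onb_def length_4)
  from L have "\<forall>i<4. \<forall>j<4. G (es ! i) (es ! j) = (if i = j then 1 else 0)" by (simp add: oriented_onb_def)
  then have on: "orthonormal e1 e2 e3 e4"
    by (simp add: es orthonormal_def numeral_eq_Suc All_less_Suc)
  from L obtain u v where uv: "0 < det (vector es :: real^4^4) * det (vector [u, J u, v, J v] :: real^4^4)"
    by (auto simp: oriented_onb_def)
  let ?k = "vol (E4 1) (E4 2) (E4 3) (E4 4)"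
  have "0 < ?k\<^sup>2 * (det (vector es :: real^4^4) * det (vector [u, J u, v, J v] :: real^4^4))"
    using uv vol_E4_nonzero by simp
  also have "\<dots> = vol e1 e2 e3 e4 * vol u (J u) v (J v)"
    unfolding vol_det[of e1 e2 e3 e4] vol_det[of u "J u" v "J v"] es by (simp add: power2_eq_square)
  finally have "0 < vol e1 e2 e3 e4"
    using vol_complex_line_nonneg[of u v] by (simp add: zero_less_mult_iff)
  then have "vol e1 e2 e3 e4 = 1"
    using vol_orthonormal[OF on] by (simp add: power2_eq_1_iff)
  then show "\<exists>e1 e2 e3 e4. es = [e1,e2,e3,e4] \<and> oriented e1 e2 e3 e4"
    using es on by (auto simp: oriented_def)
next
  assume "\<exists>e1 e2 e3 e4. es = [e1,e2,e3,e4] \<and> oriented e1 e2 e3 e4"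
  then obtain e1 e2 e3 e4 where es: "es = [e1,e2,e3,e4]" and o: "oriented e1 e2 e3 e4" by blast
  have on: "orthonormal e1 e2 e3 e4" using o by (simp add: oriented_def)
  obtain e f where ef: "oriented e (J e) f (J f)" using exists_unitary_frame by blast
  let ?k = "vol (E4 1) (E4 2) (E4 3) (E4 4)"
  have "?k * det (vector [e1,e2,e3,e4] :: real^4^4) = 1" "?k * det (vector [e, J e, f, J f] :: real^4^4) = 1"
    using o ef vol_det[of e1 e2 e3 e4] vol_det[of e "J e" f "J f"] by (auto simp: oriented_def)
  then have "det (vector [e1,e2,e3,e4] :: real^4^4) = 1 / ?k" "det (vector [e, J e, f, J f] :: real^4^4) = 1 / ?k"
    using vol_E4_nonzero by (auto simp: field_simps)
  then have "0 < det (vector es :: real^4^4) * det (vector [e, J e, f, J f] :: real^4^4)"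
    using vol_E4_nonzero by (auto simp: es zero_less_mult_iff)
  then show "oriented_onb J G es"
    unfolding oriented_onb_def using es orthonormalD[OF on]
    by (auto simp: numeral_eq_Suc All_less_Suc)
qed

text \<open>Positivity is proved in frames and integrated in coordinates; this lemma translates
  between the two.\<close>

lemma oriented_alt4:
  assumes "alt4 g" "oriented e1 e2 e3 e4"
  shows "g (E4 1) (E4 2) (E4 3) (E4 4) = g e1 e2 e3 e4 * of_real (vol (E4 1) (E4 2) (E4 3) (E4 4))"
proof -
  have "complex_of_real (vol (E4 1) (E4 2) (E4 3) (E4 4) * det (vector [e1,e2,e3,e4] :: real^4^4)) = 1"
    using assms(2) vol_det[of e1 e2 e3 e4] by (simp add: oriented_def)
  then show ?thesis
    by (subst (2) alt4_det_unique[OF assms(1)]) (simp add: mult_ac)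
qed

text \<open>Even permutations, chosen so that every pair of frame vectors, up to order, reaches the
  last two places and every vector reaches the last one.\<close>

lemma oriented_permute:
  assumes "oriented e1 e2 e3 e4"
  shows "oriented e3 e4 e1 e2" "oriented e1 e3 e4 e2" "oriented e1 e4 e2 e3" "oriented e4 e2 e1 e3"
    "oriented e2 e3 e1 e4" "oriented e2 e1 e4 e3" "oriented e4 e3 e2 e1"
  using assms om_skew[of e2 e1] om_skew[of e3 e1] om_skew[of e4 e1]
    om_skew[of e3 e2] om_skew[of e4 e2] om_skew[of e4 e3]
  by (auto simp: oriented_def orthonormal_def vol_def G_sym algebra_simps)

end

section \<open>Frame-free formulas for the Hodge star\<close>

context hermitian4
begin

text \<open>The sum of \<open>a e (J e)\<close> over an oriented orthonormal frame, as
  \<open>trace2_trace\<close> shows. As a quotient of coefficients of 4-forms it mentions no frame,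
  so smoothness and invariance can be read off.\<close>

definition trace2 :: "(real^4 \<Rightarrow> real^4 \<Rightarrow> complex) \<Rightarrow> complex" where
  "trace2 a = - 2 * wedge22 a W (E4 1) (E4 2) (E4 3) (E4 4) / of_real (vol (E4 1) (E4 2) (E4 3) (E4 4))"

text \<open>The star and the pullback by \<open>J\<close> are both the identity on \<open>W\<close>
  and are opposite to each other on trace-free forms. Their sum is thus twice the projection to
  \<open>W\<close>, and this projection is \<open>- trace2 a / 4 * W\<close> because
  \<open>trace2 W = - 4\<close>.\<close>

definition star2 :: "(real^4 \<Rightarrow> real^4 \<Rightarrow> complex) \<Rightarrow> real^4 \<Rightarrow> real^4 \<Rightarrow> complex" where
  "star2 a u v = - trace2 a / 2 * W u v - a (J u) (J v)"

text \<open>Contract the 5-form t\<and>\<omega>, which is 0, with Jv: the contraction of t, wedged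
  with \<omega>, equals t wedged with the contraction of \<omega>, and the latter is
  \<open>G v\<close>. Since t\<and>(G v) is the value at v of the star of t times the volume form,
  that value is the coefficient of the first product, which is minus half a trace.\<close>

definition star3 :: "(real^4 \<Rightarrow> real^4 \<Rightarrow> real^4 \<Rightarrow> complex) \<Rightarrow> real^4 \<Rightarrow> complex" where
  "star3 t v = - trace2 (\<lambda>u w. t u w (J v)) / 2"

lemma linear_compose_J: "linear f \<Longrightarrow> linear (\<lambda>u. f (J u))"
  using linear_compose[OF linear_J, of f] by (simp add: comp_def)

lemma alt2_J: "alt2 a \<Longrightarrow> alt2 (\<lambda>u v. a (J u) (J v))"
  unfolding alt2_def using linear_compose_J by auto

lemma alt3_J: "alt3 t \<Longrightarrow> alt3 (\<lambda>u v w. t (J u) (J v) (J w))"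
  unfolding alt3_def using alt2_J by auto

lemma alt2_add_scale:
  assumes "alt2 a" "alt2 b"
  shows "alt2 (\<lambda>u v. c * a u v + d * b u v)"
  unfolding alt2_def
  by (intro conjI allI linear_complexI)
    (simp_all add: alt2_simps[OF assms(1)] alt2_simps[OF assms(2)] alt2_same[OF assms(1)] alt2_same[OF assms(2)] algebra_simps)

lemma alt2_star2: "alt2 a \<Longrightarrow> alt2 (star2 a)"
  using alt2_add_scale[OF alt2_W alt2_J, of a "- trace2 a / 2" "- 1"] by (simp add: star2_def[abs_def])

lemma wedge22_oriented:
  assumes a: "alt2 a" and o: "oriented e1 e2 e3 e4"
  shows "wedge22 a W e1 e2 e3 e4 = of_real (om e1 e2) * (a e1 e2 + a e3 e4) + of_real (om e1 e3) * (a e1 e3 - a e2 e4)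
    + of_real (om e1 e4) * (a e1 e4 + a e2 e3)"
  by (simp add: wedge22_def oriented_om[OF o] algebra_simps)

lemma trace2_oriented:
  assumes a: "alt2 a" and o: "oriented e1 e2 e3 e4"
  shows "trace2 a = - 2 * (of_real (om e1 e2) * (a e1 e2 + a e3 e4) + of_real (om e1 e3) * (a e1 e3 - a e2 e4)
    + of_real (om e1 e4) * (a e1 e4 + a e2 e3))"
  unfolding trace2_def oriented_alt4[OF alt4_wedge22[OF a alt2_W] o] wedge22_oriented[OF a o]
  using vol_E4_nonzero by simp

lemma trace2_W: "trace2 W = - 4"
  using vol_E4_nonzero by (simp add: trace2_def wedge22_W_W)

lemma trace2_trace:
  assumes a: "alt2 a" and o: "oriented e1 e2 e3 e4"
  shows "trace2 a = a e1 (J e1) + a e2 (J e2) + a e3 (J e3) + a e4 (J e4)"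
  unfolding trace2_oriented[OF a o] oriented_J[OF o]
  using alt2_skew[OF a, of e2 e1] alt2_skew[OF a, of e3 e1] alt2_skew[OF a, of e4 e1]
    alt2_skew[OF a, of e3 e2] alt2_skew[OF a, of e4 e2] alt2_skew[OF a, of e4 e3]
  by (simp add: alt2_simps[OF a] alt2_same[OF a] algebra_simps)

lemma trace2_add_scale: "trace2 (\<lambda>u v. c * a u v + d * b u v) = c * trace2 a + d * trace2 b"
  using vol_E4_nonzero by (simp add: trace2_def wedge22_def field_simps)

lemma oriented_om_sum:
  assumes "oriented e1 e2 e3 e4"
  shows "complex_of_real (om e1 e2) * of_real (om e1 e2) =
    1 - of_real (om e1 e3) * of_real (om e1 e3) - of_real (om e1 e4) * of_real (om e1 e4)"
proof -
  have "om e1 e2 * om e1 e2 = 1 - om e1 e3 * om e1 e3 - om e1 e4 * om e1 e4"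
    using orthonormal_om(1)[of e1 e2 e3 e4] assms by (simp add: oriented_def power2_eq_square)
  then have "complex_of_real (om e1 e2 * om e1 e2) = of_real (1 - om e1 e3 * om e1 e3 - om e1 e4 * om e1 e4)"
    by simp
  then show ?thesis by simp
qed

text \<open>A computation in the frame: self-duality reduces \<open>om\<close> to three numbers, and
  the relation between their squares finishes it.\<close>

lemma star2_oriented:
  assumes a: "alt2 a" and o: "oriented e1 e2 e3 e4"
  shows "star2 a e3 e4 = a e1 e2"
proof -
  define x y z where xyz: "x = complex_of_real (om e1 e2)" "y = complex_of_real (om e1 e3)" "z = complex_of_real (om e1 e4)"
  have s: "x * x = 1 - y * y - z * z" using oriented_om_sum[OF o] by (simp add: xyz)
  \<comment> \<open>The relation serves as a rewrite rule for \<open>x * x\<close>; this is its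
    shape for products nested to the right.\<close>
  have s': "x * (x * t) = t - y * (y * t) - z * (z * t)" for t
    using arg_cong[OF s, of "\<lambda>r. r * t"] by (simp add: algebra_simps)
  have jj: "a (J e3) (J e4) = - (y * y + z * z) * a e1 e2 + x * y * a e1 e3 + x * z * a e2 e3
      + x * z * a e1 e4 - x * y * a e2 e4 + x * x * a e3 e4"
    unfolding oriented_J[OF o]
    using alt2_skew[OF a, of e2 e1] alt2_skew[OF a, of e3 e1] alt2_skew[OF a, of e4 e1]
      alt2_skew[OF a, of e3 e2] alt2_skew[OF a, of e4 e2] alt2_skew[OF a, of e4 e3]
    by (simp add: alt2_simps[OF a] alt2_same[OF a] xyz algebra_simps)
  have tr: "- trace2 a / 2 = x * (a e1 e2 + a e3 e4) + y * (a e1 e3 - a e2 e4) + z * (a e1 e4 + a e2 e3)"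
    unfolding trace2_oriented[OF a o] xyz by simp
  show ?thesis
    unfolding star2_def jj tr oriented_om[OF o]
    by (simp add: xyz[symmetric] algebra_simps s s')
qed

lemma star3_oriented:
  assumes t: "alt3 t" and o: "oriented e1 e2 e3 e4"
  shows "star3 t e4 = t e1 e2 e3"
proof -
  define x y z where xyz: "x = complex_of_real (om e1 e2)" "y = complex_of_real (om e1 e3)" "z = complex_of_real (om e1 e4)"
  have s: "x * x = 1 - y * y - z * z" using oriented_om_sum[OF o] by (simp add: xyz)
  have s': "x * (x * t) = t - y * (y * t) - z * (z * t)" for t
    using arg_cong[OF s, of "\<lambda>r. r * t"] by (simp add: algebra_simps)
  have j: "t u w (J e4) = z * t u w e1 - y * t u w e2 + x * t u w e3" for u w
    unfolding oriented_J[OF o] by (simp add: alt3_simps[OF t] xyz)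
  have p: "t e1 e3 e2 = - t e1 e2 e3" "t e2 e3 e1 = t e1 e2 e3" "t e2 e4 e1 = t e1 e2 e4" "t e1 e4 e2 = - t e1 e2 e4"
     "t e3 e4 e1 = t e1 e3 e4" "t e1 e4 e3 = - t e1 e3 e4" "t e3 e4 e2 = t e2 e3 e4" "t e2 e4 e3 = - t e2 e3 e4"
    using alt3_skew(2)[OF t, of e1 e3 e2] alt3_skew(2)[OF t, of e1 e4 e2] alt3_skew(2)[OF t, of e1 e4 e3]
      alt3_skew(2)[OF t, of e2 e4 e3] alt3_skew(2)[OF t, of e2 e3 e1] alt3_skew(1)[OF t, of e2 e1 e3]
      alt3_skew(2)[OF t, of e2 e4 e1] alt3_skew(1)[OF t, of e2 e1 e4]
      alt3_skew(2)[OF t, of e3 e4 e1] alt3_skew(1)[OF t, of e3 e1 e4]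
      alt3_skew(2)[OF t, of e3 e4 e2] alt3_skew(1)[OF t, of e3 e2 e4] by simp_all
  have tr: "- trace2 (\<lambda>u w. t u w (J e4)) / 2 = x * (t e1 e2 (J e4) + t e3 e4 (J e4))
      + y * (t e1 e3 (J e4) - t e2 e4 (J e4)) + z * (t e1 e4 (J e4) + t e2 e3 (J e4))"
    unfolding trace2_oriented[OF alt3_alt2(2)[OF t] o] xyz by simp
  show ?thesis
    unfolding star3_def tr unfolding j
    by (simp add: xyz[symmetric] alt3_same[OF t] p algebra_simps s s')
qed

lemma linear_star3:
  assumes t: "alt3 t" shows "linear (star3 t)"
proof (rule linear_complexI)
  show "star3 t (u + v) = star3 t u + star3 t v" for u v
    using vol_E4_nonzero
    by (simp add: star3_def trace2_def wedge22_def J_simps alt3_simps[OF t] field_simps)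
  show "star3 t (c *\<^sub>R u) = of_real c * star3 t u" for c u
    using vol_E4_nonzero
    by (simp add: star3_def trace2_def wedge22_def J_simps alt3_simps[OF t] field_simps)
qed

text \<open>Up to order every pair of frame vectors is the last pair of some even permutation, so a
  2-form is determined by its values on last pairs.\<close>

lemma oriented_unique2:
  assumes b: "alt2 b" and z: "\<And>e1 e2 e3 e4. oriented e1 e2 e3 e4 \<Longrightarrow> b e3 e4 = 0"
  shows "b u v = 0"
proof -
  obtain e1 e2 e3 e4 where o: "oriented e1 e2 e3 e4" using exists_unitary_frame by blast
  note p = oriented_permute[OF o]
  have on: "orthonormal e1 e2 e3 e4" using o by (simp add: oriented_def)
  have "b e1 e3 = 0" "b e2 e3 = 0" "b e1 e4 = 0" "b e1 e2 = 0" "b e2 e4 = 0" "b e3 e4 = 0"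
    using z[OF o] z[OF p(1)] z[OF p(2)] z[OF p(3)] z[OF p(4)] z[OF p(5)] alt2_skew[OF b, of e4 e2] by auto
  then show ?thesis using alt2_eq_0[OF b orthonormal_span[OF on]] by simp
qed

text \<open>\<open>star2\<close> satisfies the description, and any two solutions agree on the last
  pair of every oriented frame.\<close>

lemma hodge_cov_2:
  assumes "alternating 2 \<alpha>"
  shows "hodge_cov J G 2 \<alpha> = cov2 (star2 (\<lambda>u v. \<alpha> [u, v]))"
proof -
  have a: "alt2 (\<lambda>u v. \<alpha> [u, v])" using assms by (simp add: alternating_2)
  show ?thesis unfolding hodge_cov_def
  proof (rule the_equality)
    show "alternating (4 - 2) (cov2 (star2 (\<lambda>u v. \<alpha> [u, v]))) \<and>
      (\<forall>es. oriented_onb J G es \<longrightarrow> cov2 (star2 (\<lambda>u v. \<alpha> [u, v])) (drop 2 es) = \<alpha> (take 2 es))"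
      using alternating_cov2[OF alt2_star2[OF a]] star2_oriented[OF a]
      by (auto simp: oriented_onb_iff)
  next
    fix \<beta> assume H: "alternating (4 - 2) \<beta> \<and> (\<forall>es. oriented_onb J G es \<longrightarrow> \<beta> (drop 2 es) = \<alpha> (take 2 es))"
    then have b: "alternating 2 \<beta>" by simp
    have "\<beta> [e3, e4] = \<alpha> [e1, e2]" if "oriented e1 e2 e3 e4" for e1 e2 e3 e4
      using H[THEN conjunct2, rule_format, of "[e1, e2, e3, e4]"] that by (simp add: oriented_onb_iff)
    then have z: "1 * \<beta> [e3, e4] + (- 1) * star2 (\<lambda>u v. \<alpha> [u, v]) e3 e4 = 0"
      if "oriented e1 e2 e3 e4" for e1 e2 e3 e4
      using star2_oriented[OF a that] that by simp
    have b2: "alt2 (\<lambda>u v. \<beta> [u, v])" using b by (simp add: alternating_2)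
    have "1 * \<beta> [u, v] + (- 1) * star2 (\<lambda>u v. \<alpha> [u, v]) u v = 0" for u v
      by (rule oriented_unique2[OF alt2_add_scale[OF b2 alt2_star2[OF a]]]) (rule z)
    then have "\<beta> [u, v] = star2 (\<lambda>u v. \<alpha> [u, v]) u v" for u v
      by simp
    then show "\<beta> = cov2 (star2 (\<lambda>u v. \<alpha> [u, v]))"
      by (intro alternating_eqI2[OF b alternating_cov2[OF alt2_star2[OF a]]]) simp
  qed
qed

lemma hodge_cov_3:
  assumes "alternating 3 \<alpha>"
  shows "hodge_cov J G 3 \<alpha> = cov1 (star3 (\<lambda>u v w. \<alpha> [u, v, w]))"
proof -
  let ?t = "\<lambda>u v w. \<alpha> [u, v, w]"
  have a: "alt3 ?t" using assms by (simp add: alternating_3)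
  show ?thesis unfolding hodge_cov_def
  proof (rule the_equality)
    show "alternating (4 - 3) (cov1 (star3 ?t)) \<and>
      (\<forall>es. oriented_onb J G es \<longrightarrow> cov1 (star3 ?t) (drop 3 es) = \<alpha> (take 3 es))"
      using alternating_cov1[OF linear_star3[OF a]] star3_oriented[OF a]
      by (auto simp: oriented_onb_iff)
  next
    fix \<beta> assume H: "alternating (4 - 3) \<beta> \<and> (\<forall>es. oriented_onb J G es \<longrightarrow> \<beta> (drop 3 es) = \<alpha> (take 3 es))"
    then have b: "alternating 1 \<beta>" by simp
    have "\<beta> [e4] = \<alpha> [e1, e2, e3]" if "oriented e1 e2 e3 e4" for e1 e2 e3 e4
      using H[THEN conjunct2, rule_format, of "[e1, e2, e3, e4]"] that by (simp add: oriented_onb_iff)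
    then have eq: "oriented e1 e2 e3 e4 \<Longrightarrow> \<beta> [e4] - star3 ?t e4 = 0" for e1 e2 e3 e4
      using star3_oriented[OF a] by auto
    have "linear (\<lambda>v. \<beta> [v])" and b0: "\<And>vs. length vs \<noteq> 1 \<Longrightarrow> \<beta> vs = 0"
      using b unfolding alternating_1 by auto
    then have l: "linear (\<lambda>v. \<beta> [v] - star3 ?t v)"
      using linear_compose_sub[OF _ linear_star3[OF a]] by blast
    obtain e1 e2 e3 e4 where o: "oriented e1 e2 e3 e4" using exists_unitary_frame by blast
    note p = oriented_permute[OF o]
    have "span {e1,e2,e3,e4} = UNIV" using o orthonormal_span by (simp add: oriented_def)
    then have z: "\<beta> [v] - star3 ?t v = 0" for v
      by (rule linear_eq_0_spanning[OF l]) (rule eq[OF p(7)] eq[OF p(6)] eq[OF p(1)] eq[OF o])+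
    show "\<beta> = cov1 (star3 ?t)"
    proof
      fix vs
      show "\<beta> vs = cov1 (star3 ?t) vs"
        using b0[of vs] z by (cases "length vs = 1") (auto simp: cov1_def length_Suc_conv)
    qed
  qed
qed

lemma hodge_cov_4:
  assumes "alternating 4 \<alpha>"
  shows "hodge_cov J G 4 \<alpha> = (\<lambda>vs. if vs = [] then \<alpha> [E4 1, E4 2, E4 3, E4 4] / of_real (vol (E4 1) (E4 2) (E4 3) (E4 4)) else 0)"
proof -
  have a: "alt4 (\<lambda>u v w x. \<alpha> [u, v, w, x])" using assms by (simp add: alternating_4)
  have c: "\<alpha> [E4 1, E4 2, E4 3, E4 4] / of_real (vol (E4 1) (E4 2) (E4 3) (E4 4)) = \<alpha> [e1, e2, e3, e4]"
    if "oriented e1 e2 e3 e4" for e1 e2 e3 e4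
    using oriented_alt4[OF a that] vol_E4_nonzero by simp
  obtain e f where o: "oriented e (J e) f (J f)" using exists_unitary_frame by blast
  show ?thesis unfolding hodge_cov_def
  proof (rule the_equality)
    fix \<beta> assume H: "alternating (4 - 4) \<beta> \<and> (\<forall>es. oriented_onb J G es \<longrightarrow> \<beta> (drop 4 es) = \<alpha> (take 4 es))"
    then have "\<beta> vs = 0" if "vs \<noteq> []" for vs
      using that by (simp add: alternating_0)
    moreover have "\<beta> [] = \<alpha> [e, J e, f, J f]"
      using H[THEN conjunct2, rule_format, of "[e, J e, f, J f]"] o by (simp add: oriented_onb_iff)
    ultimately show "\<beta> = (\<lambda>vs. if vs = [] then \<alpha> [E4 1, E4 2, E4 3, E4 4] / of_real (vol (E4 1) (E4 2) (E4 3) (E4 4)) else 0)"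
      using c[OF o] by auto
  qed (use c in \<open>auto simp: oriented_onb_iff alternating_0\<close>)
qed

text \<open>Lets the outer star be dropped from the equation for the adjoint of dd^c.\<close>

lemma hodge_cov_4_eq_0:
  assumes "alternating 4 \<alpha>" "hodge_cov J G 4 \<alpha> = 0"
  shows "\<alpha> [E4 1, E4 2, E4 3, E4 4] = 0"
  using fun_cong[OF assms(2), of "[]"] vol_E4_nonzero by (simp add: hodge_cov_4[OF assms(1)])


subsection \<open>Positivity\<close>

text \<open>If the star multiplies a by s, then a\<and>cnj a is s times the wedge of a with the star
  of cnj a, which is s times the squared norm times the volume form. Duality leaves three free
  coefficients, and \<open>r\<close> is twice the sum of their squared absolute values.\<close>

lemma star2_selfdual_norm:
  assumes a: "alt2 a" and s: "s = 1 \<or> s = - 1" and eq: "\<And>u v. star2 a u v = of_real s * a u v"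
  shows "\<exists>r\<ge>0. wedge22 a (\<lambda>u v. cnj (a u v)) (E4 1) (E4 2) (E4 3) (E4 4) =
      of_real (s * r) * of_real (vol (E4 1) (E4 2) (E4 3) (E4 4)) \<and> (r = 0 \<longrightarrow> (\<forall>u v. a u v = 0))"
proof -
  obtain e1 e2 e3 e4 where o: "oriented e1 e2 e3 e4" using exists_unitary_frame by blast
  note p = oriented_permute[OF o]
  have on: "orthonormal e1 e2 e3 e4" using o by (simp add: oriented_def)
  have ss: "of_real s * (of_real s * w) = w" for w :: complex
    using s by auto
  have k: "a e3 e4 = of_real s * a e1 e2" if "oriented e1 e2 e3 e4" for e1 e2 e3 e4
    using star2_oriented[OF a that] unfolding eq using ss[of "a e3 e4"] by simp
  have e: "a e3 e4 = of_real s * a e1 e2" "a e4 e2 = of_real s * a e1 e3" "a e2 e3 = of_real s * a e1 e4"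
    by (rule k[OF o], rule k[OF p(2)], rule k[OF p(3)])
  then have e': "a e2 e4 = - (of_real s * a e1 e3)" using alt2_skew[OF a, of e2 e4] by simp
  define r where "r = 2 * ((cmod (a e1 e2))\<^sup>2 + (cmod (a e1 e3))\<^sup>2 + (cmod (a e1 e4))\<^sup>2)"
  have b: "alt2 (\<lambda>u v. cnj (a u v))"
    unfolding alt2_def by (intro conjI allI linear_complexI) (simp_all add: alt2_simps[OF a] alt2_same[OF a])
  have "wedge22 a (\<lambda>u v. cnj (a u v)) e1 e2 e3 e4 = of_real s *
    (2 * (a e1 e2 * cnj (a e1 e2) + a e1 e3 * cnj (a e1 e3) + a e1 e4 * cnj (a e1 e4)))"
    unfolding wedge22_def e e' by (simp add: algebra_simps)
  then have "wedge22 a (\<lambda>u v. cnj (a u v)) e1 e2 e3 e4 = of_real (s * r)"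
    by (simp add: r_def complex_norm_square[symmetric])
  moreover have "r = 0 \<longrightarrow> (\<forall>u v. a u v = 0)"
  proof (intro impI allI)
    fix u v assume r0: "r = 0"
    have z: "a e1 e2 = 0" "a e1 e3 = 0" "a e1 e4 = 0"
      using r0 zero_le_power2[of "cmod (a e1 e2)"] zero_le_power2[of "cmod (a e1 e3)"] zero_le_power2[of "cmod (a e1 e4)"]
      unfolding r_def by (auto simp: add_nonneg_eq_0_iff)
    show "a u v = 0"
      by (rule alt2_eq_0[OF a orthonormal_span[OF on]]) (simp_all add: z e e')
  qed
  moreover have "r \<ge> 0" by (simp add: r_def)
  ultimately show ?thesis
    unfolding oriented_alt4[OF alt4_wedge22[OF a b] o] by (intro exI[of _ r]) auto
qed

text \<open>The wedge of t with the star of cnj t is the squared norm times the volume form; the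
  minus sign comes from moving a 1-form past a 3-form.\<close>

lemma star3_norm:
  assumes t: "alt3 t"
  shows "\<exists>r\<ge>0. wedge13 (\<lambda>v. cnj (star3 t v)) t (E4 1) (E4 2) (E4 3) (E4 4) =
      of_real (- r) * of_real (vol (E4 1) (E4 2) (E4 3) (E4 4)) \<and> (r = 0 \<longrightarrow> (\<forall>u v w. t u v w = 0))"
proof -
  obtain e1 e2 e3 e4 where o: "oriented e1 e2 e3 e4" using exists_unitary_frame by blast
  note p = oriented_permute[OF o]
  have on: "orthonormal e1 e2 e3 e4" using o by (simp add: oriented_def)
  have e4: "star3 t e4 = t e1 e2 e3" using star3_oriented[OF t o] .
  have e3: "star3 t e3 = - t e1 e2 e4"
    using star3_oriented[OF t p(6)] alt3_skew(1)[OF t, of e2 e1 e4] by simp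
  have e2: "star3 t e2 = t e1 e3 e4" using star3_oriented[OF t p(2)] by simp
  have e1: "star3 t e1 = - t e2 e3 e4"
    using star3_oriented[OF t p(7)] alt3_skew(1)[OF t, of e4 e3 e2] alt3_skew(2)[OF t, of e3 e4 e2] alt3_skew(1)[OF t, of e3 e2 e4]
    by simp
  define r where "r = (cmod (t e1 e2 e3))\<^sup>2 + (cmod (t e1 e2 e4))\<^sup>2 + (cmod (t e1 e3 e4))\<^sup>2 + (cmod (t e2 e3 e4))\<^sup>2"
  have l: "linear (\<lambda>v. cnj (star3 t v))"
    by (rule linear_complexI) (simp_all add: linear_complexD[OF linear_star3[OF t]])
  have "wedge13 (\<lambda>v. cnj (star3 t v)) t e1 e2 e3 e4 =
    - (t e1 e2 e3 * cnj (t e1 e2 e3) + t e1 e2 e4 * cnj (t e1 e2 e4) + t e1 e3 e4 * cnj (t e1 e3 e4) + t e2 e3 e4 * cnj (t e2 e3 e4))"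
    unfolding wedge13_def e1 e2 e3 e4 by (simp add: algebra_simps)
  then have "wedge13 (\<lambda>v. cnj (star3 t v)) t e1 e2 e3 e4 = of_real (- r)"
    by (simp add: r_def complex_norm_square[symmetric])
  moreover have "r = 0 \<longrightarrow> (\<forall>u v w. t u v w = 0)"
  proof (intro impI allI)
    fix u v w assume r0: "r = 0"
    have z: "t e1 e2 e3 = 0" "t e1 e2 e4 = 0" "t e1 e3 e4 = 0" "t e2 e3 e4 = 0"
      using r0 unfolding r_def by (auto simp: add_nonneg_eq_0_iff)
    show "t u v w = 0"
      by (rule alt3_eq_0[OF t orthonormal_span[OF on]]) (simp_all add: z)
  qed
  moreover have "r \<ge> 0" by (simp add: r_def)
  ultimately show ?thesis
    unfolding oriented_alt4[OF alt4_wedge13[OF l t] o] by (intro exI[of _ r]) auto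
qed

text \<open>The second factor is J^{-1}\<theta>. In a unitary frame each of the two complex lines
  contributes its share of the squared norm of \<theta>; the sign is that of
  \<open>om e (J e) = - 1\<close>.\<close>

lemma gradient_norm:
  assumes l: "linear \<theta>"
  shows "\<exists>r\<ge>0. wedge22 (wedge11 (\<lambda>v. cnj (\<theta> v)) (\<lambda>v. - \<theta> (J v))) W (E4 1) (E4 2) (E4 3) (E4 4) =
      of_real (- r) * of_real (vol (E4 1) (E4 2) (E4 3) (E4 4)) \<and> (r = 0 \<longrightarrow> (\<forall>v. \<theta> v = 0))"
proof -
  obtain e f where o: "oriented e (J e) f (J f)" using exists_unitary_frame by blast
  have on: "orthonormal e (J e) f (J f)" using o by (simp add: oriented_def)
  define r where "r = (cmod (\<theta> e))\<^sup>2 + (cmod (\<theta> (J e)))\<^sup>2 + (cmod (\<theta> f))\<^sup>2 + (cmod (\<theta> (J f)))\<^sup>2"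
  have l1: "linear (\<lambda>v. cnj (\<theta> v))"
    by (rule linear_complexI) (simp_all add: linear_complexD[OF l])
  have l2: "linear (\<lambda>v. - \<theta> (J v))"
    by (rule linear_complexI) (simp_all add: linear_complexD[OF l] J_simps)
  have "om e (J e) = - 1" "om e f = 0" "om e (J f) = 0"
    using orthonormalD[OF on] by (simp_all add: om_def G_simps)
  then have "wedge22 (wedge11 (\<lambda>v. cnj (\<theta> v)) (\<lambda>v. - \<theta> (J v))) W e (J e) f (J f) =
    - (wedge11 (\<lambda>v. cnj (\<theta> v)) (\<lambda>v. - \<theta> (J v)) e (J e) + wedge11 (\<lambda>v. cnj (\<theta> v)) (\<lambda>v. - \<theta> (J v)) f (J f))"
    unfolding wedge22_oriented[OF alt2_wedge11[OF l1 l2] o] by simp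
  also have "\<dots> = - ((\<theta> e * cnj (\<theta> e) + \<theta> (J e) * cnj (\<theta> (J e))) + (\<theta> f * cnj (\<theta> f) + \<theta> (J f) * cnj (\<theta> (J f))))"
    unfolding wedge11_def by (simp add: linear_complexD[OF l] algebra_simps)
  finally have "wedge22 (wedge11 (\<lambda>v. cnj (\<theta> v)) (\<lambda>v. - \<theta> (J v))) W e (J e) f (J f) = - of_real r"
    by (simp add: r_def complex_norm_square[symmetric])
  moreover have "r = 0 \<longrightarrow> (\<forall>v. \<theta> v = 0)"
  proof (intro impI allI)
    fix v assume "r = 0"
    then have "\<theta> e = 0" "\<theta> (J e) = 0" "\<theta> f = 0" "\<theta> (J f) = 0"
      by (auto simp: r_def add_nonneg_eq_0_iff)
    then show "\<theta> v = 0" by (rule linear_eq_0_spanning[OF l orthonormal_span[OF on]])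
  qed
  moreover have "r \<ge> 0" by (simp add: r_def)
  ultimately show ?thesis
    unfolding oriented_alt4[OF alt4_wedge22[OF alt2_wedge11[OF l1 l2] alt2_W] o] by (intro exI[of _ r]) auto
qed

end

section \<open>Bidegree decompositions in degrees 2 and 3, and J as precomposition\<close>

section \<open>The action of an almost complex structure on covectors\<close>

lemma covectors_pq_sum:
  assumes "finite I" "\<And>i. i \<in> I \<Longrightarrow> f i \<in> covectors_pq J p q"
  shows "(\<lambda>vs. \<Sum>i\<in>I. f i vs) \<in> covectors_pq J p q"
proof -
  interpret module "\<lambda>(a::complex) (\<alpha>::covector) vs. a * \<alpha> vs" by (rule module_covector)
  show ?thesis using assms
  proof (induction I)
    case empty
    have "(0::covector) \<in> covectors_pq J p q" unfolding covectors_pq_def by (rule span_zero)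
    then show ?case by (simp add: zero_fun_def)
  next
    case (insert i I)
    then have "f i + (\<lambda>vs. \<Sum>i\<in>I. f i vs) \<in> covectors_pq J p q"
      unfolding covectors_pq_def by (intro span_add) auto
    then show ?case using insert by (simp add: plus_fun_def)
  qed
qed

lemma covectors_pq_wedge1:
  assumes "set \<theta>s \<subseteq> covector10 J" "set \<eta>s \<subseteq> covector01 J" "length \<theta>s = p" "length \<eta>s = q"
  shows "(\<lambda>vs. c * wedge1 (\<theta>s @ \<eta>s) vs) \<in> covectors_pq J p q"
proof -
  interpret module "\<lambda>(a::complex) (\<alpha>::covector) vs. a * \<alpha> vs" by (rule module_covector)
  show ?thesis unfolding covectors_pq_def
    by (intro span_scale span_base) (use assms in blast)
qed

text \<open>Reduces the action of \<open>J\<close> to the mere existence of a decomposition: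
  whichever one is taken, the result is precomposition with \<open>J\<close>.\<close>

lemma J_cov_decomposition:
  fixes part :: "nat \<Rightarrow> covector" and k :: nat
  assumes "\<forall>p\<le>k. part p \<in> covectors_pq J p (k - p)" "\<alpha> = (\<lambda>vs. \<Sum>p\<le>k. part p vs)"
  shows "J_cov J k \<alpha> = (\<lambda>vs. \<alpha> (map J vs))"
  unfolding J_cov_def
proof (rule the_equality)
  show "\<exists>part. (\<forall>p\<le>k. part p \<in> covectors_pq J p (k - p)) \<and> \<alpha> = (\<lambda>vs. \<Sum>p\<le>k. part p vs) \<and>
     (\<lambda>vs. \<alpha> (map J vs)) = (\<lambda>vs. \<Sum>p\<le>k. \<i> powi (int p - int (k - p)) * part p vs)"
    using assms J_decomposition_unique[OF assms(1)] by (intro exI[of _ part]) simp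
next
  fix \<beta>
  assume "\<exists>part. (\<forall>p\<le>k. part p \<in> covectors_pq J p (k - p)) \<and> \<alpha> = (\<lambda>vs. \<Sum>p\<le>k. part p vs) \<and>
     \<beta> = (\<lambda>vs. \<Sum>p\<le>k. \<i> powi (int p - int (k - p)) * part p vs)"
  then obtain part where c: "\<forall>p\<le>k. part p \<in> covectors_pq J p (k - p)"
    "\<alpha> = (\<lambda>vs. \<Sum>p\<le>k. part p vs)" "\<beta> = (\<lambda>vs. \<Sum>p\<le>k. \<i> powi (int p - int (k - p)) * part p vs)"
    by blast
  then show "\<beta> = (\<lambda>vs. \<alpha> (map J vs))"
    using J_decomposition_unique[OF c(1)] by simp
qed

definition wedge111 :: "(real^4 \<Rightarrow> complex) \<Rightarrow> (real^4 \<Rightarrow> complex) \<Rightarrow> (real^4 \<Rightarrow> complex) \<Rightarrow>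
    real^4 \<Rightarrow> real^4 \<Rightarrow> real^4 \<Rightarrow> complex" where
  "wedge111 p q r u v w = p u * q v * r w - p u * q w * r v - p v * q u * r w
     + p v * q w * r u + p w * q u * r v - p w * q v * r u"

lemma wedge1_2: "wedge1 [p, q] = cov2 (wedge11 p q)"
proof
  fix vs
  have 2: "{..<2} = insert 0 {1::nat}" by auto
  have f: "finite {1::nat}" "0 \<notin> {1::nat}" by auto
  show "wedge1 [p, q] vs = cov2 (wedge11 p q) vs"
  proof (cases "length vs = 2")
    case True
    then obtain a b where vs: "vs = [a, b]" by (auto simp: length_2)
    show ?thesis
      unfolding wedge1_def cov2_def wedge11_def True 2 sum_over_permutations_insert[OF f] permutes_sing
      by (simp add: vs sign_swap_id permutation_swap_id sign_id transpose_def numeral_2_eq_2)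
  qed (simp add: wedge1_def cov2_def)
qed

lemma wedge1_3: "wedge1 [p, q, r] = cov3 (wedge111 p q r)"
proof
  fix vs
  have 3: "{..<3} = insert 0 (insert 1 {2::nat})" by auto
  have f: "finite {2::nat}" "1 \<notin> {2::nat}" "finite {1,2::nat}" "0 \<notin> {1,2::nat}" by auto
  show "wedge1 [p, q, r] vs = cov3 (wedge111 p q r) vs"
  proof (cases "length vs = 3")
    case True
    then obtain a b c where vs: "vs = [a, b, c]" by (auto simp: length_3)
    show ?thesis
      unfolding wedge1_def cov3_def wedge111_def True 3 sum_over_permutations_insert[OF f(3,4)]
        sum_over_permutations_insert[OF f(1,2)] permutes_sing
      by (simp add: vs sign_swap_id permutation_swap_id sign_id sign_compose permutation_compose transpose_def numeral_2_eq_2 algebra_simps)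
  qed (simp add: wedge1_def cov3_def)
qed

text \<open>For the coordinate functionals as \<open>p\<close> and \<open>q\<close> this returns
  \<open>a\<close>. Splitting them by type and expanding multilinearly produces the bidegree
  components.\<close>

definition frame2 :: "(real^4 \<Rightarrow> real^4 \<Rightarrow> complex) \<Rightarrow> (4 \<Rightarrow> real^4 \<Rightarrow> complex) \<Rightarrow> (4 \<Rightarrow> real^4 \<Rightarrow> complex) \<Rightarrow>
    real^4 \<Rightarrow> real^4 \<Rightarrow> complex" where
  "frame2 a p q u v = (\<Sum>i\<in>UNIV. \<Sum>j\<in>UNIV. p i u * q j v * a (E4 i) (E4 j))"

definition frame3 :: "(real^4 \<Rightarrow> real^4 \<Rightarrow> real^4 \<Rightarrow> complex) \<Rightarrow> (4 \<Rightarrow> real^4 \<Rightarrow> complex) \<Rightarrow> (4 \<Rightarrow> real^4 \<Rightarrow> complex) \<Rightarrow>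
    (4 \<Rightarrow> real^4 \<Rightarrow> complex) \<Rightarrow> real^4 \<Rightarrow> real^4 \<Rightarrow> real^4 \<Rightarrow> complex" where
  "frame3 t p q r u v w = (\<Sum>i\<in>UNIV. \<Sum>j\<in>UNIV. \<Sum>k\<in>UNIV. p i u * q j v * r k w * t (E4 i) (E4 j) (E4 k))"

lemma linear_expand:
  fixes f :: "real^4 \<Rightarrow> complex"
  assumes "linear f"
  shows "(\<Sum>i\<in>UNIV. of_real (v $ i) * f (E4 i)) = f v"
proof -
  have "f v = f (\<Sum>i\<in>UNIV. (v $ i) *\<^sub>R E4 i)"
    using basis_expansion[of v] by (simp add: scalar_mult_eq_scaleR)
  also have "\<dots> = (\<Sum>i\<in>UNIV. of_real (v $ i) * f (E4 i))"
    by (simp add: linear_sum[OF assms] linear_complexD[OF assms])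
  finally show ?thesis by simp
qed

lemma frame2_expand:
  assumes "alt2 a"
  shows "frame2 a (\<lambda>i u. of_real (u $ i)) (\<lambda>i u. of_real (u $ i)) u v = a u v"
proof -
  have "(\<Sum>j\<in>UNIV. of_real (u $ i) * of_real (v $ j) * a (E4 i) (E4 j)) = of_real (u $ i) * a (E4 i) v" for i
    using linear_expand[OF alt2_linear(2)[OF assms, of "E4 i"], of v]
    by (simp add: mult.assoc flip: sum_distrib_left)
  then show ?thesis
    unfolding frame2_def using linear_expand[OF alt2_linear(1)[OF assms], of u v] by simp
qed

lemma frame3_expand:
  assumes "alt3 t"
  shows "frame3 t (\<lambda>i u. of_real (u $ i)) (\<lambda>i u. of_real (u $ i)) (\<lambda>i u. of_real (u $ i)) u v w = t u v w"
proof -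
  have "(\<Sum>j\<in>UNIV. \<Sum>k\<in>UNIV. of_real (u $ i) * of_real (v $ j) * of_real (w $ k) * t (E4 i) (E4 j) (E4 k)) =
      of_real (u $ i) * t (E4 i) v w" for i
    using frame2_expand[OF alt3_alt2(1)[OF assms, of "E4 i"], of v w]
    by (simp add: frame2_def mult.assoc flip: sum_distrib_left)
  then show ?thesis
    unfolding frame3_def using linear_expand[OF alt3_linear(1)[OF assms], of u v w] by simp
qed

lemma frame2_add:
  "frame2 a (\<lambda>i u. p i u + p' i u) q u v = frame2 a p q u v + frame2 a p' q u v"
  "frame2 a p (\<lambda>i u. q i u + q' i u) u v = frame2 a p q u v + frame2 a p q' u v"
  by (simp_all add: frame2_def algebra_simps sum.distrib)

lemma frame3_add:
  "frame3 t (\<lambda>i u. p i u + p' i u) q r u v w = frame3 t p q r u v w + frame3 t p' q r u v w"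
  "frame3 t p (\<lambda>i u. q i u + q' i u) r u v w = frame3 t p q r u v w + frame3 t p q' r u v w"
  "frame3 t p q (\<lambda>i u. r i u + r' i u) u v w = frame3 t p q r u v w + frame3 t p q r' u v w"
  by (simp_all add: frame3_def algebra_simps sum.distrib)

lemma frame2_swap:
  assumes "alt2 a"
  shows "frame2 a p q u v = - frame2 a q p v u"
proof -
  have "frame2 a p q u v = (\<Sum>j\<in>UNIV. \<Sum>i\<in>UNIV. p i u * q j v * a (E4 i) (E4 j))"
    unfolding frame2_def by (rule sum.swap)
  also have "\<dots> = (\<Sum>j\<in>UNIV. \<Sum>i\<in>UNIV. - (q j v * p i u * a (E4 j) (E4 i)))"
  proof (intro sum.cong refl)
    fix i j :: 4
    show "p i u * q j v * a (E4 i) (E4 j) = - (q j v * p i u * a (E4 j) (E4 i))"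
      using alt2_skew[OF assms, of "E4 i" "E4 j"] by simp
  qed
  finally show ?thesis by (simp add: frame2_def sum_negf)
qed

lemma frame3_swap:
  assumes "alt3 t"
  shows "frame3 t p q r u v w = - frame3 t q p r v u w" "frame3 t p q r u v w = - frame3 t p r q u w v"
proof -
  have "frame3 t p q r u v w = (\<Sum>j\<in>UNIV. \<Sum>i\<in>UNIV. \<Sum>k\<in>UNIV. p i u * q j v * r k w * t (E4 i) (E4 j) (E4 k))"
    unfolding frame3_def by (rule sum.swap)
  also have "\<dots> = (\<Sum>j\<in>UNIV. \<Sum>i\<in>UNIV. \<Sum>k\<in>UNIV. - (q j v * p i u * r k w * t (E4 j) (E4 i) (E4 k)))"
  proof (intro sum.cong refl)
    fix i j k :: 4
    show "p i u * q j v * r k w * t (E4 i) (E4 j) (E4 k) = - (q j v * p i u * r k w * t (E4 j) (E4 i) (E4 k))"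
      using alt3_skew(1)[OF assms, of "E4 i" "E4 j"] by simp
  qed
  finally show "frame3 t p q r u v w = - frame3 t q p r v u w" by (simp add: frame3_def sum_negf)
  have "frame3 t p q r u v w = (\<Sum>i\<in>UNIV. p i u * frame2 (t (E4 i)) q r v w)" for q r v w
    by (simp add: frame3_def frame2_def sum_distrib_left mult.assoc)
  then show "frame3 t p q r u v w = - frame3 t p r q u w v"
    using frame2_swap[OF alt3_alt2(1)[OF assms], of _ q r v w] by (simp add: sum_negf)
qed

text \<open>Because \<open>a\<close> alternates, exchanging the two vectors amounts to exchanging
  the two families. For equal families the sum is twice \<open>frame2 a p p\<close>.\<close>

lemma frame2_wedge:
  assumes "alt2 a"
  shows "(\<Sum>i\<in>UNIV. \<Sum>j\<in>UNIV. a (E4 i) (E4 j) * wedge11 (p i) (q j) u v) = frame2 a p q u v + frame2 a q p u v"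
proof -
  have "(\<Sum>i\<in>UNIV. \<Sum>j\<in>UNIV. a (E4 i) (E4 j) * wedge11 (p i) (q j) u v) = frame2 a p q u v - frame2 a p q v u"
    by (simp add: frame2_def wedge11_def algebra_simps flip: sum_subtractf)
  then show ?thesis using frame2_swap[OF assms, of p q v u] by simp
qed

lemma frame3_wedge:
  assumes "alt3 t"
  shows "(\<Sum>i\<in>UNIV. \<Sum>j\<in>UNIV. \<Sum>k\<in>UNIV. t (E4 i) (E4 j) (E4 k) * wedge111 (p i) (q j) (r k) u v w) =
    frame3 t p q r u v w + frame3 t p r q u v w + frame3 t q p r u v w + frame3 t q r p u v w
    + frame3 t r p q u v w + frame3 t r q p u v w"
proof -
  have "(\<Sum>i\<in>UNIV. \<Sum>j\<in>UNIV. \<Sum>k\<in>UNIV. t (E4 i) (E4 j) (E4 k) * wedge111 (p i) (q j) (r k) u v w) =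
      frame3 t p q r u v w - frame3 t p q r u w v - frame3 t p q r v u w + frame3 t p q r v w u
      + frame3 t p q r w u v - frame3 t p q r w v u"
    by (simp add: frame3_def wedge111_def algebra_simps flip: sum_subtractf sum.distrib)
  moreover have "frame3 t p q r u w v = - frame3 t p r q u v w" "frame3 t p q r v u w = - frame3 t q p r u v w"
    by (rule frame3_swap[OF assms])+
  moreover have "frame3 t p q r v w u = frame3 t r p q u v w"
    using frame3_swap(2)[OF assms, of p q r v w u] frame3_swap(1)[OF assms, of p r q v u w] by simp
  moreover have "frame3 t p q r w u v = frame3 t q r p u v w"
    using frame3_swap(1)[OF assms, of p q r w u v] frame3_swap(2)[OF assms, of q p r u w v] by simp
  moreover have "frame3 t p q r w v u = - frame3 t r q p u v w"
    using frame3_swap(1)[OF assms, of p q r w v u] frame3_swap(2)[OF assms, of q p r v w u]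
      frame3_swap(1)[OF assms, of q r p v u w] by simp
  ultimately show ?thesis by simp
qed

locale complex_structure4 =
  fixes J :: "real^4 \<Rightarrow> real^4"
  assumes linear_J: "linear J" and JJ: "J (J v) = - v"
begin

text \<open>The (1,0) parts of the four real coordinates. They are linearly dependent, which does no
  harm: a decomposition is wanted, not a basis.\<close>

definition coord10 :: "4 \<Rightarrow> real^4 \<Rightarrow> complex" where
  "coord10 i v = (of_real (v $ i) - \<i> * of_real (J v $ i)) / 2"

definition coord01 :: "4 \<Rightarrow> real^4 \<Rightarrow> complex" where
  "coord01 i v = (of_real (v $ i) + \<i> * of_real (J v $ i)) / 2"

lemma coord_sum: "(\<lambda>i v. coord10 i v + coord01 i v) = (\<lambda>i v. complex_of_real (v $ i))"
  by (auto simp: coord10_def coord01_def fun_eq_iff field_simps)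

lemma coord10: "coord10 i \<in> covector10 J"
proof -
  have "linear (coord10 i)"
    by (rule linear_complexI) (simp_all add: coord10_def linear_add[OF linear_J] linear_cmul[OF linear_J] algebra_simps add_divide_distrib diff_divide_distrib)
  then show ?thesis by (simp add: covector10_def coord10_def JJ field_simps)
qed

lemma coord01: "coord01 i \<in> covector01 J"
proof -
  have "linear (coord01 i)"
    by (rule linear_complexI) (simp_all add: coord01_def linear_add[OF linear_J] linear_cmul[OF linear_J] algebra_simps add_divide_distrib)
  then show ?thesis by (simp add: covector01_def coord01_def JJ field_simps)
qed

definition part2 :: "(real^4 \<Rightarrow> real^4 \<Rightarrow> complex) \<Rightarrow> nat \<Rightarrow> covector" where
  "part2 a p = (\<lambda>vs. \<Sum>i\<in>UNIV. \<Sum>j\<in>UNIV.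
     (if p = 1 then a (E4 i) (E4 j) else a (E4 i) (E4 j) / 2) *
     wedge1 ((if p = 2 then [coord10 i, coord10 j] else if p = 1 then [coord10 i] else []) @
       (if p = 2 then [] else if p = 1 then [coord01 j] else [coord01 i, coord01 j])) vs)"

lemma part2_pq: "p \<le> 2 \<Longrightarrow> part2 a p \<in> covectors_pq J p (2 - p)"
  unfolding part2_def using coord10 coord01
  by (intro covectors_pq_sum covectors_pq_wedge1) auto

lemma part2_sum:
  assumes a: "alt2 a"
  shows "cov2 a vs = (\<Sum>p\<le>2. part2 a p vs)"
proof (cases "length vs = 2")
  case True
  then obtain u v where vs: "vs = [u, v]" by (auto simp: length_2)
  have h: "(\<Sum>i\<in>UNIV. \<Sum>j\<in>UNIV. a (E4 i) (E4 j) * wedge11 (p i) (p j) u v / 2) = frame2 a p p u v" for p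
    using frame2_wedge[OF a, of p p u v] by (simp flip: sum_divide_distrib)
  have "part2 a 0 vs = frame2 a coord01 coord01 u v"
    "part2 a 1 vs = frame2 a coord10 coord01 u v + frame2 a coord01 coord10 u v"
    "part2 a 2 vs = frame2 a coord10 coord10 u v"
    by (simp_all add: part2_def vs wedge1_2 h frame2_wedge[OF a])
  moreover have "a u v = frame2 a (\<lambda>i v. coord10 i v + coord01 i v) (\<lambda>i v. coord10 i v + coord01 i v) u v"
    unfolding coord_sum frame2_expand[OF a] ..
  ultimately show ?thesis
    unfolding vs cov_simps frame2_add by (simp add: numeral_2_eq_2)
qed (auto simp: part2_def cov2_def wedge1_def intro!: sum.neutral)

lemma J_cov_2:
  assumes "alternating 2 \<alpha>"
  shows "J_cov J 2 \<alpha> = (\<lambda>vs. \<alpha> (map J vs))"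
proof -
  have a: "alt2 (\<lambda>u v. \<alpha> [u, v])" using assms by (simp add: alternating_2)
  have "\<alpha> = cov2 (\<lambda>u v. \<alpha> [u, v])"
    by (rule alternating_eqI2[OF assms alternating_cov2[OF a]]) simp
  then have "\<alpha> = (\<lambda>vs. \<Sum>p\<le>2. part2 (\<lambda>u v. \<alpha> [u, v]) p vs)"
    using part2_sum[OF a] by (metis ext)
  then show ?thesis
    by (intro J_cov_decomposition) (use part2_pq in auto)
qed

text \<open>The eigenvalue condition makes the (0,1) parts of the coordinates contribute nothing, so
  \<open>a\<close> equals its own (2,0) component.\<close>

lemma covectors_20:
  assumes a: "alt2 a" and J: "\<And>u v. a (J u) v = \<i> * a u v"
  shows "cov2 a \<in> covectors_pq J 2 0"
proof -
  have f: "(\<Sum>i\<in>UNIV. coord10 i u * a (E4 i) v) = a u v" for u v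
  proof -
    have "(\<Sum>i\<in>UNIV. coord10 i u * a (E4 i) v) = ((\<Sum>i\<in>UNIV. of_real (u $ i) * a (E4 i) v) - \<i> * (\<Sum>i\<in>UNIV. of_real (J u $ i) * a (E4 i) v)) / 2"
      unfolding coord10_def sum_distrib_left sum_subtractf[symmetric] sum_divide_distrib
      by (intro sum.cong refl) (simp add: field_simps)
    also have "\<dots> = (a u v - \<i> * a (J u) v) / 2"
      by (simp only: linear_expand[OF alt2_linear(1)[OF a]])
    finally show ?thesis by (simp add: J)
  qed
  have f2: "(\<Sum>i\<in>UNIV. coord10 i v * a u (E4 i)) = a u v" for u v
    using f[of v u] alt2_skew[OF a, of u] by (simp add: sum_negf)
  have fr: "frame2 a coord10 coord10 u v = a u v" for u v
    unfolding frame2_def using f2 f by (simp add: mult.assoc flip: sum_distrib_left)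
  have "cov2 a vs = part2 a 2 vs" for vs
  proof (cases "length vs = 2")
    case True
    then obtain u v where vs: "vs = [u, v]" by (auto simp: length_2)
    show ?thesis
      using frame2_wedge[OF a, of coord10 coord10 u v]
      by (simp add: part2_def vs wedge1_2 fr flip: sum_divide_distrib)
  qed (simp_all add: part2_def cov2_def wedge1_def)
  then have "cov2 a = part2 a 2" by blast
  then show ?thesis using part2_pq[of 2 a] by simp
qed

lemma covectors_02:
  assumes a: "alt2 a" and J: "\<And>u v. a (J u) v = - \<i> * a u v"
  shows "cov2 a \<in> covectors_pq J 0 2"
proof -
  have f: "(\<Sum>i\<in>UNIV. coord01 i u * a (E4 i) v) = a u v" for u v
  proof -
    have "(\<Sum>i\<in>UNIV. coord01 i u * a (E4 i) v) = ((\<Sum>i\<in>UNIV. of_real (u $ i) * a (E4 i) v) + \<i> * (\<Sum>i\<in>UNIV. of_real (J u $ i) * a (E4 i) v)) / 2"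
      unfolding coord01_def sum_distrib_left sum.distrib[symmetric] sum_divide_distrib
      by (intro sum.cong refl) (simp add: field_simps)
    also have "\<dots> = (a u v + \<i> * a (J u) v) / 2"
      by (simp only: linear_expand[OF alt2_linear(1)[OF a]])
    finally show ?thesis by (simp add: J)
  qed
  have f2: "(\<Sum>i\<in>UNIV. coord01 i v * a u (E4 i)) = a u v" for u v
    using f[of v u] alt2_skew[OF a, of u] by (simp add: sum_negf)
  have fr: "frame2 a coord01 coord01 u v = a u v" for u v
    unfolding frame2_def using f2 f by (simp add: mult.assoc flip: sum_distrib_left)
  have "cov2 a vs = part2 a 0 vs" for vs
  proof (cases "length vs = 2")
    case True
    then obtain u v where vs: "vs = [u, v]" by (auto simp: length_2)
    show ?thesis
      using frame2_wedge[OF a, of coord01 coord01 u v]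
      by (simp add: part2_def vs wedge1_2 fr flip: sum_divide_distrib)
  qed (simp_all add: part2_def cov2_def wedge1_def)
  then have "cov2 a = part2 a 0" by blast
  then show ?thesis using part2_pq[of 0 a] by simp
qed

text \<open>The factors count orders: six for the pure types; for the mixed ones three positions of
  the odd factor, each occurring twice.\<close>

definition part3 :: "(real^4 \<Rightarrow> real^4 \<Rightarrow> real^4 \<Rightarrow> complex) \<Rightarrow> nat \<Rightarrow> covector" where
  "part3 t p = (\<lambda>vs. \<Sum>i\<in>UNIV. \<Sum>j\<in>UNIV. \<Sum>k\<in>UNIV.
     (if p = 1 \<or> p = 2 then t (E4 i) (E4 j) (E4 k) / 2 else t (E4 i) (E4 j) (E4 k) / 6) *
     wedge1 ((if p = 3 then [coord10 i, coord10 j, coord10 k] else if p = 2 then [coord10 i, coord10 j]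
         else if p = 1 then [coord10 i] else []) @
       (if p = 3 then [] else if p = 2 then [coord01 k] else if p = 1 then [coord01 j, coord01 k]
         else [coord01 i, coord01 j, coord01 k])) vs)"

lemma part3_pq: "p \<le> 3 \<Longrightarrow> part3 t p \<in> covectors_pq J p (3 - p)"
  unfolding part3_def using coord10 coord01
  by (intro covectors_pq_sum covectors_pq_wedge1) auto

lemma part3_sum:
  assumes t: "alt3 t"
  shows "cov3 t vs = (\<Sum>p\<le>3. part3 t p vs)"
proof (cases "length vs = 3")
  case True
  then obtain u v w where vs: "vs = [u, v, w]" by (auto simp: length_3)
  have h: "(\<Sum>i\<in>UNIV. \<Sum>j\<in>UNIV. \<Sum>k\<in>UNIV. t (E4 i) (E4 j) (E4 k) * wedge111 (p i) (q j) (r k) u v w / c) =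
    (frame3 t p q r u v w + frame3 t p r q u v w + frame3 t q p r u v w + frame3 t q r p u v w
    + frame3 t r p q u v w + frame3 t r q p u v w) / c" for p q r c
    unfolding frame3_wedge[OF t, symmetric] by (simp flip: sum_divide_distrib)
  have "part3 t 0 vs = frame3 t coord01 coord01 coord01 u v w"
    "part3 t 1 vs = frame3 t coord10 coord01 coord01 u v w + frame3 t coord01 coord10 coord01 u v w + frame3 t coord01 coord01 coord10 u v w"
    "part3 t 2 vs = frame3 t coord10 coord10 coord01 u v w + frame3 t coord10 coord01 coord10 u v w + frame3 t coord01 coord10 coord10 u v w"
    "part3 t 3 vs = frame3 t coord10 coord10 coord10 u v w"
    by (simp_all add: part3_def vs wedge1_3 h)
  moreover have "t u v w = frame3 t (\<lambda>i v. coord10 i v + coord01 i v) (\<lambda>i v. coord10 i v + coord01 i v)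
      (\<lambda>i v. coord10 i v + coord01 i v) u v w"
    unfolding coord_sum frame3_expand[OF t] ..
  ultimately show ?thesis
    unfolding vs cov_simps frame3_add by (simp add: numeral_3_eq_3 numeral_2_eq_2)
qed (auto simp: part3_def cov3_def wedge1_def intro!: sum.neutral)

lemma J_cov_3:
  assumes "alternating 3 \<alpha>"
  shows "J_cov J 3 \<alpha> = (\<lambda>vs. \<alpha> (map J vs))"
proof -
  have a: "alt3 (\<lambda>u v w. \<alpha> [u, v, w])" using assms by (simp add: alternating_3)
  have "\<alpha> = cov3 (\<lambda>u v w. \<alpha> [u, v, w])"
    by (rule alternating_eqI3[OF assms alternating_cov3[OF a]]) simp
  then have "\<alpha> = (\<lambda>vs. \<Sum>p\<le>3. part3 (\<lambda>u v w. \<alpha> [u, v, w]) p vs)"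
    using part3_sum[OF a] by (metis ext)
  then show ?thesis
    by (intro J_cov_decomposition) (use part3_pq in auto)
qed

text \<open>In odd degree the action of \<open>J\<close> squares to -1, so its inverse is its
  negative. Injectivity on alternating covectors makes \<open>inv_into\<close> select it.\<close>

lemma J_inv_cov_3:
  assumes "alternating 3 \<alpha>"
  shows "J_inv_cov J 3 \<alpha> = (\<lambda>vs. - \<alpha> (map J vs))"
proof -
  have sq: "\<beta> (map J (map J vs)) = - \<beta> vs" if "alternating 3 \<beta>" for \<beta> vs
  proof (cases "length vs = 3")
    case True
    then obtain u v w where "vs = [u, v, w]" by (auto simp: length_3)
    moreover have "alt3 (\<lambda>u v w. \<beta> [u, v, w])" using that by (simp add: alternating_3)
    note l = alt3_linear[OF this]
    ultimately show ?thesis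
      using linear_neg[OF l(1)] linear_neg[OF l(2)] linear_neg[OF l(3)] by (simp add: JJ)
  next
    case False
    then show ?thesis using that by (simp add: alternating_3)
  qed
  have neg: "alternating 3 (\<lambda>vs. - \<alpha> (map J vs))"
  proof -
    have a: "alt3 (\<lambda>u v w. \<alpha> [u, v, w])" and z: "\<And>vs. length vs \<noteq> 3 \<Longrightarrow> \<alpha> vs = 0"
      using assms by (auto simp: alternating_3)
    have "alt3 (\<lambda>u v w. - \<alpha> [J u, J v, J w])"
      unfolding alt3_def alt2_def
      by (intro conjI allI linear_complexI)
        (simp_all add: alt3_simps[OF a] alt3_same[OF a] linear_add[OF linear_J] linear_cmul[OF linear_J])
    then show ?thesis using z by (simp add: alternating_3)
  qed
  show ?thesis
    unfolding J_inv_cov_def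
  proof (rule inv_into_f_eq)
    show "inj_on (J_cov J 3) {\<alpha>. alternating 3 \<alpha>}"
    proof (rule inj_onI)
      fix \<beta> \<gamma> assume *: "\<beta> \<in> {\<alpha>. alternating 3 \<alpha>}" "\<gamma> \<in> {\<alpha>. alternating 3 \<alpha>}" "J_cov J 3 \<beta> = J_cov J 3 \<gamma>"
      then have e: "(\<lambda>vs. \<beta> (map J vs)) = (\<lambda>vs. \<gamma> (map J vs))"
        by (simp add: J_cov_3)
      have "\<beta> vs = \<gamma> vs" for vs
        using fun_cong[OF e, of "map J vs"] * by (simp add: sq del: map_map)
      then show "\<beta> = \<gamma>" by blast
    qed
    show "(\<lambda>vs. - \<alpha> (map J vs)) \<in> {\<alpha>. alternating 3 \<alpha>}" using neg by simp
    show "J_cov J 3 (\<lambda>vs. - \<alpha> (map J vs)) = \<alpha>"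
      using sq[OF assms] by (simp add: J_cov_3[OF neg] del: map_map)
  qed
qed

end

sublocale hermitian4 \<subseteq> cs: complex_structure4 J
  by unfold_locales (simp_all add: J_simps)

section \<open>Alternation, Leibniz rules, dd = 0 and pullback for the coordinate exterior
  derivative\<close>

section \<open>Exterior derivatives in a chart\<close>

text \<open>Linearity in the vector holds on a whole neighbourhood, so it survives differentiation
  in the base point.\<close>

lemma linear_family_derivative:
  fixes a :: "real^4 \<Rightarrow> real^4 \<Rightarrow> complex"
  assumes "open U" "x \<in> U" "\<And>y. y \<in> U \<Longrightarrow> linear (a y)" "\<And>v. (\<lambda>y. a y v) differentiable (at x)"
  shows "linear (\<lambda>v. frechet_derivative (\<lambda>y. a y v) (at x) w)"
proof (rule linear_complexI)
  fix u v
  have "frechet_derivative (\<lambda>y. a y (u + v)) (at x) = frechet_derivative (\<lambda>y. a y u + a y v) (at x)"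
    using assms(3) by (intro frechet_derivative_cong_open[OF assms(1,2)]) (simp add: linear_add)
  then show "frechet_derivative (\<lambda>y. a y (u + v)) (at x) w =
      frechet_derivative (\<lambda>y. a y u) (at x) w + frechet_derivative (\<lambda>y. a y v) (at x) w"
    by (simp add: frechet_derivative_add_at assms(4))
next
  fix c u
  have "frechet_derivative (\<lambda>y. a y (c *\<^sub>R u)) (at x) = frechet_derivative (\<lambda>y. of_real c * a y u) (at x)"
    using assms(3) by (intro frechet_derivative_cong_open[OF assms(1,2)]) (simp add: linear_complexD)
  then show "frechet_derivative (\<lambda>y. a y (c *\<^sub>R u)) (at x) w = of_real c * frechet_derivative (\<lambda>y. a y u) (at x) w"
    by (simp add: frechet_derivative_bounded_linear_at[OF bounded_linear_mult_right] assms(4))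
qed

lemma zero_family_derivative:
  fixes a :: "'a::real_normed_vector \<Rightarrow> 'b::real_normed_vector"
  assumes "open U" "x \<in> U" "\<And>y. y \<in> U \<Longrightarrow> a y = 0"
  shows "frechet_derivative a (at x) w = 0"
  using frechet_derivative_cong_open[OF assms(1,2), of a "\<lambda>_. 0"] assms(3) by (simp add: frechet_derivative_const)

lemma alt2_family_derivative:
  fixes a :: "real^4 \<Rightarrow> real^4 \<Rightarrow> real^4 \<Rightarrow> complex"
  assumes "open U" "x \<in> U" "\<And>y. y \<in> U \<Longrightarrow> alt2 (a y)" "\<And>u v. (\<lambda>y. a y u v) differentiable (at x)"
  shows "alt2 (\<lambda>u v. frechet_derivative (\<lambda>y. a y u v) (at x) w)"
  unfolding alt2_def
proof (intro conjI allI)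
  show "linear (\<lambda>u. frechet_derivative (\<lambda>y. a y u v) (at x) w)" for v
    using assms(3) by (intro linear_family_derivative[OF assms(1,2)] assms(4)) (rule alt2_linear)
  show "linear (\<lambda>v. frechet_derivative (\<lambda>y. a y u v) (at x) w)" for u
    using assms(3) by (intro linear_family_derivative[OF assms(1,2)] assms(4)) (rule alt2_linear)
  show "frechet_derivative (\<lambda>y. a y u u) (at x) w = 0" for u
    using assms(3) by (intro zero_family_derivative[OF assms(1,2)]) (rule alt2_same)
qed

lemma alt3_family_derivative:
  fixes t :: "real^4 \<Rightarrow> real^4 \<Rightarrow> real^4 \<Rightarrow> real^4 \<Rightarrow> complex"
  assumes "open U" "x \<in> U" "\<And>y. y \<in> U \<Longrightarrow> alt3 (t y)" "\<And>u v w. (\<lambda>y. t y u v w) differentiable (at x)"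
  shows "alt3 (\<lambda>u v w. frechet_derivative (\<lambda>y. t y u v w) (at x) z)"
  unfolding alt3_def
proof (intro conjI allI)
  show "alt2 (\<lambda>v w. frechet_derivative (\<lambda>y. t y u v w) (at x) z)" for u
    using assms(3) by (intro alt2_family_derivative[OF assms(1,2)] assms(4)) (rule alt3_alt2)
  show "alt2 (\<lambda>u v. frechet_derivative (\<lambda>y. t y u v w) (at x) z)" for w
    using assms(3) by (intro alt2_family_derivative[OF assms(1,2)] assms(4)) (rule alt3_alt2)
qed

lemma alt2_antisym:
  assumes "\<And>u. linear (P u)" "\<And>v. linear (\<lambda>u. P u v)"
  shows "alt2 (\<lambda>u v. P u v - P v u)"
  unfolding alt2_def
  by (intro conjI allI linear_complexI) (simp_all add: linear_complexD[OF assms(1)] linear_complexD[OF assms(2)] algebra_simps)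

lemma alt3_antisym:
  assumes "\<And>u. alt2 (P u)" "\<And>v w. linear (\<lambda>u. P u v w)"
  shows "alt3 (\<lambda>u v w. P u v w - P v u w + P w u v)"
  unfolding alt3_def alt2_def
proof (intro conjI allI linear_complexI)
  show "P u v v - P v u v + P v u v = 0" for u v by (simp add: alt2_same[OF assms(1)])
qed (simp_all add: alt2_simps[OF assms(1)] alt2_same[OF assms(1)] linear_complexD[OF assms(2)] algebra_simps)

lemma alt4_antisym:
  assumes "\<And>u. alt3 (P u)" "\<And>v w z. linear (\<lambda>u. P u v w z)"
  shows "alt4 (\<lambda>u v w z. P u v w z - P v u w z + P w u v z - P z u v w)"
  unfolding alt4_def alt3_def alt2_def
  by (intro conjI allI linear_complexI)
    (simp_all add: alt3_simps[OF assms(1)] alt3_same[OF assms(1)] linear_complexD[OF assms(2)] algebra_simps)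

text \<open>\<open>d1\<close>, \<open>d2\<close>, \<open>d3\<close> are \<open>ext_d\<close> in one
  chart on forms of degree 1, 2, 3, with the alternating sum written out.\<close>

definition d1 :: "(real^4 \<Rightarrow> real^4 \<Rightarrow> complex) \<Rightarrow> real^4 \<Rightarrow> real^4 \<Rightarrow> real^4 \<Rightarrow> complex" where
  "d1 b x u v = frechet_derivative (\<lambda>y. b y v) (at x) u - frechet_derivative (\<lambda>y. b y u) (at x) v"

definition d2 :: "(real^4 \<Rightarrow> real^4 \<Rightarrow> real^4 \<Rightarrow> complex) \<Rightarrow> real^4 \<Rightarrow> real^4 \<Rightarrow> real^4 \<Rightarrow> real^4 \<Rightarrow> complex" where
  "d2 a x u v w = frechet_derivative (\<lambda>y. a y v w) (at x) u - frechet_derivative (\<lambda>y. a y u w) (at x) v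
     + frechet_derivative (\<lambda>y. a y u v) (at x) w"

definition d3 :: "(real^4 \<Rightarrow> real^4 \<Rightarrow> real^4 \<Rightarrow> real^4 \<Rightarrow> complex) \<Rightarrow>
    real^4 \<Rightarrow> real^4 \<Rightarrow> real^4 \<Rightarrow> real^4 \<Rightarrow> real^4 \<Rightarrow> complex" where
  "d3 t x u v w z = frechet_derivative (\<lambda>y. t y v w z) (at x) u - frechet_derivative (\<lambda>y. t y u w z) (at x) v
     + frechet_derivative (\<lambda>y. t y u v z) (at x) w - frechet_derivative (\<lambda>y. t y u v w) (at x) z"

lemma alt2_d1:
  assumes "open U" "x \<in> U" "\<And>y. y \<in> U \<Longrightarrow> linear (b y)" "\<And>v. (\<lambda>y. b y v) differentiable (at x)"
  shows "alt2 (d1 b x)"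
  using alt2_antisym[of "\<lambda>u v. frechet_derivative (\<lambda>y. b y v) (at x) u"]
    linear_family_derivative[OF assms] linear_frechet_derivative_at[OF assms(4)]
  by (simp add: d1_def[abs_def])

lemma alt3_d2:
  assumes "open U" "x \<in> U" "\<And>y. y \<in> U \<Longrightarrow> alt2 (a y)" "\<And>u v. (\<lambda>y. a y u v) differentiable (at x)"
  shows "alt3 (d2 a x)"
  using alt3_antisym[of "\<lambda>u v w. frechet_derivative (\<lambda>y. a y v w) (at x) u"]
    alt2_family_derivative[OF assms] linear_frechet_derivative_at[OF assms(4)]
  by (simp add: d2_def[abs_def])

lemma alt4_d3:
  assumes "open U" "x \<in> U" "\<And>y. y \<in> U \<Longrightarrow> alt3 (t y)" "\<And>u v w. (\<lambda>y. t y u v w) differentiable (at x)"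
  shows "alt4 (d3 t x)"
  using alt4_antisym[of "\<lambda>u v w z. frechet_derivative (\<lambda>y. t y v w z) (at x) u"]
    alt3_family_derivative[OF assms] linear_frechet_derivative_at[OF assms(4)]
  by (simp add: d3_def[abs_def])

lemma d2_scale:
  assumes "f differentiable (at x)" "\<And>u v. (\<lambda>y. a y u v) differentiable (at x)"
  shows "d2 (\<lambda>y u v. f y * a y u v) x u v w = wedge12 (frechet_derivative f (at x)) (a x) u v w + f x * d2 a x u v w"
  by (simp add: d2_def wedge12_def frechet_derivative_mult_at[OF assms] algebra_simps)

lemma d3_scale:
  assumes "f differentiable (at x)" "\<And>u v w. (\<lambda>y. t y u v w) differentiable (at x)"
  shows "d3 (\<lambda>y u v w. f y * t y u v w) x u v w z = wedge13 (frechet_derivative f (at x)) (t x) u v w z + f x * d3 t x u v w z"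
  by (simp add: d3_def wedge13_def frechet_derivative_mult_at[OF assms] algebra_simps)

text \<open>The rule d(b\<and>a) = db\<and>a - b\<and>da, by which the integrands of
  \<open>dual_harmonic_closed\<close> are recognised as exact.\<close>

lemma d3_wedge12:
  assumes b: "\<And>v. (\<lambda>y. b y v) differentiable (at x)" and a: "\<And>u v. (\<lambda>y. a y u v) differentiable (at x)"
  shows "d3 (\<lambda>y. wedge12 (b y) (a y)) x u v w z = wedge22 (d1 b x) (a x) u v w z - wedge13 (b x) (d2 a x) u v w z"
proof -
  have m: "(\<lambda>y. b y v * a y u w) differentiable (at x)" for u v w
    by (intro differentiable_mult a b)
  have D: "frechet_derivative (\<lambda>y. wedge12 (b y) (a y) p q r) (at x) s =
      (b x p * frechet_derivative (\<lambda>y. a y q r) (at x) s + frechet_derivative (\<lambda>y. b y p) (at x) s * a x q r)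
      - (b x q * frechet_derivative (\<lambda>y. a y p r) (at x) s + frechet_derivative (\<lambda>y. b y q) (at x) s * a x p r)
      + (b x r * frechet_derivative (\<lambda>y. a y p q) (at x) s + frechet_derivative (\<lambda>y. b y r) (at x) s * a x p q)" for p q r s
    unfolding wedge12_def
    by (simp add: frechet_derivative_add_at frechet_derivative_diff_at frechet_derivative_mult_at[OF b a] m differentiable_diff)
  show ?thesis
    unfolding d3_def D by (simp add: d2_def d1_def wedge22_def wedge13_def algebra_simps)
qed

text \<open>By Schwarz's theorem the six second derivatives cancel in pairs.\<close>

lemma d2_d1:
  assumes "open U" "x \<in> U" "\<And>v. Ck_on 2 U (\<lambda>y. b y v)"
  shows "d2 (d1 b) x u v w = 0"
proof -
  have m: "(\<lambda>y. frechet_derivative (\<lambda>y. b y v) (at y) u) differentiable (at x)" for u v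
    using assms(2,3) by (simp add: numeral_2_eq_2)
  have D: "frechet_derivative (\<lambda>y. d1 b y p q) (at x) s =
      frechet_derivative (\<lambda>y. frechet_derivative (\<lambda>y. b y q) (at y) p) (at x) s
      - frechet_derivative (\<lambda>y. frechet_derivative (\<lambda>y. b y p) (at y) q) (at x) s" for p q s
    unfolding d1_def by (simp add: frechet_derivative_diff_at m)
  show ?thesis
    unfolding d2_def D
    using symmetric_second_derivative[OF assms, of w v u] symmetric_second_derivative[OF assms, of w u v]
      symmetric_second_derivative[OF assms, of v u w] symmetric_second_derivative[OF assms, of u w v]
      symmetric_second_derivative[OF assms, of u v w] symmetric_second_derivative[OF assms, of v w u]
    by simp
qed

lemma frechet_derivative_cnj:
  assumes "f differentiable (at x)"
  shows "frechet_derivative (\<lambda>y. cnj (f y)) (at x) v = cnj (frechet_derivative f (at x) v)"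
  by (rule frechet_derivative_bounded_linear_at[OF bounded_linear_cnj assms])


subsection \<open>Naturality\<close>

context
  fixes \<phi> :: "real^4 \<Rightarrow> real^4" and V V' :: "(real^4) set" and x
  assumes V: "open V" "x \<in> V" and V': "open V'" "\<phi> ` V \<subseteq> V'" and phi: "Ck_on 2 V \<phi>"
begin

private abbreviation (input) "T y \<equiv> frechet_derivative \<phi> (at y)"

lemma phi_derivs:
  shows "(\<phi> has_derivative T x) (at x)"
    "((\<lambda>y. T y u) has_derivative frechet_derivative (\<lambda>y. T y u) (at x)) (at x)"
    "frechet_derivative (\<lambda>y. T y u) (at x) v = frechet_derivative (\<lambda>y. T y v) (at x) u"
    "\<phi> x \<in> V'"
proof -
  have p: "Ck_on (Suc (Suc 0)) V \<phi>" using phi by (simp add: numeral_2_eq_2)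
  show "(\<phi> has_derivative T x) (at x)"
    by (rule Ck_on_has_derivative[OF p V(2)])
  have "Ck_on (Suc 0) V (\<lambda>y. T y u)" using p unfolding Ck_on.simps(2)[of "Suc 0" V \<phi>] by blast
  then show "((\<lambda>y. T y u) has_derivative frechet_derivative (\<lambda>y. T y u) (at x)) (at x)"
    by (rule Ck_on_has_derivative) (rule V(2))
  show "frechet_derivative (\<lambda>y. T y u) (at x) v = frechet_derivative (\<lambda>y. T y v) (at x) u"
    by (rule symmetric_second_derivative[OF V phi])
  show "\<phi> x \<in> V'" using V V' by blast
qed

lemma pullback1_derivative:
  assumes lin: "\<And>z. z \<in> V' \<Longrightarrow> linear (b z)" and d: "\<And>v. (\<lambda>z. b z v) differentiable (at (\<phi> x))"
  shows "((\<lambda>y. b (\<phi> y) (T y u)) has_derivative (\<lambda>w. frechet_derivative (\<lambda>z. b z (T x u)) (at (\<phi> x)) (T x w)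
    + b (\<phi> x) (frechet_derivative (\<lambda>y. T y u) (at x) w))) (at x)"
proof (rule has_derivative_evaluate[OF V])
  show "linear (b (\<phi> y))" if "y \<in> V" for y using that lin V' by blast
  show "((\<lambda>y. b (\<phi> y) v) has_derivative (\<lambda>w. frechet_derivative (\<lambda>z. b z v) (at (\<phi> x)) (T x w))) (at x)" for v
    by (rule has_derivative_compose[OF phi_derivs(1)]) (rule d[unfolded frechet_derivative_works])
qed (rule phi_derivs)

lemma pullback2_derivative:
  assumes lin: "\<And>z. z \<in> V' \<Longrightarrow> alt2 (a z)" and d: "\<And>u v. (\<lambda>z. a z u v) differentiable (at (\<phi> x))"
  shows "((\<lambda>y. a (\<phi> y) (T y u) (T y v)) has_derivative (\<lambda>w. (frechet_derivative (\<lambda>z. a z (T x u) (T x v)) (at (\<phi> x)) (T x w)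
    + a (\<phi> x) (frechet_derivative (\<lambda>y. T y u) (at x) w) (T x v))
    + a (\<phi> x) (T x u) (frechet_derivative (\<lambda>y. T y v) (at x) w))) (at x)"
proof (rule has_derivative_evaluate[OF V, where a = "\<lambda>y. a (\<phi> y) (T y u)" and X = "\<lambda>y. T y v" and
    X' = "\<lambda>w. frechet_derivative (\<lambda>y. T y v) (at x) w" and
    a' = "\<lambda>q w. frechet_derivative (\<lambda>z. a z (T x u) q) (at (\<phi> x)) (T x w)
    + a (\<phi> x) (frechet_derivative (\<lambda>y. T y u) (at x) w) q"])
  show "linear (a (\<phi> y) (T y u))" if "y \<in> V" for y using that lin V' alt2_linear(2) by blast
  show "((\<lambda>y. a (\<phi> y) (T y u) q) has_derivative (\<lambda>w. frechet_derivative (\<lambda>z. a z (T x u) q) (at (\<phi> x)) (T x w)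
    + a (\<phi> x) (frechet_derivative (\<lambda>y. T y u) (at x) w) q)) (at x)" for q
  proof (rule pullback1_derivative[of "\<lambda>z p. a z p q"])
    show "linear (\<lambda>p. a z p q)" if "z \<in> V'" for z by (rule alt2_linear(1)[OF lin[OF that]])
  qed (rule d)
qed (rule phi_derivs)

text \<open>Differentiating a pullback brings in second derivatives of \<open>\<phi>\<close>; being
  symmetric, they drop out of the alternating sum. This is why d does not depend on the
  chart.\<close>

lemma d1_pullback:
  assumes lin: "\<And>z. z \<in> V' \<Longrightarrow> linear (b z)" and d: "\<And>v. (\<lambda>z. b z v) differentiable (at (\<phi> x))"
    and eq: "\<And>y u. y \<in> V \<Longrightarrow> b0 y u = b (\<phi> y) (T y u)"
  shows "d1 b0 x u v = d1 b (\<phi> x) (T x u) (T x v)"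
proof -
  have "frechet_derivative (\<lambda>y. b0 y u) (at x) w = frechet_derivative (\<lambda>z. b z (T x u)) (at (\<phi> x)) (T x w)
    + b (\<phi> x) (frechet_derivative (\<lambda>y. T y u) (at x) w)" for u w
  proof -
    have "frechet_derivative (\<lambda>y. b0 y u) (at x) = frechet_derivative (\<lambda>y. b (\<phi> y) (T y u)) (at x)"
      by (rule frechet_derivative_cong_open[OF V]) (rule eq)
    also have "\<dots> = (\<lambda>w. frechet_derivative (\<lambda>z. b z (T x u)) (at (\<phi> x)) (T x w)
        + b (\<phi> x) (frechet_derivative (\<lambda>y. T y u) (at x) w))"
      by (rule frechet_derivative_at[symmetric], rule pullback1_derivative) (erule lin, rule d)
    finally show ?thesis by (rule fun_cong)
  qed
  then show ?thesis using phi_derivs(3)[of u v] by (simp add: d1_def)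
qed

lemma d2_pullback:
  assumes lin: "\<And>z. z \<in> V' \<Longrightarrow> alt2 (a z)" and d: "\<And>u v. (\<lambda>z. a z u v) differentiable (at (\<phi> x))"
    and eq: "\<And>y u v. y \<in> V \<Longrightarrow> a0 y u v = a (\<phi> y) (T y u) (T y v)"
  shows "d2 a0 x u v w = d2 a (\<phi> x) (T x u) (T x v) (T x w)"
proof -
  define S where "S = (\<lambda>u w. frechet_derivative (\<lambda>y. T y u) (at x) w)"
  have D: "frechet_derivative (\<lambda>y. a0 y u v) (at x) w = frechet_derivative (\<lambda>z. a z (T x u) (T x v)) (at (\<phi> x)) (T x w)
    + a (\<phi> x) (S u w) (T x v) + a (\<phi> x) (T x u) (S v w)" for u v w
  proof -
    have "frechet_derivative (\<lambda>y. a0 y u v) (at x) = frechet_derivative (\<lambda>y. a (\<phi> y) (T y u) (T y v)) (at x)"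
      by (rule frechet_derivative_cong_open[OF V]) (rule eq)
    also have "\<dots> = (\<lambda>w. frechet_derivative (\<lambda>z. a z (T x u) (T x v)) (at (\<phi> x)) (T x w)
        + a (\<phi> x) (S u w) (T x v) + a (\<phi> x) (T x u) (S v w))"
      unfolding S_def
      by (rule frechet_derivative_at[symmetric], rule pullback2_derivative) (erule lin, rule d)
    finally show ?thesis by (rule fun_cong)
  qed
  \<comment> \<open>Of the three pairs of second-derivative terms, two cancel by this symmetry and
    the third by skewness of \<open>a\<close>.\<close>
  have s: "S v u = S u v" "S w u = S u w" "S w v = S v w" unfolding S_def by (rule phi_derivs(3))+
  note sk = alt2_skew[OF lin[OF phi_derivs(4)]]
  show ?thesis
    unfolding d2_def D s using sk[of "T x v" "S u w"] by simp
qed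

end

section \<open>Smooth functions\<close>

lemma smooth_on_cong: "open S \<Longrightarrow> (\<And>x. x \<in> S \<Longrightarrow> f x = g x) \<Longrightarrow> smooth_on S f \<longleftrightarrow> smooth_on S g"
  unfolding smooth_on_def using Ck_on_cong[of S f g] by blast

lemma smooth_on_const: "smooth_on S (\<lambda>x. c)"
  by (simp add: smooth_on_def)

lemma smooth_on_bounded_linear: "open S \<Longrightarrow> bounded_linear h \<Longrightarrow> smooth_on S f \<Longrightarrow> smooth_on S (\<lambda>x. h (f x))"
  by (simp add: smooth_on_def Ck_on_bounded_linear)

lemma smooth_on_add: "open S \<Longrightarrow> smooth_on S f \<Longrightarrow> smooth_on S g \<Longrightarrow> smooth_on S (\<lambda>x. f x + g x)"
  by (simp add: smooth_on_def Ck_on_add)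

lemma smooth_on_diff: "open S \<Longrightarrow> smooth_on S f \<Longrightarrow> smooth_on S g \<Longrightarrow> smooth_on S (\<lambda>x. f x - g x)"
  by (simp add: smooth_on_def Ck_on_diff)

lemma smooth_on_mult:
  fixes f g :: "'a::real_normed_vector \<Rightarrow> 'b::real_normed_algebra"
  shows "open S \<Longrightarrow> smooth_on S f \<Longrightarrow> smooth_on S g \<Longrightarrow> smooth_on S (\<lambda>x. f x * g x)"
  by (simp add: smooth_on_def Ck_on_bilinear[OF _ bounded_bilinear_mult])

lemma smooth_on_sum:
  "open S \<Longrightarrow> (\<And>i. i \<in> I \<Longrightarrow> smooth_on S (f i)) \<Longrightarrow> smooth_on S (\<lambda>x. \<Sum>i\<in>I. f i x)"
  by (simp add: smooth_on_def Ck_on_sum)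

lemma smooth_on_divide:
  fixes f g :: "'a::real_normed_vector \<Rightarrow> 'b::real_normed_field"
  assumes "open S" "smooth_on S f" "smooth_on S g" "\<And>x. x \<in> S \<Longrightarrow> g x \<noteq> 0"
  shows "smooth_on S (\<lambda>x. f x / g x)"
  using assms unfolding divide_inverse
  by (simp add: smooth_on_def Ck_on_bilinear[OF _ bounded_bilinear_mult] Ck_on_inverse)

lemma smooth_on_derivative: "smooth_on S f \<Longrightarrow> smooth_on S (\<lambda>x. frechet_derivative f (at x) v)"
  unfolding smooth_on_def using Ck_on.simps(2) by blast

lemma smooth_on_evaluate:
  fixes a :: "'a::real_normed_vector \<Rightarrow> 'b::euclidean_space \<Rightarrow> 'c::real_normed_vector"
  assumes "open S" "\<And>x. x \<in> S \<Longrightarrow> linear (a x)" "\<And>v. smooth_on S (\<lambda>x. a x v)" "smooth_on S X"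
  shows "smooth_on S (\<lambda>x. a x (X x))"
  using assms by (simp add: smooth_on_def Ck_on_evaluate)

lemma smooth_on_differentiable: "smooth_on S f \<Longrightarrow> x \<in> S \<Longrightarrow> f differentiable (at x)"
  unfolding smooth_on_def using Ck_on.simps(2) by blast

lemmas smooth_intros = smooth_on_const smooth_on_add smooth_on_diff smooth_on_mult

lemma smooth_on_wedge22:
  assumes "open S" "\<And>u v. smooth_on S (\<lambda>x. a x u v)" "\<And>u v. smooth_on S (\<lambda>x. b x u v)"
  shows "smooth_on S (\<lambda>x. wedge22 (a x) (b x) u v w z)"
  unfolding wedge22_def by (intro smooth_intros assms)

abbreviation ev1 :: "'a cform \<Rightarrow> 'a chart \<Rightarrow> real^4 \<Rightarrow> real^4 \<Rightarrow> complex" where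
  "ev1 \<alpha> c x u \<equiv> \<alpha> c x [u]"

abbreviation ev2 :: "'a cform \<Rightarrow> 'a chart \<Rightarrow> real^4 \<Rightarrow> real^4 \<Rightarrow> real^4 \<Rightarrow> complex" where
  "ev2 \<alpha> c x u v \<equiv> \<alpha> c x [u, v]"

abbreviation ev3 :: "'a cform \<Rightarrow> 'a chart \<Rightarrow> real^4 \<Rightarrow> real^4 \<Rightarrow> real^4 \<Rightarrow> real^4 \<Rightarrow> complex" where
  "ev3 \<alpha> c x u v w \<equiv> \<alpha> c x [u, v, w]"

lemma on_charts_apply: "c \<in> A \<Longrightarrow> x \<in> chart_image c \<Longrightarrow> on_charts A \<alpha> c x = \<alpha> c x"
  by (simp add: on_charts_def)

lemma on_charts_outside: "\<not> (c \<in> A \<and> x \<in> chart_image c) \<Longrightarrow> on_charts A \<alpha> c x = 0"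
  by (auto simp: on_charts_def)

lemma on_charts_eqI:
  assumes "on_charts A \<alpha> = \<alpha>" "on_charts A \<beta> = \<beta>" "\<And>c x. c \<in> A \<Longrightarrow> x \<in> chart_image c \<Longrightarrow> \<alpha> c x = \<beta> c x"
  shows "\<alpha> = \<beta>"
proof -
  have "on_charts A \<alpha> = on_charts A \<beta>"
    using assms(3) by (intro ext) (simp add: on_charts_def)
  then show ?thesis using assms(1,2) by simp
qed

lemma on_charts_idem: "on_charts A (on_charts A \<alpha>) = on_charts A \<alpha>"
  by (simp add: on_charts_def fun_eq_iff)

lemma ext_d_1: "c \<in> A \<Longrightarrow> x \<in> chart_image c \<Longrightarrow> ext_d A \<alpha> c x [u, v] = d1 (ev1 \<alpha> c) x u v"
  by (simp add: ext_d_def on_charts_apply d1_def)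

lemma ext_d_2: "c \<in> A \<Longrightarrow> x \<in> chart_image c \<Longrightarrow> ext_d A \<alpha> c x [u, v, w] = d2 (ev2 \<alpha> c) x u v w"
  by (simp add: ext_d_def on_charts_apply d2_def)

lemma ext_d_3: "c \<in> A \<Longrightarrow> x \<in> chart_image c \<Longrightarrow> ext_d A \<alpha> c x [u, v, w, z] = d3 (ev3 \<alpha> c) x u v w z"
  by (simp add: ext_d_def on_charts_apply d3_def)

lemma ext_d_wrong_length:
  assumes "open (chart_image c)" "c \<in> A" "x \<in> chart_image c" "\<And>y. y \<in> chart_image c \<Longrightarrow> alternating k (\<alpha> c y)"
    and "length vs \<noteq> Suc k"
  shows "ext_d A \<alpha> c x vs = 0"
proof -
  have "frechet_derivative (\<lambda>y. \<alpha> c y (take i vs @ drop (Suc i) vs)) (at x) (vs ! i) = 0" if "i < length vs" for i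
    using assms that by (intro zero_family_derivative[of "chart_image c"]) (auto simp: alternating_def)
  then show ?thesis by (simp add: ext_d_def on_charts_apply assms)
qed

lemma alternating_ext_d:
  assumes "open (chart_image c)" "c \<in> A" "x \<in> chart_image c"
    and alt: "\<And>y. y \<in> chart_image c \<Longrightarrow> alternating k (\<alpha> c y)"
    and d: "\<And>vs. (\<lambda>y. \<alpha> c y vs) differentiable (at x)"
    and k: "k = 1 \<or> k = 2 \<or> k = 3"
  shows "alternating (Suc k) (ext_d A \<alpha> c x)"
proof -
  note z = ext_d_wrong_length[of c A x k \<alpha>, OF assms(1-3) alt]
  note i = assms(1,3)
  from k consider "k = 1" | "k = 2" | "k = 3" by blast
  then show ?thesis
  proof cases
    case 1
    have "alt2 (d1 (ev1 \<alpha> c) x)"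
      using alt unfolding 1 alternating_1 by (intro alt2_d1[OF i] d) blast
    then have "alternating 2 (ext_d A \<alpha> c x)"
      using z unfolding alternating_2 ext_d_1[OF assms(2,3)] by (simp add: 1 numeral_2_eq_2)
    then show ?thesis by (simp add: 1 numeral_2_eq_2)
  next
    case 2
    have "alt3 (d2 (ev2 \<alpha> c) x)"
      using alt unfolding 2 alternating_2 by (intro alt3_d2[OF i] d) blast
    then have "alternating 3 (ext_d A \<alpha> c x)"
      using z unfolding alternating_3 ext_d_2[OF assms(2,3)] by (simp add: 2)
    then show ?thesis by (simp add: 2)
  next
    case 3
    have "alt4 (d3 (ev3 \<alpha> c) x)"
      using alt unfolding 3 alternating_3 by (intro alt4_d3[OF i] d) blast
    then have "alternating 4 (ext_d A \<alpha> c x)"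
      using z unfolding alternating_4 ext_d_3[OF assms(2,3)] by (simp add: 3)
    then show ?thesis by (simp add: 3)
  qed
qed

lemma ext_d_zero: "ext_d A 0 = 0"
  by (simp add: ext_d_def on_charts_def fun_eq_iff zero_fun_def frechet_derivative_const)


section \<open>Global forms, compatibility between charts, and d on forms\<close>

section \<open>Forms on an almost Kaehler manifold\<close>

locale almost_kahler =
  fixes M :: "'a topology" and A :: "'a chart set"
    and J :: "'a endo_field" and g :: "'a metric_field" and \<omega> :: "'a cform"
  assumes ak: "almost_kahler4 M A J g \<omega>"
begin

lemma mfd: "smooth_manifold4 M A"
  and acs: "almost_complex_structure A J"
  and sympl: "symplectic_form A \<omega>"
  and riem: "riemannian_metric A g"
  using ak by (auto simp: almost_kahler4_def)

lemma chart: "c \<in> A \<Longrightarrow> is_chart M c"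
  using mfd by (auto simp: smooth_manifold4_def)

lemma open_chart: "c \<in> A \<Longrightarrow> open (chart_image c)"
  using chart by (auto simp: is_chart_def)

lemma openin_chart: "c \<in> A \<Longrightarrow> openin M (fst c)"
  using chart by (auto simp: is_chart_def)

lemma topspace_chart: "c \<in> A \<Longrightarrow> topspace (subtopology M (fst c)) = fst c"
  using openin_subset[OF openin_chart[of c]] by (simp add: topspace_subtopology Int_absorb1)

lemma homeo_chart: "c \<in> A \<Longrightarrow> homeomorphic_map (subtopology M (fst c)) (top_of_set (chart_image c)) (snd c)"
  using chart by (auto simp: is_chart_def)

lemma inj_chart: "c \<in> A \<Longrightarrow> inj_on (snd c) (fst c)"
  using homeomorphic_imp_injective_map[OF homeo_chart[of c]] topspace_chart[of c] by simp

lemma chart_image_I: "p \<in> fst c \<Longrightarrow> snd c p \<in> chart_image c"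
  by (auto simp: chart_image_def)

lemma open_image:
  assumes "c \<in> A" "openin M S" "S \<subseteq> fst c"
  shows "open (snd c ` S)"
proof -
  have "openin (subtopology M (fst c)) S"
    using assms(2,3) unfolding openin_subtopology by (intro exI[of _ S]) auto
  then have "openin (top_of_set (chart_image c)) (snd c ` S)"
    using homeomorphic_imp_open_map[OF homeo_chart[OF assms(1)]] by (auto simp: open_map_def)
  then show ?thesis using open_chart[OF assms(1)] openin_open_trans by blast
qed

lemma open_overlap: "c \<in> A \<Longrightarrow> c' \<in> A \<Longrightarrow> open (snd c ` (fst c \<inter> fst c'))"
  by (rule open_image) (auto intro: openin_Int openin_chart)

lemma transition_apply: "c \<in> A \<Longrightarrow> p \<in> fst c \<Longrightarrow> transition c c' (snd c p) = snd c' p"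
  using inj_chart by (simp add: transition_def)

lemma transition_smooth: "c \<in> A \<Longrightarrow> c' \<in> A \<Longrightarrow> smooth_on (snd c ` (fst c \<inter> fst c')) (transition c c')"
  using mfd by (auto simp: smooth_manifold4_def)

lemma linear_transition_deriv:
  assumes "c \<in> A" "c' \<in> A" "p \<in> fst c \<inter> fst c'"
  shows "linear (transition_deriv c c' p)"
  unfolding transition_deriv_def
  by (rule linear_frechet_derivative_at, rule smooth_on_differentiable[OF transition_smooth[OF assms(1,2)]])
    (use assms(3) in blast)

lemma formsD:
  assumes "\<alpha> \<in> forms A k"
  shows "on_charts A \<alpha> = \<alpha>"
    "c \<in> A \<Longrightarrow> x \<in> chart_image c \<Longrightarrow> alternating k (\<alpha> c x)"
    "c \<in> A \<Longrightarrow> smooth_on (chart_image c) (\<lambda>x. \<alpha> c x vs)"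
    "c \<in> A \<Longrightarrow> c' \<in> A \<Longrightarrow> p \<in> fst c \<inter> fst c' \<Longrightarrow>
      \<alpha> c (snd c p) vs = \<alpha> c' (snd c' p) (map (transition_deriv c c' p) vs)"
  using assms unfolding forms_def mem_Collect_eq by blast+

lemma forms_differentiable:
  "\<alpha> \<in> forms A k \<Longrightarrow> c \<in> A \<Longrightarrow> x \<in> chart_image c \<Longrightarrow> (\<lambda>x. \<alpha> c x vs) differentiable (at x)"
  using formsD(3) smooth_on_differentiable by blast

lemma forms1_linear: "\<alpha> \<in> forms A 1 \<Longrightarrow> c \<in> A \<Longrightarrow> x \<in> chart_image c \<Longrightarrow> linear (ev1 \<alpha> c x)"
  using formsD(2)[of \<alpha> 1 c x] by (simp only: alternating_1)

lemma forms2_alt2: "\<alpha> \<in> forms A 2 \<Longrightarrow> c \<in> A \<Longrightarrow> x \<in> chart_image c \<Longrightarrow> alt2 (ev2 \<alpha> c x)"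
  using formsD(2)[of \<alpha> 2 c x] by (simp only: alternating_2)

lemma forms3_alt3: "\<alpha> \<in> forms A 3 \<Longrightarrow> c \<in> A \<Longrightarrow> x \<in> chart_image c \<Longrightarrow> alt3 (ev3 \<alpha> c x)"
  using formsD(2)[of \<alpha> 3 c x] by (simp only: alternating_3)

text \<open>Builds a global form from curried chart data; what remains to be checked is linearity,
  smoothness on fixed vectors and compatibility.\<close>

lemma forms1I:
  assumes "\<And>c x. c \<in> A \<Longrightarrow> x \<in> chart_image c \<Longrightarrow> linear (b c x)"
    and "\<And>c u. c \<in> A \<Longrightarrow> smooth_on (chart_image c) (\<lambda>x. b c x u)"
    and nat: "\<And>c c' p u. c \<in> A \<Longrightarrow> c' \<in> A \<Longrightarrow> p \<in> fst c \<inter> fst c' \<Longrightarrow>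
      b c (snd c p) u = b c' (snd c' p) (transition_deriv c c' p u)"
  shows "on_charts A (\<lambda>c x. cov1 (b c x)) \<in> forms A 1"
  unfolding forms_def mem_Collect_eq
proof (intro conjI ballI allI)
  fix c vs assume c: "c \<in> A"
  have "smooth_on (chart_image c) (\<lambda>x. cov1 (b c x) vs)"
    using assms(2)[OF c] by (cases "length vs = 1") (simp_all add: cov1_def smooth_on_const)
  then show "smooth_on (chart_image c) (\<lambda>x. on_charts A (\<lambda>c x. cov1 (b c x)) c x vs)"
    using smooth_on_cong[OF open_chart[OF c], of "\<lambda>x. cov1 (b c x) vs" "\<lambda>x. on_charts A (\<lambda>c x. cov1 (b c x)) c x vs"]
    by (simp add: on_charts_apply[OF c])
next
  fix c c' p and vs :: "(real^4) list" assume c: "c \<in> A" "c' \<in> A" "p \<in> fst c \<inter> fst c'"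
  then show "on_charts A (\<lambda>c x. cov1 (b c x)) c (snd c p) vs =
      on_charts A (\<lambda>c x. cov1 (b c x)) c' (snd c' p) (map (transition_deriv c c' p) vs)"
    using nat[OF c] by (simp add: on_charts_apply chart_image_I cov1_def)
qed (simp_all add: on_charts_idem on_charts_apply alternating_cov1[unfolded One_nat_def] assms(1))

lemma forms2I:
  assumes "\<And>c x. c \<in> A \<Longrightarrow> x \<in> chart_image c \<Longrightarrow> alt2 (b c x)"
    and "\<And>c u v. c \<in> A \<Longrightarrow> smooth_on (chart_image c) (\<lambda>x. b c x u v)"
    and nat: "\<And>c c' p u v. c \<in> A \<Longrightarrow> c' \<in> A \<Longrightarrow> p \<in> fst c \<inter> fst c' \<Longrightarrow>
      b c (snd c p) u v = b c' (snd c' p) (transition_deriv c c' p u) (transition_deriv c c' p v)"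
  shows "on_charts A (\<lambda>c x. cov2 (b c x)) \<in> forms A 2"
  unfolding forms_def mem_Collect_eq
proof (intro conjI ballI allI)
  fix c vs assume c: "c \<in> A"
  have "smooth_on (chart_image c) (\<lambda>x. cov2 (b c x) vs)"
    using assms(2)[OF c] by (cases "length vs = 2") (simp_all add: cov2_def smooth_on_const)
  then show "smooth_on (chart_image c) (\<lambda>x. on_charts A (\<lambda>c x. cov2 (b c x)) c x vs)"
    using smooth_on_cong[OF open_chart[OF c], of "\<lambda>x. cov2 (b c x) vs" "\<lambda>x. on_charts A (\<lambda>c x. cov2 (b c x)) c x vs"]
    by (simp add: on_charts_apply[OF c])
next
  fix c c' p and vs :: "(real^4) list" assume c: "c \<in> A" "c' \<in> A" "p \<in> fst c \<inter> fst c'"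
  then show "on_charts A (\<lambda>c x. cov2 (b c x)) c (snd c p) vs =
      on_charts A (\<lambda>c x. cov2 (b c x)) c' (snd c' p) (map (transition_deriv c c' p) vs)"
    using nat[OF c] by (simp add: on_charts_apply chart_image_I cov2_def)
qed (simp_all add: on_charts_idem on_charts_apply alternating_cov2 assms(1))

lemma forms2_eqI:
  assumes "\<alpha> \<in> forms A 2" "\<beta> \<in> forms A 2"
    "\<And>c x u v. c \<in> A \<Longrightarrow> x \<in> chart_image c \<Longrightarrow> \<alpha> c x [u, v] = \<beta> c x [u, v]"
  shows "\<alpha> = \<beta>"
  by (rule on_charts_eqI[OF formsD(1)[OF assms(1)] formsD(1)[OF assms(2)]], rule alternating_eqI2)
    (use assms formsD(2) in blast)+

lemma forms2_add_scale:
  assumes "\<alpha> \<in> forms A 2" "\<beta> \<in> forms A 2"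
  shows "scale_form a \<alpha> + scale_form b \<beta> \<in> forms A 2"
proof -
  have F: "on_charts A (\<lambda>c x. cov2 (\<lambda>u v. a * ev2 \<alpha> c x u v + b * ev2 \<beta> c x u v)) \<in> forms A 2" (is "?F \<in> _")
  proof (rule forms2I)
    show "alt2 (\<lambda>u v. a * ev2 \<alpha> c x u v + b * ev2 \<beta> c x u v)" if "c \<in> A" "x \<in> chart_image c" for c x
      unfolding alt2_def
      by (intro conjI allI linear_complexI)
        (simp_all add: alt2_simps[OF forms2_alt2[OF assms(1) that]] alt2_simps[OF forms2_alt2[OF assms(2) that]]
          alt2_same[OF forms2_alt2[OF assms(1) that]] alt2_same[OF forms2_alt2[OF assms(2) that]] algebra_simps)
    show "smooth_on (chart_image c) (\<lambda>x. a * ev2 \<alpha> c x u v + b * ev2 \<beta> c x u v)" if "c \<in> A" for c u v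
      using that by (intro smooth_intros formsD(3)[OF assms(1)] formsD(3)[OF assms(2)] open_chart)
  next
    fix c c' p u v assume c: "c \<in> A" "c' \<in> A" "p \<in> fst c \<inter> fst c'"
    show "a * ev2 \<alpha> c (snd c p) u v + b * ev2 \<beta> c (snd c p) u v =
        a * ev2 \<alpha> c' (snd c' p) (transition_deriv c c' p u) (transition_deriv c c' p v) +
        b * ev2 \<beta> c' (snd c' p) (transition_deriv c c' p u) (transition_deriv c c' p v)"
      using formsD(4)[OF assms(1) c, of "[u, v]"] formsD(4)[OF assms(2) c, of "[u, v]"] by simp
  qed
  have "?F = scale_form a \<alpha> + scale_form b \<beta>"
  proof (intro ext)
    fix c x vs
    show "?F c x vs = (scale_form a \<alpha> + scale_form b \<beta>) c x vs"
    proof (cases "c \<in> A \<and> x \<in> chart_image c")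
      case True
      then show ?thesis
        using formsD(2)[OF assms(1), of c x] formsD(2)[OF assms(2), of c x]
        by (cases "length vs = 2") (auto simp: on_charts_apply scale_form_def cov2_def alternating_2 length_2)
    next
      case False
      then show ?thesis
        using on_charts_outside[of c A x \<alpha>] on_charts_outside[of c A x \<beta>]
        unfolding formsD(1)[OF assms(1)] formsD(1)[OF assms(2)]
        by (simp add: on_charts_outside scale_form_def)
    qed
  qed
  then show ?thesis using F by simp
qed

text \<open>The common premises of the pullback lemmas, in their order, for a transition
  map.\<close>

lemma pullback_hyps:
  assumes "c \<in> A" "c' \<in> A" "p \<in> fst c \<inter> fst c'"
  shows "open (snd c ` (fst c \<inter> fst c'))" "snd c p \<in> snd c ` (fst c \<inter> fst c')"
    "open (chart_image c')" "transition c c' ` (snd c ` (fst c \<inter> fst c')) \<subseteq> chart_image c'"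
    "Ck_on 2 (snd c ` (fst c \<inter> fst c')) (transition c c')"
proof -
  show "transition c c' ` (snd c ` (fst c \<inter> fst c')) \<subseteq> chart_image c'"
  proof (intro image_subsetI)
    fix y assume "y \<in> snd c ` (fst c \<inter> fst c')"
    then obtain q where "y = snd c q" "q \<in> fst c" "q \<in> fst c'" by blast
    then show "transition c c' y \<in> chart_image c'"
      using transition_apply[OF assms(1), of q c'] chart_image_I[of q c'] by simp
  qed
  show "Ck_on 2 (snd c ` (fst c \<inter> fst c')) (transition c c')"
    using transition_smooth[OF assms(1,2)] by (simp add: smooth_on_def)
qed (use assms(3) open_overlap[OF assms(1,2)] open_chart[OF assms(2)] in blast)+

text \<open>Compatibility of a form says that its representation in one chart is the pullback of
  that in another by the transition map, so compatibility of d\<alpha> is naturality of d.\<close>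

lemma ext_d_forms:
  assumes k: "k = 1 \<or> k = 2" and a: "\<alpha> \<in> forms A k"
  shows "ext_d A \<alpha> \<in> forms A (Suc k)"
  unfolding forms_def mem_Collect_eq
proof (intro conjI ballI allI)
  show "on_charts A (ext_d A \<alpha>) = ext_d A \<alpha>" by (simp add: ext_d_def on_charts_idem)
next
  fix c x assume c: "c \<in> A" "x \<in> chart_image c"
  show "alternating (Suc k) (ext_d A \<alpha> c x)"
    using k by (intro alternating_ext_d[OF open_chart[OF c(1)] c] formsD(2)[OF a c(1)] forms_differentiable[OF a c]) auto
next
  fix c vs assume c: "c \<in> A"
  have "smooth_on (chart_image c) (\<lambda>x. \<Sum>i<length vs. (-1) ^ i *
     frechet_derivative (\<lambda>y. \<alpha> c y (take i vs @ drop (Suc i) vs)) (at x) (vs ! i))"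
    by (intro smooth_on_sum smooth_intros smooth_on_derivative formsD(3)[OF a c] open_chart[OF c])
  then show "smooth_on (chart_image c) (\<lambda>x. ext_d A \<alpha> c x vs)"
    using smooth_on_cong[OF open_chart[OF c], of "\<lambda>x. ext_d A \<alpha> c x vs"] by (simp add: ext_d_def on_charts_apply[OF c])
next
  fix c c' p vs assume c: "c \<in> A" "c' \<in> A" "p \<in> fst c \<inter> fst c'"
  let ?T = "transition_deriv c c' p"
  have x: "snd c p \<in> chart_image c" "snd c' p \<in> chart_image c'" using c by (auto intro: chart_image_I)
  have tr: "transition c c' (snd c p) = snd c' p" using transition_apply c by auto
  have nat: "\<alpha> c y vs = \<alpha> c' (transition c c' y) (map (frechet_derivative (transition c c') (at y)) vs)"
    if "y \<in> snd c ` (fst c \<inter> fst c')" for y vs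
    using that formsD(4)[OF a c(1,2), of _ vs] transition_apply[OF c(1), of _ c'] by (auto simp: transition_deriv_def)
  show "ext_d A \<alpha> c (snd c p) vs = ext_d A \<alpha> c' (snd c' p) (map ?T vs)"
  proof (cases "length vs = Suc k")
    case False
    then show ?thesis
      using ext_d_wrong_length[of c A "snd c p" k \<alpha> vs, OF open_chart c(1) x(1) formsD(2)[OF a c(1)]]
        ext_d_wrong_length[of c' A "snd c' p" k \<alpha> "map ?T vs", OF open_chart c(2) x(2) formsD(2)[OF a c(2)]] c by simp
  next
    case True
    show ?thesis
    proof (cases "k = 1")
      case 1: True
      with True obtain u v where vs: "vs = [u, v]" using length_2 by (metis Suc_1)
      have "d1 (ev1 \<alpha> c) (snd c p) u v = d1 (ev1 \<alpha> c') (transition c c' (snd c p)) (?T u) (?T v)"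
        unfolding transition_deriv_def
      proof (rule d1_pullback[OF pullback_hyps[OF c]])
        show "linear (ev1 \<alpha> c' z)" if "z \<in> chart_image c'" for z
          using forms1_linear[OF _ c(2) that] a 1 by simp
        show "(\<lambda>z. ev1 \<alpha> c' z v) differentiable (at (transition c c' (snd c p)))" for v
          unfolding tr by (rule forms_differentiable[OF a c(2) x(2)])
      qed (simp add: nat)
      then show ?thesis unfolding vs tr by (simp add: ext_d_1 c x)
    next
      case False
      then have 2: "k = 2" using k by simp
      with True obtain u v w where vs: "vs = [u, v, w]" using length_3[of vs] by auto
      have "d2 (ev2 \<alpha> c) (snd c p) u v w = d2 (ev2 \<alpha> c') (transition c c' (snd c p)) (?T u) (?T v) (?T w)"
        unfolding transition_deriv_def
      proof (rule d2_pullback[OF pullback_hyps[OF c]])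
        show "alt2 (ev2 \<alpha> c' z)" if "z \<in> chart_image c'" for z
          using forms2_alt2[OF _ c(2) that] a 2 by simp
        show "(\<lambda>z. ev2 \<alpha> c' z u v) differentiable (at (transition c c' (snd c p)))" for u v
          unfolding tr by (rule forms_differentiable[OF a c(2) x(2)])
      qed (simp add: nat)
      then show ?thesis unfolding vs tr by (simp add: ext_d_2 c x)
    qed
  qed
qed

end

lemma wedge22_natural:
  assumes "\<And>u v. a u v = a' (T u) (T v)" "\<And>u v. b u v = b' (T u) (T v)"
  shows "wedge22 a b u v w z = wedge22 a' b' (T u) (T v) (T w) (T z)"
  unfolding wedge22_def assms ..

lemma wedge13_natural:
  assumes "\<And>u. \<theta> u = \<theta>' (T u)" "\<And>u v w. t u v w = t' (T u) (T v) (T w)"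
  shows "wedge13 \<theta> t u v w z = wedge13 \<theta>' t' (T u) (T v) (T w) (T z)"
  unfolding wedge13_def assms ..

lemma wedge12_natural:
  assumes "\<And>u. \<theta> u = \<theta>' (T u)" "\<And>u v. a u v = a' (T u) (T v)"
  shows "wedge12 \<theta> a u v w = wedge12 \<theta>' a' (T u) (T v) (T w)"
  unfolding wedge12_def assms ..

section \<open>Smoothness and chart independence of volume, trace, J and star\<close>

context almost_kahler
begin

lemma J_facts:
  assumes "c \<in> A"
  shows "x \<in> chart_image c \<Longrightarrow> linear (J c x)" "x \<in> chart_image c \<Longrightarrow> J c x (J c x v) = - v"
    "smooth_on (chart_image c) (\<lambda>x. J c x v)"
    "c' \<in> A \<Longrightarrow> p \<in> fst c \<inter> fst c' \<Longrightarrow>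
      transition_deriv c c' p (J c (snd c p) v) = J c' (snd c' p) (transition_deriv c c' p v)"
  using acs assms unfolding almost_complex_structure_def by blast+

lemma g_omega: "c \<in> A \<Longrightarrow> x \<in> chart_image c \<Longrightarrow> complex_of_real (g c x u v) = \<omega> c x [J c x u, v]"
  and omega_J: "c \<in> A \<Longrightarrow> x \<in> chart_image c \<Longrightarrow> \<omega> c x [J c x u, J c x v] = \<omega> c x [u, v]"
  using ak unfolding almost_kahler4_def by blast+

lemma omega_forms: "\<omega> \<in> forms A 2" and d_omega: "ext_d A \<omega> = 0"
  using sympl unfolding symplectic_form_def by blast+

lemma herm:
  assumes "c \<in> A" "x \<in> chart_image c"
  shows "hermitian4 (J c x) (g c x)"
proof
  show "J c x (b1 + b2) = J c x b1 + J c x b2" "J c x (r *\<^sub>R b1) = r *\<^sub>R J c x b1" for b1 b2 r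
    using J_facts(1)[OF assms] by (auto simp: linear_add linear_cmul)
  show "J c x (J c x v) = - v" for v by (rule J_facts(2)[OF assms])
  show "bilinear (g c x)" "g c x u v = g c x v u" "v \<noteq> 0 \<Longrightarrow> 0 < g c x v v" for u v
    using riem assms unfolding riemannian_metric_def by blast+
  have "complex_of_real (g c x (J c x u) (J c x v)) = complex_of_real (g c x u v)" for u v
    unfolding g_omega[OF assms] omega_J[OF assms] ..
  then show "g c x (J c x u) (J c x v) = g c x u v" for u v by (simp only: of_real_eq_iff)
qed

lemma omega_eq:
  assumes "c \<in> A" "x \<in> chart_image c"
  shows "ev2 \<omega> c x = (\<lambda>u v. complex_of_real (hermitian4.om (J c x) (g c x) u v))"
  unfolding hermitian4.om_def[OF herm[OF assms]] g_omega[OF assms] omega_J[OF assms] ..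

text \<open>The coefficient of \<omega>\<and>\<omega>/2. On chart images it is real and nowhere 0,
  but its sign depends on the chart.\<close>

definition Vol :: "'a chart \<Rightarrow> real^4 \<Rightarrow> complex" where
  "Vol c x = wedge22 (ev2 \<omega> c x) (ev2 \<omega> c x) (E4 1) (E4 2) (E4 3) (E4 4) / 2"

text \<open>\<open>trace2\<close> expressed through \<omega> only, so that smoothness is inherited
  from \<omega>.\<close>

definition tr :: "'a chart \<Rightarrow> real^4 \<Rightarrow> (real^4 \<Rightarrow> real^4 \<Rightarrow> complex) \<Rightarrow> complex" where
  "tr c x a = - 2 * wedge22 a (ev2 \<omega> c x) (E4 1) (E4 2) (E4 3) (E4 4) / Vol c x"

lemma Vol_eq:
  assumes "c \<in> A" "x \<in> chart_image c"
  shows "Vol c x = of_real (hermitian4.vol (J c x) (g c x) (E4 1) (E4 2) (E4 3) (E4 4))"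
  unfolding Vol_def omega_eq[OF assms] hermitian4.wedge22_W_W[OF herm[OF assms]] by simp

lemma Vol_nonzero: "c \<in> A \<Longrightarrow> x \<in> chart_image c \<Longrightarrow> Vol c x \<noteq> 0"
  using hermitian4.vol_E4_nonzero[OF herm] by (simp add: Vol_eq)

lemma tr_eq:
  assumes "c \<in> A" "x \<in> chart_image c"
  shows "hermitian4.trace2 (J c x) (g c x) a = tr c x a"
  unfolding hermitian4.trace2_def[OF herm[OF assms]] tr_def Vol_eq[OF assms] omega_eq[OF assms] ..

lemma alt2_omega: "c \<in> A \<Longrightarrow> x \<in> chart_image c \<Longrightarrow> alt2 (ev2 \<omega> c x)"
  by (rule forms2_alt2[OF omega_forms])

lemma natural_E4:
  assumes c: "c \<in> A" "c' \<in> A" "p \<in> fst c \<inter> fst c'" and "alt4 \<kappa>'"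
    and "\<And>u v w z. \<kappa> u v w z = \<kappa>' (transition_deriv c c' p u) (transition_deriv c c' p v)
      (transition_deriv c c' p w) (transition_deriv c c' p z)"
  shows "\<kappa> (E4 1) (E4 2) (E4 3) (E4 4) = of_real (det (matrix (transition_deriv c c' p))) * \<kappa>' (E4 1) (E4 2) (E4 3) (E4 4)"
  unfolding assms(5) by (rule alt4_linear_image[OF assms(4) linear_transition_deriv[OF c]])

lemma omega_natural:
  assumes c: "c \<in> A" "c' \<in> A" "p \<in> fst c \<inter> fst c'"
  shows "\<omega> c (snd c p) [u, v] = \<omega> c' (snd c' p) [transition_deriv c c' p u, transition_deriv c c' p v]"
  using formsD(4)[OF omega_forms c, of "[u, v]"] by simp

lemma Vol_natural:
  assumes c: "c \<in> A" "c' \<in> A" "p \<in> fst c \<inter> fst c'"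
  shows "Vol c (snd c p) = of_real (det (matrix (transition_deriv c c' p))) * Vol c' (snd c' p)"
proof -
  have x': "snd c' p \<in> chart_image c'" using c by (auto intro: chart_image_I)
  have "wedge22 (ev2 \<omega> c (snd c p)) (ev2 \<omega> c (snd c p)) (E4 1) (E4 2) (E4 3) (E4 4) =
      of_real (det (matrix (transition_deriv c c' p))) *
      wedge22 (ev2 \<omega> c' (snd c' p)) (ev2 \<omega> c' (snd c' p)) (E4 1) (E4 2) (E4 3) (E4 4)"
    by (rule natural_E4[OF c alt4_wedge22[OF alt2_omega[OF c(2) x'] alt2_omega[OF c(2) x']]])
      (rule wedge22_natural; rule omega_natural[OF c])
  then show ?thesis by (simp add: Vol_def)
qed

text \<open>Numerator and denominator are coefficients of 4-forms and acquire the same Jacobian, so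
  the quotient is a function on the manifold.\<close>

lemma tr_natural:
  assumes c: "c \<in> A" "c' \<in> A" "p \<in> fst c \<inter> fst c'" and a': "alt2 a'"
    and eq: "\<And>u v. a u v = a' (transition_deriv c c' p u) (transition_deriv c c' p v)"
  shows "tr c (snd c p) a = tr c' (snd c' p) a'"
proof -
  have x: "snd c p \<in> chart_image c" "snd c' p \<in> chart_image c'" using c by (auto intro: chart_image_I)
  have "wedge22 a (ev2 \<omega> c (snd c p)) (E4 1) (E4 2) (E4 3) (E4 4) =
      of_real (det (matrix (transition_deriv c c' p))) *
      wedge22 a' (ev2 \<omega> c' (snd c' p)) (E4 1) (E4 2) (E4 3) (E4 4)"
    by (rule natural_E4[OF c alt4_wedge22[OF a' alt2_omega[OF c(2) x(2)]]])
      (rule wedge22_natural, rule eq, rule omega_natural[OF c])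
  moreover have "of_real (det (matrix (transition_deriv c c' p))) \<noteq> (0::complex)"
    using Vol_natural[OF c] Vol_nonzero[OF c(1) x(1)] by auto
  ultimately show ?thesis by (simp add: tr_def Vol_natural[OF c])
qed

lemma smooth_Vol: "c \<in> A \<Longrightarrow> smooth_on (chart_image c) (Vol c)"
  unfolding Vol_def[abs_def]
  by (intro smooth_on_divide smooth_on_const smooth_on_wedge22 open_chart formsD(3)[OF omega_forms]) auto

lemma smooth_tr:
  assumes "c \<in> A" "\<And>u v. smooth_on (chart_image c) (\<lambda>x. a x u v)"
  shows "smooth_on (chart_image c) (\<lambda>x. tr c x (a x))"
  unfolding tr_def
  by (intro smooth_on_divide smooth_on_mult smooth_on_const smooth_on_wedge22 open_chart assms smooth_Vol Vol_nonzero formsD(3)[OF omega_forms])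

lemma J_form_2:
  assumes "\<alpha> \<in> forms A 2"
  shows "c \<in> A \<Longrightarrow> x \<in> chart_image c \<Longrightarrow> J_form A J 2 \<alpha> c x = (\<lambda>vs. \<alpha> c x (map (J c x) vs))"
proof -
  assume c: "c \<in> A" "x \<in> chart_image c"
  interpret complex_structure4 "J c x"
    by unfold_locales (use J_facts(1,2)[OF c] in \<open>auto simp: linear_add linear_cmul\<close>)
  show ?thesis by (simp add: J_form_def on_charts_apply c J_cov_2[OF formsD(2)[OF assms c]])
qed

lemma J_form_2_forms:
  assumes a: "\<alpha> \<in> forms A 2"
  shows "J_form A J 2 \<alpha> \<in> forms A 2"
proof -
  have F: "on_charts A (\<lambda>c x. cov2 (\<lambda>u v. \<alpha> c x [J c x u, J c x v])) \<in> forms A 2"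
  proof (rule forms2I)
    fix c x assume c: "c \<in> A" "x \<in> chart_image c"
    then show "alt2 (\<lambda>u v. \<alpha> c x [J c x u, J c x v])"
      using hermitian4.alt2_J[OF herm[OF c] forms2_alt2[OF a c]] by simp
  next
    fix c u v assume c: "c \<in> A"
    show "smooth_on (chart_image c) (\<lambda>x. \<alpha> c x [J c x u, J c x v])"
    proof (rule smooth_on_evaluate[OF open_chart[OF c], where a = "\<lambda>x v. \<alpha> c x [J c x u, v]"])
      show "linear (\<lambda>v. \<alpha> c x [J c x u, v])" if "x \<in> chart_image c" for x
        by (rule alt2_linear(2)[OF forms2_alt2[OF a c that]])
      show "smooth_on (chart_image c) (\<lambda>x. \<alpha> c x [J c x u, v])" for v
      proof (rule smooth_on_evaluate[OF open_chart[OF c], where a = "\<lambda>x u. \<alpha> c x [u, v]"])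
        show "linear (\<lambda>u. \<alpha> c x [u, v])" if "x \<in> chart_image c" for x
          by (rule alt2_linear(1)[OF forms2_alt2[OF a c that]])
      qed (rule formsD(3)[OF a c] J_facts(3)[OF c])+
    qed (rule J_facts(3)[OF c])
  next
    fix c c' p u v assume c: "c \<in> A" "c' \<in> A" "p \<in> fst c \<inter> fst c'"
    show "\<alpha> c (snd c p) [J c (snd c p) u, J c (snd c p) v] =
      \<alpha> c' (snd c' p) [J c' (snd c' p) (transition_deriv c c' p u), J c' (snd c' p) (transition_deriv c c' p v)]"
      unfolding J_facts(4)[OF c, symmetric]
      using formsD(4)[OF a c, of "[J c (snd c p) u, J c (snd c p) v]"] by simp
  qed
  have "J_form A J 2 \<alpha> = on_charts A (\<lambda>c x. cov2 (\<lambda>u v. \<alpha> c x [J c x u, J c x v]))"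
  proof (rule on_charts_eqI[OF _ on_charts_idem])
    show "on_charts A (J_form A J 2 \<alpha>) = J_form A J 2 \<alpha>" by (simp add: J_form_def on_charts_idem)
    fix c x assume c: "c \<in> A" "x \<in> chart_image c"
    have z: "\<And>vs. length vs \<noteq> 2 \<Longrightarrow> \<alpha> c x vs = 0" using formsD(2)[OF a c] by (simp add: alternating_def)
    have "\<alpha> c x (map (J c x) vs) = cov2 (\<lambda>u v. \<alpha> c x [J c x u, J c x v]) vs" for vs
      using z[of "map (J c x) vs"] by (cases "length vs = 2") (auto simp: length_2 cov2_def)
    then show "J_form A J 2 \<alpha> c x = on_charts A (\<lambda>c x. cov2 (\<lambda>u v. \<alpha> c x [J c x u, J c x v])) c x"
      unfolding J_form_2[OF a c] on_charts_apply[OF c] by (rule ext)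
  qed
  then show ?thesis using F by simp
qed

lemma hodge_2:
  assumes "\<alpha> \<in> forms A 2" "c \<in> A" "x \<in> chart_image c"
  shows "hodge A J g 2 \<alpha> c x = cov2 (\<lambda>u v. - tr c x (ev2 \<alpha> c x) / 2 * \<omega> c x [u, v] - \<alpha> c x [J c x u, J c x v])"
proof -
  interpret h: hermitian4 "J c x" "g c x" by (rule herm[OF assms(2,3)])
  have "hodge A J g 2 \<alpha> c x = cov2 (h.star2 (ev2 \<alpha> c x))"
    by (simp add: hodge_def on_charts_apply assms(2,3) h.hodge_cov_2[OF formsD(2)[OF assms]])
  then show ?thesis
    unfolding h.star2_def[abs_def] tr_eq[OF assms(2,3)] fun_cong[OF fun_cong[OF omega_eq[OF assms(2,3)]]] .
qed

text \<open>In the closed formula the star is a combination of \<omega> and J\<alpha> with globally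
  defined smooth coefficients; no local frame is chosen.\<close>

lemma hodge_2_forms:
  assumes a: "\<alpha> \<in> forms A 2"
  shows "hodge A J g 2 \<alpha> \<in> forms A 2"
proof -
  have F: "on_charts A (\<lambda>c x. cov2 (\<lambda>u v. - tr c x (ev2 \<alpha> c x) / 2 * \<omega> c x [u, v] - J_form A J 2 \<alpha> c x [u, v])) \<in> forms A 2" (is "?F \<in> _")
  proof (rule forms2I)
    fix c x assume c: "c \<in> A" "x \<in> chart_image c"
    show "alt2 (\<lambda>u v. - tr c x (ev2 \<alpha> c x) / 2 * \<omega> c x [u, v] - J_form A J 2 \<alpha> c x [u, v])"
      using hermitian4.alt2_add_scale[OF herm[OF c] alt2_omega[OF c] forms2_alt2[OF J_form_2_forms[OF a] c],
          of "- tr c x (ev2 \<alpha> c x) / 2" "-1"] by simp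
  next
    fix c u v assume c: "c \<in> A"
    have "smooth_on (chart_image c) (\<lambda>x. (- 1 / 2) * tr c x (ev2 \<alpha> c x) * \<omega> c x [u, v] - J_form A J 2 \<alpha> c x [u, v])"
      by (intro smooth_intros open_chart[OF c] smooth_tr[OF c] formsD(3)[OF a c] formsD(3)[OF omega_forms c]
          formsD(3)[OF J_form_2_forms[OF a] c])
    then show "smooth_on (chart_image c) (\<lambda>x. - tr c x (ev2 \<alpha> c x) / 2 * \<omega> c x [u, v] - J_form A J 2 \<alpha> c x [u, v])"
      by simp
  next
    fix c c' p u v assume c: "c \<in> A" "c' \<in> A" "p \<in> fst c \<inter> fst c'"
    have x': "snd c' p \<in> chart_image c'" using c by (auto intro: chart_image_I)
    have "tr c (snd c p) (ev2 \<alpha> c (snd c p)) = tr c' (snd c' p) (ev2 \<alpha> c' (snd c' p))"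
    proof (rule tr_natural[OF c forms2_alt2[OF a c(2) x']])
      show "\<alpha> c (snd c p) [u, v] = \<alpha> c' (snd c' p) [transition_deriv c c' p u, transition_deriv c c' p v]" for u v
        using formsD(4)[OF a c, of "[u, v]"] by simp
    qed
    then show "- tr c (snd c p) (ev2 \<alpha> c (snd c p)) / 2 * \<omega> c (snd c p) [u, v] - J_form A J 2 \<alpha> c (snd c p) [u, v] =
       - tr c' (snd c' p) (ev2 \<alpha> c' (snd c' p)) / 2 * \<omega> c' (snd c' p) [transition_deriv c c' p u, transition_deriv c c' p v]
        - J_form A J 2 \<alpha> c' (snd c' p) [transition_deriv c c' p u, transition_deriv c c' p v]"
      using omega_natural[OF c, of u v] formsD(4)[OF J_form_2_forms[OF a] c, of "[u, v]"] by simp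
  qed
  have "hodge A J g 2 \<alpha> = ?F"
  proof (rule on_charts_eqI[OF _ on_charts_idem])
    show "on_charts A (hodge A J g 2 \<alpha>) = hodge A J g 2 \<alpha>" by (simp add: hodge_def on_charts_idem)
    fix c x assume c: "c \<in> A" "x \<in> chart_image c"
    show "hodge A J g 2 \<alpha> c x = ?F c x"
      unfolding hodge_2[OF a c] on_charts_apply[OF c] J_form_2[OF a c] by simp
  qed
  then show ?thesis using F by simp
qed

lemma hodge_3:
  assumes "\<tau> \<in> forms A 3" "c \<in> A" "x \<in> chart_image c"
  shows "hodge A J g 3 \<tau> c x = cov1 (hermitian4.star3 (J c x) (g c x) (ev3 \<tau> c x))"
proof -
  interpret h: hermitian4 "J c x" "g c x" by (rule herm[OF assms(2,3)])
  show ?thesis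
    by (simp add: hodge_def on_charts_apply assms(2,3) h.hodge_cov_3[OF formsD(2)[OF assms]])
qed

lemma hodge_3_forms:
  assumes a: "\<tau> \<in> forms A 3"
  shows "hodge A J g 3 \<tau> \<in> forms A 1"
proof -
  let ?b = "\<lambda>c x v. - tr c x (\<lambda>u w. \<tau> c x [u, w, J c x v]) / 2"
  have st: "hermitian4.star3 (J c x) (g c x) (ev3 \<tau> c x) = ?b c x" if c: "c \<in> A" "x \<in> chart_image c" for c x
    unfolding hermitian4.star3_def[OF herm[OF c], abs_def] tr_eq[OF c] ..
  have F: "on_charts A (\<lambda>c x. cov1 (?b c x)) \<in> forms A 1"
  proof (rule forms1I)
    fix c x assume c: "c \<in> A" "x \<in> chart_image c"
    show "linear (?b c x)"
      using hermitian4.linear_star3[OF herm[OF c] forms3_alt3[OF a c]] unfolding st[OF c] .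
  next
    fix c v assume c: "c \<in> A"
    have "smooth_on (chart_image c) (\<lambda>x. (- 1 / 2) * tr c x (\<lambda>u w. \<tau> c x [u, w, J c x v]))"
    proof (intro smooth_intros open_chart[OF c] smooth_tr[OF c])
      show "smooth_on (chart_image c) (\<lambda>x. \<tau> c x [u, w, J c x v])" for u w
      proof (rule smooth_on_evaluate[OF open_chart[OF c], where a = "\<lambda>x v. \<tau> c x [u, w, v]"])
        show "linear (\<lambda>v. \<tau> c x [u, w, v])" if "x \<in> chart_image c" for x
          by (rule alt3_linear(3)[OF forms3_alt3[OF a c that]])
      qed (rule formsD(3)[OF a c] J_facts(3)[OF c])+
    qed
    then show "smooth_on (chart_image c) (\<lambda>x. ?b c x v)" by simp
  next
    fix c c' p v assume c: "c \<in> A" "c' \<in> A" "p \<in> fst c \<inter> fst c'"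
    have x': "snd c' p \<in> chart_image c'" using c by (auto intro: chart_image_I)
    have "tr c (snd c p) (\<lambda>u w. \<tau> c (snd c p) [u, w, J c (snd c p) v]) =
       tr c' (snd c' p) (\<lambda>u w. \<tau> c' (snd c' p) [u, w, J c' (snd c' p) (transition_deriv c c' p v)])"
    proof (rule tr_natural[OF c alt3_alt2(2)[OF forms3_alt3[OF a c(2) x']]])
      show "\<tau> c (snd c p) [u, w, J c (snd c p) v] = \<tau> c' (snd c' p) [transition_deriv c c' p u, transition_deriv c c' p w,
          J c' (snd c' p) (transition_deriv c c' p v)]" for u w
        unfolding J_facts(4)[OF c, symmetric]
        using formsD(4)[OF a c, of "[u, w, J c (snd c p) v]"] by simp
    qed
    then show "?b c (snd c p) v = ?b c' (snd c' p) (transition_deriv c c' p v)" by simp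
  qed
  have "hodge A J g 3 \<tau> = on_charts A (\<lambda>c x. cov1 (?b c x))"
  proof (rule on_charts_eqI[OF _ on_charts_idem])
    show "on_charts A (hodge A J g 3 \<tau>) = hodge A J g 3 \<tau>" by (simp add: hodge_def on_charts_idem)
    fix c x assume c: "c \<in> A" "x \<in> chart_image c"
    show "hodge A J g 3 \<tau> c x = on_charts A (\<lambda>c x. cov1 (?b c x)) c x"
      unfolding hodge_3[OF a c] on_charts_apply[OF c] st[OF c] ..
  qed
  then show ?thesis using F by simp
qed

lemma zero_forms: "0 \<in> forms A k"
  by (auto simp: forms_def on_charts_def fun_eq_iff alternating_def smooth_on_const linear_zero zero_fun_def)

lemma hodge_zero:
  assumes "k = 2 \<or> k = 3 \<or> k = 4"
  shows "hodge A J g k 0 = 0"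
proof -
  have "hodge_cov (J c x) (g c x) k 0 = 0" if c: "c \<in> A" "x \<in> chart_image c" for c x
  proof -
    interpret h: hermitian4 "J c x" "g c x" by (rule herm[OF c])
    have z: "alternating k 0" using formsD(2)[OF zero_forms c] by simp
    have "wedge22 (\<lambda>u v. 0) b u v w z = 0" for b u v w z by (simp add: wedge22_def)
    then have t: "h.trace2 (\<lambda>u v. 0) = 0" by (simp add: h.trace2_def)
    from assms show ?thesis
      using z by (auto simp: h.hodge_cov_2 h.hodge_cov_3 h.hodge_cov_4 h.star2_def h.star3_def t cov1_def cov2_def fun_eq_iff)
  qed
  then show ?thesis by (simp add: hodge_def on_charts_def fun_eq_iff)
qed

end

section \<open>Integration on a compact manifold by bump functions of class C1\<close>

section \<open>The divergence theorem\<close>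

lemma absolutely_integrable_on_compact:
  fixes f :: "'a::euclidean_space \<Rightarrow> 'b::euclidean_space"
  assumes "compact S" "continuous_on S f"
  shows "f absolutely_integrable_on S"
proof -
  have "integrable lborel (\<lambda>x. indicator S x *\<^sub>R f x)"
    by (rule borel_integrable_compact[OF assms])
  then have "integrable lebesgue (\<lambda>x. indicator S x *\<^sub>R f x)"
    by (subst integrable_completion) auto
  then show ?thesis by (simp add: set_integrable_def)
qed

lemma integral_change_of_variables_compact_real:
  fixes F :: "real^4 \<Rightarrow> real" and \<phi> :: "real^4 \<Rightarrow> real^4"
  assumes S: "compact S" and d: "\<And>x. x \<in> S \<Longrightarrow> (\<phi> has_derivative \<phi>' x) (at x)" and inj: "inj_on \<phi> S"
    and F: "continuous_on (\<phi> ` S) F"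
  shows "integral (\<phi> ` S) F = integral S (\<lambda>x. \<bar>det (matrix (\<phi>' x))\<bar> * F (\<phi> x))"
proof -
  \<comment> \<open>The change of variables formula is used for vector-valued integrands; the single
    component recovers \<open>F\<close>.\<close>
  define f :: "real^4 \<Rightarrow> real^1" where "f = (\<lambda>x. vec (F x))"
  have leb: "S \<in> sets lebesgue" using S by (simp add: lmeasurable_compact fmeasurableD)
  have d': "\<And>x. x \<in> S \<Longrightarrow> (\<phi> has_derivative \<phi>' x) (at x within S)"
    using d has_derivative_at_withinI by blast
  have "continuous_on S \<phi>"
    using d' has_derivative_continuous_on by blast
  then have "compact (\<phi> ` S)" using S compact_continuous_image by blast
  moreover have "continuous_on (\<phi> ` S) f"
    using F unfolding f_def vec_def by (intro continuous_on_vec_lambda)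
  ultimately have ai: "f absolutely_integrable_on (\<phi> ` S)"
    by (rule absolutely_integrable_on_compact)
  have eq: "integral (\<phi> ` S) f = integral S (\<lambda>x. \<bar>det (matrix (\<phi>' x))\<bar> *\<^sub>R f (\<phi> x))"
    using integral_change_of_variables[OF leb d' inj] ai by blast
  have ai2: "(\<lambda>x. \<bar>det (matrix (\<phi>' x))\<bar> *\<^sub>R f (\<phi> x)) absolutely_integrable_on S"
    using absolutely_integrable_change_of_variables[OF leb d' inj] ai by blast
  have "integral (\<phi> ` S) f $ 1 = integral (\<phi> ` S) F"
    using integral_component_eq_cart[OF set_lebesgue_integral_eq_integral(1)[OF ai], of 1] by (simp add: f_def)
  moreover have "integral S (\<lambda>x. \<bar>det (matrix (\<phi>' x))\<bar> *\<^sub>R f (\<phi> x)) $ 1 = integral S (\<lambda>x. \<bar>det (matrix (\<phi>' x))\<bar> * F (\<phi> x))"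
    using integral_component_eq_cart[OF set_lebesgue_integral_eq_integral(1)[OF ai2], of 1] by (simp add: f_def)
  ultimately show ?thesis using eq by simp
qed

text \<open>On a box around \<open>y\<close> inside the ball the integral lies between 0 and that
  over the ball, so it is 0, and continuity applies.\<close>

lemma integral_nonneg_eq_0:
  fixes f :: "real^4 \<Rightarrow> real"
  assumes f: "continuous_on (cball p r) f" "\<And>x. x \<in> cball p r \<Longrightarrow> 0 \<le> f x" and 0: "integral (cball p r) f = 0"
    and y: "y \<in> ball p r"
  shows "f y = 0"
proof -
  obtain a b where ab: "y \<in> box a b" "cbox a b \<subseteq> ball p r"
    using open_contains_cbox[of "ball p r"] y by (metis open_ball)
  then have sub: "cbox a b \<subseteq> cball p r" by force
  have c: "continuous_on (cbox a b) f" using continuous_on_subset[OF f(1) sub] .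
  have int: "f integrable_on cbox a b" using c by (rule integrable_continuous)
  have "f integrable_on cball p r"
    using absolutely_integrable_on_compact[OF compact_cball f(1)] set_lebesgue_integral_eq_integral(1) by blast
  then have "integral (cbox a b) f \<le> 0"
    using integral_subset_le[OF sub int] f(2) 0 by simp
  moreover have "0 \<le> integral (cbox a b) f"
    using integral_nonneg[OF int] f(2) sub by blast
  ultimately have "(f has_integral 0) (cbox a b)"
    using integrable_integral[OF int] by simp
  moreover have "0 \<le> f x" if "x \<in> box a b" for x using f(2) sub that box_subset_cbox by blast
  moreover have "y \<in> cbox a b" "box a b \<noteq> {}" using ab(1) box_subset_cbox by blast+
  ultimately show ?thesis by (intro has_integral_0_cbox_imp_0[OF c, of y])
qed

text \<open>The extension by 0 is C1, since \<open>U\<close> and the complement of the closed ball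
  are open and cover the space.\<close>

lemma integral_derivative_chart_eq_0:
  fixes w :: "real^4 \<Rightarrow> real"
  assumes U: "open U" "cball p r \<subseteq> U" and w: "Ck_on 1 U w" and supp: "\<And>y. y \<in> U \<Longrightarrow> y \<notin> cball p r \<Longrightarrow> w y = 0"
  shows "integral (cball p r) (\<lambda>y. frechet_derivative w (at y) u) = 0"
proof -
  define w' where "w' = (\<lambda>y. if y \<in> U then w y else 0)"
  have "Ck_on 1 UNIV w'"
  proof (rule Ck_on_local)
    fix y
    show "\<exists>T. open T \<and> y \<in> T \<and> Ck_on 1 T w'"
    proof (cases "y \<in> U")
      case True
      have "Ck_on 1 U w'" using w Ck_on_cong[OF U(1), of w w' 1] by (simp add: w'_def)
      then show ?thesis using True U(1) by blast
    next
      case False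
      have o: "open (- cball p r)" by (simp add: open_Compl)
      have "Ck_on 1 (- cball p r) w'"
        using Ck_on_cong[OF o, of w' "\<lambda>_. 0" 1] supp Ck_on_const[of 1 "- cball p r" 0] by (auto simp: w'_def)
      then show ?thesis using False U(2) o by blast
    qed
  qed
  then have "integral (cball p r) (\<lambda>y. frechet_derivative w' (at y) u) = 0"
    by (rule integral_derivative_eq_0) (use supp in \<open>auto simp: w'_def\<close>)
  moreover have "frechet_derivative w' (at y) = frechet_derivative w (at y)" if "y \<in> cball p r" for y
    using that U by (intro frechet_derivative_cong_open[OF U(1)]) (auto simp: w'_def)
  ultimately show ?thesis
    using integral_cong[of "cball p r" "\<lambda>y. frechet_derivative w' (at y) u" "\<lambda>y. frechet_derivative w (at y) u"] by simp
qed

lemma DERIV_max0_square: "((\<lambda>t::real. (max 0 t)\<^sup>2) has_real_derivative 2 * max 0 t) (at t)"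
proof -
  consider "t > 0" | "t < 0" | "t = 0" by linarith
  then show ?thesis
  proof cases
    case 1
    have "((\<lambda>t::real. t\<^sup>2) has_real_derivative 2 * max 0 t) (at t)"
      using 1 by (auto intro!: derivative_eq_intros)
    then show ?thesis
      by (rule has_field_derivative_transform_within_open[where S = "{0<..}"]) (use 1 in auto)
  next
    case 2
    have "((\<lambda>t::real. 0) has_real_derivative 2 * max 0 t) (at t)" using 2 by simp
    then show ?thesis
      by (rule has_field_derivative_transform_within_open[where S = "{..<0}"]) (use 2 in auto)
  next
    case 3
    have "((\<lambda>h::real. (max 0 h)\<^sup>2 / h) \<longlongrightarrow> 0) (at 0)"
    proof (rule Lim_null_comparison)
      show "\<forall>\<^sub>F h in at 0. norm ((max 0 h)\<^sup>2 / h) \<le> \<bar>h\<bar>"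
        by (rule always_eventually) (auto simp: max_def power2_eq_square)
      show "((\<lambda>h::real. \<bar>h\<bar>) \<longlongrightarrow> 0) (at 0)"
        by (intro tendsto_rabs_zero tendsto_ident_at)
    qed
    then show ?thesis using 3 by (simp add: DERIV_def)
  qed
qed

text \<open>Class C1 is enough: the divergence of a cut-off field differentiates the bump
  once.\<close>

lemma Ck1_bump:
  fixes z :: "real^4"
  shows "Ck_on 1 UNIV (\<lambda>y. (max 0 (r\<^sup>2 - (dist y z)\<^sup>2))\<^sup>2)"
proof -
  have "Ck_on (Suc 0) UNIV (\<lambda>t::real. (max 0 t)\<^sup>2)"
  proof (rule Ck_on_Suc_I[OF open_UNIV])
    show "((\<lambda>t::real. (max 0 t)\<^sup>2) has_derivative (*) (2 * max 0 t)) (at t)" for t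
      using DERIV_max0_square[of t] by (simp add: has_field_derivative_def)
    show "Ck_on 0 UNIV (\<lambda>t::real. 2 * max 0 t * v)" for v
      by (simp, intro continuous_intros)
  qed
  then have 1: "Ck_on 1 UNIV (\<lambda>t::real. (max 0 t)\<^sup>2)" by simp
  have id: "Ck_on 1 UNIV (\<lambda>y::real^4. y - z)"
    by (intro Ck_on_diff[OF open_UNIV] Ck_on_const Ck_on_linear linear_ident)
  have "Ck_on 1 UNIV (\<lambda>y::real^4. r\<^sup>2 - (y - z) \<bullet> (y - z))"
    by (intro Ck_on_diff[OF open_UNIV] Ck_on_const Ck_on_bilinear[OF open_UNIV bounded_bilinear_inner] id)
  then have 2: "Ck_on 1 UNIV (\<lambda>y::real^4. r\<^sup>2 - (dist y z)\<^sup>2)"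
    by (simp add: dist_norm power2_norm_eq_inner)
  show ?thesis by (rule Ck_on_compose[OF open_UNIV open_UNIV 1 2]) simp
qed

definition cinv :: "'a chart \<Rightarrow> real^4 \<Rightarrow> 'a" where
  "cinv c = inv_into (fst c) (snd c)"

text \<open>Chart, centre on the manifold, radius measured in coordinates.\<close>

type_synonym 'a coord_ball = "'a chart \<times> 'a \<times> real"

definition ball_of :: "'a coord_ball \<Rightarrow> (real^4) set" where
  "ball_of = (\<lambda>(c, p, r). cball (snd c p) r)"

definition bump :: "'a coord_ball \<Rightarrow> 'a \<Rightarrow> real" where
  "bump = (\<lambda>(c, p, r) q. if q \<in> fst c then (max 0 (r\<^sup>2 - (dist (snd c q) (snd c p))\<^sup>2))\<^sup>2 else 0)"

definition supp_of :: "'a coord_ball \<Rightarrow> 'a set" where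
  "supp_of = (\<lambda>(c, p, r). {q \<in> fst c. snd c q \<in> cball (snd c p) r})"

context almost_kahler
begin

lemma cinv:
  assumes "c \<in> A"
  shows "y \<in> chart_image c \<Longrightarrow> cinv c y \<in> fst c" "y \<in> chart_image c \<Longrightarrow> snd c (cinv c y) = y"
    "p \<in> fst c \<Longrightarrow> cinv c (snd c p) = p"
  using inj_chart[OF assms] by (auto simp: cinv_def chart_image_def inv_into_into f_inv_into_f)

definition chart_cball :: "'a coord_ball \<Rightarrow> bool" where
  "chart_cball = (\<lambda>(c, p, r). c \<in> A \<and> p \<in> fst c \<and> 0 < r \<and> cball (snd c p) r \<subseteq> chart_image c)"

lemma compactin_supp:
  assumes "chart_cball i"
  shows "compactin M (supp_of i)"
proof -
  obtain c p r where i: "i = (c, p, r)" by (cases i)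
  have c: "c \<in> A" "cball (snd c p) r \<subseteq> chart_image c" using assms by (auto simp: i chart_cball_def)
  have "snd c ` supp_of i = cball (snd c p) r"
    using c(2) by (auto simp: i supp_of_def chart_image_def)
  moreover have "compactin (top_of_set (chart_image c)) (cball (snd c p) r)"
    using c(2) by (simp add: compactin_subtopology)
  moreover have sub: "supp_of i \<subseteq> topspace (subtopology M (fst c))"
    unfolding topspace_chart[OF c(1)] by (auto simp: i supp_of_def)
  ultimately have "compactin (subtopology M (fst c)) (supp_of i)"
    using homeomorphic_map_compactness[OF homeo_chart[OF c(1)] sub] by simp
  then show ?thesis by (simp add: compactin_subtopology)
qed

text \<open>Here the Hausdorff property enters. Closed support means that a bump vanishes near every
  point off its support, including points outside its chart.\<close>

lemma closedin_supp: "chart_cball i \<Longrightarrow> closedin M (supp_of i)"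
  using compactin_imp_closedin[OF _ compactin_supp] mfd by (simp add: smooth_manifold4_def)

lemma bump_nonneg: "0 \<le> bump i q"
  by (simp add: bump_def split: prod.split)

lemma bump_outside:
  assumes "chart_cball i" "q \<notin> supp_of i"
  shows "bump i q = 0"
proof -
  obtain c p r where i: "i = (c, p, r)" by (cases i)
  have "r\<^sup>2 \<le> (dist (snd c q) (snd c p))\<^sup>2" if "q \<in> fst c"
    using that assms by (intro power_mono) (auto simp: i supp_of_def chart_cball_def dist_commute)
  then show ?thesis by (simp add: i bump_def)
qed

lemma bump_pos:
  assumes "q \<in> fst c" "snd c q \<in> ball (snd c p) r"
  shows "0 < bump (c, p, r) q"
proof -
  have "(dist (snd c q) (snd c p))\<^sup>2 < r\<^sup>2"
    using assms by (intro power_strict_mono) (auto simp: dist_commute)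
  then show ?thesis using assms by (simp add: bump_def)
qed

text \<open>At a point of the bump's own chart domain it is an explicit function of the transition
  map; any other point has a neighbourhood that misses the closed support.\<close>

lemma bump_C1:
  assumes i: "chart_cball i" and c: "c \<in> A"
  shows "Ck_on 1 (chart_image c) (\<lambda>y. bump i (cinv c y))"
proof (rule Ck_on_local)
  fix y assume y: "y \<in> chart_image c"
  obtain c' p r where i': "i = (c', p, r)" by (cases i)
  have c': "c' \<in> A" using i by (simp add: i' chart_cball_def)
  show "\<exists>T. open T \<and> y \<in> T \<and> Ck_on 1 T (\<lambda>y. bump i (cinv c y))"
  proof (cases "cinv c y \<in> fst c'")
    case True
    let ?T = "snd c ` (fst c \<inter> fst c')"
    have T: "open ?T" by (rule open_overlap[OF c c'])
    have "Ck_on 1 ?T (transition c c')" using transition_smooth[OF c c'] by (simp add: smooth_on_def)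
    then have "Ck_on 1 ?T (\<lambda>y. (max 0 (r\<^sup>2 - (dist (transition c c' y) (snd c' p))\<^sup>2))\<^sup>2)"
      by (rule Ck_on_compose[OF T open_UNIV Ck1_bump]) simp
    moreover have "bump i (cinv c y) = (max 0 (r\<^sup>2 - (dist (transition c c' y) (snd c' p))\<^sup>2))\<^sup>2" if "y \<in> ?T" for y
    proof -
      from that obtain q where "y = snd c q" "q \<in> fst c" "q \<in> fst c'" by blast
      then show ?thesis by (simp add: i' bump_def cinv(3)[OF c] transition_apply[OF c])
    qed
    ultimately have "Ck_on 1 ?T (\<lambda>y. bump i (cinv c y))"
      using Ck_on_cong[OF T, of "\<lambda>y. bump i (cinv c y)" "\<lambda>y. (max 0 (r\<^sup>2 - (dist (transition c c' y) (snd c' p))\<^sup>2))\<^sup>2" 1] by simp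
    moreover have "y \<in> ?T"
      using True cinv(1,2)[OF c y] by (metis IntI image_eqI)
    ultimately show ?thesis using T by blast
  next
    case False
    let ?T = "snd c ` (fst c - supp_of i)"
    have T: "open ?T"
      by (rule open_image[OF c]) (auto intro: openin_diff openin_chart[OF c] closedin_supp[OF i])
    have "bump i (cinv c y) = 0" if "y \<in> ?T" for y
      using that cinv(3)[OF c] bump_outside[OF i] by auto
    then have "Ck_on 1 ?T (\<lambda>y. bump i (cinv c y))"
      using Ck_on_cong[OF T, of "\<lambda>y. bump i (cinv c y)" "\<lambda>_. 0" 1] Ck_on_const[of 1 ?T 0] by simp
    moreover have "cinv c y \<notin> supp_of i" using False by (auto simp: i' supp_of_def)
    then have "y \<in> ?T"
      using cinv(1,2)[OF c y] by (metis DiffI image_eqI)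
    ultimately show ?thesis using T by blast
  qed
qed

lemma finite_cover:
  assumes "compact_space M"
  obtains I where "finite I" "\<And>i. i \<in> I \<Longrightarrow> chart_cball i"
    "\<And>q. q \<in> topspace M \<Longrightarrow> \<exists>(c, p, r)\<in>I. q \<in> fst c \<and> snd c q \<in> ball (snd c p) r"
proof -
  define N where "N = (\<lambda>(c :: 'a chart, p :: 'a, r). {q \<in> fst c. snd c q \<in> ball (snd c p) r})"
  have op: "openin M (N i)" if i: "chart_cball i" for i
  proof -
    obtain c p r where i': "i = (c, p, r)" by (cases i)
    have c: "c \<in> A" using i by (simp add: i' chart_cball_def)
    have cont: "continuous_map (subtopology M (fst c)) (top_of_set (chart_image c)) (snd c)"
      by (rule homeomorphic_imp_continuous_map[OF homeo_chart[OF c]])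
    have "openin (top_of_set (chart_image c)) (chart_image c \<inter> ball (snd c p) r)"
      by (intro openin_open_Int) simp
    from openin_continuous_map_preimage[OF cont this]
    have "openin (subtopology M (fst c)) {q \<in> fst c. snd c q \<in> chart_image c \<inter> ball (snd c p) r}"
      unfolding topspace_chart[OF c] .
    moreover have "{q \<in> fst c. snd c q \<in> chart_image c \<inter> ball (snd c p) r} = N i"
      by (auto simp: N_def i' chart_image_def)
    ultimately show ?thesis using openin_trans_full openin_chart[OF c] by fastforce
  qed
  have ex: "\<exists>i. chart_cball i \<and> q \<in> N i" if "q \<in> topspace M" for q
  proof -
    from that have "q \<in> (\<Union>c\<in>A. fst c)" using mfd by (simp add: smooth_manifold4_def)
    then obtain c where c: "c \<in> A" "q \<in> fst c" by blast
    obtain r where "r > 0" "cball (snd c q) r \<subseteq> chart_image c"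
      using open_contains_cball[of "chart_image c"] open_chart[OF c(1)] chart_image_I[OF c(2)] by blast
    then have "chart_cball (c, q, r) \<and> q \<in> N (c, q, r)" using c by (simp add: chart_cball_def N_def)
    then show ?thesis by blast
  qed
  have K: "compactin M (topspace M)" using assms by (simp add: compact_space_def)
  have "\<exists>F. finite F \<and> F \<subseteq> N ` {i. chart_cball i} \<and> topspace M \<subseteq> \<Union>F"
    by (rule compactinD[OF K]) (use op ex in auto)
  then obtain F where F: "finite F" "F \<subseteq> N ` {i. chart_cball i}" "topspace M \<subseteq> \<Union>F" by blast
  then obtain I where I: "I \<subseteq> {i. chart_cball i}" "finite I" "F = N ` I"
    using finite_subset_image[OF F(1,2)] by blast
  show ?thesis
  proof (rule that[OF I(2)])
    show "chart_cball i" if "i \<in> I" for i using I that by blast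
    fix q assume "q \<in> topspace M"
    then obtain i where "i \<in> I" "q \<in> N i" using F(3) I(3) by blast
    then show "\<exists>(c, p, r)\<in>I. q \<in> fst c \<and> snd c q \<in> ball (snd c p) r"
      by (cases i) (auto simp: N_def)
  qed
qed

end

lemma linear_expand_real:
  fixes f :: "real^4 \<Rightarrow> real"
  assumes "linear f"
  shows "f v = (\<Sum>i\<in>UNIV. v $ i * f (E4 i))"
proof -
  have "f v = f (\<Sum>i\<in>UNIV. (v $ i) *\<^sub>R E4 i)"
    using basis_expansion[of v] by (simp add: scalar_mult_eq_scaleR)
  then show ?thesis
    by (simp add: linear_sum[OF assms] linear_cmul[OF assms])
qed

text \<open>\<open>V\<close> has no zero on a connected ball, so the factor between \<open>V\<close>
  and its absolute value can be taken out of an integral.\<close>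

lemma constant_sign:
  fixes V :: "real^4 \<Rightarrow> real"
  assumes "continuous_on (cball p r) V" "\<And>y. y \<in> cball p r \<Longrightarrow> V y \<noteq> 0"
  shows "\<exists>\<sigma>. \<forall>y\<in>cball p r. \<bar>V y\<bar> = \<sigma> * V y"
proof -
  have "connected (V ` cball p r)"
    by (rule connected_continuous_image[OF assms(1)]) (simp add: convex_connected)
  then have "0 \<in> V ` cball p r" if "a \<in> V ` cball p r" "b \<in> V ` cball p r" "a < 0" "0 < b" for a b
    using that connectedD_interval[of "V ` cball p r" a b 0] by simp
  moreover have "0 \<notin> V ` cball p r" using assms(2) by auto
  ultimately have *: "\<not> (V x < 0 \<and> 0 < V y)" if "x \<in> cball p r" "y \<in> cball p r" for x y
    using that by blast
  show ?thesis
  proof (cases "\<exists>x\<in>cball p r. V x < 0")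
    case True
    then obtain x where x: "x \<in> cball p r" "V x < 0" by blast
    have "\<bar>V y\<bar> = -1 * V y" if "y \<in> cball p r" for y
      using *[OF x(1) that] x(2) by auto
    then show ?thesis by blast
  next
    case False
    then have "\<bar>V y\<bar> = 1 * V y" if "y \<in> cball p r" for y using that by force
    then show ?thesis by blast
  qed
qed

context almost_kahler
begin

lemma chart_cballD:
  assumes "chart_cball i"
  shows "fst i \<in> A" "ball_of i \<subseteq> chart_image (fst i)" "compact (ball_of i)" "supp_of i \<subseteq> fst (fst i)"
    "q \<in> fst (fst i) \<Longrightarrow> q \<in> supp_of i \<longleftrightarrow> snd (fst i) q \<in> ball_of i"
  using assms by (cases i; auto simp: chart_cball_def ball_of_def supp_of_def)+

text \<open>Change of variables on the compact intersection of the two supports, outside of which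
  both integrands vanish. The absolute value of \<open>V\<close> absorbs the Jacobian.\<close>

lemma integral_change_chart:
  fixes V F F'
  assumes i: "chart_cball i" and j: "chart_cball j"
    and V_cont: "continuous_on (chart_image (fst j)) (V (fst j))"
    and V_nat: "\<And>q. q \<in> fst (fst i) \<inter> fst (fst j) \<Longrightarrow>
      \<bar>V (fst i) (snd (fst i) q)\<bar> = \<bar>det (matrix (transition_deriv (fst i) (fst j) q))\<bar> * \<bar>V (fst j) (snd (fst j) q)\<bar>"
    and F_cont: "continuous_on (chart_image (fst j)) F'"
    and F_nat: "\<And>q. q \<in> fst (fst i) \<inter> fst (fst j) \<Longrightarrow> F (snd (fst i) q) = F' (snd (fst j) q)"
    and supp: "\<And>q. q \<in> supp_of i \<Longrightarrow> F (snd (fst i) q) \<noteq> 0 \<Longrightarrow> q \<in> supp_of j"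
      "\<And>q. q \<in> supp_of j \<Longrightarrow> F' (snd (fst j) q) \<noteq> 0 \<Longrightarrow> q \<in> supp_of i"
  shows "integral (ball_of i) (\<lambda>y. F y * \<bar>V (fst i) y\<bar>) = integral (ball_of j) (\<lambda>y. F' y * \<bar>V (fst j) y\<bar>)"
proof -
  define c c' where "c = fst i" and "c' = fst j"
  note ci = chart_cballD[OF i, folded c_def] and cj = chart_cballD[OF j, folded c'_def]
  define N where "N = supp_of i \<inter> supp_of j"
  have N: "N \<subseteq> fst c \<inter> fst c'" using ci(4) cj(4) by (auto simp: N_def)
  have "compactin M N"
    unfolding N_def by (rule closed_Int_compactin[OF closedin_supp[OF i] compactin_supp[OF j]])
  then have "compactin (subtopology M (fst c)) N" using N by (simp add: compactin_subtopology)
  moreover have sub: "N \<subseteq> topspace (subtopology M (fst c))" unfolding topspace_chart[OF ci(1)] using N by blast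
  ultimately have "compactin (top_of_set (chart_image c)) (snd c ` N)"
    using homeomorphic_map_compactness[OF homeo_chart[OF ci(1)] sub] by simp
  then have S: "compact (snd c ` N)" by (simp add: compactin_subtopology)
  let ?\<phi> = "transition c c'"
  have ph: "?\<phi> (snd c q) = snd c' q" if "q \<in> N" for q
    using transition_apply[OF ci(1)] that N by blast
  have img: "?\<phi> ` (snd c ` N) = snd c' ` N" using ph by force
  have d: "(?\<phi> has_derivative frechet_derivative ?\<phi> (at x)) (at x)" if "x \<in> snd c ` N" for x
    using smooth_on_differentiable[OF transition_smooth[OF ci(1) cj(1)], of x] that N frechet_derivative_works by blast
  have inj: "inj_on ?\<phi> (snd c ` N)"
  proof (rule inj_onI)
    fix x y assume "x \<in> snd c ` N" "y \<in> snd c ` N" "?\<phi> x = ?\<phi> y"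
    then obtain q q' where q: "x = snd c q" "y = snd c q'" "q \<in> N" "q' \<in> N" by blast
    have "snd c' q = snd c' q'" using \<open>?\<phi> x = ?\<phi> y\<close> q ph by simp
    then have "q = q'" using inj_onD[OF inj_chart[OF cj(1)]] q N by blast
    then show "x = y" using q by simp
  qed
  let ?F = "\<lambda>y. F y * \<bar>V c y\<bar>" and ?F' = "\<lambda>y. F' y * \<bar>V c' y\<bar>"
  have NU: "snd c' ` N \<subseteq> chart_image c'" using N by (auto simp: chart_image_def)
  have cont: "continuous_on (?\<phi> ` (snd c ` N)) ?F'"
    unfolding img using continuous_on_subset[OF F_cont[folded c'_def] NU] continuous_on_subset[OF V_cont[folded c'_def] NU]
    by (intro continuous_intros)
  define X where "X = chart_image c"
  have "integral (ball_of i) ?F = integral (snd c ` N) ?F"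
  proof -
    have e: "y \<in> snd c ` N" if y: "y \<in> ball_of i" "?F y \<noteq> 0" for y
    proof -
      have yc: "y \<in> chart_image c" using ci(2) y(1) by blast
      then have q: "cinv c y \<in> fst c" "snd c (cinv c y) = y" using cinv[OF ci(1)] by auto
      then have "cinv c y \<in> supp_of i" using ci(5)[OF q(1)] y(1) by simp
      moreover have "cinv c y \<in> supp_of j"
        using supp(1)[OF calculation, folded c_def] q(2) y(2) by auto
      ultimately show ?thesis using q(2) unfolding N_def by (metis IntI image_eqI)
    qed
    have "snd c ` N \<subseteq> ball_of i" using ci(5) N by (auto simp: N_def)
    then show ?thesis
      using integral_restrict_Int[of "ball_of i" "snd c ` N" ?F] e
        integral_cong[of "ball_of i" "\<lambda>x. if x \<in> snd c ` N then ?F x else 0" ?F]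
      by (metis (no_types, lifting) Int_absorb2 Int_commute)
  qed
  also have "\<dots> = integral (snd c ` N) (\<lambda>x. \<bar>det (matrix (frechet_derivative ?\<phi> (at x)))\<bar> * ?F' (?\<phi> x))"
  proof (rule integral_cong)
    fix x assume "x \<in> snd c ` N"
    then obtain q where q: "x = snd c q" "q \<in> N" by blast
    then have qq: "q \<in> fst c \<inter> fst c'" using N by blast
    show "?F x = \<bar>det (matrix (frechet_derivative ?\<phi> (at x)))\<bar> * ?F' (?\<phi> x)"
      using F_nat[folded c_def c'_def, OF qq] V_nat[folded c_def c'_def, OF qq] ph[OF q(2)]
      by (simp add: q(1) transition_deriv_def)
  qed
  also have "\<dots> = integral (snd c' ` N) ?F'"
    using integral_change_of_variables_compact_real[OF S d inj cont] unfolding img by simp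
  also have "\<dots> = integral (ball_of j) ?F'"
  proof -
    have e: "y \<in> snd c' ` N" if y: "y \<in> ball_of j" "?F' y \<noteq> 0" for y
    proof -
      have yc: "y \<in> chart_image c'" using cj(2) y(1) by blast
      then have q: "cinv c' y \<in> fst c'" "snd c' (cinv c' y) = y" using cinv[OF cj(1)] by auto
      then have "cinv c' y \<in> supp_of j" using cj(5)[OF q(1)] y(1) by simp
      moreover have "cinv c' y \<in> supp_of i"
        using supp(2)[OF calculation, folded c'_def] q(2) y(2) by auto
      ultimately show ?thesis using q(2) unfolding N_def by (metis IntI image_eqI)
    qed
    have "snd c' ` N \<subseteq> ball_of j" using cj(5) N by (auto simp: N_def)
    then show ?thesis
      using integral_restrict_Int[of "ball_of j" "snd c' ` N" ?F'] e
        integral_cong[of "ball_of j" "\<lambda>x. if x \<in> snd c' ` N then ?F' x else 0" ?F']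
      by (metis (no_types, lifting) Int_absorb2 Int_commute)
  qed
  finally show ?thesis by (simp add: c_def c'_def)
qed


text \<open>\<open>X = Y / V\<close> is a vector field whose divergence with respect to the density
  \<open>\<bar>V\<bar>\<close> is \<open>h\<close>. For a partition of unity \<open>r\<close> let
  \<open>D i\<close> be the divergence of \<open>r i\<close> times \<open>X\<close>. The
  \<open>D i\<close> add up to \<open>h\<close>, and each has integral 0 in its own chart. Hence the
  integrals of \<open>r i * h\<close> over the charts add up to the double sum of the integrals of
  \<open>r i * D j\<close>; moving each term to the chart of \<open>j\<close> and summing over
  \<open>i\<close> leaves the integrals of \<open>D j\<close>, so the total is 0.\<close>

theorem divergence_nonneg_eq_0:
  fixes V h :: "'a chart \<Rightarrow> real^4 \<Rightarrow> real" and Y :: "'a chart \<Rightarrow> real^4 \<Rightarrow> real^4"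
  assumes compact: "compact_space M"
    and V_cont: "\<And>c. c \<in> A \<Longrightarrow> continuous_on (chart_image c) (V c)"
    and V_nz: "\<And>c x. c \<in> A \<Longrightarrow> x \<in> chart_image c \<Longrightarrow> V c x \<noteq> 0"
    and V_nat: "\<And>c c' p. c \<in> A \<Longrightarrow> c' \<in> A \<Longrightarrow> p \<in> fst c \<inter> fst c' \<Longrightarrow>
      \<bar>V c (snd c p)\<bar> = \<bar>det (matrix (transition_deriv c c' p))\<bar> * \<bar>V c' (snd c' p)\<bar>"
    and Y_C1: "\<And>c i. c \<in> A \<Longrightarrow> Ck_on 1 (chart_image c) (\<lambda>y. Y c y $ i)"
    and Y_nat: "\<And>c c' p. c \<in> A \<Longrightarrow> c' \<in> A \<Longrightarrow> p \<in> fst c \<inter> fst c' \<Longrightarrow>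
      (1 / V c (snd c p)) *\<^sub>R transition_deriv c c' p (Y c (snd c p)) = (1 / V c' (snd c' p)) *\<^sub>R Y c' (snd c' p)"
    and div: "\<And>c x. c \<in> A \<Longrightarrow> x \<in> chart_image c \<Longrightarrow>
      (\<Sum>k\<in>UNIV. frechet_derivative (\<lambda>y. Y c y $ k) (at x) (E4 k)) = h c x * V c x"
    and h_nonneg: "\<And>c x. c \<in> A \<Longrightarrow> x \<in> chart_image c \<Longrightarrow> 0 \<le> h c x"
    and h_nat: "\<And>c c' p. c \<in> A \<Longrightarrow> c' \<in> A \<Longrightarrow> p \<in> fst c \<inter> fst c' \<Longrightarrow> h c (snd c p) = h c' (snd c' p)"
    and c0: "c0 \<in> A" "x0 \<in> chart_image c0"
  shows "h c0 x0 = 0"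
proof -
  obtain I where fI: "finite I" and cb: "\<And>i. i \<in> I \<Longrightarrow> chart_cball i"
    and cov: "\<And>q. q \<in> topspace M \<Longrightarrow> \<exists>(c, p, r)\<in>I. q \<in> fst c \<and> snd c q \<in> ball (snd c p) r"
    using finite_cover[OF compact] by blast
  have chart_topspace: "q \<in> topspace M" if "c \<in> A" "q \<in> fst c" for c q
    using openin_subset[OF openin_chart[OF that(1)]] that(2) by blast
  define S where "S = (\<lambda>q. \<Sum>i\<in>I. bump i q)"
  have S_pos: "0 < S q" if "q \<in> topspace M" for q
  proof -
    from cov[OF that] obtain c p r where i: "(c, p, r) \<in> I" "q \<in> fst c" "snd c q \<in> ball (snd c p) r"
      by blast
    have "0 < bump (c, p, r) q" by (rule bump_pos[OF i(2,3)])
    then show ?thesis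
      unfolding S_def using sum_pos2[OF fI i(1), of "\<lambda>i. bump i q"] by (simp add: bump_nonneg)
  qed
  define r where "r = (\<lambda>i c y. bump i (cinv c y) / S (cinv c y))"
  have S_pos': "0 < S (cinv c y)" if "c \<in> A" "y \<in> chart_image c" for c y
    by (rule S_pos[OF chart_topspace[OF that(1) cinv(1)[OF that]]])
  have r_C1: "Ck_on 1 (chart_image c) (r i c)" if c: "c \<in> A" and i: "i \<in> I" for c i
  proof -
    have "Ck_on 1 (chart_image c) (\<lambda>y. S (cinv c y))"
      unfolding S_def by (intro Ck_on_sum[OF open_chart[OF c]] bump_C1 cb c)
    then have "Ck_on 1 (chart_image c) (\<lambda>y. inverse (S (cinv c y)))"
      using S_pos'[OF c] by (intro Ck_on_inverse[OF open_chart[OF c]]) (auto simp: less_le)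
    then show ?thesis
      unfolding r_def divide_inverse
      by (intro Ck_on_bilinear[OF open_chart[OF c] bounded_bilinear_mult] bump_C1 cb i c)
  qed
  have r_diff: "r i c differentiable (at y)" if "c \<in> A" "i \<in> I" "y \<in> chart_image c" for i c y
    using r_C1[OF that(1,2)] that(3) by simp
  have r_nat: "r i c (snd c q) = r i c' (snd c' q)" if "c \<in> A" "c' \<in> A" "q \<in> fst c \<inter> fst c'" for i c c' q
    using that by (simp add: r_def cinv(3))
  have r_nonneg: "0 \<le> r i c y" if "c \<in> A" "y \<in> chart_image c" for i c y
    using S_pos'[OF that] bump_nonneg[of i "cinv c y"] by (simp add: r_def)
  have r_sum: "(\<Sum>i\<in>I. r i c y) = 1" if "c \<in> A" "y \<in> chart_image c" for c y
    using S_pos'[OF that] unfolding r_def by (simp add: S_def flip: sum_divide_distrib)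
  have r_supp: "r i c y = 0" if "i \<in> I" "cinv c y \<notin> supp_of i" for i c y
    using bump_outside[OF cb[OF that(1)] that(2)] by (simp add: r_def)
  define X where "X = (\<lambda>c y. (1 / V c y) *\<^sub>R Y c y)"
  \<comment> \<open>The product rule for the divergence of \<open>r i\<close> times
    \<open>X\<close>; both summands are functions on the manifold, as \<open>D_nat\<close>
    confirms.\<close>
  define D where "D = (\<lambda>i c y. frechet_derivative (r i c) (at y) (X c y) + r i c y * h c y)"
  have D_div: "D i c y * V c y = (\<Sum>k\<in>UNIV. frechet_derivative (\<lambda>z. r i c z * Y c z $ k) (at y) (E4 k))"
    if c: "c \<in> A" "y \<in> chart_image c" and i: "i \<in> I" for i c y
  proof -
    have l: "linear (frechet_derivative (r i c) (at y))"
      by (rule linear_frechet_derivative_at[OF r_diff[OF c(1) i c(2)]])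
    have Yd: "(\<lambda>z. Y c z $ k) differentiable (at y)" for k
      using Y_C1[OF c(1)] c(2) by simp
    have "(\<Sum>k\<in>UNIV. frechet_derivative (\<lambda>z. r i c z * Y c z $ k) (at y) (E4 k)) =
        (\<Sum>k\<in>UNIV. r i c y * frechet_derivative (\<lambda>z. Y c z $ k) (at y) (E4 k) + frechet_derivative (r i c) (at y) (E4 k) * Y c y $ k)"
      by (simp add: frechet_derivative_mult_at[OF r_diff[OF c(1) i c(2)] Yd])
    also have "\<dots> = r i c y * (h c y * V c y) + frechet_derivative (r i c) (at y) (Y c y)"
      unfolding sum.distrib div[OF c, symmetric] sum_distrib_left[symmetric]
      using linear_expand_real[OF l, of "Y c y"] by (simp add: mult.commute)
    also have "frechet_derivative (r i c) (at y) (Y c y) = frechet_derivative (r i c) (at y) (X c y) * V c y"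
      using V_nz[OF c] by (simp add: X_def linear_cmul[OF l])
    finally show ?thesis by (simp add: D_def algebra_simps)
  qed
  have D_nat: "D i c (snd c q) = D i c' (snd c' q)" if c: "c \<in> A" "c' \<in> A" "q \<in> fst c \<inter> fst c'" and i: "i \<in> I" for i c c' q
  proof -
    let ?T = "snd c ` (fst c \<inter> fst c')" and ?\<phi> = "transition c c'"
    note ph = pullback_hyps[OF c]
    have x': "snd c' q \<in> chart_image c'" using c(3) by (auto intro: chart_image_I)
    have tq: "?\<phi> (snd c q) = snd c' q" using transition_apply[OF c(1)] c(3) by blast
    have d: "(?\<phi> has_derivative transition_deriv c c' q) (at (snd c q))"
      unfolding transition_deriv_def
      using smooth_on_differentiable[OF transition_smooth[OF c(1,2)] ph(2)] frechet_derivative_works by blast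
    have d': "(r i c' has_derivative frechet_derivative (r i c') (at (snd c' q))) (at (?\<phi> (snd c q)))"
      unfolding tq using r_diff[OF c(2) i x'] frechet_derivative_works by blast
    have "frechet_derivative (r i c) (at (snd c q)) = frechet_derivative (\<lambda>y. r i c' (?\<phi> y)) (at (snd c q))"
    proof (rule frechet_derivative_cong_open[OF ph(1,2)])
      fix y assume "y \<in> ?T"
      then obtain q' where "y = snd c q'" "q' \<in> fst c \<inter> fst c'" by blast
      then show "r i c y = r i c' (?\<phi> y)"
        using r_nat[OF c(1,2), of q' i] transition_apply[OF c(1), of q' c'] by simp
    qed
    also have "\<dots> = (\<lambda>v. frechet_derivative (r i c') (at (snd c' q)) (transition_deriv c c' q v))"
      by (rule frechet_derivative_at[symmetric], rule has_derivative_compose[OF d d'])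
    finally have "frechet_derivative (r i c) (at (snd c q)) (X c (snd c q)) =
        frechet_derivative (r i c') (at (snd c' q)) (transition_deriv c c' q (X c (snd c q)))"
      by (rule fun_cong)
    also have "transition_deriv c c' q (X c (snd c q)) = X c' (snd c' q)"
      using Y_nat[OF c] by (simp add: X_def linear_cmul[OF linear_transition_deriv[OF c]])
    finally show ?thesis using r_nat[OF c, of i] h_nat[OF c] by (simp add: D_def)
  qed
  \<comment> \<open>Off the closed support \<open>r i\<close> vanishes on an open set, so its
    derivative vanishes as well.\<close>
  have D_supp: "D i c y = 0" if c: "c \<in> A" "y \<in> chart_image c" and i: "i \<in> I" "cinv c y \<notin> supp_of i" for i c y
  proof -
    let ?T = "snd c ` (fst c - supp_of i)"
    have T: "open ?T"
      by (rule open_image[OF c(1)]) (auto intro: openin_diff openin_chart[OF c(1)] closedin_supp[OF cb[OF i(1)]])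
    have "y = snd c (cinv c y)" "cinv c y \<in> fst c - supp_of i" using cinv(1,2)[OF c] i(2) by simp_all
    then have "y \<in> ?T" by (rule image_eqI)
    moreover have "r i c z = 0" if "z \<in> ?T" for z
      using that cinv(3)[OF c(1)] r_supp[OF i(1), of c z] by auto
    ultimately have "frechet_derivative (r i c) (at y) (X c y) = 0"
      by (rule zero_family_derivative[OF T])
    then show ?thesis using r_supp[OF i] by (simp add: D_def)
  qed
  have D_cont: "continuous_on (chart_image c) (D i c)" if c: "c \<in> A" and i: "i \<in> I" for i c
  proof -
    have C: "Ck_on 1 (chart_image c) (\<lambda>z. r i c z * Y c z $ k)" for k
      by (rule Ck_on_bilinear[OF open_chart[OF c] bounded_bilinear_mult r_C1[OF c i] Y_C1[OF c]])
    have "continuous_on (chart_image c) (\<lambda>y. (\<Sum>k\<in>UNIV. frechet_derivative (\<lambda>z. r i c z * Y c z $ k) (at y) (E4 k)) / V c y)"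
      using C V_nz[OF c] by (intro continuous_on_divide continuous_on_sum V_cont c) auto
    moreover have "D i c y = (\<Sum>k\<in>UNIV. frechet_derivative (\<lambda>z. r i c z * Y c z $ k) (at y) (E4 k)) / V c y"
      if "y \<in> chart_image c" for y
      using D_div[OF c that i] V_nz[OF c that] by (simp add: field_simps)
    ultimately show ?thesis by (simp cong: continuous_on_cong)
  qed
  have D_sum: "(\<Sum>i\<in>I. D i c y) = h c y" if c: "c \<in> A" "y \<in> chart_image c" for c y
  proof -
    have "((\<lambda>z. \<Sum>i\<in>I. r i c z) has_derivative (\<lambda>v. \<Sum>i\<in>I. frechet_derivative (r i c) (at y) v)) (at y)"
      using r_diff[OF c(1) _ c(2)] frechet_derivative_works by (intro has_derivative_sum) blast
    then have "(\<lambda>v. \<Sum>i\<in>I. frechet_derivative (r i c) (at y) v) = frechet_derivative (\<lambda>z. \<Sum>i\<in>I. r i c z) (at y)"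
      by (rule frechet_derivative_at)
    also have "\<dots> = frechet_derivative (\<lambda>z. 1) (at y)"
      by (rule frechet_derivative_cong_open[OF open_chart[OF c(1)] c(2)]) (rule r_sum[OF c(1)])
    finally have "(\<Sum>i\<in>I. frechet_derivative (r i c) (at y) (X c y)) = 0"
      by (simp add: fun_eq_iff frechet_derivative_const)
    then show ?thesis
      using r_sum[OF c] by (simp add: D_def sum.distrib flip: sum_distrib_right)
  qed
  note cbD = chart_cballD[OF cb]
  have ball_cont: "continuous_on (ball_of i) f" if "i \<in> I" "continuous_on (chart_image (fst i)) f" for i and f :: "real^4 \<Rightarrow> real"
    by (rule continuous_on_subset[OF that(2) cbD(2)[OF that(1)]])
  have r_cont: "continuous_on (chart_image c) (r i c)" if "c \<in> A" "i \<in> I" for i c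
    using Ck_on_continuous_on[OF r_C1[OF that]] .
  have int: "(\<lambda>y. f y * \<bar>V (fst i) y\<bar>) integrable_on ball_of i"
    if "i \<in> I" "continuous_on (chart_image (fst i)) f" for i and f :: "real^4 \<Rightarrow> real"
  proof -
    have "continuous_on (ball_of i) (\<lambda>y. f y * \<bar>V (fst i) y\<bar>)"
      by (intro continuous_intros ball_cont that V_cont cbD(1))
    then show ?thesis
      using absolutely_integrable_on_compact[OF cbD(3)[OF that(1)]] set_lebesgue_integral_eq_integral(1) by blast
  qed
  \<comment> \<open>On the ball \<open>\<bar>V\<bar>\<close> is a constant multiple of
    \<open>V\<close>, and \<open>D j * V\<close> is a sum of partial derivatives of functions
    supported in the ball.\<close>
  have zero: "integral (ball_of j) (\<lambda>y. D j (fst j) y * \<bar>V (fst j) y\<bar>) = 0" if j: "j \<in> I" for j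
  proof -
    obtain c p \<rho> where j': "j = (c, p, \<rho>)" by (cases j)
    have c: "c \<in> A" "cball (snd c p) \<rho> \<subseteq> chart_image c" using cb[OF j] by (auto simp: j' chart_cball_def)
    obtain \<sigma> where \<sigma>: "\<And>y. y \<in> cball (snd c p) \<rho> \<Longrightarrow> \<bar>V c y\<bar> = \<sigma> * V c y"
      using constant_sign[OF continuous_on_subset[OF V_cont[OF c(1)] c(2)]] V_nz[OF c(1)] c(2) by blast
    have C: "Ck_on 1 (chart_image c) (\<lambda>z. r j c z * Y c z $ k)" for k
      by (rule Ck_on_bilinear[OF open_chart[OF c(1)] bounded_bilinear_mult r_C1[OF c(1) j] Y_C1[OF c(1)]])
    have z: "integral (cball (snd c p) \<rho>) (\<lambda>y. frechet_derivative (\<lambda>z. r j c z * Y c z $ k) (at y) (E4 k)) = 0" for k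
    proof (rule integral_derivative_chart_eq_0[OF open_chart[OF c(1)] c(2) C])
      fix y assume y: "y \<in> chart_image c" "y \<notin> cball (snd c p) \<rho>"
      then have "cinv c y \<notin> supp_of j" using cinv(2)[OF c(1) y(1)] by (simp add: j' supp_of_def)
      then show "r j c y * Y c y $ k = 0" using r_supp[OF j] by simp
    qed
    have i: "(\<lambda>y. frechet_derivative (\<lambda>z. r j c z * Y c z $ k) (at y) (E4 k)) integrable_on cball (snd c p) \<rho>" for k
      using absolutely_integrable_on_compact[OF compact_cball continuous_on_subset[OF _ c(2)],
          of "\<lambda>y. frechet_derivative (\<lambda>z. r j c z * Y c z $ k) (at y) (E4 k)"] C[of k] set_lebesgue_integral_eq_integral(1)
      by simp
    have "integral (cball (snd c p) \<rho>) (\<lambda>y. D j c y * \<bar>V c y\<bar>) =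
        integral (cball (snd c p) \<rho>) (\<lambda>y. \<sigma> * (\<Sum>k\<in>UNIV. frechet_derivative (\<lambda>z. r j c z * Y c z $ k) (at y) (E4 k)))"
    proof (rule integral_cong)
      fix y assume y: "y \<in> cball (snd c p) \<rho>"
      then have yc: "y \<in> chart_image c" using c(2) by blast
      have "D j c y * \<bar>V c y\<bar> = \<sigma> * (D j c y * V c y)" unfolding \<sigma>[OF y] by simp
      then show "D j c y * \<bar>V c y\<bar> = \<sigma> * (\<Sum>k\<in>UNIV. frechet_derivative (\<lambda>z. r j c z * Y c z $ k) (at y) (E4 k))"
        unfolding D_div[OF c(1) yc j] .
    qed
    also have "\<dots> = \<sigma> * (\<Sum>k\<in>UNIV. integral (cball (snd c p) \<rho>) (\<lambda>y. frechet_derivative (\<lambda>z. r j c z * Y c z $ k) (at y) (E4 k)))"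
      by (simp add: integral_sum i)
    finally show ?thesis by (simp add: z[unfolded j'] j' ball_of_def)
  qed
  \<comment> \<open>\<open>r i * D j\<close> is supported in both balls, so either chart may be used
    to integrate it.\<close>
  have swap: "integral (ball_of i) (\<lambda>y. r i (fst i) y * D j (fst i) y * \<bar>V (fst i) y\<bar>) =
      integral (ball_of j) (\<lambda>y. r i (fst j) y * D j (fst j) y * \<bar>V (fst j) y\<bar>)" if i: "i \<in> I" and j: "j \<in> I" for i j
  proof (rule integral_change_chart[OF cb[OF i] cb[OF j], where F = "\<lambda>y. r i (fst i) y * D j (fst i) y"
        and F' = "\<lambda>y. r i (fst j) y * D j (fst j) y"])
    show "continuous_on (chart_image (fst j)) (\<lambda>y. r i (fst j) y * D j (fst j) y)"
      by (intro continuous_intros r_cont D_cont cbD(1) i j)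
    show "r i (fst i) (snd (fst i) q) * D j (fst i) (snd (fst i) q) = r i (fst j) (snd (fst j) q) * D j (fst j) (snd (fst j) q)"
      if "q \<in> fst (fst i) \<inter> fst (fst j)" for q
      using r_nat[OF cbD(1)[OF i] cbD(1)[OF j] that, of i] D_nat[OF cbD(1)[OF i] cbD(1)[OF j] that j] by simp
    show "q \<in> supp_of j" if "q \<in> supp_of i" "r i (fst i) (snd (fst i) q) * D j (fst i) (snd (fst i) q) \<noteq> 0" for q
    proof -
      have q: "q \<in> fst (fst i)" using cbD(4)[OF i] that(1) by blast
      then show ?thesis
        using D_supp[OF cbD(1)[OF i] chart_image_I[OF q] j] that(2) cinv(3)[OF cbD(1)[OF i] q] by auto
    qed
    show "q \<in> supp_of i" if "q \<in> supp_of j" "r i (fst j) (snd (fst j) q) * D j (fst j) (snd (fst j) q) \<noteq> 0" for q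
    proof -
      have q: "q \<in> fst (fst j)" using cbD(4)[OF j] that(1) by blast
      then show ?thesis
        using r_supp[OF i, of "fst j" "snd (fst j) q"] that(2) cinv(3)[OF cbD(1)[OF j] q] by auto
    qed
  qed (intro V_cont V_nat cbD(1) i j; assumption)+
  have fint: "(\<lambda>y. r i (fst k) y * D j (fst k) y * \<bar>V (fst k) y\<bar>) integrable_on ball_of k"
    if "i \<in> I" "j \<in> I" "k \<in> I" for i j k
    by (rule int[OF that(3)]) (intro continuous_intros r_cont D_cont cbD(1) that)
  have hi: "integral (ball_of i) (\<lambda>y. r i (fst i) y * h (fst i) y * \<bar>V (fst i) y\<bar>) =
      (\<Sum>j\<in>I. integral (ball_of i) (\<lambda>y. r i (fst i) y * D j (fst i) y * \<bar>V (fst i) y\<bar>))" if i: "i \<in> I" for i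
  proof -
    have "integral (ball_of i) (\<lambda>y. r i (fst i) y * h (fst i) y * \<bar>V (fst i) y\<bar>) =
      integral (ball_of i) (\<lambda>y. \<Sum>j\<in>I. r i (fst i) y * D j (fst i) y * \<bar>V (fst i) y\<bar>)"
    proof (rule integral_cong)
      fix y assume "y \<in> ball_of i"
      then have "y \<in> chart_image (fst i)" using cbD(2)[OF i] by blast
      from D_sum[OF cbD(1)[OF i] this]
      show "r i (fst i) y * h (fst i) y * \<bar>V (fst i) y\<bar> = (\<Sum>j\<in>I. r i (fst i) y * D j (fst i) y * \<bar>V (fst i) y\<bar>)"
        by (simp flip: sum_distrib_left sum_distrib_right)
    qed
    also have "\<dots> = (\<Sum>j\<in>I. integral (ball_of i) (\<lambda>y. r i (fst i) y * D j (fst i) y * \<bar>V (fst i) y\<bar>))"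
      by (rule integral_sum[OF fI]) (rule fint[OF i _ i])
    finally show ?thesis .
  qed
  have "(\<Sum>i\<in>I. integral (ball_of i) (\<lambda>y. r i (fst i) y * h (fst i) y * \<bar>V (fst i) y\<bar>)) =
      (\<Sum>i\<in>I. \<Sum>j\<in>I. integral (ball_of j) (\<lambda>y. r i (fst j) y * D j (fst j) y * \<bar>V (fst j) y\<bar>))"
  proof (rule sum.cong[OF refl])
    fix i assume i: "i \<in> I"
    show "integral (ball_of i) (\<lambda>y. r i (fst i) y * h (fst i) y * \<bar>V (fst i) y\<bar>) =
        (\<Sum>j\<in>I. integral (ball_of j) (\<lambda>y. r i (fst j) y * D j (fst j) y * \<bar>V (fst j) y\<bar>))"
      unfolding hi[OF i] by (rule sum.cong[OF refl], rule swap[OF i])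
  qed
  also have "\<dots> = (\<Sum>j\<in>I. \<Sum>i\<in>I. integral (ball_of j) (\<lambda>y. r i (fst j) y * D j (fst j) y * \<bar>V (fst j) y\<bar>))"
    by (rule sum.swap)
  also have "\<dots> = (\<Sum>j\<in>I. integral (ball_of j) (\<lambda>y. D j (fst j) y * \<bar>V (fst j) y\<bar>))"
  proof (rule sum.cong[OF refl])
    fix j assume j: "j \<in> I"
    have "(\<Sum>i\<in>I. integral (ball_of j) (\<lambda>y. r i (fst j) y * D j (fst j) y * \<bar>V (fst j) y\<bar>)) =
      integral (ball_of j) (\<lambda>y. \<Sum>i\<in>I. r i (fst j) y * D j (fst j) y * \<bar>V (fst j) y\<bar>)"
      by (rule integral_sum[OF fI, symmetric]) (rule fint[OF _ j j])
    also have "\<dots> = integral (ball_of j) (\<lambda>y. D j (fst j) y * \<bar>V (fst j) y\<bar>)"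
    proof (rule integral_cong)
      fix y assume "y \<in> ball_of j"
      then have "y \<in> chart_image (fst j)" using cbD(2)[OF j] by blast
      from r_sum[OF cbD(1)[OF j] this]
      show "(\<Sum>i\<in>I. r i (fst j) y * D j (fst j) y * \<bar>V (fst j) y\<bar>) = D j (fst j) y * \<bar>V (fst j) y\<bar>"
        by (simp flip: sum_distrib_right)
    qed
    finally show "(\<Sum>i\<in>I. integral (ball_of j) (\<lambda>y. r i (fst j) y * D j (fst j) y * \<bar>V (fst j) y\<bar>)) =
      integral (ball_of j) (\<lambda>y. D j (fst j) y * \<bar>V (fst j) y\<bar>)" .
  qed
  also have "\<dots> = 0" using zero by simp
  finally have total: "(\<Sum>i\<in>I. integral (ball_of i) (\<lambda>y. r i (fst i) y * h (fst i) y * \<bar>V (fst i) y\<bar>)) = 0" .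
  have nn: "0 \<le> r i (fst i) y * h (fst i) y * \<bar>V (fst i) y\<bar>" if "i \<in> I" "y \<in> ball_of i" for i y
    using r_nonneg[OF cbD(1)[OF that(1)]] h_nonneg[OF cbD(1)[OF that(1)]] cbD(2)[OF that(1)] that(2) by (simp add: subset_iff)
  have h_cont: "continuous_on (chart_image c) (h c)" if c: "c \<in> A" for c
  proof -
    have "continuous_on (chart_image c) (\<lambda>y. \<Sum>i\<in>I. D i c y)"
      by (intro continuous_on_sum D_cont c)
    then show ?thesis using D_sum[OF c] by (simp cong: continuous_on_cong)
  qed
  have "integral (ball_of i) (\<lambda>y. r i (fst i) y * h (fst i) y * \<bar>V (fst i) y\<bar>) = 0" if i: "i \<in> I" for i
  proof -
    have "0 \<le> integral (ball_of i) (\<lambda>y. r i (fst i) y * h (fst i) y * \<bar>V (fst i) y\<bar>)" if i: "i \<in> I" for i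
      using nn[OF i] by (intro integral_nonneg int[OF i] continuous_intros r_cont h_cont cbD(1) i)
    then show ?thesis using total i fI by (simp add: sum_nonneg_eq_0_iff)
  qed
  note each = this
  define q where "q = cinv c0 x0"
  have q: "q \<in> fst c0" "snd c0 q = x0" using cinv(1,2)[OF c0] by (simp_all add: q_def)
  \<comment> \<open>In a ball with \<open>q\<close> in its interior the weight is positive at
    \<open>q\<close>, so vanishing of the integrand there forces \<open>h\<close> to vanish.\<close>
  obtain c p \<rho> where i: "(c, p, \<rho>) \<in> I" and qc: "q \<in> fst c" "snd c q \<in> ball (snd c p) \<rho>"
    using cov[OF chart_topspace[OF c0(1) q(1)]] by blast
  have c: "c \<in> A" "cball (snd c p) \<rho> \<subseteq> chart_image c" using cb[OF i] by (auto simp: chart_cball_def)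
  have "r (c, p, \<rho>) c (snd c q) * h c (snd c q) * \<bar>V c (snd c q)\<bar> = 0"
  proof (rule integral_nonneg_eq_0[OF _ _ _ qc(2)])
    show "continuous_on (cball (snd c p) \<rho>) (\<lambda>y. r (c, p, \<rho>) c y * h c y * \<bar>V c y\<bar>)"
      by (rule continuous_on_subset[OF _ c(2)]) (intro continuous_intros r_cont h_cont V_cont c(1) i)
    show "0 \<le> r (c, p, \<rho>) c x * h c x * \<bar>V c x\<bar>" if "x \<in> cball (snd c p) \<rho>" for x
      using nn[OF i, of x] that by (simp add: ball_of_def)
    show "integral (cball (snd c p) \<rho>) (\<lambda>y. r (c, p, \<rho>) c y * h c y * \<bar>V c y\<bar>) = 0"
      using each[OF i] by (simp add: ball_of_def)
  qed
  moreover have "r (c, p, \<rho>) c (snd c q) \<noteq> 0"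
    using bump_pos[OF qc] S_pos[OF chart_topspace[OF c(1) qc(1)]] by (simp add: r_def cinv(3)[OF c(1) qc(1)])
  moreover have "V c (snd c q) \<noteq> 0" by (rule V_nz[OF c(1) chart_image_I[OF qc(1)]])
  ultimately have "h c (snd c q) = 0" by simp
  then show ?thesis using h_nat[OF c(1) c0(1), of q] qc(1) q by simp
qed

end

lemma wedge13_wedge12: "wedge13 p (wedge12 q a) u v w z = wedge22 (wedge11 p q) a u v w z"
  by (simp add: wedge13_def wedge12_def wedge22_def wedge11_def algebra_simps)

lemma module_scale_form: "module (scale_form :: complex \<Rightarrow> 'a cform \<Rightarrow> 'a cform)"
  by unfold_locales (auto simp: scale_form_def fun_eq_iff algebra_simps)

lemma scale_form_simps [simp]: "scale_form 1 \<alpha> = \<alpha>" "scale_form 0 \<alpha> = 0" "scale_form a 0 = 0" "scale_form (- 1) \<alpha> = - \<alpha>"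
  by (auto simp: scale_form_def fun_eq_iff)

lemma scale_form_apply: "scale_form a \<alpha> c x vs = a * \<alpha> c x vs"
  by (simp add: scale_form_def)

section \<open>Stokes' theorem for 3-forms and linearity of the operators\<close>

context almost_kahler
begin

text \<open>A 3-form corresponds to a field density \<open>Y\<close>, and d\<eta> to its divergence.
  The sign \<open>s\<close> makes the resulting function nonnegative. Passing to real parts loses
  nothing, because \<kappa> is a real multiple of \<open>Vol\<close>, which is real.\<close>

theorem stokes_nonneg:
  fixes \<eta> :: "'a chart \<Rightarrow> real^4 \<Rightarrow> real^4 \<Rightarrow> real^4 \<Rightarrow> real^4 \<Rightarrow> complex" and s :: real
  assumes compact: "compact_space M" and s: "s = 1 \<or> s = - 1"
    and \<eta>_alt: "\<And>c x. c \<in> A \<Longrightarrow> x \<in> chart_image c \<Longrightarrow> alt3 (\<eta> c x)"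
    and \<eta>_C1: "\<And>c u v w. c \<in> A \<Longrightarrow> Ck_on 1 (chart_image c) (\<lambda>x. \<eta> c x u v w)"
    and \<eta>_nat: "\<And>c c' p u v w. c \<in> A \<Longrightarrow> c' \<in> A \<Longrightarrow> p \<in> fst c \<inter> fst c' \<Longrightarrow> \<eta> c (snd c p) u v w =
      \<eta> c' (snd c' p) (transition_deriv c c' p u) (transition_deriv c c' p v) (transition_deriv c c' p w)"
    and \<kappa>_alt: "\<And>c x. c \<in> A \<Longrightarrow> x \<in> chart_image c \<Longrightarrow> alt4 (\<kappa> c x)"
    and \<kappa>_nat: "\<And>c c' p u v w z. c \<in> A \<Longrightarrow> c' \<in> A \<Longrightarrow> p \<in> fst c \<inter> fst c' \<Longrightarrow> \<kappa> c (snd c p) u v w z =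
      \<kappa> c' (snd c' p) (transition_deriv c c' p u) (transition_deriv c c' p v) (transition_deriv c c' p w) (transition_deriv c c' p z)"
    and d: "\<And>c x. c \<in> A \<Longrightarrow> x \<in> chart_image c \<Longrightarrow>
      d3 (\<eta> c) x (E4 1) (E4 2) (E4 3) (E4 4) = \<kappa> c x (E4 1) (E4 2) (E4 3) (E4 4)"
    and pos: "\<And>c x. c \<in> A \<Longrightarrow> x \<in> chart_image c \<Longrightarrow>
      \<exists>r\<ge>0. \<kappa> c x (E4 1) (E4 2) (E4 3) (E4 4) = of_real (s * r) * Vol c x"
    and c0: "c0 \<in> A" "x0 \<in> chart_image c0"
  shows "\<kappa> c0 x0 (E4 1) (E4 2) (E4 3) (E4 4) = 0"
proof -
  define V where "V = (\<lambda>c x. Re (Vol c x))"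
  have V: "Vol c x = of_real (V c x)" if "c \<in> A" "x \<in> chart_image c" for c x
    using Vol_eq[OF that] by (simp add: V_def)
  define K where "K = (\<lambda>c x. \<kappa> c x (E4 1) (E4 2) (E4 3) (E4 4))"
  define h where "h = (\<lambda>c x. s * Re (K c x) / V c x)"
  define Y :: "'a chart \<Rightarrow> real^4 \<Rightarrow> real^4" where
    "Y = (\<lambda>c x. vector [s * Re (\<eta> c x (E4 2) (E4 3) (E4 4)), - s * Re (\<eta> c x (E4 1) (E4 3) (E4 4)),
      s * Re (\<eta> c x (E4 1) (E4 2) (E4 4)), - s * Re (\<eta> c x (E4 1) (E4 2) (E4 3))])"
  have V_nz: "V c x \<noteq> 0" if "c \<in> A" "x \<in> chart_image c" for c x
    using Vol_nonzero[OF that] V[OF that] by auto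
  have V_nat: "V c (snd c p) = det (matrix (transition_deriv c c' p)) * V c' (snd c' p)"
    if c: "c \<in> A" "c' \<in> A" "p \<in> fst c \<inter> fst c'" for c c' p
    using Vol_natural[OF c] by (simp add: V_def)
  have K_nat: "K c (snd c p) = of_real (det (matrix (transition_deriv c c' p))) * K c' (snd c' p)"
    if c: "c \<in> A" "c' \<in> A" "p \<in> fst c \<inter> fst c'" for c c' p
    unfolding K_def
  proof (rule natural_E4[OF c])
    show "alt4 (\<kappa> c' (snd c' p))" using c by (intro \<kappa>_alt chart_image_I) auto
  qed (rule \<kappa>_nat[OF c])
  have det_nz: "det (matrix (transition_deriv c c' p)) \<noteq> 0" if c: "c \<in> A" "c' \<in> A" "p \<in> fst c \<inter> fst c'" for c c' p
    using V_nat[OF c] V_nz[OF c(1) chart_image_I[of p c]] c(3) by auto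
  have h_nonneg: "0 \<le> h c x" if c: "c \<in> A" "x \<in> chart_image c" for c x
  proof -
    obtain r where r: "r \<ge> 0" "K c x = of_real (s * r) * Vol c x" using pos[OF c] unfolding K_def by blast
    then have "Re (K c x) = s * r * V c x" unfolding V[OF c] by simp
    then have "h c x = (s * s) * r" using V_nz[OF c] by (simp add: h_def)
    then show ?thesis using s r(1) by auto
  qed
  have lin: "bounded_linear (\<lambda>z. a * Re z)" for a
    by (rule bounded_linear_compose[OF bounded_linear_mult_right bounded_linear_Re])
  have Y_C1: "Ck_on 1 (chart_image c) (\<lambda>y. Y c y $ k)" if c: "c \<in> A" for c k
  proof -
    have C: "Ck_on 1 (chart_image c) (\<lambda>y. a * Re (\<eta> c y u v w))" for a u v w
      by (rule Ck_on_bounded_linear[OF open_chart[OF c] lin \<eta>_C1[OF c]])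
    have "\<forall>k. Ck_on 1 (chart_image c) (\<lambda>y. Y c y $ k)"
      unfolding forall_4 using C C[of "- s"] by (simp add: Y_def del: Ck_on.simps One_nat_def)
    then show ?thesis by blast
  qed
  have "h c0 x0 = 0"
  proof (rule divergence_nonneg_eq_0[OF compact, where V = V and Y = Y and h = h, OF _ V_nz _ Y_C1 _ _ h_nonneg _ c0])
    show "continuous_on (chart_image c) (V c)" if "c \<in> A" for c
    proof -
      have "Ck_on 0 (chart_image c) (Vol c)" using smooth_Vol[OF that] unfolding smooth_on_def by blast
      then show ?thesis unfolding V_def by (intro continuous_intros) simp
    qed
    show "\<bar>V c (snd c p)\<bar> = \<bar>det (matrix (transition_deriv c c' p))\<bar> * \<bar>V c' (snd c' p)\<bar>"
      if c: "c \<in> A" "c' \<in> A" "p \<in> fst c \<inter> fst c'" for c c' p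
      by (simp add: V_nat[OF c] abs_mult)
    show "h c (snd c p) = h c' (snd c' p)" if c: "c \<in> A" "c' \<in> A" "p \<in> fst c \<inter> fst c'" for c c' p
      using det_nz[OF c] by (simp add: h_def V_nat[OF c] K_nat[OF c])
    show "(1 / V c (snd c p)) *\<^sub>R transition_deriv c c' p (Y c (snd c p)) = (1 / V c' (snd c' p)) *\<^sub>R Y c' (snd c' p)"
      if c: "c \<in> A" "c' \<in> A" "p \<in> fst c \<inter> fst c'" for c c' p
    proof -
      let ?T = "transition_deriv c c' p" and ?x = "snd c p" and ?x' = "snd c' p"
      have x': "?x' \<in> chart_image c'" using c by (auto intro: chart_image_I)
      have lT: "linear ?T" by (rule linear_transition_deriv[OF c])
      \<comment> \<open>\<open>Y\<close> is determined by its pairings with linear functionals, and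
        each pairing is the coefficient of a 4-form; the transformation law of \<open>Y\<close>
        follows from that of 4-forms.\<close>
      have wY: "s * Re (wedge13 (\<lambda>v. of_real (l v)) (\<eta> c x) (E4 1) (E4 2) (E4 3) (E4 4)) = l (Y c x)"
        if "linear l" for l :: "real^4 \<Rightarrow> real" and c x
        unfolding linear_expand_real[OF that, of "Y c x"]
        by (simp add: wedge13_def Y_def sum_4 algebra_simps)
      have comp: "linear (\<lambda>v::real^4. v $ i)" for i
        by (rule linearI) auto
      have "?T (Y c ?x) $ i = det (matrix ?T) * Y c' ?x' $ i" for i
      proof -
        have l: "linear (\<lambda>v. ?T v $ i)"
          using linear_compose[OF lT comp] by (simp add: comp_def)
        have lc: "linear (\<lambda>v::real^4. complex_of_real (v $ i))"
          by (rule linear_complexI) auto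
        have W: "wedge13 (\<lambda>v. of_real (?T v $ i)) (\<eta> c ?x) (E4 1) (E4 2) (E4 3) (E4 4) =
          of_real (det (matrix ?T)) * wedge13 (\<lambda>v. of_real (v $ i)) (\<eta> c' ?x') (E4 1) (E4 2) (E4 3) (E4 4)"
        proof (rule natural_E4[OF c alt4_wedge13[OF lc \<eta>_alt[OF c(2) x']]])
          show "wedge13 (\<lambda>v. of_real (?T v $ i)) (\<eta> c ?x) u v w z =
            wedge13 (\<lambda>v. of_real (v $ i)) (\<eta> c' ?x') (?T u) (?T v) (?T w) (?T z)" for u v w z
            by (rule wedge13_natural) (rule refl, rule \<eta>_nat[OF c])
        qed
        have "?T (Y c ?x) $ i = s * Re (wedge13 (\<lambda>v. of_real (?T v $ i)) (\<eta> c ?x) (E4 1) (E4 2) (E4 3) (E4 4))"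
          by (rule wY[OF l, symmetric])
        also have "\<dots> = det (matrix ?T) * (s * Re (wedge13 (\<lambda>v. of_real (v $ i)) (\<eta> c' ?x') (E4 1) (E4 2) (E4 3) (E4 4)))"
          unfolding W by simp
        finally show ?thesis unfolding wY[OF comp] .
      qed
      then show ?thesis using det_nz[OF c] by (simp add: vec_eq_iff V_nat[OF c])
    qed
    show "(\<Sum>k\<in>UNIV. frechet_derivative (\<lambda>y. Y c y $ k) (at x) (E4 k)) = h c x * V c x"
      if c: "c \<in> A" "x \<in> chart_image c" for c x
    proof -
      have dd: "(\<lambda>y. \<eta> c y u v w) differentiable (at x)" for u v w using \<eta>_C1[OF c(1)] c(2) by simp
      note D = frechet_derivative_bounded_linear_at[OF lin dd]
      have "(\<Sum>k\<in>UNIV. frechet_derivative (\<lambda>y. Y c y $ k) (at x) (E4 k)) = s * Re (d3 (\<eta> c) x (E4 1) (E4 2) (E4 3) (E4 4))"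
        using D[of "- s"] by (simp add: sum_4 Y_def D d3_def algebra_simps)
      then show ?thesis unfolding d[OF c] using V_nz[OF c] by (simp add: h_def K_def)
    qed
  qed
  then have "Re (K c0 x0) = 0" using V_nz[OF c0] s by (auto simp: h_def)
  moreover obtain r where "K c0 x0 = of_real (s * r) * of_real (V c0 x0)"
    using pos[OF c0] V[OF c0] unfolding K_def by metis
  ultimately show ?thesis using s by (auto simp: K_def complex_eq_iff)
qed

lemma ext_d_add_scale:
  assumes a: "\<alpha> \<in> forms A k" and b: "\<beta> \<in> forms A k"
  shows "ext_d A (scale_form a \<alpha> + scale_form b \<beta>) = scale_form a (ext_d A \<alpha>) + scale_form b (ext_d A \<beta>)"
proof (intro ext)
  fix c x vs
  show "ext_d A (scale_form a \<alpha> + scale_form b \<beta>) c x vs = (scale_form a (ext_d A \<alpha>) + scale_form b (ext_d A \<beta>)) c x vs"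
  proof (cases "c \<in> A \<and> x \<in> chart_image c")
    case True
    then have c: "c \<in> A" "x \<in> chart_image c" by auto
    note d = forms_differentiable[OF a c] forms_differentiable[OF b c]
    have "frechet_derivative (\<lambda>y. a * \<alpha> c y vs + b * \<beta> c y vs) (at x) v =
        a * frechet_derivative (\<lambda>y. \<alpha> c y vs) (at x) v + b * frechet_derivative (\<lambda>y. \<beta> c y vs) (at x) v" for vs v
      using d by (simp add: frechet_derivative_add_at frechet_derivative_bounded_linear_at[OF bounded_linear_mult_right] differentiable_mult)
    then show ?thesis
      by (simp add: ext_d_def on_charts_apply c scale_form_def sum_distrib_left sum.distrib algebra_simps)
  next
    case False
    then show ?thesis by (simp add: ext_d_def on_charts_outside scale_form_def)
  qed
qed

lemma J_form_add_scale:
  assumes a: "\<alpha> \<in> forms A 2" and b: "\<beta> \<in> forms A 2"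
  shows "J_form A J 2 (scale_form a \<alpha> + scale_form b \<beta>) = scale_form a (J_form A J 2 \<alpha>) + scale_form b (J_form A J 2 \<beta>)"
proof (rule forms2_eqI)
  show "J_form A J 2 (scale_form a \<alpha> + scale_form b \<beta>) \<in> forms A 2"
    by (intro J_form_2_forms forms2_add_scale assms)
  show "scale_form a (J_form A J 2 \<alpha>) + scale_form b (J_form A J 2 \<beta>) \<in> forms A 2"
    by (intro J_form_2_forms forms2_add_scale assms)
  fix c x u v assume c: "c \<in> A" "x \<in> chart_image c"
  show "J_form A J 2 (scale_form a \<alpha> + scale_form b \<beta>) c x [u, v] =
      (scale_form a (J_form A J 2 \<alpha>) + scale_form b (J_form A J 2 \<beta>)) c x [u, v]"
    unfolding J_form_2[OF forms2_add_scale[OF a b] c] by (simp add: scale_form_apply J_form_2[OF a c] J_form_2[OF b c])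
qed

lemma tr_add_scale: "c \<in> A \<Longrightarrow> x \<in> chart_image c \<Longrightarrow> tr c x (\<lambda>u v. a * p u v + b * q u v) = a * tr c x p + b * tr c x q"
  using Vol_nonzero[of c x] by (simp add: tr_def wedge22_def field_simps)

lemma hodge_add_scale:
  assumes a: "\<alpha> \<in> forms A 2" and b: "\<beta> \<in> forms A 2"
  shows "hodge A J g 2 (scale_form a \<alpha> + scale_form b \<beta>) = scale_form a (hodge A J g 2 \<alpha>) + scale_form b (hodge A J g 2 \<beta>)"
proof (rule forms2_eqI)
  show "hodge A J g 2 (scale_form a \<alpha> + scale_form b \<beta>) \<in> forms A 2"
    by (intro hodge_2_forms forms2_add_scale assms)
  show "scale_form a (hodge A J g 2 \<alpha>) + scale_form b (hodge A J g 2 \<beta>) \<in> forms A 2"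
    by (intro hodge_2_forms forms2_add_scale assms)
  fix c x u v assume c: "c \<in> A" "x \<in> chart_image c"
  show "hodge A J g 2 (scale_form a \<alpha> + scale_form b \<beta>) c x [u, v] =
      (scale_form a (hodge A J g 2 \<alpha>) + scale_form b (hodge A J g 2 \<beta>)) c x [u, v]"
    unfolding hodge_2[OF forms2_add_scale[OF a b] c]
    by (simp add: scale_form_apply hodge_2[OF a c] hodge_2[OF b c] tr_add_scale[OF c] algebra_simps add_divide_distrib diff_divide_distrib)
qed

text \<open>\<open>J\<close> is invertible in degree 3 at every point, so the outer J^{-1} may be
  dropped.\<close>

lemma d_c_eq_0_iff:
  assumes a: "\<alpha> \<in> forms A 2"
  shows "d_c A J 2 \<alpha> = 0 \<longleftrightarrow> ext_d A (J_form A J 2 \<alpha>) = 0"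
proof -
  let ?\<sigma> = "ext_d A (J_form A J 2 \<alpha>)"
  have s: "?\<sigma> \<in> forms A 3" using ext_d_forms[OF _ J_form_2_forms[OF a]] by simp
  have v: "d_c A J 2 \<alpha> c x = (\<lambda>vs. - ?\<sigma> c x (map (J c x) vs))" if c: "c \<in> A" "x \<in> chart_image c" for c x
  proof -
    interpret h: hermitian4 "J c x" "g c x" by (rule herm[OF c])
    show ?thesis by (simp add: d_c_def J_inv_form_def on_charts_apply c h.cs.J_inv_cov_3[OF formsD(2)[OF s c]])
  qed
  show ?thesis
  proof
    assume 0: "d_c A J 2 \<alpha> = 0"
    show "?\<sigma> = 0"
    proof (rule on_charts_eqI[OF formsD(1)[OF s] formsD(1)[OF zero_forms[of 3]]])
      fix c x assume c: "c \<in> A" "x \<in> chart_image c"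
      have "?\<sigma> c x [u, v, w] = 0" for u v w
      proof -
        have "- ?\<sigma> c x [J c x (J c x u), J c x (J c x v), J c x (J c x w)] = 0"
          using fun_cong[OF v[OF c], of "[J c x u, J c x v, J c x w]"] 0 by simp
        then show ?thesis
          by (simp add: J_facts(2)[OF c] alt3_simps(4,9,14)[OF forms3_alt3[OF s c]])
      qed
      then show "?\<sigma> c x = 0 c x"
        by (intro alternating_eqI3 formsD(2)[OF s c] formsD(2)[OF zero_forms c]) simp
    qed
  next
    assume "?\<sigma> = 0"
    then have "d_c A J 2 \<alpha> c x = 0" if "c \<in> A" "x \<in> chart_image c" for c x
      using v[OF that] by (simp add: zero_fun_def)
    moreover have "on_charts A (d_c A J 2 \<alpha>) = d_c A J 2 \<alpha>"
      by (simp add: d_c_def J_inv_form_def on_charts_idem)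
    ultimately show "d_c A J 2 \<alpha> = 0"
      by (intro on_charts_eqI[OF _ formsD(1)[OF zero_forms[of 3]]]) simp_all
  qed
qed

end

lemma (in hermitian4) star3_scale: "star3 (\<lambda>u v w. a * t u v w) v = a * star3 t v"
  by (simp add: star3_def trace2_def wedge22_def algebra_simps)

lemma alt2_cnj:
  assumes "alt2 a" shows "alt2 (\<lambda>u v. cnj (a u v))"
  unfolding alt2_def
  by (intro conjI allI linear_complexI) (simp_all add: alt2_simps[OF assms] alt2_same[OF assms])

lemma d2_cnj:
  assumes "\<And>u v. (\<lambda>y. a y u v) differentiable (at x)"
  shows "d2 (\<lambda>y u v. cnj (a y u v)) x u v w = cnj (d2 a x u v w)"
  by (simp add: d2_def frechet_derivative_cnj[OF assms])

lemma d1_cnj: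
  assumes "\<And>u. (\<lambda>y. b y u) differentiable (at x)"
  shows "d1 (\<lambda>y u. cnj (b y u)) x u v = cnj (d1 b x u v)"
  by (simp add: d1_def frechet_derivative_cnj[OF assms])

lemma d2_cong_open:
  assumes "open U" "x \<in> U" "\<And>y u v. y \<in> U \<Longrightarrow> a y u v = b y u v"
  shows "d2 a x u v w = d2 b x u v w"
  unfolding d2_def using frechet_derivative_cong_open[OF assms(1,2), of "\<lambda>y. a y p q" "\<lambda>y. b y p q" for p q] assms(3) by simp

lemma d1_cong_open:
  assumes "open U" "x \<in> U" "\<And>y u. y \<in> U \<Longrightarrow> a y u = b y u"
  shows "d1 a x u v = d1 b x u v"
  unfolding d1_def using frechet_derivative_cong_open[OF assms(1,2), of "\<lambda>y. a y p" "\<lambda>y. b y p" for p] assms(3) by simp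

section \<open>Harmonic forms of definite duality are closed; functions with zero derivative are
  constant\<close>

context almost_kahler
begin

lemma hodge_2_star2:
  assumes "\<alpha> \<in> forms A 2" "c \<in> A" "x \<in> chart_image c"
  shows "hodge A J g 2 \<alpha> c x [u, v] = hermitian4.star2 (J c x) (g c x) (ev2 \<alpha> c x) u v"
proof -
  interpret h: hermitian4 "J c x" "g c x" by (rule herm[OF assms(2,3)])
  show ?thesis by (simp add: hodge_def on_charts_apply assms(2,3) h.hodge_cov_2[OF formsD(2)[OF assms]])
qed

lemma ext_d_ext_d_1:
  assumes b: "b \<in> forms A 1" and c: "c \<in> A" "x \<in> chart_image c"
  shows "d2 (ev2 (ext_d A b) c) x u v w = 0"
proof -
  have "d2 (ev2 (ext_d A b) c) x u v w = d2 (d1 (ev1 b c)) x u v w"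
    by (rule d2_cong_open[OF open_chart[OF c(1)] c(2)]) (rule ext_d_1[OF c(1)])
  also have "\<dots> = 0"
    using formsD(3)[OF b c(1)] by (intro d2_d1[OF open_chart[OF c(1)] c(2)]) (simp add: smooth_on_def)
  finally show ?thesis .
qed

lemma smooth_on_cnj: "open S \<Longrightarrow> smooth_on S f \<Longrightarrow> smooth_on S (\<lambda>x. cnj (f x))"
  by (rule smooth_on_bounded_linear[OF _ bounded_linear_cnj])

lemma smooth_on_Ck: "smooth_on S f \<Longrightarrow> Ck_on k S f"
  by (simp add: smooth_on_def)

lemma smooth_on_wedge12:
  assumes "open S" "\<And>u. smooth_on S (\<lambda>x. \<theta> x u)" "\<And>u v. smooth_on S (\<lambda>x. a x u v)"
  shows "smooth_on S (\<lambda>x. wedge12 (\<theta> x) (a x) u v w)"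
  unfolding wedge12_def by (intro smooth_intros assms)

text \<open>In the proof \<open>b\<close> is the star of d\<alpha> and \<open>\<beta>\<close> is db.
  The codifferential of \<alpha> is -s b, so the Laplace equation says that the star multiplies
  \<open>\<beta>\<close> by -s. This opposite duality gives the first exact integrand a definite
  sign; the second has one for either value of s.\<close>

lemma dual_harmonic_closed:
  assumes compact: "compact_space M" and a: "\<alpha> \<in> forms A 2" and s: "s = 1 \<or> s = - 1"
    and dual: "hodge A J g 2 \<alpha> = scale_form (of_real s) \<alpha>" and harm: "hodge_laplacian A J g 2 \<alpha> = 0"
  shows "ext_d A \<alpha> = 0"
proof -
  define \<tau> where "\<tau> = ext_d A \<alpha>"
  have t: "\<tau> \<in> forms A 3" using ext_d_forms[OF _ a] by (simp add: \<tau>_def)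
  define b where "b = hodge A J g 3 \<tau>"
  have b: "b \<in> forms A 1" unfolding b_def by (rule hodge_3_forms[OF t])
  define \<beta> where "\<beta> = ext_d A b"
  have be: "\<beta> \<in> forms A 2" using ext_d_forms[OF _ b] by (simp add: \<beta>_def numeral_2_eq_2)
  have b_star: "ev1 b c x = hermitian4.star3 (J c x) (g c x) (ev3 \<tau> c x)" if c: "c \<in> A" "x \<in> chart_image c" for c x
    by (simp add: b_def hodge_3[OF t c])
  have d_adj: "d_adj A J g 2 \<alpha> c y [u] = - (of_real s * b c y [u])" if c: "c \<in> A" "y \<in> chart_image c" for c y u
  proof -
    interpret h: hermitian4 "J c y" "g c y" by (rule herm[OF c])
    have "ext_d A (hodge A J g 2 \<alpha>) = scale_form (of_real s) \<tau>"
      unfolding dual \<tau>_def using ext_d_add_scale[OF a a, of "of_real s" 0] by simp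
    moreover have "ext_d A (hodge A J g 2 \<alpha>) \<in> forms A 3"
      using ext_d_forms[OF _ hodge_2_forms[OF a]] by simp
    ultimately have f: "scale_form (of_real s) \<tau> \<in> forms A 3"
      and e: "d_adj A J g 2 \<alpha> = - hodge A J g 3 (scale_form (of_real s) \<tau>)" by (simp_all add: d_adj_def)
    show ?thesis
      unfolding e by (simp add: hodge_3[OF f c] scale_form_apply h.star3_scale fun_cong[OF b_star[OF c], of u])
  qed
  have star_b: "hermitian4.star2 (J c x) (g c x) (ev2 \<beta> c x) u v = of_real (- s) * ev2 \<beta> c x u v"
    if c: "c \<in> A" "x \<in> chart_image c" for c x u v
  proof -
    have "hodge_laplacian A J g 2 \<alpha> c x [u, v] = 0" using harm by simp
    then have "ext_d A (d_adj A J g 2 \<alpha>) c x [u, v] + d_adj A J g 3 \<tau> c x [u, v] = 0"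
      by (simp add: hodge_laplacian_def \<tau>_def numeral_3_eq_3 numeral_2_eq_2)
    moreover have "d_adj A J g 3 \<tau> c x [u, v] = - hodge A J g 2 \<beta> c x [u, v]"
      by (simp add: d_adj_def b_def \<beta>_def numeral_2_eq_2)
    moreover have "ext_d A (d_adj A J g 2 \<alpha>) c x [u, v] = of_real (- s) * \<beta> c x [u, v]"
    proof -
      have "ext_d A (d_adj A J g 2 \<alpha>) c x [u, v] = d1 (\<lambda>y u. of_real (- s) * b c y [u]) x u v"
        unfolding ext_d_1[OF c]
        by (rule d1_cong_open[OF open_chart[OF c(1)] c(2)]) (simp add: d_adj[OF c(1)])
      also have "\<dots> = of_real (- s) * d1 (ev1 b c) x u v"
        unfolding d1_def frechet_derivative_bounded_linear_at[OF bounded_linear_mult_right forms_differentiable[OF b c]]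
        by (simp add: algebra_simps)
      finally show ?thesis by (simp add: \<beta>_def ext_d_1[OF c])
    qed
    ultimately show ?thesis by (simp add: hodge_2_star2[OF be c])
  qed
  have db: "(\<lambda>y. b c y vs) differentiable (at x)" "(\<lambda>y. \<beta> c y vs) differentiable (at x)" "(\<lambda>y. \<alpha> c y vs) differentiable (at x)"
    if c: "c \<in> A" "x \<in> chart_image c" for c x vs
    using forms_differentiable[OF b c] forms_differentiable[OF be c] forms_differentiable[OF a c] by auto
  have cnj_d: "(\<lambda>y. cnj (f y)) differentiable (at x)" if "f differentiable (at x)" for f :: "real^4 \<Rightarrow> complex" and x
    using bounded_linear.has_derivative[OF bounded_linear_cnj that[unfolded frechet_derivative_works]]
    unfolding differentiable_def by blast
  \<comment> \<open>d(b\<and>cnj \<beta>) = \<beta>\<and>cnj \<beta>, as \<open>\<beta>\<close> is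
    exact and hence closed.\<close>
  have beta0: "ev2 \<beta> c x u v = 0" if c: "c \<in> A" "x \<in> chart_image c" for c x u v
  proof -
    let ?c\<beta> = "\<lambda>c x u v. cnj (ev2 \<beta> c x u v)"
    have "wedge22 (ev2 \<beta> c x) (?c\<beta> c x) (E4 1) (E4 2) (E4 3) (E4 4) = 0"
    proof (rule stokes_nonneg[OF compact, where s = "- s" and \<eta> = "\<lambda>c x. wedge12 (ev1 b c x) (?c\<beta> c x)" and
          \<kappa> = "\<lambda>c x. wedge22 (ev2 \<beta> c x) (?c\<beta> c x)", OF _ _ _ _ _ _ _ _ c])
      show "- s = 1 \<or> - s = - 1" using s by auto
    next
      fix c x assume c: "c \<in> A" "x \<in> chart_image c"
      show "alt3 (wedge12 (ev1 b c x) (?c\<beta> c x))"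
        by (rule alt3_wedge12[OF forms1_linear[OF b c] alt2_cnj[OF forms2_alt2[OF be c]]])
      show "alt4 (wedge22 (ev2 \<beta> c x) (?c\<beta> c x))"
        by (rule alt4_wedge22[OF forms2_alt2[OF be c] alt2_cnj[OF forms2_alt2[OF be c]]])
      have "d2 (?c\<beta> c) x u v w = 0" for u v w
        using ext_d_ext_d_1[OF b c, folded \<beta>_def] by (simp add: d2_cnj[OF db(2)[OF c]])
      then show "d3 (\<lambda>x. wedge12 (ev1 b c x) (?c\<beta> c x)) x (E4 1) (E4 2) (E4 3) (E4 4) =
          wedge22 (ev2 \<beta> c x) (?c\<beta> c x) (E4 1) (E4 2) (E4 3) (E4 4)"
        unfolding d3_wedge12[of "ev1 b c" x "?c\<beta> c", OF db(1)[OF c] cnj_d[OF db(2)[OF c]]]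
        by (simp add: wedge13_def \<beta>_def wedge22_def ext_d_1[OF c])
      interpret h: hermitian4 "J c x" "g c x" by (rule herm[OF c])
      show "\<exists>r\<ge>0. wedge22 (ev2 \<beta> c x) (?c\<beta> c x) (E4 1) (E4 2) (E4 3) (E4 4) = of_real (- s * r) * Vol c x"
        using h.star2_selfdual_norm[OF forms2_alt2[OF be c], of "- s"] star_b[OF c] s
        unfolding Vol_eq[OF c, symmetric] by auto
    next
      fix c u v w assume c: "c \<in> A"
      show "Ck_on 1 (chart_image c) (\<lambda>x. wedge12 (ev1 b c x) (?c\<beta> c x) u v w)"
        by (intro smooth_on_Ck smooth_on_wedge12 smooth_on_cnj open_chart[OF c] formsD(3)[OF b c] formsD(3)[OF be c])
    next
      fix c c' p u v w assume c: "c \<in> A" "c' \<in> A" "p \<in> fst c \<inter> fst c'"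
      have n1: "ev1 b c (snd c p) u = ev1 b c' (snd c' p) (transition_deriv c c' p u)" for u
        using formsD(4)[OF b c, of "[u]"] by simp
      have n2: "ev2 \<beta> c (snd c p) u v = ev2 \<beta> c' (snd c' p) (transition_deriv c c' p u) (transition_deriv c c' p v)" for u v
        using formsD(4)[OF be c, of "[u, v]"] by simp
      then have n3: "?c\<beta> c (snd c p) u v = ?c\<beta> c' (snd c' p) (transition_deriv c c' p u) (transition_deriv c c' p v)" for u v
        by simp
      show "wedge12 (ev1 b c (snd c p)) (?c\<beta> c (snd c p)) u v w = wedge12 (ev1 b c' (snd c' p)) (?c\<beta> c' (snd c' p))
          (transition_deriv c c' p u) (transition_deriv c c' p v) (transition_deriv c c' p w)"
        by (rule wedge12_natural) (rule n1, rule n3)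
      fix z
      show "wedge22 (ev2 \<beta> c (snd c p)) (?c\<beta> c (snd c p)) u v w z = wedge22 (ev2 \<beta> c' (snd c' p)) (?c\<beta> c' (snd c' p))
          (transition_deriv c c' p u) (transition_deriv c c' p v) (transition_deriv c c' p w) (transition_deriv c c' p z)"
        by (rule wedge22_natural) (rule n2, rule n3)
    qed
    moreover interpret h: hermitian4 "J c x" "g c x" by (rule herm[OF c])
    obtain r where r: "wedge22 (ev2 \<beta> c x) (?c\<beta> c x) (E4 1) (E4 2) (E4 3) (E4 4) = of_real (- s * r) * Vol c x"
      "r = 0 \<longrightarrow> (\<forall>u v. ev2 \<beta> c x u v = 0)"
      using h.star2_selfdual_norm[OF forms2_alt2[OF be c], of "- s"] star_b[OF c] s
      unfolding Vol_eq[OF c, symmetric] by auto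
    ultimately have "r = 0" using Vol_nonzero[OF c] s by auto
    then show ?thesis using r(2) by blast
  qed
  \<comment> \<open>Once \<open>\<beta>\<close> is 0, d(cnj b\<and>\<alpha>) = - cnj
    b\<and>d\<alpha>. The minus sign is absorbed in \<open>?nb\<close> and cancels the one in
    \<open>star3_norm\<close>.\<close>
  have tau0: "ev3 \<tau> c x u v w = 0" if c: "c \<in> A" "x \<in> chart_image c" for c x u v w
  proof -
    let ?cb = "\<lambda>c x u. cnj (ev1 b c x u)" and ?nb = "\<lambda>c x u. - cnj (ev1 b c x u)"
    have lb: "linear (?cb c x)" "linear (?nb c x)" if c: "c \<in> A" "x \<in> chart_image c" for c x
      by (rule linear_complexI; simp add: linear_complexD[OF forms1_linear[OF b c]])+
    have neg: "wedge13 (?nb c x) t u v w z = - wedge13 (?cb c x) t u v w z" for c x t u v w z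
      by (simp add: wedge13_def)
    have norm: "\<exists>r\<ge>0. wedge13 (?nb c x) (ev3 \<tau> c x) (E4 1) (E4 2) (E4 3) (E4 4) = of_real r * Vol c x \<and>
        (r = 0 \<longrightarrow> (\<forall>u v w. ev3 \<tau> c x u v w = 0))" if c: "c \<in> A" "x \<in> chart_image c" for c x
    proof -
      interpret h: hermitian4 "J c x" "g c x" by (rule herm[OF c])
      obtain r where "r \<ge> 0" "wedge13 (?cb c x) (ev3 \<tau> c x) (E4 1) (E4 2) (E4 3) (E4 4) = of_real (- r) * Vol c x"
          "r = 0 \<longrightarrow> (\<forall>u v w. ev3 \<tau> c x u v w = 0)"
        using h.star3_norm[OF forms3_alt3[OF t c]] unfolding Vol_eq[OF c, symmetric] b_star[OF c, symmetric] by blast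
      then show ?thesis unfolding neg by (intro exI[of _ r]) simp
    qed
    have "wedge13 (?nb c x) (ev3 \<tau> c x) (E4 1) (E4 2) (E4 3) (E4 4) = 0"
    proof (rule stokes_nonneg[OF compact, where s = 1 and \<eta> = "\<lambda>c x. wedge12 (?cb c x) (ev2 \<alpha> c x)" and
          \<kappa> = "\<lambda>c x. wedge13 (?nb c x) (ev3 \<tau> c x)", OF _ _ _ _ _ _ _ _ c])
      fix c x assume c: "c \<in> A" "x \<in> chart_image c"
      show "alt3 (wedge12 (?cb c x) (ev2 \<alpha> c x))"
        by (rule alt3_wedge12[OF lb(1)[OF c] forms2_alt2[OF a c]])
      show "alt4 (wedge13 (?nb c x) (ev3 \<tau> c x))"
        by (rule alt4_wedge13[OF lb(2)[OF c] forms3_alt3[OF t c]])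
      have "d1 (?cb c) x u v = 0" for u v
        using beta0[OF c, of u v] by (simp add: d1_cnj[OF db(1)[OF c]] \<beta>_def ext_d_1[OF c])
      then show "d3 (\<lambda>x. wedge12 (?cb c x) (ev2 \<alpha> c x)) x (E4 1) (E4 2) (E4 3) (E4 4) =
          wedge13 (?nb c x) (ev3 \<tau> c x) (E4 1) (E4 2) (E4 3) (E4 4)"
        unfolding d3_wedge12[of "?cb c" x "ev2 \<alpha> c", OF cnj_d[OF db(1)[OF c]] db(3)[OF c]]
        by (simp add: wedge13_def \<tau>_def wedge22_def ext_d_2[OF c])
      show "\<exists>r\<ge>0. wedge13 (?nb c x) (ev3 \<tau> c x) (E4 1) (E4 2) (E4 3) (E4 4) = of_real (1 * r) * Vol c x"
        using norm[OF c] by auto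
    next
      fix c u v w assume c: "c \<in> A"
      show "Ck_on 1 (chart_image c) (\<lambda>x. wedge12 (?cb c x) (ev2 \<alpha> c x) u v w)"
        by (intro smooth_on_Ck smooth_on_wedge12 smooth_on_cnj open_chart[OF c] formsD(3)[OF b c] formsD(3)[OF a c])
    next
      fix c c' p u v w assume c: "c \<in> A" "c' \<in> A" "p \<in> fst c \<inter> fst c'"
      have n1: "?cb c (snd c p) u = ?cb c' (snd c' p) (transition_deriv c c' p u)"
        "?nb c (snd c p) u = ?nb c' (snd c' p) (transition_deriv c c' p u)" for u
        using formsD(4)[OF b c, of "[u]"] by simp_all
      have n2: "ev2 \<alpha> c (snd c p) u v = ev2 \<alpha> c' (snd c' p) (transition_deriv c c' p u) (transition_deriv c c' p v)" for u v
        using formsD(4)[OF a c, of "[u, v]"] by simp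
      have n3: "ev3 \<tau> c (snd c p) u v w = ev3 \<tau> c' (snd c' p) (transition_deriv c c' p u) (transition_deriv c c' p v) (transition_deriv c c' p w)" for u v w
        using formsD(4)[OF t c, of "[u, v, w]"] by simp
      show "wedge12 (?cb c (snd c p)) (ev2 \<alpha> c (snd c p)) u v w = wedge12 (?cb c' (snd c' p)) (ev2 \<alpha> c' (snd c' p))
          (transition_deriv c c' p u) (transition_deriv c c' p v) (transition_deriv c c' p w)"
        by (rule wedge12_natural) (rule n1(1), rule n2)
      fix z
      show "wedge13 (?nb c (snd c p)) (ev3 \<tau> c (snd c p)) u v w z = wedge13 (?nb c' (snd c' p)) (ev3 \<tau> c' (snd c' p))
          (transition_deriv c c' p u) (transition_deriv c c' p v) (transition_deriv c c' p w) (transition_deriv c c' p z)"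
        by (rule wedge13_natural) (rule n1(2), rule n3)
    qed simp
    then show ?thesis using norm[OF c] Vol_nonzero[OF c] by auto
  qed
  have "\<tau> = 0"
  proof (rule on_charts_eqI[OF formsD(1)[OF t] formsD(1)[OF zero_forms[of 3]]])
    fix c x assume c: "c \<in> A" "x \<in> chart_image c"
    show "\<tau> c x = 0 c x"
      by (intro alternating_eqI3 formsD(2)[OF t c] formsD(2)[OF zero_forms c]) (simp add: tau0[OF c])
  qed
  then show ?thesis by (simp add: \<tau>_def)
qed

text \<open>If the star multiplies \<alpha> by a constant, closed implies coclosed.\<close>

lemma dual_closed_harmonic:
  assumes a: "\<alpha> \<in> forms A 2" and dual: "hodge A J g 2 \<alpha> = scale_form s \<alpha>" and cl: "ext_d A \<alpha> = 0"
  shows "\<alpha> \<in> d_harmonic A J g 2"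
proof -
  have "ext_d A (hodge A J g 2 \<alpha>) = 0"
    unfolding dual using ext_d_add_scale[OF a a, of s 0] cl by simp
  then have "d_adj A J g 2 \<alpha> = 0" by (simp add: d_adj_def hodge_zero)
  moreover have "d_adj A J g 3 0 = 0" by (simp add: d_adj_def hodge_zero ext_d_zero)
  ultimately have "hodge_laplacian A J g 2 \<alpha> = 0"
    by (simp add: hodge_laplacian_def cl ext_d_zero numeral_3_eq_3[symmetric] flip: numeral_3_eq_3)
  then show ?thesis using a by (simp add: d_harmonic_def)
qed

lemma constant_function:
  fixes f :: "'a chart \<Rightarrow> real^4 \<Rightarrow> complex"
  assumes conn: "connected_space M"
    and d: "\<And>c x. c \<in> A \<Longrightarrow> x \<in> chart_image c \<Longrightarrow> (f c has_derivative (\<lambda>v. 0)) (at x)"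
    and nat: "\<And>c c' p. c \<in> A \<Longrightarrow> c' \<in> A \<Longrightarrow> p \<in> fst c \<inter> fst c' \<Longrightarrow> f c (snd c p) = f c' (snd c' p)"
  shows "\<exists>a. \<forall>c\<in>A. \<forall>x\<in>chart_image c. f c x = a"
proof (cases "topspace M = {}")
  case True
  then have "fst c = {}" if "c \<in> A" for c
    using openin_subset[OF openin_chart[OF that]] by blast
  then show ?thesis by (auto simp: chart_image_def)
next
  case False
  \<comment> \<open>\<open>f\<close> is constant on small balls, so \<open>Z P\<close> is open for
    every \<open>P\<close>; a predicate and its negation make a level set both open and
    closed.\<close>
  define Z where "Z = (\<lambda>P. {q. \<exists>c\<in>A. q \<in> fst c \<and> P (f c (snd c q))})"
  have op: "openin M (Z P)" for P
  proof (subst openin_subopen, intro ballI)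
    fix q assume "q \<in> Z P"
    then obtain c where c: "c \<in> A" "q \<in> fst c" "P (f c (snd c q))" by (auto simp: Z_def)
    obtain r where r: "r > 0" "ball (snd c q) r \<subseteq> chart_image c"
      using open_chart[OF c(1)] chart_image_I[OF c(2)] openE by blast
    have eq: "f c x = f c (snd c q)" if "x \<in> ball (snd c q) r" for x
      using has_derivative_zero_unique[of "ball (snd c q) r" "f c" "snd c q" x] d[OF c(1)] r that
      by (metis (no_types, lifting) centre_in_ball convex_ball has_derivative_at_withinI subsetD)
    have cont: "continuous_map (subtopology M (fst c)) (top_of_set (chart_image c)) (snd c)"
      by (rule homeomorphic_imp_continuous_map[OF homeo_chart[OF c(1)]])
    have "openin (top_of_set (chart_image c)) (chart_image c \<inter> ball (snd c q) r)"
      by (intro openin_open_Int) simp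
    from openin_continuous_map_preimage[OF cont this]
    have "openin (subtopology M (fst c)) {p \<in> fst c. snd c p \<in> chart_image c \<inter> ball (snd c q) r}"
      unfolding topspace_chart[OF c(1)] .
    then have "openin M {p \<in> fst c. snd c p \<in> chart_image c \<inter> ball (snd c q) r}"
      using openin_trans_full[OF _ openin_chart[OF c(1)]] by blast
    moreover have "{p \<in> fst c. snd c p \<in> chart_image c \<inter> ball (snd c q) r} \<subseteq> Z P"
      using c eq by (auto simp: Z_def)
    moreover have "q \<in> {p \<in> fst c. snd c p \<in> chart_image c \<inter> ball (snd c q) r}"
      using c r(1) chart_image_I[OF c(2)] by simp
    ultimately show "\<exists>T. openin M T \<and> q \<in> T \<and> T \<subseteq> Z P" by blast
  qed
  have cov: "topspace M = (\<Union>c\<in>A. fst c)" using mfd by (simp add: smooth_manifold4_def)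
  have un: "f c (snd c q) = f c' (snd c' q)" if "c \<in> A" "c' \<in> A" "q \<in> fst c" "q \<in> fst c'" for c c' q
    using nat that by blast
  obtain q0 where "q0 \<in> topspace M" using False by blast
  then obtain c0 where c0: "c0 \<in> A" "q0 \<in> fst c0" using cov by blast
  define a where "a = f c0 (snd c0 q0)"
  have compl: "topspace M - Z (\<lambda>z. z = a) = Z (\<lambda>z. z \<noteq> a)"
  proof
    show "topspace M - Z (\<lambda>z. z = a) \<subseteq> Z (\<lambda>z. z \<noteq> a)" unfolding cov Z_def by blast
    show "Z (\<lambda>z. z \<noteq> a) \<subseteq> topspace M - Z (\<lambda>z. z = a)"
    proof
      fix q assume "q \<in> Z (\<lambda>z. z \<noteq> a)"
      then obtain c where c: "c \<in> A" "q \<in> fst c" "f c (snd c q) \<noteq> a" by (auto simp: Z_def)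
      have "f c' (snd c' q) \<noteq> a" if "c' \<in> A" "q \<in> fst c'" for c'
        using un[OF c(1) that(1) c(2) that(2)] c(3) by simp
      then show "q \<in> topspace M - Z (\<lambda>z. z = a)" unfolding cov Z_def using c by blast
    qed
  qed
  have "closedin M (Z (\<lambda>z. z = a))"
    unfolding closedin_def compl using op openin_subset[OF op] by blast
  moreover have "q0 \<in> Z (\<lambda>z. z = a)" using c0 by (auto simp: Z_def a_def)
  ultimately have Z: "Z (\<lambda>z. z = a) = topspace M"
    using conn op unfolding connected_space_clopen_in by blast
  show ?thesis
  proof (intro exI ballI)
    fix c x assume c: "c \<in> A" "x \<in> chart_image c"
    then obtain q where q: "q \<in> fst c" "x = snd c q" by (auto simp: chart_image_def)
    then have "q \<in> Z (\<lambda>z. z = a)" using Z cov c(1) by blast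
    then obtain c' where "c' \<in> A" "q \<in> fst c'" "f c' (snd c' q) = a" by (auto simp: Z_def)
    then show "f c x = a" using un[OF c(1), of c' q] q by simp
  qed
qed

end

section \<open>Types and duality of 2-forms in one tangent space\<close>

context hermitian4
begin

lemma trace2_frame:
  assumes a: "alt2 a" and o: "oriented e (J e) f (J f)"
  shows "trace2 a = 2 * (a e (J e) + a f (J f))"
  unfolding trace2_trace[OF a o]
  using alt2_skew[OF a, of "J e" e] alt2_skew[OF a, of "J f" f] by (simp add: alt2_simps[OF a])

text \<open>On a unitary frame \<open>a (J e) (J (J e))\<close> is again
  \<open>a e (J e)\<close>.\<close>

lemma trace2_J:
  assumes a: "alt2 a"
  shows "trace2 (\<lambda>u v. a (J u) (J v)) = trace2 a"
proof -
  obtain e f where o: "oriented e (J e) f (J f)" using exists_unitary_frame by blast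
  show ?thesis
    unfolding trace2_frame[OF a o] trace2_frame[OF alt2_J[OF a] o]
    using alt2_skew[OF a, of "J e" e] alt2_skew[OF a, of "J f" f] by (simp add: alt2_simps[OF a])
qed

text \<open>The trace is invariant under \<open>J\<close> and also changes sign, so it is 0; what
  remains of \<open>star2\<close> is minus the pullback by \<open>J\<close>.\<close>

lemma star2_anti_invariant:
  assumes a: "alt2 a" and J: "\<And>u v. a (J u) (J v) = - a u v"
  shows "star2 a u v = a u v"
proof -
  have "trace2 (\<lambda>u v. (- 1) * a u v + 0 * a u v) = trace2 a"
    using trace2_J[OF a] by (simp add: J)
  then have "trace2 a = 0" unfolding trace2_add_scale by simp
  then show ?thesis by (simp add: star2_def J)
qed

text \<open>Solving for \<open>a (J u) (J v)\<close> and taking traces gives tr a = tr a + 2 tr a,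
  because \<open>trace2 W = - 4\<close>.\<close>

lemma star2_anti_selfdual:
  assumes a: "alt2 a" and s: "\<And>u v. star2 a u v = - a u v"
  shows "a (J u) (J v) = a u v"
proof -
  have e: "a (J u) (J v) = 1 * a u v + (- trace2 a / 2) * W u v" for u v
    using s[of u v] by (simp add: star2_def algebra_simps eq_neg_iff_add_eq_0)
  have "trace2 a = trace2 (\<lambda>u v. 1 * a u v + (- trace2 a / 2) * W u v)"
    using trace2_J[OF a] unfolding e by simp
  then have "trace2 a = 0" unfolding trace2_add_scale trace2_W by simp
  then show ?thesis using e by simp
qed

end

lemma d2_diff:
  assumes "\<And>u v. (\<lambda>y. a y u v) differentiable (at x)" "\<And>u v. (\<lambda>y. b y u v) differentiable (at x)"
  shows "d2 (\<lambda>y u v. a y u v - b y u v) x u v w = d2 a x u v w - d2 b x u v w"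
  by (simp add: d2_def frechet_derivative_diff_at[OF assms])

section \<open>The trace of a form in \<open>H2_d_dc\<close> is constant\<close>

context almost_kahler
begin

lemma d_c_apply:
  assumes a: "\<alpha> \<in> forms A 2" and c: "c \<in> A" "x \<in> chart_image c"
  shows "d_c A J 2 \<alpha> c x = (\<lambda>vs. - ext_d A (J_form A J 2 \<alpha>) c x (map (J c x) vs))"
proof -
  interpret h: hermitian4 "J c x" "g c x" by (rule herm[OF c])
  have s: "ext_d A (J_form A J 2 \<alpha>) \<in> forms A 3" using ext_d_forms[OF _ J_form_2_forms[OF a]] by simp
  show ?thesis by (simp add: d_c_def J_inv_form_def on_charts_apply c h.cs.J_inv_cov_3[OF formsD(2)[OF s c]])
qed

text \<open>Required because the operator dd^c differentiates the result once more and Stokes'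
  theorem needs it to be compatible between charts.\<close>

lemma d_c_forms:
  assumes a: "\<alpha> \<in> forms A 2"
  shows "d_c A J 2 \<alpha> \<in> forms A 3"
  unfolding forms_def mem_Collect_eq
proof (intro conjI ballI allI)
  define \<sigma> where "\<sigma> = ext_d A (J_form A J 2 \<alpha>)"
  have s: "\<sigma> \<in> forms A 3" using ext_d_forms[OF _ J_form_2_forms[OF a]] by (simp add: \<sigma>_def)
  note ap = d_c_apply[OF a, folded \<sigma>_def]
  show "on_charts A (d_c A J 2 \<alpha>) = d_c A J 2 \<alpha>" by (simp add: d_c_def J_inv_form_def on_charts_idem)
  {
    fix c x assume c: "c \<in> A" "x \<in> chart_image c"
    have al: "alt3 (\<lambda>u v w. \<sigma> c x [J c x u, J c x v, J c x w])"
      using hermitian4.alt3_J[OF herm[OF c] forms3_alt3[OF s c]] .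
    have "alt3 (\<lambda>u v w. - \<sigma> c x [J c x u, J c x v, J c x w])"
      unfolding alt3_def alt2_def
      by (intro conjI allI linear_complexI) (simp_all add: alt3_simps[OF al] alt3_same[OF al])
    then show "alternating 3 (d_c A J 2 \<alpha> c x)"
      using formsD(2)[OF s c] unfolding ap[OF c] alternating_3 by simp
  next
    fix c vs assume c: "c \<in> A"
    have "smooth_on (chart_image c) (\<lambda>x. - \<sigma> c x (map (J c x) vs))"
    proof (cases "length vs = 3")
      case True
      then obtain u v w where vs: "vs = [u, v, w]" by (auto simp: length_3)
      note l = alt3_linear[OF forms3_alt3[OF s c]]
      \<comment> \<open>\<open>J\<close> is inserted into one argument at a time.\<close>
      have s1: "smooth_on (chart_image c) (\<lambda>x. \<sigma> c x [J c x u, v, w])" for v w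
        by (rule smooth_on_evaluate[OF open_chart[OF c], where a = "\<lambda>x u. \<sigma> c x [u, v, w]"])
          (rule l(1), assumption, rule formsD(3)[OF s c], rule J_facts(3)[OF c])
      have s2: "smooth_on (chart_image c) (\<lambda>x. \<sigma> c x [J c x u, J c x v, w])" for w
        by (rule smooth_on_evaluate[OF open_chart[OF c], where a = "\<lambda>x v. \<sigma> c x [J c x u, v, w]"])
          (rule l(2), assumption, rule s1, rule J_facts(3)[OF c])
      have "smooth_on (chart_image c) (\<lambda>x. \<sigma> c x [J c x u, J c x v, J c x w])"
        by (rule smooth_on_evaluate[OF open_chart[OF c], where a = "\<lambda>x w. \<sigma> c x [J c x u, J c x v, w]"])
          (rule l(3), assumption, rule s2, rule J_facts(3)[OF c])
      from smooth_on_bounded_linear[OF open_chart[OF c] bounded_linear_minus[OF bounded_linear_ident] this]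
      show ?thesis by (simp add: vs)
    next
      case False
      then have "smooth_on (chart_image c) (\<lambda>x. - \<sigma> c x (map (J c x) vs)) \<longleftrightarrow> smooth_on (chart_image c) (\<lambda>x. 0::complex)"
        using formsD(2)[OF s c] by (intro smooth_on_cong[OF open_chart[OF c]]) (simp add: alternating_3)
      then show ?thesis by (simp add: smooth_on_const)
    qed
    then show "smooth_on (chart_image c) (\<lambda>x. d_c A J 2 \<alpha> c x vs)"
      using smooth_on_cong[OF open_chart[OF c], of "\<lambda>x. d_c A J 2 \<alpha> c x vs" "\<lambda>x. - \<sigma> c x (map (J c x) vs)"]
      by (simp add: ap[OF c])
  next
    fix c c' p vs assume c: "c \<in> A" "c' \<in> A" "p \<in> fst c \<inter> fst c'"
    have x: "snd c p \<in> chart_image c" "snd c' p \<in> chart_image c'" using c by (auto intro: chart_image_I)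
    have "map (transition_deriv c c' p) (map (J c (snd c p)) vs) = map (J c' (snd c' p)) (map (transition_deriv c c' p) vs)"
      by (simp add: J_facts(4)[OF c])
    then show "d_c A J 2 \<alpha> c (snd c p) vs = d_c A J 2 \<alpha> c' (snd c' p) (map (transition_deriv c c' p) vs)"
      unfolding ap[OF c(1) x(1)] ap[OF c(2) x(2)] formsD(4)[OF s c, of "map (J c (snd c p)) vs"] by (rule arg_cong)
  }
qed

text \<open>With t the trace, closedness of \<alpha> and \<omega> reduces \<open>\<sigma>\<close> to
  -1/2 dt\<and>\<omega>. Hence \<open>\<delta>\<close> is -1/2 \<lambda>\<and>\<omega> with
  \<lambda> = J^{-1}dt, and it is closed. The exact form d(cnj t \<delta>) is then half the squared
  norm of dt times the volume form.\<close>

lemma H2_trace_constant: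
  assumes compact: "compact_space M" and conn: "connected_space M" and H: "\<alpha> \<in> H2_d_dc A J g"
  shows "\<exists>a. \<forall>c\<in>A. \<forall>x\<in>chart_image c. tr c x (ev2 \<alpha> c x) = a"
proof -
  have a: "\<alpha> \<in> forms A 2" and d0: "ext_d A \<alpha> = 0" and dd: "ddc_adj A J g 2 \<alpha> = 0"
    using H by (auto simp: H2_d_dc_def)
  define t where "t = (\<lambda>c x. tr c x (ev2 \<alpha> c x))"
  have t_smooth: "smooth_on (chart_image c) (t c)" if "c \<in> A" for c
    unfolding t_def by (rule smooth_tr[OF that formsD(3)[OF a that]])
  have t_nat: "t c (snd c p) = t c' (snd c' p)" if c: "c \<in> A" "c' \<in> A" "p \<in> fst c \<inter> fst c'" for c c' p
    unfolding t_def
  proof (rule tr_natural[OF c])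
    show "alt2 (ev2 \<alpha> c' (snd c' p))" using c by (intro forms2_alt2[OF a] chart_image_I) auto
    show "\<alpha> c (snd c p) [u, v] = \<alpha> c' (snd c' p) [transition_deriv c c' p u, transition_deriv c c' p v]" for u v
      using formsD(4)[OF a c, of "[u, v]"] by simp
  qed
  note t_diff = smooth_on_differentiable[OF t_smooth]
  define \<theta> where "\<theta> = (\<lambda>c x. frechet_derivative (t c) (at x))"
  have lin: "linear (\<theta> c x)" if "c \<in> A" "x \<in> chart_image c" for c x
    unfolding \<theta>_def by (rule linear_frechet_derivative_at[OF t_diff[OF that]])
  have \<theta>_nat: "\<theta> c (snd c p) v = \<theta> c' (snd c' p) (transition_deriv c c' p v)"
    if c: "c \<in> A" "c' \<in> A" "p \<in> fst c \<inter> fst c'" for c c' p v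
  proof -
    let ?\<phi> = "transition c c'"
    note ph = pullback_hyps[OF c]
    have x': "snd c' p \<in> chart_image c'" using c(3) by (auto intro: chart_image_I)
    have tp: "?\<phi> (snd c p) = snd c' p" using transition_apply[OF c(1)] c(3) by blast
    have d: "(?\<phi> has_derivative transition_deriv c c' p) (at (snd c p))"
      unfolding transition_deriv_def
      using smooth_on_differentiable[OF transition_smooth[OF c(1,2)] ph(2)] frechet_derivative_works by blast
    have d': "(t c' has_derivative \<theta> c' (snd c' p)) (at (?\<phi> (snd c p)))"
      unfolding tp \<theta>_def using t_diff[OF c(2) x'] frechet_derivative_works by blast
    have "\<theta> c (snd c p) = frechet_derivative (\<lambda>y. t c' (?\<phi> y)) (at (snd c p))"
      unfolding \<theta>_def
    proof (rule frechet_derivative_cong_open[OF ph(1,2)])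
      fix y assume "y \<in> snd c ` (fst c \<inter> fst c')"
      then obtain q where "y = snd c q" "q \<in> fst c \<inter> fst c'" by blast
      then show "t c y = t c' (?\<phi> y)"
        using t_nat[OF c(1,2), of q] transition_apply[OF c(1), of q c'] by simp
    qed
    also have "\<dots> = (\<lambda>v. \<theta> c' (snd c' p) (transition_deriv c c' p v))"
      by (rule frechet_derivative_at[symmetric], rule has_derivative_compose[OF d d'])
    finally show ?thesis by (rule fun_cong)
  qed
  define \<beta> where "\<beta> = hodge A J g 2 \<alpha>"
  have b: "\<beta> \<in> forms A 2" unfolding \<beta>_def by (rule hodge_2_forms[OF a])
  have Jb: "J_form A J 2 \<beta> \<in> forms A 2" by (rule J_form_2_forms[OF b])
  \<comment> \<open>\<open>J\<close> undoes the precomposition in the formula for the star and so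
    brings back \<alpha>, whose differential is 0.\<close>
  have B: "J_form A J 2 \<beta> c x [u, v] = (- 1 / 2 * t c x) * \<omega> c x [u, v] - \<alpha> c x [u, v]"
    if c: "c \<in> A" "x \<in> chart_image c" for c x u v
    unfolding J_form_2[OF b c]
    by (simp add: \<beta>_def hodge_2[OF a c] t_def omega_J[OF c] J_facts(2)[OF c] alt2_simps[OF forms2_alt2[OF a c]])
  define \<sigma> where "\<sigma> = ext_d A (J_form A J 2 \<beta>)"
  have \<sigma>: "\<sigma> c x [u, v, w] = wedge12 (\<lambda>v. - 1 / 2 * \<theta> c x v) (ev2 \<omega> c x) u v w"
    if c: "c \<in> A" "x \<in> chart_image c" for c x u v w
  proof -
    let ?f = "\<lambda>y. - 1 / 2 * t c y"
    have f: "?f differentiable (at x)"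
      by (intro differentiable_mult differentiable_const t_diff[OF c])
    have f': "frechet_derivative ?f (at x) = (\<lambda>v. - 1 / 2 * \<theta> c x v)"
      using frechet_derivative_bounded_linear_at[OF bounded_linear_mult_right t_diff[OF c], of "- 1 / 2"]
      by (simp add: fun_eq_iff \<theta>_def)
    note od = forms_differentiable[OF omega_forms c]
    have "\<sigma> c x [u, v, w] = d2 (\<lambda>y u v. ?f y * \<omega> c y [u, v] - \<alpha> c y [u, v]) x u v w"
      unfolding \<sigma>_def ext_d_2[OF c] by (rule d2_cong_open[OF open_chart[OF c(1)] c(2)]) (rule B[OF c(1)])
    also have "\<dots> = d2 (\<lambda>y u v. ?f y * \<omega> c y [u, v]) x u v w - d2 (ev2 \<alpha> c) x u v w"
      by (intro d2_diff differentiable_mult f od forms_differentiable[OF a c])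
    also have "d2 (ev2 \<alpha> c) x u v w = 0"
      unfolding ext_d_2[OF c, symmetric] d0 by simp
    also have "d2 (\<lambda>y u v. ?f y * \<omega> c y [u, v]) x u v w = wedge12 (\<lambda>v. - 1 / 2 * \<theta> c x v) (ev2 \<omega> c x) u v w + ?f x * d2 (ev2 \<omega> c) x u v w"
      unfolding d2_scale[OF f od] f' ..
    also have "d2 (ev2 \<omega> c) x u v w = 0"
      unfolding ext_d_2[OF c, symmetric] d_omega by simp
    finally show ?thesis by simp
  qed
  define \<delta> where "\<delta> = d_c A J 2 \<beta>"
  have de: "\<delta> \<in> forms A 3" unfolding \<delta>_def by (rule d_c_forms[OF b])
  let ?lam = "\<lambda>c x v. - \<theta> c x (J c x v)"
  have \<delta>: "\<delta> c x [u, v, w] = wedge12 (\<lambda>v. - 1 / 2 * ?lam c x v) (ev2 \<omega> c x) u v w"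
    if c: "c \<in> A" "x \<in> chart_image c" for c x u v w
    unfolding \<delta>_def d_c_apply[OF b c] by (simp add: \<sigma>[OF c, unfolded \<sigma>_def] wedge12_def omega_J[OF c])
  \<comment> \<open>The outer star in \<open>ddc_adj\<close> acts on a 4-form, where it is
    injective.\<close>
  have dz: "d3 (ev3 \<delta> c) x (E4 1) (E4 2) (E4 3) (E4 4) = 0" if c: "c \<in> A" "x \<in> chart_image c" for c x
  proof -
    have "alternating (Suc 3) (ext_d A \<delta> c x)"
      by (rule alternating_ext_d[where \<alpha> = \<delta>, OF open_chart[OF c(1)] c])
        (rule formsD(2)[OF de c(1)], assumption, rule forms_differentiable[OF de c], simp)
    then have "alternating 4 (ext_d A \<delta> c x)" by simp
    moreover have "hodge_cov (J c x) (g c x) 4 (ext_d A \<delta> c x) = 0"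
    proof -
      have "hodge A J g 4 (ext_d A \<delta>) = 0" using dd by (simp add: ddc_adj_def \<delta>_def \<beta>_def)
      then have "hodge A J g 4 (ext_d A \<delta>) c x = 0" by simp
      then show ?thesis by (simp add: hodge_def on_charts_apply c)
    qed
    ultimately show ?thesis
      unfolding ext_d_3[OF c, symmetric] by (rule hermitian4.hodge_cov_4_eq_0[OF herm[OF c]])
  qed
  \<comment> \<open>The factor -1/2 of \<open>\<delta>\<close> is placed in the first slot so that
    \<open>gradient_norm\<close> applies to \<open>?lam\<close>; its minus sign makes that lemma's
    negative value positive.\<close>
  let ?\<kappa> = "\<lambda>c x. wedge22 (wedge11 (\<lambda>v. - 1 / 2 * cnj (\<theta> c x v)) (?lam c x)) (ev2 \<omega> c x)"
  have lins: "linear (\<lambda>v. - 1 / 2 * cnj (\<theta> c x v))" "linear (?lam c x)" if c: "c \<in> A" "x \<in> chart_image c" for c x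
  proof -
    show "linear (\<lambda>v. - 1 / 2 * cnj (\<theta> c x v))"
      by (rule linear_complexI) (simp_all add: linear_complexD[OF lin[OF c]] add_divide_distrib)
    show "linear (?lam c x)"
      by (rule linear_complexI)
        (simp_all add: linear_complexD[OF lin[OF c]] linear_add[OF J_facts(1)[OF c]] linear_cmul[OF J_facts(1)[OF c]])
  qed
  have norm: "\<exists>r\<ge>0. ?\<kappa> c x (E4 1) (E4 2) (E4 3) (E4 4) = of_real r * Vol c x \<and> (r = 0 \<longrightarrow> (\<forall>v. \<theta> c x v = 0))"
    if c: "c \<in> A" "x \<in> chart_image c" for c x
  proof -
    interpret h: hermitian4 "J c x" "g c x" by (rule herm[OF c])
    obtain r where r: "r \<ge> 0" "wedge22 (wedge11 (\<lambda>v. cnj (\<theta> c x v)) (?lam c x)) (ev2 \<omega> c x) (E4 1) (E4 2) (E4 3) (E4 4) = of_real (- r) * Vol c x"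
      "r = 0 \<longrightarrow> (\<forall>v. \<theta> c x v = 0)"
      using h.gradient_norm[OF lin[OF c]] unfolding Vol_eq[OF c, symmetric] omega_eq[OF c, symmetric] by blast
    have "?\<kappa> c x (E4 1) (E4 2) (E4 3) (E4 4) = - 1 / 2 * wedge22 (wedge11 (\<lambda>v. cnj (\<theta> c x v)) (?lam c x)) (ev2 \<omega> c x) (E4 1) (E4 2) (E4 3) (E4 4)"
      by (simp add: wedge22_def wedge11_def field_simps)
    then show ?thesis using r by (intro exI[of _ "r / 2"]) simp
  qed
  have "?\<kappa> c x (E4 1) (E4 2) (E4 3) (E4 4) = 0" if c: "c \<in> A" "x \<in> chart_image c" for c x
  proof (rule stokes_nonneg[OF compact, where s = 1 and \<eta> = "\<lambda>c x u v w. cnj (t c x) * \<delta> c x [u, v, w]" and \<kappa> = ?\<kappa>,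
        OF _ _ _ _ _ _ _ _ c])
    fix c x assume c: "c \<in> A" "x \<in> chart_image c"
    note dl = forms3_alt3[OF de c]
    show "alt3 (\<lambda>u v w. cnj (t c x) * \<delta> c x [u, v, w])"
      unfolding alt3_def alt2_def
      by (intro conjI allI linear_complexI) (simp_all add: alt3_simps[OF dl] alt3_same[OF dl] algebra_simps)
    show "alt4 (?\<kappa> c x)"
      by (rule alt4_wedge22[OF alt2_wedge11[OF lins[OF c]] alt2_omega[OF c]])
    have f: "(\<lambda>y. cnj (t c y)) differentiable (at x)"
      by (rule smooth_on_differentiable[OF smooth_on_cnj[OF open_chart[OF c(1)] t_smooth[OF c(1)]] c(2)])
    have f': "frechet_derivative (\<lambda>y. cnj (t c y)) (at x) = (\<lambda>v. cnj (\<theta> c x v))"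
      by (rule ext) (simp add: frechet_derivative_cnj[OF t_diff[OF c]] \<theta>_def)
    have \<delta>': "ev3 \<delta> c x = wedge12 (\<lambda>v. - 1 / 2 * ?lam c x v) (ev2 \<omega> c x)"
      by (intro ext) (rule \<delta>[OF c])
    show "d3 (\<lambda>x u v w. cnj (t c x) * \<delta> c x [u, v, w]) x (E4 1) (E4 2) (E4 3) (E4 4) = ?\<kappa> c x (E4 1) (E4 2) (E4 3) (E4 4)"
      unfolding d3_scale[OF f forms_differentiable[OF de c]] dz[OF c] f' \<delta>' wedge13_wedge12
      by (simp add: wedge22_def wedge11_def)
    show "\<exists>r\<ge>0. ?\<kappa> c x (E4 1) (E4 2) (E4 3) (E4 4) = of_real (1 * r) * Vol c x"
      using norm[OF c] by auto
  next
    fix c u v w assume c: "c \<in> A"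
    show "Ck_on 1 (chart_image c) (\<lambda>x. cnj (t c x) * \<delta> c x [u, v, w])"
      by (intro smooth_on_Ck smooth_on_mult smooth_on_cnj open_chart[OF c] t_smooth[OF c] formsD(3)[OF de c])
  next
    fix c c' p u v w assume c: "c \<in> A" "c' \<in> A" "p \<in> fst c \<inter> fst c'"
    show "cnj (t c (snd c p)) * \<delta> c (snd c p) [u, v, w] = cnj (t c' (snd c' p)) *
        \<delta> c' (snd c' p) [transition_deriv c c' p u, transition_deriv c c' p v, transition_deriv c c' p w]"
      using formsD(4)[OF de c, of "[u, v, w]"] by (simp add: t_nat[OF c])
    have n: "wedge11 (\<lambda>v. - 1 / 2 * cnj (\<theta> c (snd c p) v)) (?lam c (snd c p)) u v =
      wedge11 (\<lambda>v. - 1 / 2 * cnj (\<theta> c' (snd c' p) v)) (?lam c' (snd c' p)) (transition_deriv c c' p u) (transition_deriv c c' p v)" for u v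
      unfolding wedge11_def \<theta>_nat[OF c] J_facts(4)[OF c] ..
    fix z
    show "?\<kappa> c (snd c p) u v w z = ?\<kappa> c' (snd c' p) (transition_deriv c c' p u) (transition_deriv c c' p v)
        (transition_deriv c c' p w) (transition_deriv c c' p z)"
      by (rule wedge22_natural) (rule n, rule omega_natural[OF c])
  qed simp
  then have \<theta>0: "\<theta> c x v = 0" if "c \<in> A" "x \<in> chart_image c" for c x v
    using norm[OF that] Vol_nonzero[OF that] that by fastforce
  have "\<exists>a. \<forall>c\<in>A. \<forall>x\<in>chart_image c. t c x = a"
  proof (rule constant_function[OF conn, where f = t, OF _ t_nat])
    fix c x assume c: "c \<in> A" "x \<in> chart_image c"
    have "(t c has_derivative \<theta> c x) (at x)"
      unfolding \<theta>_def using t_diff[OF c] frechet_derivative_works by blast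
    moreover have "\<theta> c x = (\<lambda>v. 0)" using \<theta>0[OF c] by blast
    ultimately show "(t c has_derivative (\<lambda>v. 0)) (at x)" by simp
  qed
  then show ?thesis by (simp add: t_def)
qed


section \<open>The three summands as spaces of closed forms, and the direct sum\<close>

lemma J_form_omega: "J_form A J 2 \<omega> = \<omega>"
  by (rule forms2_eqI[OF J_form_2_forms[OF omega_forms] omega_forms]) (simp add: J_form_2[OF omega_forms] omega_J)

lemma tr_omega: "c \<in> A \<Longrightarrow> x \<in> chart_image c \<Longrightarrow> tr c x (ev2 \<omega> c x) = - 4"
  using hermitian4.trace2_W[OF herm] by (simp add: tr_eq[symmetric] omega_eq)

lemma hodge_omega: "hodge A J g 2 \<omega> = \<omega>"
  by (rule forms2_eqI[OF hodge_2_forms[OF omega_forms] omega_forms])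
    (simp add: hodge_2[OF omega_forms] tr_omega omega_J)

lemma tr_J:
  assumes a: "\<alpha> \<in> forms A 2" and c: "c \<in> A" "x \<in> chart_image c"
  shows "tr c x (ev2 (J_form A J 2 \<alpha>) c x) = tr c x (ev2 \<alpha> c x)"
proof -
  interpret h: hermitian4 "J c x" "g c x" by (rule herm[OF c])
  show ?thesis using h.trace2_J[OF forms2_alt2[OF a c]] by (simp add: tr_eq[OF c] J_form_2[OF a c])
qed

lemma J_form_J_form:
  assumes a: "\<alpha> \<in> forms A 2"
  shows "J_form A J 2 (J_form A J 2 \<alpha>) = \<alpha>"
  by (rule forms2_eqI[OF J_form_2_forms[OF J_form_2_forms[OF a]] a])
    (simp add: J_form_2[OF J_form_2_forms[OF a]] J_form_2[OF a] J_facts(2) alt2_simps[OF forms2_alt2[OF a]])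

lemma forms2_minus: "\<alpha> \<in> forms A 2 \<Longrightarrow> - \<alpha> \<in> forms A 2"
  using forms2_add_scale[of \<alpha> \<alpha> "- 1" 0] by simp

lemma J_form_of_antiselfdual:
  assumes a: "\<alpha> \<in> forms A 2" and s: "hodge A J g 2 \<alpha> = - \<alpha>"
  shows "J_form A J 2 \<alpha> = \<alpha>"
proof (rule forms2_eqI[OF J_form_2_forms[OF a] a])
  fix c x u v assume c: "c \<in> A" "x \<in> chart_image c"
  interpret h: hermitian4 "J c x" "g c x" by (rule herm[OF c])
  have "h.star2 (ev2 \<alpha> c x) u v = - ev2 \<alpha> c x u v" for u v
    using s hodge_2_star2[OF a c, of u v] by simp
  from h.star2_anti_selfdual[OF forms2_alt2[OF a c] this]
  show "J_form A J 2 \<alpha> c x [u, v] = \<alpha> c x [u, v]" by (simp add: J_form_2[OF a c])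
qed

lemma hodge_of_J_anti_invariant:
  assumes a: "\<alpha> \<in> forms A 2" and J: "J_form A J 2 \<alpha> = - \<alpha>"
  shows "hodge A J g 2 \<alpha> = \<alpha>"
proof (rule forms2_eqI[OF hodge_2_forms[OF a] a])
  fix c x u v assume c: "c \<in> A" "x \<in> chart_image c"
  interpret h: hermitian4 "J c x" "g c x" by (rule herm[OF c])
  have "ev2 \<alpha> c x (J c x u) (J c x v) = - ev2 \<alpha> c x u v" for u v
    using fun_cong[OF J_form_2[OF a c], of "[u, v]"] J by simp
  from h.star2_anti_invariant[OF forms2_alt2[OF a c] this]
  show "hodge A J g 2 \<alpha> c x [u, v] = \<alpha> c x [u, v]" by (simp add: hodge_2_star2[OF a c])
qed

text \<open>For forms of definite duality harmonic and closed coincide; compactness enters in the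
  passage from harmonic to closed.\<close>

lemma H_minus_eq:
  assumes "compact_space M"
  shows "H_minus A J g = {\<alpha> \<in> forms A 2. ext_d A \<alpha> = 0 \<and> hodge A J g 2 \<alpha> = - \<alpha>}"
proof (intro set_eqI iffI)
  fix \<alpha> assume "\<alpha> \<in> H_minus A J g"
  then have a: "\<alpha> \<in> forms A 2" "hodge_laplacian A J g 2 \<alpha> = 0" "hodge A J g 2 \<alpha> = - \<alpha>"
    by (auto simp: H_minus_def d_harmonic_def)
  then show "\<alpha> \<in> {\<alpha> \<in> forms A 2. ext_d A \<alpha> = 0 \<and> hodge A J g 2 \<alpha> = - \<alpha>}"
    using dual_harmonic_closed[OF assms a(1), of "- 1"] by simp
next
  fix \<alpha> assume "\<alpha> \<in> {\<alpha> \<in> forms A 2. ext_d A \<alpha> = 0 \<and> hodge A J g 2 \<alpha> = - \<alpha>}"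
  then show "\<alpha> \<in> H_minus A J g"
    using dual_closed_harmonic[of \<alpha> "- 1"] by (simp add: H_minus_def)
qed

text \<open>The components of bidegree \<open>(2,0)\<close> (for \<open>s = -1\<close>) and \<open>(0,2)\<close> (for \<open>s = 1\<close>) of a
  \<open>J\<close>-anti-invariant form.\<close>

definition half_form :: "complex \<Rightarrow> 'a cform \<Rightarrow> 'a cform" where
  "half_form s \<alpha> = on_charts A (\<lambda>c x. cov2 (\<lambda>u v. (\<alpha> c x [u, v] + s * \<i> * \<alpha> c x [J c x u, v]) / 2))"

lemma half_form:
  assumes a: "\<alpha> \<in> forms A 2" and J: "J_form A J 2 \<alpha> = - \<alpha>"
  shows "half_form s \<alpha> \<in> forms A 2"
    "c \<in> A \<Longrightarrow> x \<in> chart_image c \<Longrightarrow> alt2 (\<lambda>u v. (\<alpha> c x [u, v] + s * \<i> * \<alpha> c x [J c x u, v]) / 2)"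
proof -
  show alt: "alt2 (\<lambda>u v. (\<alpha> c x [u, v] + s * \<i> * \<alpha> c x [J c x u, v]) / 2)" if c: "c \<in> A" "x \<in> chart_image c" for c x
  proof -
    note al = forms2_alt2[OF a c]
    \<comment> \<open>Anti-invariance makes this value equal to its own negative; without it the
      second summand of \<open>half_form\<close> would not alternate.\<close>
    have J1: "\<alpha> c x [J c x u, u] = 0" for u
    proof -
      have "\<alpha> c x [J c x (J c x u), J c x u] = - \<alpha> c x [J c x u, u]"
        using fun_cong[OF J_form_2[OF a c], of "[J c x u, u]"] J by simp
      then show ?thesis
        using alt2_skew[OF al, of "J c x u" u] by (simp add: J_facts(2)[OF c] alt2_simps[OF al])
    qed
    show ?thesis
      unfolding alt2_def
      by (intro conjI allI linear_complexI)
        (simp_all add: alt2_simps[OF al] alt2_same[OF al] J1 linear_add[OF J_facts(1)[OF c]] linear_cmul[OF J_facts(1)[OF c]]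
          algebra_simps add_divide_distrib)
  qed
  show "half_form s \<alpha> \<in> forms A 2"
    unfolding half_form_def
  proof (rule forms2I[OF alt])
    fix c u v assume c: "c \<in> A"
    have "smooth_on (chart_image c) (\<lambda>x. \<alpha> c x [J c x u, v])"
      by (rule smooth_on_evaluate[OF open_chart[OF c], where a = "\<lambda>x u. \<alpha> c x [u, v]"])
        (rule alt2_linear(1)[OF forms2_alt2[OF a c]], assumption, rule formsD(3)[OF a c], rule J_facts(3)[OF c])
    then show "smooth_on (chart_image c) (\<lambda>x. (\<alpha> c x [u, v] + s * \<i> * \<alpha> c x [J c x u, v]) / 2)"
      by (intro smooth_on_divide smooth_intros open_chart[OF c] formsD(3)[OF a c]) auto
  next
    fix c c' p u v assume c: "c \<in> A" "c' \<in> A" "p \<in> fst c \<inter> fst c'"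
    show "(\<alpha> c (snd c p) [u, v] + s * \<i> * \<alpha> c (snd c p) [J c (snd c p) u, v]) / 2 =
       (\<alpha> c' (snd c' p) [transition_deriv c c' p u, transition_deriv c c' p v] +
        s * \<i> * \<alpha> c' (snd c' p) [J c' (snd c' p) (transition_deriv c c' p u), transition_deriv c c' p v]) / 2"
      using formsD(4)[OF a c, of "[u, v]"] formsD(4)[OF a c, of "[J c (snd c p) u, v]"]
      by (simp add: J_facts(4)[OF c])
  qed
qed

lemma half_form_pq:
  assumes a: "\<alpha> \<in> forms A 2" and J: "J_form A J 2 \<alpha> = - \<alpha>"
  shows "half_form (- 1) \<alpha> \<in> forms_pq A J 2 0" "half_form 1 \<alpha> \<in> forms_pq A J 0 2"
proof -
  have "half_form (- 1) \<alpha> c x \<in> covectors_pq (J c x) 2 0" if c: "c \<in> A" "x \<in> chart_image c" for c x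
  proof -
    interpret h: hermitian4 "J c x" "g c x" by (rule herm[OF c])
    show ?thesis
      unfolding half_form_def on_charts_apply[OF c]
      by (rule h.cs.covectors_20[OF half_form(2)[OF a J c]])
        (simp add: alt2_simps[OF forms2_alt2[OF a c]] field_simps)
  qed
  then show "half_form (- 1) \<alpha> \<in> forms_pq A J 2 0"
    using half_form(1)[OF a J] by (simp add: forms_pq_def)
  have "half_form 1 \<alpha> c x \<in> covectors_pq (J c x) 0 2" if c: "c \<in> A" "x \<in> chart_image c" for c x
  proof -
    interpret h: hermitian4 "J c x" "g c x" by (rule herm[OF c])
    show ?thesis
      unfolding half_form_def on_charts_apply[OF c]
      by (rule h.cs.covectors_02[OF half_form(2)[OF a J c]])
        (simp add: alt2_simps[OF forms2_alt2[OF a c]] field_simps)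
  qed
  then show "half_form 1 \<alpha> \<in> forms_pq A J 0 2"
    using half_form(1)[OF a J] by (simp add: forms_pq_def numeral_2_eq_2)
qed

lemma half_form_sum:
  assumes a: "\<alpha> \<in> forms A 2" and J: "J_form A J 2 \<alpha> = - \<alpha>"
  shows "\<alpha> = half_form (- 1) \<alpha> + half_form 1 \<alpha>"
proof (rule forms2_eqI[OF a])
  show "half_form (- 1) \<alpha> + half_form 1 \<alpha> \<in> forms A 2"
    using forms2_add_scale[OF half_form(1)[OF a J] half_form(1)[OF a J], of 1 _ 1] by simp
  fix c x u v assume c: "c \<in> A" "x \<in> chart_image c"
  show "\<alpha> c x [u, v] = (half_form (- 1) \<alpha> + half_form 1 \<alpha>) c x [u, v]"
    by (simp add: half_form_def on_charts_apply[OF c] field_simps)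
qed

text \<open>On types (2,0) and (0,2) alike \<open>J\<close> acts by -1, the square of i and of -i;
  conversely an anti-invariant form splits into its two halves. Anti-invariant forms are self-dual,
  so harmonic again means closed.\<close>

lemma H_J_anti_invariant_eq:
  assumes "compact_space M"
  shows "H_J_anti_invariant A J g = {\<alpha> \<in> forms A 2. ext_d A \<alpha> = 0 \<and> J_form A J 2 \<alpha> = - \<alpha>}"
proof (intro set_eqI iffI)
  fix \<alpha> assume "\<alpha> \<in> H_J_anti_invariant A J g"
  then obtain \<beta> \<gamma> where a: "\<alpha> \<in> forms A 2" "hodge_laplacian A J g 2 \<alpha> = 0"
    and bc: "\<beta> \<in> forms_pq A J 2 0" "\<gamma> \<in> forms_pq A J 0 2" "\<alpha> = \<beta> + \<gamma>"
    by (auto simp: H_J_anti_invariant_def d_harmonic_def)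
  have J: "J_form A J 2 \<alpha> = - \<alpha>"
  proof (rule forms2_eqI[OF J_form_2_forms[OF a(1)] forms2_minus[OF a(1)]])
    fix c x u v assume c: "c \<in> A" "x \<in> chart_image c"
    have "\<beta> c x \<in> covectors_pq (J c x) 2 0" "\<gamma> c x \<in> covectors_pq (J c x) 0 2"
      using bc c by (auto simp: forms_pq_def)
    from covectors_pq_J[OF this(1), of "[u, v]"] covectors_pq_J[OF this(2), of "[u, v]"]
    have "\<beta> c x [J c x u, J c x v] = - \<beta> c x [u, v]" "\<gamma> c x [J c x u, J c x v] = - \<gamma> c x [u, v]"
      unfolding i_powi_diff by simp_all
    then show "J_form A J 2 \<alpha> c x [u, v] = (- \<alpha>) c x [u, v]"
      unfolding J_form_2[OF a(1) c] by (simp add: bc(3))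
  qed
  have "ext_d A \<alpha> = 0"
    using dual_harmonic_closed[OF assms a(1), of 1] a(2) hodge_of_J_anti_invariant[OF a(1) J] by simp
  then show "\<alpha> \<in> {\<alpha> \<in> forms A 2. ext_d A \<alpha> = 0 \<and> J_form A J 2 \<alpha> = - \<alpha>}" using a J by simp
next
  fix \<alpha> assume "\<alpha> \<in> {\<alpha> \<in> forms A 2. ext_d A \<alpha> = 0 \<and> J_form A J 2 \<alpha> = - \<alpha>}"
  then have a: "\<alpha> \<in> forms A 2" "ext_d A \<alpha> = 0" "J_form A J 2 \<alpha> = - \<alpha>" by auto
  have "\<alpha> \<in> d_harmonic A J g 2"
    using dual_closed_harmonic[OF a(1), of 1] hodge_of_J_anti_invariant[OF a(1,3)] a(2) by simp
  then show "\<alpha> \<in> H_J_anti_invariant A J g"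
    using half_form_pq[OF a(1,3)] half_form_sum[OF a(1,3)] unfolding H_J_anti_invariant_def by blast
qed

lemma subspace_forms2I:
  assumes "S = {\<alpha> \<in> forms A 2. P \<alpha>}" "P 0"
    and "\<And>\<alpha> \<beta> a b. \<alpha> \<in> forms A 2 \<Longrightarrow> \<beta> \<in> forms A 2 \<Longrightarrow> P \<alpha> \<Longrightarrow> P \<beta> \<Longrightarrow> P (scale_form a \<alpha> + scale_form b \<beta>)"
  shows "module.subspace scale_form S"
proof -
  interpret module "scale_form :: complex \<Rightarrow> 'a cform \<Rightarrow> 'a cform" by (rule module_scale_form)
  have cl: "scale_form a \<alpha> + scale_form b \<beta> \<in> S" if "\<alpha> \<in> S" "\<beta> \<in> S" for a b \<alpha> \<beta>
    using that assms(3) forms2_add_scale unfolding assms(1) by simp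
  show ?thesis
  proof (rule subspaceI)
    show "0 \<in> S" using zero_forms assms(1,2) by simp
    show "\<alpha> + \<beta> \<in> S" if "\<alpha> \<in> S" "\<beta> \<in> S" for \<alpha> \<beta> using cl[OF that, of 1 1] by simp
    show "scale_form c \<alpha> \<in> S" if "\<alpha> \<in> S" for c \<alpha> using cl[OF that that, of c 0] by simp
  qed
qed

lemma forms2_add: "\<alpha> \<in> forms A 2 \<Longrightarrow> \<beta> \<in> forms A 2 \<Longrightarrow> \<alpha> + \<beta> \<in> forms A 2"
  using forms2_add_scale[of \<alpha> \<beta> 1 1] by simp

lemma forms2_scale: "\<alpha> \<in> forms A 2 \<Longrightarrow> scale_form a \<alpha> \<in> forms A 2"
  using forms2_add_scale[of \<alpha> \<alpha> a 0] by simp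

lemma ops_add:
  assumes "\<alpha> \<in> forms A 2" "\<beta> \<in> forms A 2"
  shows "ext_d A (\<alpha> + \<beta>) = ext_d A \<alpha> + ext_d A \<beta>" "J_form A J 2 (\<alpha> + \<beta>) = J_form A J 2 \<alpha> + J_form A J 2 \<beta>"
    "hodge A J g 2 (\<alpha> + \<beta>) = hodge A J g 2 \<alpha> + hodge A J g 2 \<beta>"
  using ext_d_add_scale[OF assms, of 1 1] J_form_add_scale[OF assms, of 1 1] hodge_add_scale[OF assms, of 1 1] by simp_all

lemma ops_scale:
  assumes "\<alpha> \<in> forms A 2"
  shows "ext_d A (scale_form a \<alpha>) = scale_form a (ext_d A \<alpha>)" "J_form A J 2 (scale_form a \<alpha>) = scale_form a (J_form A J 2 \<alpha>)"
    "hodge A J g 2 (scale_form a \<alpha>) = scale_form a (hodge A J g 2 \<alpha>)"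
  using ext_d_add_scale[OF assms assms, of a 0] J_form_add_scale[OF assms assms, of a 0] hodge_add_scale[OF assms assms, of a 0]
  by simp_all

lemma ops_minus:
  assumes "\<alpha> \<in> forms A 2"
  shows "ext_d A (- \<alpha>) = - ext_d A \<alpha>" "J_form A J 2 (- \<alpha>) = - J_form A J 2 \<alpha>"
    "hodge A J g 2 (- \<alpha>) = - hodge A J g 2 \<alpha>"
  using ops_scale[OF assms, of "- 1"] by simp_all

lemma scale_form_minus: "scale_form a (- \<alpha>) = - scale_form a \<alpha>"
  by (auto simp: scale_form_def fun_eq_iff)

lemma span_omega: "module.span scale_form {\<omega>} = range (\<lambda>a. scale_form a \<omega>)"
  by (rule module.span_singleton[OF module_scale_form])

text \<open>The signs of \<open>J\<close> and of the star are +,+ on \<omega>, then +,- on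
  \<open>v\<close> and -,+ on \<open>w\<close>. So J\<alpha> and J of the star of \<alpha> are
  combinations of the same closed forms.\<close>

lemma H2_superset:
  assumes v: "v \<in> forms A 2" "ext_d A v = 0" "hodge A J g 2 v = - v"
    and w: "w \<in> forms A 2" "ext_d A w = 0" "J_form A J 2 w = - w"
  shows "scale_form a \<omega> + v + w \<in> H2_d_dc A J g"
proof -
  let ?u = "scale_form a \<omega>" and ?\<alpha> = "scale_form a \<omega> + v + w"
  have u: "?u \<in> forms A 2" by (rule forms2_scale[OF omega_forms])
  have uv: "?u + v \<in> forms A 2" by (rule forms2_add[OF u v(1)])
  have al: "?\<alpha> \<in> forms A 2" by (rule forms2_add[OF uv w(1)])
  note S = ops_add[OF uv w(1)] ops_add[OF u v(1)] ops_scale[OF omega_forms] v(2,3) w(2,3) d_omega J_form_omega hodge_omega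
     J_form_of_antiselfdual[OF v(1,3)] hodge_of_J_anti_invariant[OF w(1,3)]
  have d: "ext_d A ?\<alpha> = 0" by (simp add: S)
  have nw: "- w \<in> forms A 2" "- v \<in> forms A 2" using forms2_minus v(1) w(1) by auto
  have "J_form A J 2 ?\<alpha> = ?u + v + - w" by (simp add: S)
  then have dJ: "ext_d A (J_form A J 2 ?\<alpha>) = 0"
    using ops_add(1)[OF uv nw(1)] ops_minus(1)[OF w(1)] by (simp add: S)
  have h: "hodge A J g 2 ?\<alpha> = ?u + - v + w" by (simp add: S)
  have unv: "?u + - v \<in> forms A 2" by (rule forms2_add[OF u nw(2)])
  have "J_form A J 2 (?u + - v + w) = ?u + - v + - w"
    unfolding ops_add(2)[OF unv w(1)] ops_add(2)[OF u nw(2)] ops_minus(2)[OF v(1)] by (simp add: S)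
  then have "ext_d A (J_form A J 2 (hodge A J g 2 ?\<alpha>)) = 0"
    unfolding h using ops_add(1)[OF unv nw(1)] ops_add(1)[OF u nw(2)] ops_minus(1)[OF w(1)] ops_minus(1)[OF v(1)]
    by (simp add: S)
  then have "d_c A J 2 (hodge A J g 2 ?\<alpha>) = 0"
    using d_c_eq_0_iff[OF hodge_2_forms[OF al]] by simp
  then have "ddc_adj A J g 2 ?\<alpha> = 0"
    by (simp add: ddc_adj_def ext_d_zero hodge_zero)
  then show ?thesis using al d dJ d_c_eq_0_iff[OF al] by (simp add: H2_d_dc_def)
qed

text \<open>\<open>s\<close> and \<open>w\<close> are the invariant and anti-invariant halves of
  \<alpha>; they are closed because J\<alpha> is.\<close>

lemma H2_subset:
  assumes "compact_space M" "connected_space M" and H: "\<alpha> \<in> H2_d_dc A J g"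
  shows "\<exists>a v w. \<alpha> = scale_form a \<omega> + v + w \<and> (v \<in> forms A 2 \<and> ext_d A v = 0 \<and> hodge A J g 2 v = - v) \<and>
     (w \<in> forms A 2 \<and> ext_d A w = 0 \<and> J_form A J 2 w = - w)"
proof -
  have al: "\<alpha> \<in> forms A 2" "ext_d A \<alpha> = 0" "d_c A J 2 \<alpha> = 0" using H by (auto simp: H2_d_dc_def)
  obtain t where t: "\<And>c x. c \<in> A \<Longrightarrow> x \<in> chart_image c \<Longrightarrow> tr c x (ev2 \<alpha> c x) = t"
    using H2_trace_constant[OF assms] by blast
  define J\<alpha> where "J\<alpha> = J_form A J 2 \<alpha>"
  have J: "J\<alpha> \<in> forms A 2" "ext_d A J\<alpha> = 0" "J_form A J 2 J\<alpha> = \<alpha>"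
    using J_form_2_forms[OF al(1)] d_c_eq_0_iff[OF al(1)] al(3) J_form_J_form[OF al(1)] by (auto simp: J\<alpha>_def)
  define s where "s = scale_form (1 / 2) \<alpha> + scale_form (1 / 2) J\<alpha>"
  define w where "w = scale_form (1 / 2) \<alpha> + scale_form (- 1 / 2) J\<alpha>"
  \<comment> \<open>\<open>s\<close> has trace t and \<omega> has trace -4, so this removes the
    trace, and an invariant trace-free form is anti-self-dual. That t is constant keeps
    \<open>v\<close> closed.\<close>
  define v where "v = scale_form 1 s + scale_form (t / 4) \<omega>"
  have sw: "s \<in> forms A 2" "w \<in> forms A 2" unfolding s_def w_def by (rule forms2_add_scale[OF al(1) J(1)])+
  have v: "v \<in> forms A 2" unfolding v_def by (rule forms2_add_scale[OF sw(1) omega_forms])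
  have "ext_d A s = 0" "ext_d A w = 0"
    unfolding s_def w_def ext_d_add_scale[OF al(1) J(1)] by (simp_all add: al J)
  moreover have "ext_d A v = scale_form 1 (ext_d A s) + scale_form (t / 4) (ext_d A \<omega>)"
    unfolding v_def by (rule ext_d_add_scale[OF sw(1) omega_forms])
  ultimately have d: "ext_d A v = 0" "ext_d A w = 0" by (simp_all add: d_omega)
  have Jw: "J_form A J 2 w = - w"
  proof (rule forms2_eqI[OF J_form_2_forms[OF sw(2)] forms2_minus[OF sw(2)]])
    fix c x u u' assume c: "c \<in> A" "x \<in> chart_image c"
    show "J_form A J 2 w c x [u, u'] = (- w) c x [u, u']"
      unfolding w_def J_form_add_scale[OF al(1) J(1)] J(3) J\<alpha>_def[symmetric] by (simp add: scale_form_apply)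
  qed
  have Js: "J_form A J 2 s = s"
    unfolding s_def J_form_add_scale[OF al(1) J(1)] J(3) J\<alpha>_def[symmetric] by (rule add.commute)
  have hv: "hodge A J g 2 v = - v"
  proof (rule forms2_eqI[OF hodge_2_forms[OF v] forms2_minus[OF v]])
    fix c x u u' assume c: "c \<in> A" "x \<in> chart_image c"
    have "tr c x (ev2 J\<alpha> c x) = t" unfolding J\<alpha>_def tr_J[OF al(1) c] by (rule t[OF c])
    then have "tr c x (ev2 s c x) = t"
      using tr_add_scale[OF c, of "1 / 2" "ev2 \<alpha> c x" "1 / 2" "ev2 J\<alpha> c x"] t[OF c]
      by (simp add: s_def scale_form_apply)
    then have "tr c x (ev2 v c x) = 0"
      using tr_add_scale[OF c, of 1 "ev2 s c x" "t / 4" "ev2 \<omega> c x"] tr_omega[OF c]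
      by (simp add: v_def scale_form_apply)
    moreover have "J_form A J 2 v = v"
      unfolding v_def J_form_add_scale[OF sw(1) omega_forms] Js J_form_omega ..
    then have "v c x [J c x u, J c x u'] = v c x [u, u']"
      using fun_cong[OF J_form_2[OF v c], of "[u, u']"] by simp
    ultimately show "hodge A J g 2 v c x [u, u'] = (- v) c x [u, u']"
      by (simp add: hodge_2[OF v c])
  qed
  have "\<alpha> = scale_form (- t / 4) \<omega> + v + w"
    by (intro ext) (simp add: v_def s_def w_def scale_form_apply algebra_simps)
  then show ?thesis using v d hv sw(2) Jw by blast
qed

text \<open>Applying \<open>J\<close> and the star to the relation yields it with two further sign
  patterns; the three patterns are linearly independent.\<close>

lemma H2_independent:
  assumes v: "v \<in> forms A 2" "hodge A J g 2 v = - v"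
    and w: "w \<in> forms A 2" "J_form A J 2 w = - w" and 0: "scale_form a \<omega> + v + w = 0"
  shows "scale_form a \<omega> = 0 \<and> v = 0 \<and> w = 0"
proof -
  let ?u = "scale_form a \<omega>"
  have u: "?u \<in> forms A 2" by (rule forms2_scale[OF omega_forms])
  have uv: "?u + v \<in> forms A 2" by (rule forms2_add[OF u v(1)])
  have Z: "J_form A J 2 0 = 0" "hodge A J g 2 0 = 0"
    using ops_scale(2,3)[OF omega_forms, of 0] by simp_all
  have "J_form A J 2 (?u + v + w) = ?u + v - w"
    unfolding ops_add(2)[OF uv w(1)] ops_add(2)[OF u v(1)] ops_scale(2)[OF omega_forms]
    by (simp add: J_form_omega J_form_of_antiselfdual[OF v] w(2))
  then have j: "?u + v - w = 0" using 0 Z by simp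
  have "hodge A J g 2 (?u + v + w) = ?u - v + w"
    unfolding ops_add(3)[OF uv w(1)] ops_add(3)[OF u v(1)] ops_scale(3)[OF omega_forms]
    by (simp add: hodge_omega v(2) hodge_of_J_anti_invariant[OF w])
  then have h: "?u - v + w = 0" using 0 Z by simp
  have z: "p = 0 \<and> q = 0 \<and> r = 0" if "p + q + r = 0" "p + q - r = 0" "p - q + r = 0" for p q r :: complex
    using that by algebra
  have "?u c x vs = 0 \<and> v c x vs = 0 \<and> w c x vs = 0" for c x vs
    using fun_cong[OF fun_cong[OF fun_cong[OF 0]], of c x vs] fun_cong[OF fun_cong[OF fun_cong[OF j]], of c x vs]
      fun_cong[OF fun_cong[OF fun_cong[OF h]], of c x vs] by (intro z) simp_all
  then show ?thesis by (simp add: fun_eq_iff)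
qed

lemma H2_direct_sum:
  assumes "compact_space M" "connected_space M"
  shows "direct_sum3 (H2_d_dc A J g) (module.span scale_form {\<omega>}) (H_minus A J g) (H_J_anti_invariant A J g)"
  unfolding direct_sum3_def
proof (intro conjI)
  note m = H_minus_eq[OF assms(1)] and j = H_J_anti_invariant_eq[OF assms(1)]
  have Z: "ext_d A 0 = 0" "J_form A J 2 0 = 0" "hodge A J g 2 0 = 0"
    using ops_scale[OF omega_forms, of 0] by simp_all
  show "module.subspace scale_form (module.span scale_form {\<omega>})"
    by (rule module.subspace_span[OF module_scale_form])
  show "module.subspace scale_form (H_minus A J g)"
    by (rule subspace_forms2I[OF m]) (auto simp: Z ext_d_add_scale hodge_add_scale scale_form_minus)
  show "module.subspace scale_form (H_J_anti_invariant A J g)"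
    by (rule subspace_forms2I[OF j]) (auto simp: Z ext_d_add_scale J_form_add_scale scale_form_minus)
  show "H2_d_dc A J g = {u + v + w |u v w. u \<in> module.span scale_form {\<omega>} \<and> v \<in> H_minus A J g \<and> w \<in> H_J_anti_invariant A J g}"
  proof (intro subset_antisym subsetI)
    fix \<alpha> assume "\<alpha> \<in> H2_d_dc A J g"
    from H2_subset[OF assms this]
    show "\<alpha> \<in> {u + v + w |u v w. u \<in> module.span scale_form {\<omega>} \<and> v \<in> H_minus A J g \<and> w \<in> H_J_anti_invariant A J g}"
      unfolding m j span_omega by blast
  next
    fix \<alpha> assume "\<alpha> \<in> {u + v + w |u v w. u \<in> module.span scale_form {\<omega>} \<and> v \<in> H_minus A J g \<and> w \<in> H_J_anti_invariant A J g}"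
    then show "\<alpha> \<in> H2_d_dc A J g"
      unfolding m j span_omega using H2_superset by blast
  qed
  show "\<forall>u\<in>module.span scale_form {\<omega>}. \<forall>v\<in>H_minus A J g. \<forall>w\<in>H_J_anti_invariant A J g.
      u + v + w = 0 \<longrightarrow> u = 0 \<and> v = 0 \<and> w = 0"
    unfolding m j span_omega using H2_independent by blast
qed

end

theorem theorem5p1:
  fixes M :: "'a topology" and A :: "'a chart set"
    and J :: "'a endo_field" and g :: "'a metric_field" and \<omega> :: "'a cform"
  assumes "almost_kahler4 M A J g \<omega>"
    and "compact_space M" and "connected_space M"
  shows "direct_sum3 (H2_d_dc A J g)
    (module.span scale_form {\<omega>}) (H_minus A J g) (H_J_anti_invariant A J g)"
proof -
  interpret almost_kahler M A J g \<omega> by unfold_locales (rule assms(1))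
  show ?thesis by (rule H2_direct_sum[OF assms(2,3)])
qed

end
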